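(* Let $T>0$, let $b:[0,T]\times\mathbb{R}^d\to\mathbb{R}^d$ be measurable, and suppose there are nonnegative $C_0,C_1\in L^1([0,T])$ such that for all $t\in[0,T]$ and $x,y\in\mathbb{R}^d$, $|b(t,x)|\le C_0(t)(1+|x|)$ and $(b(t,x)-b(t,y))\cdot(x-y)\ge -C_1(t)|x-y|^2$. Let $f\in C([0,T],\mathcal{M}_{\mathrm{loc},\mathrm{w}})$ with $f(0,\cdot)=f_0$. Assume either that $b$ is continuous, or that $f(t,\cdot)\in L^1_{\mathrm{loc}}(\mathbb{R}^d)$ for all $t\in[0,T]$. Then $f$ is a distributional solution of $$\partial_tf-\operatorname{div}(b(t,x)f)=0\ \text{ in }(0,T)\times\mathbb{R}^d,\qquad f(0,\cdot)=f_0,$$ if and only if $f$ is the unique duality solution of this initial value problem.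
   Context: $\mathcal{M}_{\mathrm{loc},\mathrm{w}}$ is the space of locally finite signed Radon measures on $\mathbb{R}^d$ with the topology of weak convergence against $C_c(\mathbb{R}^d)$. Compressive flow: let $\hat b(t,x)$ be the convex hull of all limit points of $b(t,y)$ as $y\to x$. For every $(t,x)$ there is a unique absolutely continuous $[t,T]\ni s\mapsto\phi_{t,s}(x)$ with $\partial_s\phi_{t,s}(x)\in-\hat b(s,\phi_{t,s}(x))$ for a.e. $s$ and $\phi_{t,t}(x)=x$. Duality solution: $f\in C([0,T],\mathcal{M}_{\mathrm{loc},\mathrm{w}})$ such that for all $t\in[0,T]$ and $g\in C_c(\mathbb{R}^d)$, $\int g(x)f(t,dx)=\int g(\phi_{0,t}(x))f_0(dx)$; there is exactly one such $f$ for each $f_0$. *)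

theory Defs
  imports "HOL-Analysis.Analysis"
begin

section \<open>Locally finite signed Radon measures\<close>

definition locally_finite_borel :: "'a::euclidean_space measure \<Rightarrow> bool" where
  "locally_finite_borel M \<longleftrightarrow>
     sets M = sets borel \<and> (\<forall>K. compact K \<longrightarrow> emeasure M K < \<infinity>)"

definition mutually_singular :: "'a::euclidean_space measure \<Rightarrow> 'a measure \<Rightarrow> bool" where
  "mutually_singular M N \<longleftrightarrow>
     (\<exists>A \<in> sets borel. emeasure M A = 0 \<and> emeasure N (- A) = 0)"

text \<open>
  A locally finite signed measure need not have a value on unbounded sets, so it is not a set
  function on all Borel sets. It is represented by its Jordan decomposition, which is unique; hence
  equality in this type is equality of signed measures. Locally finite Borel measures on a Euclidean
  space are automatically regular.
\<close>

typedef (overloaded) ('a::euclidean_space) signed_radon =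
  "{(M, N). locally_finite_borel M \<and> locally_finite_borel N \<and> mutually_singular M N}
     :: ('a measure \<times> 'a measure) set"
proof -
  have "locally_finite_borel (null_measure borel :: 'a measure)"
    by (simp add: locally_finite_borel_def)
  moreover have "mutually_singular (null_measure borel :: 'a measure) (null_measure borel)"
    by (auto simp: mutually_singular_def)
  ultimately show ?thesis
    by blast
qed

definition pos_part :: "'a::euclidean_space signed_radon \<Rightarrow> 'a measure" where
  "pos_part \<mu> = fst (Rep_signed_radon \<mu>)"

definition neg_part :: "'a::euclidean_space signed_radon \<Rightarrow> 'a measure" where
  "neg_part \<mu> = snd (Rep_signed_radon \<mu>)"

text \<open>
  The completions make it possible to integrate a Lebesgue measurable function when the measure
  is absolutely continuous; for Borel functions they change nothing.
\<close>

definition signed_integral :: "'a::euclidean_space signed_radon \<Rightarrow> ('a \<Rightarrow> real) \<Rightarrow> real" where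
  "signed_integral \<mu> g =
     integral\<^sup>L (completion (pos_part \<mu>)) g - integral\<^sup>L (completion (neg_part \<mu>)) g"

definition Cc :: "('a::euclidean_space \<Rightarrow> real) set" where
  "Cc = {g. continuous_on UNIV g \<and> compact (closure {x. g x \<noteq> 0})}"

text \<open>The initial topology of the maps \<open>\<mu> \<mapsto> \<integral> g d\<mu>\<close>, \<open>g \<in> Cc\<close>.\<close>

definition weak_topology :: "'a::euclidean_space signed_radon topology" where
  "weak_topology =
     topology_generated_by {{\<mu>. signed_integral \<mu> g \<in> U} | g U. g \<in> Cc \<and> open U}"

lemma topspace_weak_topology [simp]: "topspace weak_topology = UNIV"
proof -
  have "(\<lambda>_. 0) \<in> (Cc :: ('a::euclidean_space \<Rightarrow> real) set)"
    by (simp add: Cc_def)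
  then have "UNIV \<in> {{\<mu> :: 'a signed_radon. signed_integral \<mu> g \<in> U} | g U. g \<in> Cc \<and> open U}"
    by (intro CollectI exI[of _ "\<lambda>_. 0"] exI[of _ UNIV]) auto
  then show ?thesis
    unfolding weak_topology_def topology_generated_by_topspace by blast
qed

text \<open>The space \<open>C([0,T], M\<^bsub>loc,w\<^esub>)\<close>; only the values on \<open>[0,T]\<close> of the functions matter.\<close>

definition C_weak :: "real \<Rightarrow> (real \<Rightarrow> 'a::euclidean_space signed_radon) set" where
  "C_weak T = {f. continuous_map (top_of_set {0..T}) weak_topology f}"

lemma C_weak_iff:
  "f \<in> C_weak T \<longleftrightarrow> (\<forall>g\<in>Cc. continuous_on {0..T} (\<lambda>t. signed_integral (f t) g))"
proof
  assume f: "f \<in> C_weak T"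
  show "\<forall>g\<in>Cc. continuous_on {0..T} (\<lambda>t. signed_integral (f t) g)"
  proof
    fix g :: "'a \<Rightarrow> real" assume g: "g \<in> Cc"
    have "continuous_map weak_topology euclidean (\<lambda>\<mu>. signed_integral \<mu> g)"
      unfolding continuous_map_def
    proof (intro conjI allI impI)
      fix U :: "real set" assume "openin euclidean U"
      then have "openin weak_topology {\<mu>. signed_integral \<mu> g \<in> U}"
        using g unfolding weak_topology_def by (intro topology_generated_by_Basis) auto
      then show "openin weak_topology {\<mu> \<in> topspace weak_topology. signed_integral \<mu> g \<in> U}"
        by simp
    qed auto
    then have "continuous_map (top_of_set {0..T}) euclidean ((\<lambda>\<mu>. signed_integral \<mu> g) \<circ> f)"
      using f unfolding C_weak_def by (blast intro: continuous_map_compose)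
    then show "continuous_on {0..T} (\<lambda>t. signed_integral (f t) g)"
      by (simp add: o_def)
  qed
next
  assume cont: "\<forall>g\<in>Cc. continuous_on {0..T} (\<lambda>t. signed_integral (f t) g)"
  have top: "\<Union> {{\<mu>::'a signed_radon. signed_integral \<mu> g \<in> U} | g U. g \<in> Cc \<and> open U} = UNIV"
    using topspace_weak_topology[where 'a = 'a]
    by (simp add: weak_topology_def topology_generated_by_topspace)
  show "f \<in> C_weak T"
    unfolding C_weak_def mem_Collect_eq weak_topology_def
  proof (rule continuous_on_generated_topo)
    fix V :: "'a signed_radon set"
    assume "V \<in> {{\<mu>. signed_integral \<mu> g \<in> U} | g U. g \<in> Cc \<and> open U}"
    then obtain g U where gU: "g \<in> Cc" "open U" "V = {\<mu>. signed_integral \<mu> g \<in> U}"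
      by blast
    have "openin (top_of_set {0..T}) ({0..T} \<inter> (\<lambda>t. signed_integral (f t) g) -` U)"
      using cont gU continuous_openin_preimage_gen by blast
    then show "openin (top_of_set {0..T}) (f -` V \<inter> topspace (top_of_set {0..T}))"
      using gU by (simp add: vimage_def Int_commute)
  qed (use top in auto)
qed

text \<open>
  \<open>\<mu>(dx) = h(x) dx\<close> with \<open>h\<close> locally integrable. The identity is tested on bounded Borel sets,
  where the signed measure has a finite value.
\<close>

definition L1_loc :: "'a::euclidean_space signed_radon set" where
  "L1_loc = {\<mu>. \<exists>h. (\<forall>K. compact K \<longrightarrow> set_integrable lebesgue K h) \<and>
      (\<forall>A. A \<in> sets borel \<and> bounded A \<longrightarrow>
         measure (pos_part \<mu>) A - measure (neg_part \<mu>) A = (LINT x:A|lebesgue. h x))}"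


section \<open>The compressive flow\<close>

definition abs_continuous_on :: "real set \<Rightarrow> (real \<Rightarrow> 'a::euclidean_space) \<Rightarrow> bool" where
  "abs_continuous_on S \<gamma> \<longleftrightarrow>
     (\<forall>\<epsilon>>0. \<exists>\<delta>>0. \<forall>(I::nat set) u v.
        finite I \<and> (\<forall>i\<in>I. u i \<le> v i \<and> {u i..v i} \<subseteq> S) \<and>
        disjoint_family_on (\<lambda>i. {u i<..<v i}) I \<and> (\<Sum>i\<in>I. v i - u i) < \<delta>
        \<longrightarrow> (\<Sum>i\<in>I. dist (\<gamma> (u i)) (\<gamma> (v i))) < \<epsilon>)"

definition b_hat :: "(real \<Rightarrow> 'a::euclidean_space \<Rightarrow> 'a) \<Rightarrow> real \<Rightarrow> 'a \<Rightarrow> 'a set" where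
  "b_hat b t x =
     convex hull {l. \<exists>y::nat \<Rightarrow> 'a. y \<longlonglongrightarrow> x \<and> (\<lambda>n. b t (y n)) \<longlonglongrightarrow> l}"

definition flow_line ::
  "(real \<Rightarrow> 'a::euclidean_space \<Rightarrow> 'a) \<Rightarrow> real \<Rightarrow> real \<Rightarrow> 'a \<Rightarrow> (real \<Rightarrow> 'a) \<Rightarrow> bool" where
  "flow_line b T t x \<gamma> \<longleftrightarrow>
     abs_continuous_on {t..T} \<gamma> \<and> \<gamma> t = x \<and>
     (AE s in lebesgue_on {t..T}.
        \<exists>v. (\<gamma> has_vector_derivative v) (at s within {t..T}) \<and> - v \<in> b_hat b s (\<gamma> s))"

text \<open>
  \<open>flow b T t s x\<close> is \<open>\<phi>\<^bsub>t,s\<^esub>(x)\<close> for \<open>t \<le> s \<le> T\<close>. Flow lines are unique only on \<open>[t,T]\<close>,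
  so the definite description is applied to the value at \<open>s\<close>.
\<close>

definition flow ::
  "(real \<Rightarrow> 'a::euclidean_space \<Rightarrow> 'a) \<Rightarrow> real \<Rightarrow> real \<Rightarrow> real \<Rightarrow> 'a \<Rightarrow> 'a" where
  "flow b T t s x = (THE y. \<exists>\<gamma>. flow_line b T t x \<gamma> \<and> \<gamma> s = y)"


section \<open>Notions of solution\<close>

definition duality_solution ::
  "(real \<Rightarrow> 'a::euclidean_space \<Rightarrow> 'a) \<Rightarrow> real \<Rightarrow> 'a signed_radon \<Rightarrow>
     (real \<Rightarrow> 'a signed_radon) \<Rightarrow> bool" where
  "duality_solution b T f0 f \<longleftrightarrow>
     f \<in> C_weak T \<and>
     (\<forall>t\<in>{0..T}. \<forall>g\<in>Cc.
        signed_integral (f t) g = signed_integral f0 (\<lambda>x. g (flow b T 0 t x)))"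

definition unique_duality_solution ::
  "(real \<Rightarrow> 'a::euclidean_space \<Rightarrow> 'a) \<Rightarrow> real \<Rightarrow> 'a signed_radon \<Rightarrow>
     (real \<Rightarrow> 'a signed_radon) \<Rightarrow> bool" where
  "unique_duality_solution b T f0 f \<longleftrightarrow>
     duality_solution b T f0 f \<and>
     (\<forall>f'. duality_solution b T f0 f' \<longrightarrow> (\<forall>t\<in>{0..T}. f' t = f t))"

primrec Ck :: "nat \<Rightarrow> ('a::euclidean_space \<Rightarrow> real) \<Rightarrow> bool" where
  "Ck 0 \<psi> \<longleftrightarrow> continuous_on UNIV \<psi>"
| "Ck (Suc k) \<psi> \<longleftrightarrow>
     \<psi> differentiable_on UNIV \<and> (\<forall>v. Ck k (\<lambda>p. frechet_derivative \<psi> (at p) v))"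

definition test_functions :: "real \<Rightarrow> (real \<times> 'a::euclidean_space \<Rightarrow> real) set" where
  "test_functions T =
     {\<psi>. (\<forall>k. Ck k \<psi>) \<and> compact (closure {p. \<psi> p \<noteq> 0}) \<and>
         closure {p. \<psi> p \<noteq> 0} \<subseteq> {0<..<T} \<times> UNIV}"

text \<open>
  The weak form of \<open>\<partial>\<^sub>t f - div (b f) = 0\<close> is
  \<open>\<integral>\<integral> (\<partial>\<^sub>t \<psi>(t,x) - b(t,x) \<cdot> \<nabla>\<^sub>x \<psi>(t,x)) f(t,dx) dt = 0\<close>. Both derivatives are written as values of
  the total derivative of \<open>\<psi>\<close> on \<open>\<real> \<times> \<real>\<^sup>d\<close>, in the directions \<open>(1,0)\<close> and \<open>(0,b(t,x))\<close>.
  \<open>has_bochner_integral\<close> also asserts that the inner integral is integrable in time.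
\<close>

definition distributional_solution ::
  "(real \<Rightarrow> 'a::euclidean_space \<Rightarrow> 'a) \<Rightarrow> real \<Rightarrow> 'a signed_radon \<Rightarrow>
     (real \<Rightarrow> 'a signed_radon) \<Rightarrow> bool" where
  "distributional_solution b T f0 f \<longleftrightarrow>
     f \<in> C_weak T \<and> f 0 = f0 \<and>
     (\<forall>\<psi>\<in>test_functions T.
        has_bochner_integral (lebesgue_on {0..T})
          (\<lambda>t. signed_integral (f t)
             (\<lambda>x. frechet_derivative \<psi> (at (t, x)) (1, 0)
                  - frechet_derivative \<psi> (at (t, x)) (0, b t x)))
          0)"

end

theory Submission
 imports Defs
begin

text \<open>
 Duality implies the weak form: for a test function \<open>\<psi>\<close>, duality and the semigroup property move the whole time
 dependence of \<open>\<integral> \<psi>(t,\<cdot>) df(t)\<close> into \<open>\<psi>(t + h, \<phi>\<^bsub>t,t+h\<^esub>(x))\<close>. At almost every \<open>t\<close> the difference quotient of the flow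
 converges to \<open>-b(t,x)\<close> at every continuity point \<open>x\<close> of \<open>b(t,\<cdot>)\<close>. A one-sided Lipschitz field is continuous Lebesgue-almost
 everywhere, because it is monotone up to a linear term; so \<open>|f(t)|\<close>-almost every \<open>x\<close> is such a point in both cases
 of the hypothesis.

 Conversely, fix a Lipschitz function \<open>g\<close> with compact support and put \<open>\<psi>(t,y) = g(\<phi>\<^bsub>t,\<tau>\<^esub>(y))\<close>, which is Lipschitz in \<open>y\<close> but
 not smooth. Mollify in space at scale \<open>r\<close>. The derivative of \<open>\<integral> (\<psi>(t,\<cdot>) * \<eta>\<^sub>r) df(t)\<close> compares \<open>b(t,x)\<close> with \<open>b(t,y)\<close> for
 \<open>|x - y| < r\<close> only, hence it is bounded by the Lipschitz constant times the mean oscillation of \<open>b(t,\<cdot>)\<close> at scale \<open>r\<close>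
 integrated against \<open>|f(t)|\<close>. This tends to \<open>0\<close> as \<open>r\<close> does, again by continuity \<open>|f(t)|\<close>-almost everywhere, so
 \<open>\<integral> \<psi>(t,\<cdot>) df(t)\<close> is constant in \<open>t\<close>. Local masses are bounded uniformly in time by the principle of uniform boundedness.
\<close>

section \<open>Lebesgue points and increments dominated by an integral\<close>

text \<open>Two obstacles shape the construction of the flow and its derivative: b(t,.) may be
  discontinuous, and t |-> b(t,x) need not be measurable for a given x. All time integrals of b are
  therefore taken at points of one countable dense set \<open>D\<close> of measurable sections.
  Elsewhere the field is met only through the inequality (b(t,z) - p).(z - x) >= - C1(t) |z - x|^2
  with z in \<open>D\<close>. By Minty's argument, its validity for all z in \<open>D\<close>
  already puts p into the hull of the limit points of b(t,.) at x. This identifies the limit of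
  Euler paths as a flow line, and cluster points of the difference quotients of the flow as
  velocities. Since only countably many z are tested, one null set of times serves every x; this is
  what allows limits to be taken under integrals against f(t) at a fixed time.

  Velocities of flow lines are handled pointwise, without a measurable selection: a path is
  described by an integrable majorant of its increments (\<open>dom_increments\<close>), a notion
  stable under pointwise limits. The flow has no inverse; growth bounds run backwards in time take
  its place whenever compact supports are needed.\<close>

lemma Lebesgue_point_right:
 fixes f :: "real => 'b::euclidean_space"
 assumes f: "!!a b. f integrable_on {a..b}"
 obtains N where "negligible N"
  "!!t. t \<notin> N ==> ((\<lambda>h. integral {t..t + h} f /\<^sub>R h) \<longlongrightarrow> f t) (at_right 0)"
proof -
 have "!!a b. f integrable_on cbox a b" using f by simp
 then obtain N where N: "negligible N"
  "!!x e. x \<notin> N ==> 0 < e ==> \<exists>d>0. \<forall>h. 0 < h \<and> h < d -->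
    norm (integral (cbox x (x + h *\<^sub>R One)) f /\<^sub>R h ^ DIM(real) - f x) < e"
  using integrable_ccontinuous_explicit[of f] by metis
 show thesis
 proof (rule that[OF N(1)])
  fix t assume t: "t \<notin> N"
  show "((\<lambda>h. integral {t..t + h} f /\<^sub>R h) \<longlongrightarrow> f t) (at_right 0)"
   unfolding tendsto_iff
  proof safe
   fix e :: real assume "e > 0"
   with N(2)[OF t this] obtain d where "d > 0" and d: "!!h. 0 < h ==> h < d ==>
    norm (integral (cbox t (t + h *\<^sub>R One)) f /\<^sub>R h ^ DIM(real) - f t) < e" by blast
   show "\<forall>\<^sub>F h in at_right 0. dist (integral {t..t + h} f /\<^sub>R h) (f t) < e"
    unfolding eventually_at_right_field
    by (rule exI[of _ d]) (use \<open>d > 0\<close> d in \<open>auto simp: dist_norm\<close>)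
  qed
 qed
qed

text \<open>Left averages of \<open>f\<close> are right averages of its reflection, so the one-sided
  statement applied twice gives the two-sided derivative. Extension by zero (\<open>g\<close>)
  supplies integrability on every interval.\<close>

lemma Lebesgue_point:
 fixes f :: "real => 'b::euclidean_space"
 assumes f: "f integrable_on {a..b}"
 obtains N where "negligible N"
  "!!t. t \<in> {a<..<b} ==> t \<notin> N ==> ((\<lambda>h. integral {t..t + h} f /\<^sub>R h) \<longlongrightarrow> f t) (at_right 0)"
  "!!t. t \<in> {a<..<b} ==> t \<notin> N ==> ((\<lambda>u. integral {a..u} f) has_vector_derivative f t) (at t)"
proof -
 define g where "g = (\<lambda>x. if x \<in> {a..b} then f x else 0)"
 have gU: "g integrable_on UNIV" unfolding g_def using f by (simp only: integrable_restrict_UNIV)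
 have g: "g integrable_on {c..d}" for c d
  using integrable_on_subinterval[OF gU] by simp
 have g': "(\<lambda>x. g (- x)) integrable_on {c..d}" for c d
  using g[of "-d" "-c"] Henstock_Kurzweil_Integration.integrable_reflect_real[where f=g and a="-d" and b="-c"] by (simp only: minus_minus)
 obtain N1 where N1: "negligible N1"
  "!!t. t \<notin> N1 ==> ((\<lambda>h. integral {t..t + h} g /\<^sub>R h) \<longlongrightarrow> g t) (at_right 0)"
  using Lebesgue_point_right[OF g] by blast
 obtain N2 where N2: "negligible N2"
  "!!t. t \<notin> N2 ==> ((\<lambda>h. integral {t..t + h} (\<lambda>x. g (-x)) /\<^sub>R h) \<longlongrightarrow> g (-t)) (at_right 0)"
  using Lebesgue_point_right[OF g'] by metis
 have N2': "negligible (uminus ` N2)"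
  using N2(1) by (rule negligible_differentiable_image_negligible[rotated]) (auto intro!: derivative_intros)
 show thesis
 proof (rule that[of "N1 \<union> uminus ` N2"])
  show "negligible (N1 \<union> uminus ` N2)" using N1(1) N2' by simp
  fix t assume t: "t \<in> {a<..<b}" and tN: "t \<notin> N1 \<union> uminus ` N2"
  have ev: "\<forall>\<^sub>F h in at_right (0::real). h > 0 \<and> h < b - t \<and> h < t - a"
   using t by (auto simp: eventually_at_right_field intro!: exI[of _ "min (b-t) (t-a)"])
  have eq: "integral {c..d} g = integral {c..d} f" if "a \<le> c" "d \<le> b" for c d
   by (rule integral_cong) (use that in \<open>auto simp: g_def\<close>)
  have gt: "g t = f t" using t by (auto simp: g_def)
  show R: "((\<lambda>h. integral {t..t + h} f /\<^sub>R h) \<longlongrightarrow> f t) (at_right 0)"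
  proof (rule Lim_transform_eventually)
   show "((\<lambda>h. integral {t..t + h} g /\<^sub>R h) \<longlongrightarrow> f t) (at_right 0)"
    using N1(2)[of t] tN gt by auto
   show "\<forall>\<^sub>F h in at_right 0. integral {t..t + h} g /\<^sub>R h = integral {t..t + h} f /\<^sub>R h"
    using ev by eventually_elim (use t in \<open>auto simp: eq\<close>)
  qed
  have L: "((\<lambda>h. integral {t - h..t} f /\<^sub>R h) \<longlongrightarrow> f t) (at_right 0)"
  proof (rule Lim_transform_eventually)
   have "- t \<notin> N2" using tN by (metis UnI2 image_eqI minus_minus)
   from N2(2)[OF this]
   show "((\<lambda>h. integral {- t..- t + h} (\<lambda>x. g (-x)) /\<^sub>R h) \<longlongrightarrow> f t) (at_right 0)"
    using gt by auto
   show "\<forall>\<^sub>F h in at_right 0. integral {-t..-t + h} (\<lambda>x. g (-x)) /\<^sub>R h = integral {t - h..t} f /\<^sub>R h"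
    using ev
   proof eventually_elim
    case (elim h)
    have "integral {-t..-(t - h)} (\<lambda>x. g (-x)) = integral {t - h..t} g"
     by (rule Henstock_Kurzweil_Integration.integral_reflect_real)
    then show ?case using t elim by (auto simp: eq)
   qed
  qed
  have IR: "integral {a..t + h} f - integral {a..t} f = integral {t..t + h} f"
   if "0 < h" "h < b - t" for h
  proof -
   have "integral {a..t} f + integral {t..t+h} f = integral {a..t + h} f"
    by (rule Henstock_Kurzweil_Integration.integral_combine) (use that t in \<open>auto intro: integrable_on_subinterval[OF f]\<close>)
   then show ?thesis by (simp add: algebra_simps)
  qed
  have IL: "integral {a..t - h} f - integral {a..t} f = - integral {t - h..t} f"
   if "0 < h" "h < t - a" for h
  proof -
   have "integral {a..t-h} f + integral {t-h..t} f = integral {a..t} f"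
    by (rule Henstock_Kurzweil_Integration.integral_combine) (use that t in \<open>auto intro: integrable_on_subinterval[OF f]\<close>)
   then show ?thesis by (simp add: algebra_simps)
  qed
  show "((\<lambda>u. integral {a..u} f) has_vector_derivative f t) (at t)"
   unfolding has_vector_derivative_def has_derivative_at_within
  proof (intro conjI bounded_linear_scaleR_left)
   let ?q = "\<lambda>h. (integral {a..t + h} f - integral {a..t} f - h *\<^sub>R f t) /\<^sub>R \<bar>h\<bar>"
   have r: "(?q \<longlongrightarrow> 0) (at_right 0)"
   proof (rule Lim_transform_eventually)
    show "((\<lambda>h. integral {t..t + h} f /\<^sub>R h - f t) \<longlongrightarrow> 0) (at_right 0)"
     using R by (simp add: LIM_zero_iff)
    show "\<forall>\<^sub>F h in at_right 0. integral {t..t + h} f /\<^sub>R h - f t = ?q h"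
     using ev by eventually_elim (simp add: IR scaleR_diff_right)
   qed
   have l: "(?q \<longlongrightarrow> 0) (at_left 0)"
    unfolding filterlim_at_left_to_right minus_zero
   proof (rule Lim_transform_eventually)
    show "((\<lambda>h. f t - integral {t-h..t} f /\<^sub>R h) \<longlongrightarrow> 0) (at_right 0)"
     using tendsto_diff[OF tendsto_const L, of "f t"] by simp
    show "\<forall>\<^sub>F h in at_right 0. f t - integral {t-h..t} f /\<^sub>R h = ?q (- h)"
     using ev by eventually_elim (simp add: IL scaleR_diff_right)
   qed
   have "(?q \<longlongrightarrow> 0) (at 0)"
    using l r by (simp add: filterlim_split_at)
   then have "((\<lambda>y. ?q (y - t)) \<longlongrightarrow> 0) (at t)"
    using LIM_offset_zero_iff[of t "\<lambda>y. ?q (y - t)" 0] by simp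
   then show "((\<lambda>y. (integral {a..y} f - integral {a..t} f - (y - t) *\<^sub>R f t) /\<^sub>R norm (y - t)) \<longlongrightarrow> 0) (at t)"
    by simp
  qed
 qed
qed

text \<open>A Henstock argument. On a tagged division fine enough for the Riemann sums of
  \<open>m\<close>, intervals tagged off \<open>N\<close> obey the pointwise derivative estimate,
  and those tagged in \<open>N\<close> lie in an open set so short that absolute continuity makes
  their contribution small. Velocities enter only pointwise, so nothing has to be selected
  measurably from \<open>b_hat\<close>.\<close>

lemma norm_increment_le_integral:
 fixes z :: "real => 'a::euclidean_space"
 assumes ab: "a \<le> b" and ac: "abs_continuous_on {a..b} z"
  and m: "m integrable_on {a..b}" and N: "negligible N"
  and der: "!!t. t \<in> {a..b} ==> t \<notin> N ==>
   \<exists>v. (z has_vector_derivative v) (at t within {a..b}) \<and> norm v \<le> m t"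
 shows "norm (z b - z a) \<le> integral {a..b} m"
proof -
 define I where "I = integral {a..b} m"
 \<comment> \<open>Zero on \<open>N\<close>, so that badly tagged intervals contribute nothing to
   the Riemann sum.\<close>
 define m' where "m' = (\<lambda>t. if t \<in> N then 0 else m t)"
 have m': "(m' has_integral I) (cbox a b)"
  unfolding I_def
  using has_integral_spike[OF N _ integrable_integral[OF m], of m'] by (simp add: m'_def)
 have step: "norm (z b - z a) \<le> I + e * (b - a) + 2 * e" if e: "e > 0" for e
 proof -
  obtain g1 where g1a: "gauge g1 \<and> (\<forall>p. p tagged_division_of (cbox a b) \<and> g1 fine p -->
    norm ((\<Sum>(x, k)\<in>p. measure lborel k *\<^sub>R m' x) - I) < e)"
   using m'[unfolded has_integral, rule_format, OF e] by (elim exE)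
  then have g1: "gauge g1" by (rule conjunct1)
  have g1f: "norm ((\<Sum>(x, k)\<in>p. measure lborel k *\<^sub>R m' x) - I) < e"
   if "p tagged_division_of (cbox a b)" "g1 fine p" for p
   using conjunct2[OF g1a] that by simp
  obtain \<delta> where \<delta>: "\<delta> > 0" and acd: "!!(J::nat set) u v.
    finite J ==> (\<forall>i\<in>J. u i \<le> v i \<and> {u i..v i} \<subseteq> {a..b}) ==>
    disjoint_family_on (\<lambda>i. {u i<..<v i}) J ==> (\<Sum>i\<in>J. v i - u i) < \<delta>
    ==> (\<Sum>i\<in>J. dist (z (u i)) (z (v i))) < e"
   using ac e unfolding abs_continuous_on_def by meson
  have NL: "N \<in> sets lebesgue" "emeasure lebesgue N = 0"
   using N by (auto simp: negligible_iff_null_sets)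
  obtain U where U: "open U" "N \<subseteq> U" "U - N \<in> lmeasurable" "emeasure lebesgue (U - N) < ennreal \<delta>"
   using sets_lebesgue_outer_open[OF NL(1) \<delta>] by blast
  have Um: "emeasure lebesgue U < ennreal \<delta>"
  proof -
   have "emeasure lebesgue (U - N) = emeasure lebesgue U"
    by (rule emeasure_Diff_null_set) (use NL U(1) in auto)
   with U(4) show ?thesis by simp
  qed
  have "\<exists>d. P' x d" if "P' = (\<lambda>x d. d > 0 \<and> (\<exists>v. norm v \<le> m x \<and> (\<forall>y\<in>{a..b}. \<bar>y - x\<bar> < d -->
     norm (z y - z x - (y - x) *\<^sub>R v) \<le> e * \<bar>y - x\<bar>)))" "x \<in> {a..b}" "x \<notin> N" for x P'
  proof -
   from der[OF that(2,3)] obtain v where v: "(z has_vector_derivative v) (at x within {a..b})" "norm v \<le> m x" by blast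
   from v(1) e have "\<exists>d>0. \<forall>y\<in>{a..b}. norm (y - x) < d --> norm (z y - z x - (y - x) *\<^sub>R v) \<le> e * norm (y - x)"
    unfolding has_vector_derivative_def has_derivative_within_alt by blast
   with v(2) show ?thesis unfolding that(1) by auto
  qed
  then have "\<forall>x. x \<in> {a..b} \<and> x \<notin> N --> (\<exists>d>0. \<exists>v. norm v \<le> m x \<and> (\<forall>y\<in>{a..b}. \<bar>y - x\<bar> < d -->
     norm (z y - z x - (y - x) *\<^sub>R v) \<le> e * \<bar>y - x\<bar>))" by blast
  then obtain d where d: "!!x. x \<in> {a..b} ==> x \<notin> N ==> d x > 0 \<and> (\<exists>v. norm v \<le> m x \<and> (\<forall>y\<in>{a..b}. \<bar>y - x\<bar> < d x -->
     norm (z y - z x - (y - x) *\<^sub>R v) \<le> e * \<bar>y - x\<bar>))"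
   by metis
  \<comment> \<open>Tags in \<open>N\<close> force their interval into \<open>U\<close>, whose
    measure is below the \<delta> of absolute continuity; the other tags force it into the range of
    the pointwise derivative estimate.\<close>
  define g2 where "g2 = (\<lambda>x. if x \<in> N then U else if x \<in> {a..b} then ball x (d x) else UNIV)"
  have "gauge g2"
   unfolding gauge_def g2_def using U(1,2) d by auto
  with g1 have "gauge (\<lambda>x. g1 x \<inter> g2 x)" by (rule gauge_Int)
  then obtain p where p: "p tagged_division_of {a..b}" "(\<lambda>x. g1 x \<inter> g2 x) fine p"
   using fine_division_exists_real by blast
  then have p1: "g1 fine p" and p2: "g2 fine p" by (auto simp: fine_Int)
  have fin: "finite p" using p(1) by (rule tagged_division_ofD)
  have box: "\<exists>c d. K = {c..d} \<and> c \<le> d \<and> a \<le> c \<and> d \<le> b \<and> x \<in> K" if "(x,K) \<in> p" for x K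
  proof -
   have "x \<in> K" "K \<subseteq> {a..b}" and "\<exists>c d. K = cbox c d" using tagged_division_ofD(2,3,4)[OF p(1) that] by auto
   then show ?thesis by fastforce
  qed
  let ?S = "\<lambda>(x, K). z (Sup K) - z (Inf K)"
  have SI: "Sup K = d \<and> Inf K = c" if "K = {c..d}" "c \<le> d" for K and c d :: real using that by auto
  have sum_eq: "sum ?S p = z b - z a" by (rule additive_tagged_division_1[OF ab p(1)])
  define pN where "pN = {q \<in> p. fst q \<in> N}"
  have pN: "pN \<subseteq> p" "finite pN" using fin by (auto simp: pN_def)
  have good: "norm (?S q) \<le> (\<lambda>(x,K). measure lborel K *\<^sub>R m' x + e * measure lborel K) q" if "q \<in> p - pN" for q
  proof -
   obtain x K where q: "q = (x,K)" by force
   from that q have xK: "(x,K) \<in> p" and xN: "x \<notin> N" by (auto simp: pN_def)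
   obtain u v where K: "K = {u..v}" "u \<le> v" "a \<le> u" "v \<le> b" "x \<in> K" using box[OF xK] by blast
   have xab: "x \<in> {a..b}" using K by auto
   from d[OF xab xN] obtain w where w: "norm w \<le> m x" "\<forall>y\<in>{a..b}. \<bar>y - x\<bar> < d x -->
     norm (z y - z x - (y - x) *\<^sub>R w) \<le> e * \<bar>y - x\<bar>" by blast
   have "K \<subseteq> ball x (d x)" using fineD[OF p2 xK] xN xab by (simp add: g2_def)
   moreover have "u \<in> K" "v \<in> K" using K by auto
   ultimately have "u \<in> ball x (d x)" "v \<in> ball x (d x)" by blast+
   then have uv: "\<bar>u - x\<bar> < d x" "\<bar>v - x\<bar> < d x"
    by (auto simp: dist_real_def abs_minus_commute)
   have 1: "norm (z v - z x - (v - x) *\<^sub>R w) \<le> e * (v - x)"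
    using w(2) uv K xab by (auto dest!: bspec[where x=v])
   have 2: "norm (z u - z x - (u - x) *\<^sub>R w) \<le> e * (x - u)"
    using w(2) uv K xab by (auto dest!: bspec[where x=u])
   have eq: "z v - z u = (z v - z x - (v - x) *\<^sub>R w) - (z u - z x - (u - x) *\<^sub>R w) + (v - u) *\<^sub>R w"
    by (simp add: algebra_simps)
   have "norm (z v - z u) \<le> e * (v - x) + e * (x - u) + (v - u) * m x"
   proof -
    have "norm (z v - z u) \<le> norm (z v - z x - (v - x) *\<^sub>R w) + norm (z u - z x - (u - x) *\<^sub>R w) + norm ((v - u) *\<^sub>R w)"
     by (subst eq) (meson add_mono norm_triangle_ineq norm_triangle_ineq4 order_refl order_trans)
    moreover have "norm ((v - u) *\<^sub>R w) \<le> (v - u) * m x"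
     using K(2) w(1) by (simp add: mult_left_mono)
    ultimately show ?thesis using 1 2 by linarith
   qed
   also have "\<dots> = measure lborel K *\<^sub>R m' x + e * measure lborel K"
    using K xN by (simp add: m'_def algebra_simps)
   finally show ?thesis using SI[OF K(1,2)] q by simp
  qed
  have bad: "(\<Sum>q\<in>pN. norm (?S q)) < e"
  proof -
   \<comment> \<open>\<open>abs_continuous_on\<close> speaks of families indexed by sets of
     naturals, hence this enumeration of the bad pairs.\<close>
   obtain f where f: "bij_betw f {0..<card pN} pN" using ex_bij_betw_nat_finite[OF pN(2)] by blast
   let ?J = "{0..<card pN}"
   define u where "u = (\<lambda>i. Inf (snd (f i)))"
   define v where "v = (\<lambda>i. Sup (snd (f i)))"
   have fJ: "f i \<in> pN" if "i \<in> ?J" for i using f that by (auto simp: bij_betw_def)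
   have uv: "snd (f i) = {u i..v i} \<and> u i \<le> v i \<and> a \<le> u i \<and> v i \<le> b \<and> {u i..v i} \<subseteq> U" if "i \<in> ?J" for i
   proof -
    obtain x K where xK: "f i = (x,K)" by force
    then have xp: "(x,K) \<in> p" and xN: "x \<in> N" using fJ[OF that] by (auto simp: pN_def)
    obtain c d where K: "K = {c..d}" "c \<le> d" "a \<le> c" "d \<le> b" using box[OF xp] by blast
    have "K \<subseteq> U" using fineD[OF p2 xp] xN by (simp add: g2_def)
    with K xK show ?thesis by (simp add: u_def v_def)
   qed
   have disj: "disjoint_family_on (\<lambda>i. {u i<..<v i}) ?J"
    unfolding disjoint_family_on_def
   proof safe
    fix i j x assume ij: "i \<in> ?J" "j \<in> ?J" "i \<noteq> j" and x: "x \<in> {u i<..<v i}" "x \<in> {u j<..<v j}"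
    have "f i \<noteq> f j" using f ij by (auto simp: bij_betw_def inj_on_def)
    moreover have "f i \<in> p" "f j \<in> p" using fJ ij pN by auto
    ultimately have "interior (snd (f i)) \<inter> interior (snd (f j)) = {}"
     using tagged_division_ofD(5)[OF p(1)] by (metis surjective_pairing)
    then show "x \<in> {}" using x uv[OF ij(1)] uv[OF ij(2)] by (auto simp: interior_atLeastAtMost_real)
   qed
   have "(\<Sum>i\<in>?J. v i - u i) < \<delta>"
   proof -
    have fine_int: "emeasure lborel {u i<..<v i} \<noteq> top" for i
     by (metis box_real(1) bounded_box emeasure_bounded_finite infinity_ennreal_def less_irrefl)
    have "(\<Sum>i\<in>?J. v i - u i) = (\<Sum>i\<in>?J. measure lebesgue {u i<..<v i})"
     by (rule sum.cong) (use uv in auto)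
    also have "\<dots> = measure lebesgue (\<Union>i\<in>?J. {u i<..<v i})"
     by (rule measure_finite_Union[symmetric]) (use disj fine_int in auto)
    also have "\<dots> \<le> measure lebesgue U"
    proof (rule measure_mono_fmeasurable)
     show "(\<Union>i\<in>?J. {u i<..<v i}) \<subseteq> U" using uv by fastforce
     show "U \<in> fmeasurable lebesgue" using Um U(1)
      by (intro fmeasurableI) (auto intro: less_trans)
    qed auto
    also have "\<dots> < \<delta>" using Um \<delta> by (metis ennreal_less_iff emeasure_eq_ennreal_measure infinity_ennreal_def less_top measure_nonneg ennreal_less_top order_less_trans top.not_eq_extremum)
    finally show ?thesis .
   qed
   then have "(\<Sum>i\<in>?J. dist (z (u i)) (z (v i))) < e"
    by (intro acd disj) (use uv in auto)
   moreover have "(\<Sum>q\<in>pN. norm (?S q)) = (\<Sum>i\<in>?J. norm (?S (f i)))"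
    using sum.reindex_bij_betw[OF f, of "\<lambda>q. norm (?S q)"] by simp
   moreover have "norm (?S (f i)) = dist (z (u i)) (z (v i))" for i
    by (simp add: u_def v_def dist_norm norm_minus_commute case_prod_beta)
   ultimately show ?thesis by simp
  qed
  have nn: "0 \<le> (\<lambda>(x,K). measure lborel K *\<^sub>R m' x + e * measure lborel K) q" if "q \<in> p" for q
  proof (cases "q \<in> pN")
   case True then show ?thesis using e by (auto simp: pN_def m'_def split: prod.splits)
  next
   case False then show ?thesis using order_trans[OF norm_ge_zero good[of q]] that by blast
  qed
  have "norm (z b - z a) \<le> (\<Sum>q\<in>p. norm (?S q))" unfolding sum_eq[symmetric] by (rule norm_sum)
  also have "\<dots> = (\<Sum>q\<in>p - pN. norm (?S q)) + (\<Sum>q\<in>pN. norm (?S q))"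
   by (rule sum.subset_diff[OF pN(1) fin])
  also have "(\<Sum>q\<in>p - pN. norm (?S q)) \<le> (\<Sum>q\<in>p - pN. (\<lambda>(x,K). measure lborel K *\<^sub>R m' x + e * measure lborel K) q)"
   by (rule sum_mono) (rule good)
  also have "\<dots> \<le> (\<Sum>q\<in>p. (\<lambda>(x,K). measure lborel K *\<^sub>R m' x + e * measure lborel K) q)"
   by (rule sum_mono2[OF fin]) (use nn in auto)
  also have "\<dots> = (\<Sum>(x,K)\<in>p. measure lborel K *\<^sub>R m' x) + e * (\<Sum>(x,K)\<in>p. measure lborel K)"
   by (simp add: sum.distrib sum_distrib_left case_prod_unfold)
  also have "(\<Sum>(x,K)\<in>p. measure lborel K) = b - a"
   using additive_content_tagged_division[of p a b] p(1) ab by simp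
  also have "(\<Sum>(x,K)\<in>p. measure lborel K *\<^sub>R m' x) < I + e"
   using g1f[of p] p(1) p1 by (auto simp: abs_less_iff)
  finally show ?thesis using bad by linarith
 qed
 show ?thesis
 proof (rule field_le_epsilon)
  fix e :: real assume e: "e > 0"
  \<comment> \<open>The total error is e' per unit length at good tags, e' from the Riemann sum and
    e' from the bad tags.\<close>
  define e' where "e' = e / (b - a + 2)"
  have "e' > 0" using e ab by (simp add: e'_def)
  from step[OF this] have "norm (z b - z a) \<le> I + e' * (b - a + 2)" by (simp add: algebra_simps)
  also have "e' * (b - a + 2) = e" using ab by (simp add: e'_def)
  finally show "norm (z b - z a) \<le> integral {a..b} m + e" by (simp add: I_def)
 qed
qed

text \<open>Identities between signed quantities are stated with the negative parts moved to the
  other side, so that sums of measures are compared: in \<open>ac_real_density\<close> for Stieltjes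
  measures, in \<open>signed_radon_eqI\<close> for Jordan parts.\<close>

definition add_measure :: "'a measure => 'a measure => 'a measure" where
 "add_measure M N = measure_of (space M) (sets M) (\<lambda>A. emeasure M A + emeasure N A)"

lemma sets_add_measure [simp]: "sets (add_measure M N) = sets M"
 by (simp add: add_measure_def sets.sigma_sets_eq)

lemma emeasure_add_measure:
 assumes "sets N = sets M" "A \<in> sets M"
 shows "emeasure (add_measure M N) A = emeasure M A + emeasure N A"
 unfolding add_measure_def
proof (rule emeasure_measure_of_sigma)
 show "sigma_algebra (space M) (sets M)" by (rule sets.sigma_algebra_axioms)
 show "positive (sets M) (\<lambda>A. emeasure M A + emeasure N A)" by (simp add: positive_def)
 show "countably_additive (sets M) (\<lambda>A. emeasure M A + emeasure N A)"
  unfolding countably_additive_def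
 proof safe
  fix A :: "nat => 'a set" assume A: "range A \<subseteq> sets M" "disjoint_family A"
  have "(\<Sum>i. emeasure M (A i) + emeasure N (A i)) = (\<Sum>i. emeasure M (A i)) + (\<Sum>i. emeasure N (A i))"
   by (rule suminf_add[symmetric]) auto
  then show "(\<Sum>i. emeasure M (A i) + emeasure N (A i)) = emeasure M (\<Union> (range A)) + emeasure N (\<Union> (range A))"
   using A assms(1) by (simp add: suminf_emeasure)
 qed
qed (use assms in auto)

text \<open>Absolute continuity with a named majorant of the speed. In this form it survives
  pointwise limits with a common \<open>m\<close> and hands over dominating functions directly;
  \<open>dom_increments_of_abs_continuous\<close> and
  \<open>abs_continuous_of_dom_increments\<close> link it to
  \<open>abs_continuous_on\<close>.\<close>

definition dom_increments :: "real => real => (real => real) => (real => 'a::euclidean_space) => bool" where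
 "dom_increments a b m F \<longleftrightarrow> m integrable_on {a..b} \<and> (\<forall>t\<in>{a..b}. 0 \<le> m t) \<and>
  (\<forall>s t. a \<le> s --> s \<le> t --> t \<le> b --> norm (F t - F s) \<le> integral {s..t} m)"

lemma dom_incrementsD:
 assumes "dom_increments a b m F"
 shows "m integrable_on {a..b}" "!!t. a \<le> t ==> t \<le> b ==> 0 \<le> m t"
  "!!s t. a \<le> s ==> s \<le> t ==> t \<le> b ==> norm (F t - F s) \<le> integral {s..t} m"
 using assms by (auto simp: dom_increments_def)

lemma dom_increments_subinterval:
 assumes "dom_increments a b m F" "a \<le> c" "d \<le> b"
 shows "dom_increments c d m F"
 using assms integrable_on_subinterval[of m "{a..b}" c d] by (auto simp: dom_increments_def)

lemma integral_Icc_continuous: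
 fixes m :: "real => 'a::euclidean_space"
 assumes "m integrable_on {a..b}"
 shows "continuous_on UNIV (\<lambda>t. integral {a..max a (min b t)} m)"
proof (cases "a \<le> b")
 case True
 have "continuous_on ((\<lambda>t. max a (min b t)) ` UNIV) (\<lambda>t. integral {a..t} m)"
  by (rule continuous_on_subset[OF indefinite_integral_continuous_1[OF assms]]) (use True in auto)
 then show ?thesis
  by (rule continuous_on_compose2) (auto intro!: continuous_intros)
next
 case False
 then have "integral {a..max a (min b t)} m = 0" for t
  by (cases "max a (min b t) = a") (auto simp: max_def min_def)
 then show ?thesis by simp
qed

lemma dom_increments_continuous:
 assumes d: "dom_increments a b m F"
 shows "continuous_on {a..b} F"
 unfolding continuous_on_iff
proof safe
 fix s e :: real assume s: "s \<in> {a..b}" and e: "e > 0"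
 have "continuous_on {a..b} (\<lambda>t. integral {a..t} m)"
  by (rule indefinite_integral_continuous_1[OF dom_incrementsD(1)[OF d]])
 then obtain k where k: "k > 0" "!!t. t \<in> {a..b} ==> dist t s < k ==> dist (integral {a..t} m) (integral {a..s} m) < e"
  unfolding continuous_on_iff using s e by blast
 have *: "integral {a..u} m + integral {u..v} m = integral {a..v} m" if "a \<le> u" "u \<le> v" "v \<le> b" for u v
  by (rule Henstock_Kurzweil_Integration.integral_combine)
   (use that in \<open>auto intro: integrable_on_subinterval[OF dom_incrementsD(1)[OF d]]\<close>)
 show "\<exists>k>0. \<forall>t\<in>{a..b}. dist t s < k --> dist (F t) (F s) < e"
 proof (intro exI[of _ k] conjI ballI impI k(1))
  fix t assume t: "t \<in> {a..b}" "dist t s < k"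
  show "dist (F t) (F s) < e"
  proof (cases "s \<le> t")
   case True
   then show ?thesis using dom_incrementsD(3)[OF d, of s t] k(2)[OF t] *[of s t] s t
    by (auto simp: dist_norm)
  next
   case False
   then show ?thesis using dom_incrementsD(3)[OF d, of t s] k(2)[OF t] *[of t s] s t
    by (auto simp: dist_norm norm_minus_commute)
  qed
 qed
qed

text \<open>With \<open>M\<close> the primitive of \<open>m\<close>, domination says that
  \<open>M + F\<close> and \<open>M - F\<close> are both nondecreasing. Their Stieltjes measures add
  up to the measure with density 2 m, so each is absolutely continuous; the Radon-Nikodym density of
  the first, minus \<open>m\<close>, is the density of \<open>F\<close>.\<close>

lemma ac_real_density:
 fixes F :: "real => real"
 assumes d: "dom_increments a b m F" and ab: "a < b"
 obtains p where "p integrable_on {a..b}" "(\<lambda>t. \<bar>p t\<bar>) integrable_on {a..b}"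
  "!!t. t \<in> {a..b} ==> F t - F a = integral {a..t} p"
proof -
 note d1 = dom_incrementsD(1)[OF d] and d2 = dom_incrementsD(2)[OF d] and d3 = dom_incrementsD(3)[OF d]
 \<comment> \<open>Clamping to [a,b] makes both primitives constant outside, so that the Stieltjes
   measures live on the whole line.\<close>
 define cl where "cl = (\<lambda>t. max a (min b t))"
 have cl: "cl t \<in> {a..b}" for t using ab by (auto simp: cl_def)
 have clmono: "s \<le> t ==> cl s \<le> cl t" for s t by (auto simp: cl_def)
 have clid: "t \<in> {a..b} ==> cl t = t" for t by (auto simp: cl_def)
 have comb: "integral {a..u} m + integral {u..v} m = integral {a..v} m" if "a \<le> u" "u \<le> v" "v \<le> b" for u v
  by (rule Henstock_Kurzweil_Integration.integral_combine)
   (use that in \<open>auto intro: integrable_on_subinterval[OF d1]\<close>)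
 define M where "M = (\<lambda>t. integral {a..cl t} m)"
 define H where "H = (\<lambda>t. M t + F (cl t))"
 define J where "J = (\<lambda>t. M t - F (cl t))"
 have Mdiff: "M t - M s = integral {cl s..cl t} m" if "s \<le> t" for s t
  using comb[of "cl s" "cl t"] cl[of s] cl[of t] clmono[OF that] by (auto simp: M_def)
 have Fdiff: "\<bar>F (cl t) - F (cl s)\<bar> \<le> M t - M s" if "s \<le> t" for s t
  using d3[of "cl s" "cl t"] Mdiff[OF that] cl[of s] cl[of t] clmono[OF that] by auto
 have Hm: "H s \<le> H t" and Jm: "J s \<le> J t" if "s \<le> t" for s t
  using Fdiff[OF that] by (auto simp: H_def J_def)
 have Mc: "continuous_on UNIV M" unfolding M_def cl_def by (rule integral_Icc_continuous[OF d1])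
 have Fc: "continuous_on UNIV (\<lambda>t. F (cl t))"
  by (rule continuous_on_compose2[OF dom_increments_continuous[OF d]])
   (use cl in \<open>auto simp: cl_def intro!: continuous_intros\<close>)
 have Hc: "continuous_on UNIV H" and Jc: "continuous_on UNIV J"
  unfolding H_def J_def using Mc Fc by (auto intro!: continuous_intros)
 have Hr: "continuous (at_right t) H" and Jr: "continuous (at_right t) J" for t
  using Hc Jc by (auto simp: continuous_on_eq_continuous_at continuous_at_imp_continuous_at_within)
 let ?H = "interval_measure H" and ?J = "interval_measure J"
 have eH: "emeasure ?H {s<..t} = ennreal (H t - H s)" if "s \<le> t" for s t
  by (rule emeasure_interval_measure_Ioc[OF that Hm]) (use Hr in auto)
 have eJ: "emeasure ?J {s<..t} = ennreal (J t - J s)" if "s \<le> t" for s t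
  by (rule emeasure_interval_measure_Ioc[OF that Jm]) (use Jr in auto)
 define moll where "moll = (\<lambda>t. if t \<in> {a..b} then m t else 0)"
 have "moll absolutely_integrable_on UNIV"
  unfolding moll_def by (subst absolutely_integrable_restrict_UNIV)
   (intro nonnegative_absolutely_integrable_1 d1, use d2 in auto)
 then have mmI: "integrable lebesgue moll" by (simp add: set_integrable_def)
 \<comment> \<open>\<open>density lborel\<close> is used with a Borel function, whereas
   \<open>moll\<close> is only Lebesgue measurable.\<close>
 obtain g where g: "g \<in> borel_measurable lborel" and gm: "AE x in lborel. moll x = g x"
  using completion_ex_borel_measurable_real[of moll lborel] mmI by auto
 let ?N = "density lborel (\<lambda>x. ennreal (2 * g x))"
 have gN: "(\<lambda>x. ennreal (2 * g x)) \<in> borel_measurable lborel" using g by simp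
 have eN: "emeasure ?N {s<..t} = ennreal (2 * (M t - M s))" if "s \<le> t" for s t
 proof -
  have si': "integrable lebesgue (\<lambda>x. indicat_real {s<..t} x * moll x)"
   using integrable_mult_indicator[of "{s<..t}" lebesgue moll] mmI by simp
  have mm0: "0 \<le> moll x" for x using d2 by (simp add: moll_def)
  have "emeasure ?N {s<..t} = (\<integral>\<^sup>+x. ennreal (2 * g x) * indicator {s<..t} x \<partial>lborel)"
   by (rule emeasure_density) (use gN in auto)
  also have "\<dots> = (\<integral>\<^sup>+x. ennreal (2 * moll x) * indicator {s<..t} x \<partial>lborel)"
   by (rule nn_integral_cong_AE) (use gm in auto)
  also have "\<dots> = (\<integral>\<^sup>+x. ennreal (2 * moll x) * indicator {s<..t} x \<partial>lebesgue)"
   by (simp add: nn_integral_completion)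
  also have "\<dots> = (\<integral>\<^sup>+x. ennreal (indicator {s<..t} x * (2 * moll x)) \<partial>lebesgue)"
   by (rule nn_integral_cong) (auto simp: indicator_def)
  also have "\<dots> = ennreal (\<integral>x. indicator {s<..t} x * (2 * moll x) \<partial>lebesgue)"
   by (rule nn_integral_eq_integral) (use integrable_mult_right[OF si', of 2] mm0 in \<open>auto simp: mult.left_commute\<close>)
  also have "(\<integral>x. indicator {s<..t} x * (2 * moll x) \<partial>lebesgue) = 2 * (M t - M s)"
  proof -
   have si: "set_integrable lebesgue {s<..t} moll"
    using si' by (simp add: set_integrable_def)
   have "(\<integral>x. indicator {s<..t} x * (2 * moll x) \<partial>lebesgue) = 2 * (LINT x:{s<..t}|lebesgue. moll x)"
    by (simp add: set_lebesgue_integral_def mult.left_commute)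
   also have "(LINT x:{s<..t}|lebesgue. moll x) = integral {s<..t} moll"
    by (rule set_lebesgue_integral_eq_integral(2)[OF si])
   also have "\<dots> = integral {s..t} moll"
    by (rule integral_subset_negligible) (auto intro: negligible_subset[of "{s}"])
   also have "\<dots> = integral ({s..t} \<inter> {a..b}) m"
    unfolding moll_def by (simp only: integral_restrict_Int Int_commute)
   also have "\<dots> = integral {cl s..cl t} m"
   proof (cases "t < a \<or> b < s")
    case True
    then have "{s..t} \<inter> {a..b} = {}" "cl s = cl t" using that ab by (auto simp: cl_def max_def min_def)
    then show ?thesis by simp
   next
    case False
    then have "max s a = cl s" "min t b = cl t" using that ab by (auto simp: cl_def max_def min_def)
    then show ?thesis by (simp add: Int_atLeastAtMost)
   qed
   finally show ?thesis using Mdiff[OF that] by simp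
  qed
  finally show ?thesis .
 qed
 have sum_eq: "add_measure ?H ?J = ?N"
 proof (rule measure_eqI_generator_eq[where E="range (\<lambda>(x,y). {x<..y::real})" and \<Omega>=UNIV and A="\<lambda>i. {- real i<..real i}"])
  show "Int_stable (range (\<lambda>(x,y). {x<..y::real}))"
   unfolding Int_stable_def by (auto simp: image_iff)
  show "emeasure (add_measure ?H ?J) X = emeasure ?N X" if "X \<in> range (\<lambda>(x,y). {x<..y::real})" for X
  proof -
   obtain q where "X = (\<lambda>(x,y). {x<..y::real}) q" using \<open>X \<in> _\<close> by blast
   then obtain s t where X: "X = {s<..t}" by (cases q) auto
   show ?thesis
   proof (cases "s \<le> t")
    case True
    have "emeasure (add_measure ?H ?J) X = ennreal (H t - H s) + ennreal (J t - J s)"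
     by (subst emeasure_add_measure) (use X eH[OF True] eJ[OF True] in auto)
    also have "\<dots> = ennreal (2 * (M t - M s))"
     using Hm[OF True] Jm[OF True] by (subst ennreal_plus[symmetric]) (auto simp: H_def J_def)
    finally show ?thesis using eN[OF True] X by simp
   next
    case False then show ?thesis using X by simp
   qed
  qed
  show "emeasure (add_measure ?H ?J) {- real i<..real i} \<noteq> \<infinity>" for i
   by (subst emeasure_add_measure) (auto simp: eH eJ)
  show "(\<Union>i. {- real i<..real i}) = (UNIV::real set)"
  proof safe
   fix x :: real
   obtain n where "\<bar>x\<bar> < real n" using reals_Archimedean2 by blast
   then show "x \<in> (\<Union>i. {- real i<..real i})" by (auto intro!: exI[of _ n])
  qed auto
  show "sets (add_measure ?H ?J) = sigma_sets UNIV (range (\<lambda>(x,y). {x<..y::real}))"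
   "sets ?N = sigma_sets UNIV (range (\<lambda>(x,y). {x<..y::real}))"
   by (simp_all add: borel_sigma_sets_Ioc)
 qed auto
 have "absolutely_continuous lborel ?H"
  unfolding absolutely_continuous_def
 proof
  fix A assume A: "A \<in> null_sets (lborel :: real measure)"
  then have "A \<in> null_sets ?N"
   using absolutely_continuousI_density[OF gN] by (auto simp: absolutely_continuous_def)
  then have "emeasure ?H A + emeasure ?J A = 0"
   using emeasure_add_measure[of ?J ?H A] A unfolding sum_eq by (auto simp: null_sets_def)
  then show "A \<in> null_sets ?H" using A by (auto simp: null_sets_def)
 qed
 then obtain f where f: "f \<in> borel_measurable lborel" "density lborel f = ?H"
  using sigma_finite_measure.Radon_Nikodym[OF sigma_finite_lborel, of ?H] by auto
 have If: "(\<integral>\<^sup>+x. f x * indicator {a<..t} x \<partial>lborel) = ennreal (H t - H a)" if "a \<le> t" for t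
  using emeasure_density[OF f(1), of "{a<..t}"] eH[OF that] f(2) by simp
 have fin: "AE x in lborel. f x * indicator {a<..b} x \<noteq> \<infinity>"
  by (rule nn_integral_PInf_AE) (use f If[of b] ab in auto)
 \<comment> \<open>\<open>enn2real\<close> sends infinite values to 0, which by \<open>fin\<close>
   happens only on a null set.\<close>
 define fr where "fr = (\<lambda>x. enn2real (f x * indicator {a<..b} x))"
 have frI: "(fr has_integral (H t - H a)) {a..t}" if t: "t \<in> {a..b}" for t
 proof -
  have "((\<lambda>x. fr x * indicator {a<..t} x) has_integral (H t - H a)) UNIV"
  proof (rule nn_integral_has_integral)
   show "(\<lambda>x. fr x * indicator {a<..t} x) \<in> borel_measurable borel"
    unfolding fr_def using f(1) by measurable
   show "0 \<le> fr x * indicator {a<..t} x" for x by (simp add: fr_def)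
   show "0 \<le> H t - H a" using Hm[of a t] t by simp
   have "(\<integral>\<^sup>+x. ennreal (fr x * indicator {a<..t} x) \<partial>lborel) = (\<integral>\<^sup>+x. f x * indicator {a<..t} x \<partial>lborel)"
    by (rule nn_integral_cong_AE) (use fin t in \<open>auto simp: fr_def indicator_def ennreal_enn2real_if\<close>)
   then show "(\<integral>\<^sup>+x. ennreal (fr x * indicator {a<..t} x) \<partial>lborel) = ennreal (H t - H a)"
    using If[of t] t by simp
  qed
  moreover have "(\<lambda>x. fr x * indicator {a<..t} x) = (\<lambda>x. if x \<in> {a<..t} then fr x else 0)" by auto
  ultimately have "(fr has_integral (H t - H a)) {a<..t}" by (simp only: has_integral_restrict_UNIV)
  then show ?thesis
   by (subst has_integral_spike_set_eq[of _ "{a<..t}"]) (auto intro: negligible_subset[of "{a}"])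
 qed
 show thesis
 proof (rule that[of "\<lambda>t. fr t - m t"])
  have "fr absolutely_integrable_on {a..b}"
   using frI[of b] ab by (intro nonnegative_absolutely_integrable_1) (auto simp: fr_def intro: has_integral_integrable)
  moreover have "m absolutely_integrable_on {a..b}"
   using d1 d2 by (intro nonnegative_absolutely_integrable_1) auto
  ultimately have "(\<lambda>t. fr t - m t) absolutely_integrable_on {a..b}"
   by (rule set_integral_diff)
  then show "(\<lambda>t. fr t - m t) integrable_on {a..b}" "(\<lambda>t. \<bar>fr t - m t\<bar>) integrable_on {a..b}"
   by (auto simp: absolutely_integrable_on_def)
  fix t assume t: "t \<in> {a..b}"
  have "m integrable_on {a..t}" using d1 t by (auto intro: integrable_on_subinterval)
  then have "((\<lambda>t. fr t - m t) has_integral (H t - H a) - integral {a..t} m) {a..t}"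
   using frI[OF t] by (intro has_integral_diff integrable_integral)
  then have "integral {a..t} (\<lambda>t. fr t - m t) = (H t - H a) - integral {a..t} m" by (rule integral_unique)
  then show "F t - F a = integral {a..t} (\<lambda>t. fr t - m t)"
   using t clid[OF t] clid[of a] by (simp add: H_def M_def)
 qed
qed

text \<open>Coordinatewise densities give \<open>p\<close>. Lebesgue points of \<open>p\<close> and
  \<open>m\<close> give the derivative and its bound, the latter as the limit of the inequality
  between averages.\<close>

theorem dom_increments_FTC:
 fixes F :: "real => 'a::euclidean_space"
 assumes d: "dom_increments a b m F"
 obtains p N where "p absolutely_integrable_on {a..b}" "negligible N"
  "!!s t. a \<le> s ==> s \<le> t ==> t \<le> b ==> integral {s..t} p = F t - F s"
  "!!t. t \<in> {a<..<b} ==> t \<notin> N ==> (F has_vector_derivative p t) (at t)"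
  "!!t. t \<in> {a<..<b} ==> t \<notin> N ==> norm (p t) \<le> m t"
proof (cases "a < b")
 case False
 have st: "s = t" if "a \<le> s" "s \<le> t" "t \<le> b" for s t using that False by linarith
 show thesis
 proof (rule that[of "\<lambda>_. 0" "{}"])
  show "integral {s..t} (\<lambda>_. 0::'a) = F t - F s" if "a \<le> s" "s \<le> t" "t \<le> b" for s t
   using st[OF that] by simp
 qed (use False in auto)
next
 case ab: True
 note d1 = dom_incrementsD(1)[OF d] and d2 = dom_incrementsD(2)[OF d] and d3 = dom_incrementsD(3)[OF d]
 have di: "dom_increments a b m (\<lambda>t. F t \<bullet> i)" if "i \<in> Basis" for i
  unfolding dom_increments_def
 proof (intro conjI allI impI ballI)
  fix s t assume st: "a \<le> s" "s \<le> t" "t \<le> b"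
  have "norm (F t \<bullet> i - F s \<bullet> i) \<le> norm (F t - F s)"
   unfolding inner_diff_left[symmetric] using Basis_le_norm[OF that] by simp
  then show "norm (F t \<bullet> i - F s \<bullet> i) \<le> integral {s..t} m" using d3[OF st] by linarith
 qed (use d1 d2 in auto)
 have "\<exists>p. \<forall>i\<in>Basis. (\<lambda>t. p i t) absolutely_integrable_on {a..b} \<and>
   (\<forall>t\<in>{a..b}. F t \<bullet> i - F a \<bullet> i = integral {a..t} (p i))"
 proof (rule bchoice, intro ballI)
  fix i :: 'a assume "i \<in> Basis"
  from ac_real_density[OF di[OF this] ab] obtain p where p: "p integrable_on {a..b}" "(\<lambda>t. \<bar>p t\<bar>) integrable_on {a..b}"
   "!!t. t \<in> {a..b} ==> F t \<bullet> i - F a \<bullet> i = integral {a..t} p" by blast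
  then show "\<exists>p. p absolutely_integrable_on {a..b} \<and> (\<forall>t\<in>{a..b}. F t \<bullet> i - F a \<bullet> i = integral {a..t} p)"
   by (intro exI[of _ p]) (auto simp: absolutely_integrable_on_def)
 qed
 then obtain q where q: "!!i. i \<in> Basis ==> q i absolutely_integrable_on {a..b}"
  "!!i t. i \<in> Basis ==> t \<in> {a..b} ==> F t \<bullet> i - F a \<bullet> i = integral {a..t} (q i)" by metis
 define p where "p = (\<lambda>t. \<Sum>i\<in>Basis. q i t *\<^sub>R i)"
 have pi: "p t \<bullet> i = q i t" if "i \<in> Basis" for t i
  unfolding p_def using that by (simp add: inner_sum_left_Basis)
 have pA: "p absolutely_integrable_on {a..b}"
 proof (rule absolutely_integrable_componentwise)
  fix i :: 'a assume i: "i \<in> Basis"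
  show "(\<lambda>x. p x \<bullet> i) absolutely_integrable_on {a..b}" using q(1)[OF i] by (simp add: pi[OF i])
 qed
 then have pI: "p integrable_on {a..b}" by (simp add: absolutely_integrable_on_def)
 have Fp: "F t = F a + integral {a..t} p" if t: "t \<in> {a..b}" for t
 proof (rule euclidean_eqI)
  fix i :: 'a assume i: "i \<in> Basis"
  have "p integrable_on {a..t}" using pI t by (auto intro: integrable_on_subinterval)
  then have "integral {a..t} p \<bullet> i = integral {a..t} (\<lambda>x. p x \<bullet> i)"
   by (simp add: integral_component_eq)
  also have "\<dots> = F t \<bullet> i - F a \<bullet> i" using q(2)[OF i t] by (simp add: pi[OF i])
  finally show "F t \<bullet> i = (F a + integral {a..t} p) \<bullet> i" by (simp add: inner_add_left)
 qed
 obtain N1 where N1: "negligible N1"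
  "!!t. t \<in> {a<..<b} ==> t \<notin> N1 ==> ((\<lambda>h. integral {t..t + h} p /\<^sub>R h) \<longlongrightarrow> p t) (at_right 0)"
  "!!t. t \<in> {a<..<b} ==> t \<notin> N1 ==> ((\<lambda>u. integral {a..u} p) has_vector_derivative p t) (at t)"
  using Lebesgue_point[OF pI] by blast
 obtain N2 where N2: "negligible N2"
  "!!t. t \<in> {a<..<b} ==> t \<notin> N2 ==> ((\<lambda>h. integral {t..t + h} m /\<^sub>R h) \<longlongrightarrow> m t) (at_right 0)"
  "!!t. t \<in> {a<..<b} ==> t \<notin> N2 ==> ((\<lambda>u. integral {a..u} m) has_vector_derivative m t) (at t)"
  using Lebesgue_point[OF d1] by blast
 have inc: "integral {s..t} p = F t - F s" if "a \<le> s" "s \<le> t" "t \<le> b" for s t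
 proof -
  have "integral {a..s} p + integral {s..t} p = integral {a..t} p"
   by (rule Henstock_Kurzweil_Integration.integral_combine)
    (use that in \<open>auto intro: integrable_on_subinterval[OF pI]\<close>)
  then show ?thesis using Fp[of s] Fp[of t] that by (simp add: algebra_simps)
 qed
 show thesis
 proof (rule that[of p "N1 \<union> N2", OF pA])
  show "negligible (N1 \<union> N2)" using N1(1) N2(1) by simp
  fix t assume t: "t \<in> {a<..<b}" "t \<notin> N1 \<union> N2"
  have "((\<lambda>u. F a + integral {a..u} p) has_vector_derivative p t) (at t)"
   using has_vector_derivative_add[OF has_vector_derivative_const N1(3)[of t]] t by simp
  then show "(F has_vector_derivative p t) (at t)"
   by (rule has_vector_derivative_transform_within_open[where S="{a<..<b}"]) (use t in \<open>auto intro!: Fp[symmetric]\<close>)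
  show "norm (p t) \<le> m t"
  proof (rule tendsto_le)
   show "((\<lambda>h. norm (integral {t..t + h} p /\<^sub>R h)) \<longlongrightarrow> norm (p t)) (at_right 0)"
    using N1(2)[of t] t by (intro tendsto_norm) auto
   show "((\<lambda>h. integral {t..t + h} m /\<^sub>R h) \<longlongrightarrow> m t) (at_right 0)" using N2(2)[of t] t by auto
   have "\<forall>\<^sub>F h in at_right (0::real). h > 0 \<and> h < b - t"
    using t by (auto simp: eventually_at_right_field intro!: exI[of _ "b-t"])
   then show "\<forall>\<^sub>F h in at_right 0. norm (integral {t..t + h} p /\<^sub>R h) \<le> integral {t..t + h} m /\<^sub>R h"
   proof eventually_elim
    case (elim h)
    then have "norm (integral {t..t + h} p) \<le> integral {t..t + h} m"
     using d3[of t "t+h"] inc[of t "t+h"] t by simp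
    then show ?case using elim by (simp add: divide_right_mono field_simps)
   qed
  qed simp
 qed (use inc in auto)
qed

lemma dom_increments_FTC_ex:
 fixes F :: "real => 'a::euclidean_space"
 assumes d: "dom_increments a b m F"
 shows "\<exists>p N. p absolutely_integrable_on {a..b} \<and> negligible N \<and>
  (\<forall>s t. a \<le> s --> s \<le> t --> t \<le> b --> integral {s..t} p = F t - F s) \<and>
  (\<forall>t. t \<in> {a<..<b} --> t \<notin> N --> (F has_vector_derivative p t) (at t) \<and> norm (p t) \<le> m t)"
 by (rule dom_increments_FTC[OF d]) blast

lemma Lebesgue_point_ex:
 fixes f :: "real => 'b::euclidean_space"
 assumes "f integrable_on {a..b}"
 shows "\<exists>N. negligible N \<and> (\<forall>t. t \<in> {a<..<b} --> t \<notin> N -->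
  ((\<lambda>h. integral {t..t + h} f /\<^sub>R h) \<longlongrightarrow> f t) (at_right 0) \<and>
  ((\<lambda>u. integral {a..u} f) has_vector_derivative f t) (at t))"
 by (rule Lebesgue_point[OF assms]) blast

lemma abs_continuous_on_subset:
 assumes "abs_continuous_on S c" "S' \<subseteq> S"
 shows "abs_continuous_on S' c"
 unfolding abs_continuous_on_def
proof (intro allI impI)
 fix e :: real assume "e > 0"
 then obtain d where "d > 0" and d: "\<forall>(I::nat set) u v.
    finite I \<and> (\<forall>i\<in>I. u i \<le> v i \<and> {u i..v i} \<subseteq> S) \<and>
    disjoint_family_on (\<lambda>i. {u i<..<v i}) I \<and> (\<Sum>i\<in>I. v i - u i) < d
    --> (\<Sum>i\<in>I. dist (c (u i)) (c (v i))) < e"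
  using assms(1) unfolding abs_continuous_on_def by blast
 show "\<exists>d>0. \<forall>(I::nat set) u v.
    finite I \<and> (\<forall>i\<in>I. u i \<le> v i \<and> {u i..v i} \<subseteq> S') \<and>
    disjoint_family_on (\<lambda>i. {u i<..<v i}) I \<and> (\<Sum>i\<in>I. v i - u i) < d
    --> (\<Sum>i\<in>I. dist (c (u i)) (c (v i))) < e"
 proof (intro exI[of _ d] conjI allI impI \<open>d > 0\<close>)
  fix I :: "nat set" and u v
  assume *: "finite I \<and> (\<forall>i\<in>I. u i \<le> v i \<and> {u i..v i} \<subseteq> S') \<and>
     disjoint_family_on (\<lambda>i. {u i<..<v i}) I \<and> (\<Sum>i\<in>I. v i - u i) < d"
  then have "\<forall>i\<in>I. u i \<le> v i \<and> {u i..v i} \<subseteq> S" using assms(2) by blast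
  then show "(\<Sum>i\<in>I. dist (c (u i)) (c (v i))) < e"
   using * d[rule_format, of I u v] by blast
 qed
qed

lemma dom_increments_of_abs_continuous:
 fixes c :: "real => 'a::euclidean_space"
 assumes ac: "abs_continuous_on {a..b} c"
  and m: "m integrable_on {a..b}" "!!t. t \<in> {a..b} ==> 0 \<le> m t" and N: "negligible N"
  and der: "!!t. t \<in> {a..b} ==> t \<notin> N ==>
   \<exists>v. (c has_vector_derivative v) (at t within {a..b}) \<and> norm v \<le> m t"
 shows "dom_increments a b m c"
 unfolding dom_increments_def
proof (intro conjI ballI allI impI m)
 fix s t assume st: "a \<le> s" "s \<le> t" "t \<le> b"
 have sub: "{s..t} \<subseteq> {a..b}" using st by auto
 show "norm (c t - c s) \<le> integral {s..t} m"
 proof (rule norm_increment_le_integral[OF st(2) _ _ N])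
  show "abs_continuous_on {s..t} c" by (rule abs_continuous_on_subset[OF ac sub])
  show "m integrable_on {s..t}" by (rule integrable_on_subinterval[OF m(1) sub])
  fix r assume r: "r \<in> {s..t}" "r \<notin> N"
  then obtain v where "(c has_vector_derivative v) (at r within {a..b})" "norm v \<le> m r"
   using der[of r] sub by blast
  then show "\<exists>v. (c has_vector_derivative v) (at r within {s..t}) \<and> norm v \<le> m r"
   using has_vector_derivative_within_subset[OF _ sub] by blast
 qed
qed

lemma integral_truncation_tendsto:
 fixes m :: "real => real"
 assumes m: "m integrable_on {a..b}" "!!t. t \<in> {a..b} ==> 0 \<le> m t"
 shows "!!k::nat. (\<lambda>t. min (m t) (real k)) integrable_on {a..b}"
  "(\<lambda>k. integral {a..b} (\<lambda>t. min (m t) (real k))) \<longlonglongrightarrow> integral {a..b} m"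
proof -
 have mA: "m absolutely_integrable_on {a..b}"
  using m by (intro nonnegative_absolutely_integrable_1) auto
 show I: "(\<lambda>t. min (m t) (real k)) integrable_on {a..b}" for k
  using absolutely_integrable_min_1[OF mA absolutely_integrable_on_const[of "{a..b}" "real k"]]
  by (simp add: absolutely_integrable_on_def)
 show "(\<lambda>k. integral {a..b} (\<lambda>t. min (m t) (real k))) \<longlonglongrightarrow> integral {a..b} m"
 proof (rule dominated_convergence(2)[OF I m(1)])
  show "norm (min (m t) (real k)) \<le> m t" if "t \<in> {a..b}" for k t using m(2)[OF that] by auto
  show "(\<lambda>k. min (m t) (real k)) \<longlonglongrightarrow> m t" if "t \<in> {a..b}" for t
  proof (rule tendsto_eventually)
   obtain n where "m t < real n" using reals_Archimedean2 by blast
   then show "\<forall>\<^sub>F k in sequentially. min (m t) (real k) = m t"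
    by (intro eventually_sequentiallyI[of n]) auto
  qed
 qed
qed

text \<open>Split \<open>m\<close> into min(m,k) and a tail \<open>r\<close> of integral below e/2:
  the tail is small on every set, and the truncated part is at most k times the total
  length.\<close>

lemma abs_continuous_of_dom_increments:
 fixes c :: "real => 'a::euclidean_space"
 assumes d: "dom_increments a b m c"
 shows "abs_continuous_on {a..b} c"
 unfolding abs_continuous_on_def
proof (intro allI impI)
 note d1 = dom_incrementsD(1)[OF d] and d2 = dom_incrementsD(2)[OF d] and d3 = dom_incrementsD(3)[OF d]
 fix e :: real assume e: "e > 0"
 have d2': "!!t. t \<in> {a..b} ==> 0 \<le> m t" using d2 by auto
 note tr = integral_truncation_tendsto[OF d1 d2']
 from tendstoD[OF tr(2), of "e/2"] e obtain k where k: "\<bar>integral {a..b} (\<lambda>t. min (m t) (real k)) - integral {a..b} m\<bar> < e / 2"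
  unfolding eventually_sequentially dist_real_def by auto
 define r where "r = (\<lambda>t. m t - min (m t) (real k))"
 have rI: "r integrable_on {a..b}" unfolding r_def by (intro integrable_diff d1 tr)
 have r0: "0 \<le> r t" for t by (simp add: r_def)
 have rint: "integral {a..b} r < e / 2"
 proof -
  have "integral {a..b} r = integral {a..b} m - integral {a..b} (\<lambda>t. min (m t) (real k))"
   unfolding r_def by (rule Henstock_Kurzweil_Integration.integral_diff[OF d1 tr(1)])
  then show ?thesis using k by linarith
 qed
 show "\<exists>\<delta>>0. \<forall>(I::nat set) u v.
    finite I \<and> (\<forall>i\<in>I. u i \<le> v i \<and> {u i..v i} \<subseteq> {a..b}) \<and>
    disjoint_family_on (\<lambda>i. {u i<..<v i}) I \<and> (\<Sum>i\<in>I. v i - u i) < \<delta>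
    --> (\<Sum>i\<in>I. dist (c (u i)) (c (v i))) < e"
 \<comment> \<open>\<open>real k + 1\<close> in place of \<open>real k\<close> guards against k =
   0.\<close>
 proof (intro exI[of _ "e / (2 * (real k + 1))"] conjI allI impI)
  show "e / (2 * (real k + 1)) > 0" using e by simp
  fix I :: "nat set" and u v :: "nat => real"
  assume *: "finite I \<and> (\<forall>i\<in>I. u i \<le> v i \<and> {u i..v i} \<subseteq> {a..b}) \<and>
    disjoint_family_on (\<lambda>i. {u i<..<v i}) I \<and> (\<Sum>i\<in>I. v i - u i) < e / (2 * (real k + 1))"
  then have uv: "u i \<le> v i" "a \<le> u i" "v i \<le> b" if "i \<in> I" for i using that by auto
  have fin: "finite I" and disj: "disjoint_family_on (\<lambda>i. {u i<..<v i}) I" using * by auto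
  have Iuv: "m integrable_on {u i..v i}" "r integrable_on {u i..v i}" if "i \<in> I" for i
   using uv[OF that] by (auto intro: integrable_on_subinterval[OF d1] integrable_on_subinterval[OF rI])
  have one: "dist (c (u i)) (c (v i)) \<le> integral {u i..v i} r + (real k + 1) * (v i - u i)" if i: "i \<in> I" for i
  proof -
   have "dist (c (u i)) (c (v i)) \<le> integral {u i..v i} m"
    using d3[of "u i" "v i"] uv[OF i] by (simp add: dist_norm norm_minus_commute)
   also have "\<dots> \<le> integral {u i..v i} (\<lambda>t. r t + (real k + 1))"
    by (rule integral_le) (use Iuv[OF i] in \<open>auto intro!: integrable_add simp: r_def\<close>)
   also have "\<dots> = integral {u i..v i} r + (real k + 1) * (v i - u i)"
    by (subst Henstock_Kurzweil_Integration.integral_add) (use Iuv[OF i] uv[OF i] in \<open>auto simp: mult.commute\<close>)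
   finally show ?thesis .
  qed
  have "(\<Sum>i\<in>I. integral {u i..v i} r) = (\<Sum>i\<in>I. integral {u i<..<v i} r)"
   by (simp add: integral_open_interval_real)
  also have "\<dots> = integral (\<Union>i\<in>I. {u i<..<v i}) r"
  proof (rule integral_unique[symmetric])
   show "(r has_integral (\<Sum>i\<in>I. integral {u i<..<v i} r)) (\<Union>i\<in>I. {u i<..<v i})"
   proof (rule has_integral_UN[OF fin])
    show "(r has_integral integral {u i<..<v i} r) {u i<..<v i}" if "i \<in> I" for i
     using Iuv(2)[OF that] by (intro integrable_integral) (simp add: integrable_on_open_interval_real)
    show "pairwise (\<lambda>i i'. negligible ({u i<..<v i} \<inter> {u i'<..<v i'})) I"
     using disj by (auto simp: pairwise_def disjoint_family_on_def)
   qed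
  qed
  also have "\<dots> \<le> integral {a..b} r"
  proof (rule integral_subset_le)
   show "(\<Union>i\<in>I. {u i<..<v i}) \<subseteq> {a..b}" using uv by force
   show "r integrable_on (\<Union>i\<in>I. {u i<..<v i})"
   proof (rule has_integral_integrable, rule has_integral_UN[OF fin])
    show "(r has_integral integral {u i<..<v i} r) {u i<..<v i}" if "i \<in> I" for i
     using Iuv(2)[OF that] by (intro integrable_integral) (simp add: integrable_on_open_interval_real)
    show "pairwise (\<lambda>i i'. negligible ({u i<..<v i} \<inter> {u i'<..<v i'})) I"
     using disj by (auto simp: pairwise_def disjoint_family_on_def)
   qed
  qed (use rI r0 in auto)
  finally have 1: "(\<Sum>i\<in>I. integral {u i..v i} r) < e / 2" using rint by linarith
  have 2: "(real k + 1) * (\<Sum>i\<in>I. v i - u i) < e / 2"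
  proof -
   have "(\<Sum>i\<in>I. v i - u i) < e / (2 * (real k + 1))" using * by blast
   then have "(real k + 1) * (\<Sum>i\<in>I. v i - u i) < (real k + 1) * (e / (2 * (real k + 1)))"
    by (intro mult_strict_left_mono) auto
   also have "\<dots> = e / 2" by (simp add: field_simps)
   finally show ?thesis .
  qed
  have "(\<Sum>i\<in>I. dist (c (u i)) (c (v i))) \<le> (\<Sum>i\<in>I. integral {u i..v i} r + (real k + 1) * (v i - u i))"
   by (rule sum_mono) (rule one)
  also have "\<dots> = (\<Sum>i\<in>I. integral {u i..v i} r) + (real k + 1) * (\<Sum>i\<in>I. v i - u i)"
   by (simp add: sum.distrib sum_distrib_left)
  finally show "(\<Sum>i\<in>I. dist (c (u i)) (c (v i))) < e" using 1 2 by linarith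
 qed
qed

section \<open>Algebra of dominated increments and Gronwall's inequality\<close>

lemma dom_increments_bounded:
 assumes "dom_increments a b m F"
 obtains B where "B \<ge> 0" "!!t. t \<in> {a..b} ==> norm (F t) \<le> B"
proof -
 have "bounded (F ` {a..b})"
  by (intro compact_imp_bounded compact_continuous_image dom_increments_continuous[OF assms]) auto
 then obtain B where "!!t. t \<in> {a..b} ==> norm (F t) \<le> B" by (metis bounded_iff imageI)
 then show thesis by (intro that[of "max B 0"]) force+
qed

lemma dom_increments_bilinear:
 fixes F :: "real => 'a::euclidean_space" and G :: "real => 'b::euclidean_space"
  and prod :: "'a => 'b => 'c::euclidean_space"
 assumes F: "dom_increments a b m F" and G: "dom_increments a b n G" and bb: "bounded_bilinear prod"
 obtains k where "dom_increments a b k (\<lambda>t. prod (F t) (G t))"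
proof -
 obtain B where B: "B \<ge> 0" "!!t. t \<in> {a..b} ==> norm (F t) \<le> B" using dom_increments_bounded[OF F] by blast
 obtain C where C: "C \<ge> 0" "!!t. t \<in> {a..b} ==> norm (G t) \<le> C" using dom_increments_bounded[OF G] by blast
 obtain K where K: "K \<ge> 0" "!!x y. norm (prod x y) \<le> norm x * norm y * K"
  using bounded_bilinear.nonneg_bounded[OF bb] by blast
 note F' = dom_incrementsD[OF F] and G' = dom_incrementsD[OF G]
 show thesis
 proof (rule that[of "\<lambda>t. K * (m t * C + B * n t)"], unfold dom_increments_def, intro conjI ballI allI impI)
  show "(\<lambda>t. K * (m t * C + B * n t)) integrable_on {a..b}"
   using F'(1) G'(1) by (intro integrable_on_mult_left integrable_on_mult_right integrable_add)
  show "0 \<le> K * (m t * C + B * n t)" if "t \<in> {a..b}" for t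
   using F'(2)[of t] G'(2)[of t] that B(1) C(1) K(1) by auto
  fix s t assume st: "a \<le> s" "s \<le> t" "t \<le> b"
  have I: "m integrable_on {s..t}" "n integrable_on {s..t}"
   using st by (auto intro: integrable_on_subinterval[OF F'(1)] integrable_on_subinterval[OF G'(1)])
  have "prod (F t) (G t) - prod (F s) (G s) = prod (F t - F s) (G t) + prod (F s) (G t - G s)"
   by (simp add: bounded_bilinear.diff_left[OF bb] bounded_bilinear.diff_right[OF bb])
  then have "norm (prod (F t) (G t) - prod (F s) (G s)) \<le> norm (F t - F s) * norm (G t) * K + norm (F s) * norm (G t - G s) * K"
   by (simp add: norm_triangle_mono K(2))
  also have "\<dots> \<le> integral {s..t} m * C * K + B * integral {s..t} n * K"
  proof (intro add_mono mult_right_mono K(1))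
   show "norm (F t - F s) * norm (G t) \<le> integral {s..t} m * C"
    by (rule mult_mono[OF F'(3)[OF st] C(2)]) (use st order_trans[OF norm_ge_zero F'(3)[OF st]] in auto)
   show "norm (F s) * norm (G t - G s) \<le> B * integral {s..t} n"
    by (rule mult_mono[OF B(2) G'(3)[OF st]]) (use st B(1) in auto)
  qed
  also have "\<dots> = K * (integral {s..t} m * C + B * integral {s..t} n)" by (simp add: algebra_simps)
  also have "\<dots> = integral {s..t} (\<lambda>t. K * (m t * C + B * n t))"
   by (rule integral_unique[symmetric]) (intro has_integral_mult_right has_integral_add has_integral_mult_left integrable_integral I)
  finally show "norm (prod (F t) (G t) - prod (F s) (G s)) \<le> integral {s..t} (\<lambda>t. K * (m t * C + B * n t))" .
 qed
qed

lemma dom_increments_diff: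
 fixes F G :: "real => 'a::euclidean_space"
 assumes F: "dom_increments a b m F" and G: "dom_increments a b n G"
 shows "dom_increments a b (\<lambda>t. m t + n t) (\<lambda>t. F t - G t)"
 unfolding dom_increments_def
proof (intro conjI ballI allI impI)
 note F' = dom_incrementsD[OF F] and G' = dom_incrementsD[OF G]
 show "(\<lambda>t. m t + n t) integrable_on {a..b}" using F'(1) G'(1) by (rule integrable_add)
 show "0 \<le> m t + n t" if "t \<in> {a..b}" for t using F'(2)[of t] G'(2)[of t] that by auto
 fix s t assume st: "a \<le> s" "s \<le> t" "t \<le> b"
 have I: "m integrable_on {s..t}" "n integrable_on {s..t}"
  using st by (auto intro: integrable_on_subinterval[OF F'(1)] integrable_on_subinterval[OF G'(1)])
 have "norm ((F t - G t) - (F s - G s)) \<le> norm (F t - F s) + norm (G t - G s)"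
  by (metis (no_types, lifting) diff_diff_eq2 diff_add_eq add_diff_eq norm_triangle_ineq4 add.commute diff_diff_eq)
 then show "norm ((F t - G t) - (F s - G s)) \<le> integral {s..t} (\<lambda>t. m t + n t)"
  using F'(3)[OF st] G'(3)[OF st] Henstock_Kurzweil_Integration.integral_add[OF I] by linarith
qed

lemma dom_increments_exp:
 fixes F :: "real => real"
 assumes F: "dom_increments a b m F"
 obtains K where "dom_increments a b (\<lambda>t. K * m t) (\<lambda>t. exp (F t))"
proof -
 obtain B where B: "B \<ge> 0" "!!t. t \<in> {a..b} ==> norm (F t) \<le> B" using dom_increments_bounded[OF F] by blast
 note F' = dom_incrementsD[OF F]
 have ex: "\<bar>exp x - exp y\<bar> \<le> exp B * \<bar>x - y\<bar>" if "\<bar>x\<bar> \<le> B" "\<bar>y\<bar> \<le> B" for x y :: real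
 proof -
  have "norm (exp x - exp y) \<le> exp B * norm (x - y)"
  proof (rule field_differentiable_bound[where S="{-B..B}" and f'=exp])
   show "(exp has_field_derivative exp z) (at z within {-B..B})" for z :: real by (rule DERIV_subset[OF DERIV_exp]) simp
   show "norm (exp z) \<le> exp B" if "z \<in> {-B..B}" for z :: real using that by simp
  qed (use that in auto)
  then show ?thesis by simp
 qed
 show thesis
 proof (rule that[of "exp B"], unfold dom_increments_def, intro conjI ballI allI impI)
  show "(\<lambda>t. exp B * m t) integrable_on {a..b}" using F'(1) by (auto intro!: integrable_on_cmult_right)
  show "0 \<le> exp B * m t" if "t \<in> {a..b}" for t using F'(2)[of t] that by auto
  fix s t assume st: "a \<le> s" "s \<le> t" "t \<le> b"
  have "norm (exp (F t) - exp (F s)) \<le> exp B * \<bar>F t - F s\<bar>" using ex B(2)[of t] B(2)[of s] st by auto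
  also have "\<dots> \<le> exp B * integral {s..t} m" using F'(3)[OF st] by (intro mult_left_mono) auto
  finally show "norm (exp (F t) - exp (F s)) \<le> integral {s..t} (\<lambda>t. exp B * m t)" by simp
 qed
qed

lemma dom_increments_integral:
 fixes f :: "real => 'a::euclidean_space"
 assumes f: "f absolutely_integrable_on {a..b}"
 shows "dom_increments a b (\<lambda>t. norm (f t)) (\<lambda>t. integral {a..t} f)"
 unfolding dom_increments_def
proof (intro conjI ballI allI impI)
 have fI: "f integrable_on {a..b}" and nI: "(\<lambda>t. norm (f t)) integrable_on {a..b}"
  using f by (auto simp: absolutely_integrable_on_def)
 show "(\<lambda>t. norm (f t)) integrable_on {a..b}" by (rule nI)
 fix s t assume st: "a \<le> s" "s \<le> t" "t \<le> b"
 have "integral {a..s} f + integral {s..t} f = integral {a..t} f"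
  by (rule Henstock_Kurzweil_Integration.integral_combine) (use st in \<open>auto intro: integrable_on_subinterval[OF fI]\<close>)
 then have "integral {a..t} f - integral {a..s} f = integral {s..t} f" by (simp add: algebra_simps)
 also have "norm \<dots> \<le> integral {s..t} (\<lambda>t. norm (f t))"
  by (rule integral_norm_bound_integral) (use st in \<open>auto intro: integrable_on_subinterval[OF fI] integrable_on_subinterval[OF nI]\<close>)
 finally show "norm (integral {a..t} f - integral {a..s} f) \<le> integral {s..t} (\<lambda>t. norm (f t))" .
qed auto

text \<open>Multiply by the integrating factor exp(- integral of c) and integrate the a.e.
  derivative. The hypothesis speaks of any \<open>d\<close> that is a derivative of \<open>w\<close>
  at \<open>t\<close>: differentiability a.e. is supplied here, and callers only estimate.
  \<open>B\<close> bounds the integrating factor.\<close>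

lemma gronwall_increments:
 fixes w :: "real => real"
 assumes ab: "a \<le> b" and w: "dom_increments a b k w" and c: "c absolutely_integrable_on {a..b}"
  and e: "e integrable_on {a..b}" "!!t. t \<in> {a..b} ==> 0 \<le> e t" and N: "negligible N"
  and der: "!!t d. t \<in> {a<..<b} ==> t \<notin> N ==> (w has_vector_derivative d) (at t) ==> d \<le> c t * w t + e t"
  and B: "integral {a..b} (\<lambda>t. \<bar>c t\<bar>) \<le> B"
 shows "w b * exp (- integral {a..b} c) \<le> w a + exp B * integral {a..b} e"
proof -
 have cI: "c integrable_on {a..b}" and cn: "(\<lambda>t. \<bar>c t\<bar>) integrable_on {a..b}"
  using c by (auto simp: absolutely_integrable_on_def)
 have C: "dom_increments a b (\<lambda>t. norm (- c t)) (\<lambda>t. integral {a..t} (\<lambda>t. - c t))"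
  by (rule dom_increments_integral) (use integrable_neg[OF cI] cn in \<open>simp add: absolutely_integrable_on_def\<close>)
 obtain K where E: "dom_increments a b (\<lambda>t. K * norm (- c t)) (\<lambda>t. exp (integral {a..t} (\<lambda>t. - c t)))"
  by (rule dom_increments_exp[OF C])
 define Ef where "Ef = (\<lambda>t. exp (integral {a..t} (\<lambda>t. - c t)))"
 obtain k' where u: "dom_increments a b k' (\<lambda>t. w t * Ef t)"
  unfolding Ef_def by (rule dom_increments_bilinear[OF w E bounded_bilinear_mult])
 obtain p N1 where p: "p absolutely_integrable_on {a..b}" "negligible N1"
  "!!s t. a \<le> s ==> s \<le> t ==> t \<le> b ==> integral {s..t} p = w t * Ef t - w s * Ef s"
  "!!t. t \<in> {a<..<b} ==> t \<notin> N1 ==> ((\<lambda>t. w t * Ef t) has_vector_derivative p t) (at t)"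
  using dom_increments_FTC_ex[OF u] by blast
 obtain q N2 where q: "negligible N2"
  "!!t. t \<in> {a<..<b} ==> t \<notin> N2 ==> (w has_vector_derivative q t) (at t)"
  using dom_increments_FTC_ex[OF w] by blast
 have mcI: "(\<lambda>t. - c t) integrable_on {a..b}" using cI by (rule integrable_neg)
 obtain N3 where N3: "negligible N3"
  "!!t. t \<in> {a<..<b} ==> t \<notin> N3 ==> ((\<lambda>u. integral {a..u} (\<lambda>t. - c t)) has_vector_derivative - c t) (at t)"
  using Lebesgue_point_ex[OF mcI] by blast
 let ?Z = "N \<union> N1 \<union> N2 \<union> N3 \<union> {a,b}"
 have Z: "negligible ?Z" using N p(2) q(1) N3(1) by auto
 have EB: "Ef t \<le> exp B" if t: "t \<in> {a..b}" for t
 proof -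
  have "integral {a..t} (\<lambda>t. - c t) \<le> integral {a..t} (\<lambda>t. \<bar>c t\<bar>)"
   by (rule integral_le) (use t in \<open>auto intro: integrable_on_subinterval[OF mcI] integrable_on_subinterval[OF cn]\<close>)
  also have "\<dots> \<le> integral {a..b} (\<lambda>t. \<bar>c t\<bar>)"
   by (rule integral_subset_le) (use t in \<open>auto intro: integrable_on_subinterval[OF cn]\<close>)
  finally show ?thesis using B by (simp add: Ef_def)
 qed
 have le: "p t \<le> exp B * e t" if t: "t \<in> {a..b}" "t \<notin> ?Z" for t
 proof -
  have t': "t \<in> {a<..<b}" using t by auto
  have "((\<lambda>u. integral {a..u} (\<lambda>t. - c t)) has_real_derivative - c t) (at t)"
   unfolding has_real_derivative_iff_has_vector_derivative using N3(2)[OF t'] t by blast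
  then have dE: "(Ef has_real_derivative Ef t * (- c t)) (at t)"
   unfolding Ef_def by (rule DERIV_fun_exp)
  have dw: "(w has_real_derivative q t) (at t)" using q(2)[OF t'] t by (simp add: has_real_derivative_iff_has_vector_derivative)
  have "((\<lambda>t. w t * Ef t) has_real_derivative q t * Ef t + (Ef t * (- c t)) * w t) (at t)"
   by (rule DERIV_mult[OF dw dE])
  moreover have "((\<lambda>t. w t * Ef t) has_real_derivative p t) (at t)"
   using p(4)[OF t'] t by (simp add: has_real_derivative_iff_has_vector_derivative)
  ultimately have "p t = q t * Ef t + (Ef t * (- c t)) * w t" by (metis DERIV_unique)
  then have "p t = (q t - c t * w t) * Ef t" by (simp add: algebra_simps)
  also have "\<dots> \<le> e t * Ef t"
   using der[OF t' _ q(2)[OF t']] t by (intro mult_right_mono) (auto simp: Ef_def)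
  also have "\<dots> \<le> e t * exp B" using e(2)[OF t(1)] EB[OF t(1)] by (intro mult_left_mono)
  finally show ?thesis by (simp add: mult.commute)
 qed
 have eI: "(\<lambda>t. exp B * e t) integrable_on {a..b}" using e(1) by (rule integrable_on_mult_right)
 have pI: "p integrable_on {a..b}" using p(1) by (simp add: absolutely_integrable_on_def)
 have "integral {a..b} p \<le> integral {a..b} (\<lambda>t. exp B * e t)"
 proof -
  have "integral {a..b} p = integral {a..b} (\<lambda>t. if t \<in> ?Z then 0 else p t)"
   by (rule integral_spike[OF Z]) auto
  also have "\<dots> \<le> integral {a..b} (\<lambda>t. exp B * e t)"
   by (rule integral_le[OF integrable_spike[OF pI Z] eI]) (use le e(2) in auto)
  finally show ?thesis .
 qed
 then show ?thesis using p(3)[of a b] ab by (simp add: Ef_def)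
qed

text \<open>Dominated convergence is applied to the a.e. derivatives \<open>p n\<close>, with
  \<open>r n\<close> entering only as a pointwise bound; the exceptional sets of all n are joined in
  one \<open>Z\<close>.\<close>

lemma increments_tendsto_0:
 fixes F :: "nat => real => real"
 assumes ab: "a \<le> b" and F: "!!n. dom_increments a b (m n) (F n)" and M: "M integrable_on {a..b}"
  and N: "negligible N"
  and der: "!!n t d. t \<in> {a<..<b} ==> t \<notin> N ==> (F n has_vector_derivative d) (at t) ==> \<bar>d\<bar> \<le> r n t \<and> r n t \<le> M t"
  and r: "!!t. t \<in> {a<..<b} ==> t \<notin> N ==> (\<lambda>n. r n t) \<longlonglongrightarrow> 0"
 shows "(\<lambda>n. F n b - F n a) \<longlonglongrightarrow> 0"
proof -
 have "\<exists>p N. p absolutely_integrable_on {a..b} \<and> negligible N \<and> integral {a..b} p = F n b - F n a \<and>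
  (\<forall>t. t \<in> {a<..<b} --> t \<notin> N --> (F n has_vector_derivative p t) (at t))" for n
  by (rule dom_increments_FTC[OF F[of n]]) (use ab in blast)
 then obtain p NN where p: "!!n. p n absolutely_integrable_on {a..b}" "!!n. negligible (NN n)"
  "!!n. integral {a..b} (p n) = F n b - F n a"
  "!!n t. t \<in> {a<..<b} ==> t \<notin> NN n ==> (F n has_vector_derivative p n t) (at t)" by metis
 define Z where "Z = N \<union> (\<Union>n. NN n) \<union> {a,b}"
 have Z: "negligible Z" unfolding Z_def using N p(2) by (auto intro!: negligible_Union_nat negligible_Un)
 define p' where "p' = (\<lambda>n t. if t \<in> Z then 0 else p n t)"
 define M' where "M' = (\<lambda>t. if t \<in> Z then 0 else M t)"
 have pI: "p n integrable_on {a..b}" for n using p(1)[of n] by (simp add: absolutely_integrable_on_def)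
 have p'I: "p' n integrable_on {a..b}" for n
  by (rule integrable_spike[OF pI[of n] Z]) (auto simp: p'_def)
 have p'e: "integral {a..b} (p' n) = F n b - F n a" for n
  unfolding p(3)[symmetric] by (rule integral_spike[OF Z]) (auto simp: p'_def)
 have M'I: "M' integrable_on {a..b}" by (rule integrable_spike[OF M Z]) (auto simp: M'_def)
 have d: "\<bar>p n t\<bar> \<le> r n t \<and> r n t \<le> M t" if "t \<in> {a..b}" "t \<notin> Z" for n t
  using der[OF _ _ p(4), of t n] that by (auto simp: Z_def)
 have "(\<lambda>n. integral {a..b} (p' n)) \<longlonglongrightarrow> integral {a..b} (\<lambda>t. 0::real)"
 proof (rule dominated_convergence(2)[OF p'I M'I])
  show "norm (p' n t) \<le> M' t" if "t \<in> {a..b}" for n t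
   using d[OF that, of n] by (auto simp: p'_def M'_def)
  show "(\<lambda>n. p' n t) \<longlonglongrightarrow> 0" if t: "t \<in> {a..b}" for t
  proof (cases "t \<in> Z")
   case True then show ?thesis by (simp add: p'_def)
  next
   case False
   then have "(\<lambda>n. r n t) \<longlonglongrightarrow> 0" using r[of t] t by (auto simp: Z_def)
   then show ?thesis
    by (rule Lim_null_comparison[rotated]) (use d[OF t False] False in \<open>auto simp: p'_def\<close>)
  qed
 qed
 then show ?thesis by (simp add: p'e)
qed

section \<open>One-sided Lipschitz fields\<close>

definition limit_set :: "('a::euclidean_space => 'a) => 'a => 'a set" where
 "limit_set u x = {l. \<exists>y::nat => 'a. y \<longlonglongrightarrow> x \<and> (\<lambda>n. u (y n)) \<longlonglongrightarrow> l}"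

lemma b_hat_eq: "b_hat b t x = convex hull limit_set (b t) x"
 by (simp add: b_hat_def limit_set_def)

definition osl :: "real => ('a::euclidean_space => 'a) => bool" where
 "osl C u \<longleftrightarrow> (\<forall>x y. (u x - u y) \<bullet> (x - y) \<ge> - C * (norm (x - y))^2)"

lemma limit_set_self: "u x \<in> limit_set u x"
 unfolding limit_set_def by (auto intro!: exI[of _ "\<lambda>_. x"])

lemma limit_set_iff:
 "l \<in> limit_set u x \<longleftrightarrow> (\<forall>e>0. \<exists>y. dist y x < e \<and> dist (u y) l < e)"
proof
 assume "l \<in> limit_set u x"
 then obtain y where y: "y \<longlonglongrightarrow> x" "(\<lambda>n. u (y n)) \<longlonglongrightarrow> l" by (auto simp: limit_set_def)
 show "\<forall>e>0. \<exists>y. dist y x < e \<and> dist (u y) l < e"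
 proof (intro allI impI)
  fix e :: real assume e: "e > 0"
  have "\<forall>\<^sub>F n in sequentially. dist (y n) x < e \<and> dist (u (y n)) l < e"
   using tendstoD[OF y(1) e] tendstoD[OF y(2) e] by eventually_elim auto
  then show "\<exists>y. dist y x < e \<and> dist (u y) l < e"
   by (metis (mono_tags, lifting) eventually_sequentially order_refl)
 qed
next
 assume *: "\<forall>e>0. \<exists>y. dist y x < e \<and> dist (u y) l < e"
 have "\<forall>n. \<exists>y. dist y x < inverse (real (Suc n)) \<and> dist (u y) l < inverse (real (Suc n))"
  using * by auto
 then obtain y where y: "!!n. dist (y n) x < inverse (real (Suc n))" "!!n. dist (u (y n)) l < inverse (real (Suc n))" by metis
 have "(\<lambda>n. dist (y n) x) \<longlonglongrightarrow> 0" "(\<lambda>n. dist (u (y n)) l) \<longlonglongrightarrow> 0"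
  by (rule Lim_null_comparison[OF _ LIMSEQ_inverse_real_of_nat], use y in \<open>auto intro!: always_eventually less_imp_le\<close>)+
 then show "l \<in> limit_set u x"
  unfolding limit_set_def using tendsto_dist_iff by blast
qed

lemma closed_limit_set: "closed (limit_set u x)"
 unfolding closure_subset_eq[symmetric]
proof
 fix l assume "l \<in> closure (limit_set u x)"
 then have *: "\<forall>e>0. \<exists>y\<in>limit_set u x. dist y l < e" by (simp add: closure_approachable)
 show "l \<in> limit_set u x"
  unfolding limit_set_iff
 proof (intro allI impI)
  fix e :: real assume e: "e > 0"
  then obtain l' where l': "l' \<in> limit_set u x" "dist l' l < e / 2" using *[rule_format, of "e/2"] by auto
  obtain y where "dist y x < e / 2" "dist (u y) l' < e / 2" using l'(1) e unfolding limit_set_iff by (meson half_gt_zero)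
  then show "\<exists>y. dist y x < e \<and> dist (u y) l < e"
   using l'(2) e dist_triangle_half_r by (intro exI[of _ y]) (smt (verit) dist_triangle field_sum_of_halves)
 qed
qed

lemma limit_set_bounded:
 assumes g: "!!x. norm (u x) \<le> K * (1 + norm x)" and l: "l \<in> limit_set u x"
 shows "norm l \<le> K * (1 + norm x)"
proof -
 obtain y where y: "y \<longlonglongrightarrow> x" "(\<lambda>n. u (y n)) \<longlonglongrightarrow> l" using l by (auto simp: limit_set_def)
 show ?thesis
 proof (rule tendsto_le[OF trivial_limit_sequentially])
  show "(\<lambda>n. norm (u (y n))) \<longlonglongrightarrow> norm l" by (rule tendsto_norm[OF y(2)])
  show "(\<lambda>n. K * (1 + norm (y n))) \<longlonglongrightarrow> K * (1 + norm x)" by (intro tendsto_intros y(1))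
 qed (use g in auto)
qed

lemma convex_hull_limit_set_bounded:
 assumes g: "!!x. norm (u x) \<le> K * (1 + norm x)" and p: "p \<in> convex hull limit_set u x"
 shows "norm p \<le> K * (1 + norm x)"
proof -
 have "convex hull limit_set u x \<subseteq> cball 0 (K * (1 + norm x))"
  by (rule hull_minimal) (use limit_set_bounded[OF g] in auto)
 then show ?thesis using p by auto
qed

text \<open>For fixed z the inequality is affine in p and so describes a closed half-space; it holds
  at limit points by continuity and hence on their hull.\<close>

lemma osl_convex_hull:
 assumes o: "osl C u" and p: "p \<in> convex hull limit_set u x"
 shows "(u z - p) \<bullet> (z - x) \<ge> - C * (norm (z - x))^2"
proof -
 let ?H = "{p. (z - x) \<bullet> p \<le> (z - x) \<bullet> u z + C * (norm (z - x))^2}"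
 have "convex hull limit_set u x \<subseteq> ?H"
 proof (rule hull_minimal)
  show "convex ?H" by (rule convex_halfspace_le)
  show "limit_set u x \<subseteq> ?H"
  proof
   fix l assume "l \<in> limit_set u x"
   then obtain y where y: "y \<longlonglongrightarrow> x" "(\<lambda>n. u (y n)) \<longlonglongrightarrow> l" by (auto simp: limit_set_def)
   have "(u z - l) \<bullet> (z - x) \<ge> - C * (norm (z - x))^2"
   proof (rule tendsto_le[OF trivial_limit_sequentially])
    show "(\<lambda>n. (u z - u (y n)) \<bullet> (z - y n)) \<longlonglongrightarrow> (u z - l) \<bullet> (z - x)" by (intro tendsto_intros y)
    show "(\<lambda>n. - C * (norm (z - y n))^2) \<longlonglongrightarrow> - C * (norm (z - x))^2" by (intro tendsto_intros y)
   qed (use o in \<open>auto simp: osl_def\<close>)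
   then show "l \<in> ?H" by (simp add: inner_diff_left inner_diff_right inner_commute algebra_simps)
  qed
 qed
 then show ?thesis using p by (auto simp: inner_diff_left inner_diff_right inner_commute algebra_simps)
qed

lemma bounded_limit_subseq:
 fixes y :: "nat => 'a::euclidean_space" and u :: "'a => 'a"
 assumes g: "!!x. norm (u x) \<le> K * (1 + norm x)" and K: "K \<ge> 0" and y: "y \<longlonglongrightarrow> x"
 obtains l r where "strict_mono (r :: nat => nat)" "(\<lambda>n. u (y (r n))) \<longlonglongrightarrow> l" "l \<in> limit_set u x"
proof -
 obtain M where M: "!!n. norm (y n) \<le> M"
  using convergent_imp_bounded[OF y] unfolding bounded_iff by auto
 have "norm (u (y n)) \<le> K * (1 + M)" for n
  using g[of "y n"] M[of n] K by (smt (verit, ccfv_SIG) mult_left_mono)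
 then have "bounded (range (\<lambda>n. u (y n)))" by (auto simp: bounded_iff)
 then obtain l r where r: "strict_mono (r :: nat => nat)" "((\<lambda>n. u (y n)) \<circ> r) \<longlonglongrightarrow> l"
  using bounded_imp_convergent_subsequence by blast
 have "(\<lambda>n. y (r n)) \<longlonglongrightarrow> x" using LIMSEQ_subseq_LIMSEQ[OF y r(1)] by (simp add: o_def)
 with r have "l \<in> limit_set u x" by (auto simp: limit_set_def o_def intro!: exI[of _ "\<lambda>n. y (r n)"])
 with r show thesis by (intro that) (auto simp: o_def)
qed

text \<open>Minty's argument, the converse of \<open>osl_convex_hull\<close>. If a hyperplane with
  normal a separated p from the hull, move from x in direction e = -a and divide the inequality by
  the step length: the quadratic term disappears and (l - p).e >= 0 remains for some limit point l,
  against the separation. Points of \<open>D\<close> can be used because only their limiting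
  direction from x matters.\<close>

lemma in_convex_hull_limit_set:
 fixes u :: "'a::euclidean_space => 'a"
 assumes g: "!!x. norm (u x) \<le> K * (1 + norm x)" and K: "K \<ge> 0"
  and D: "!!X. open X ==> X \<noteq> {} ==> \<exists>d\<in>D. d \<in> X"
  and ineq: "!!z. z \<in> D ==> (u z - p) \<bullet> (z - x) \<ge> - C * (norm (z - x))^2"
 shows "p \<in> convex hull limit_set u x"
proof (rule ccontr)
 assume np: "p \<notin> convex hull limit_set u x"
 have "bounded (limit_set u x)" using limit_set_bounded[OF g] by (auto simp: bounded_iff)
 then have "compact (limit_set u x)" using closed_limit_set compact_eq_bounded_closed by blast
 then have "closed (convex hull limit_set u x)" using compact_convex_hull compact_imp_closed by blast
 from separating_hyperplane_closed_point[OF convex_convex_hull this np]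
 obtain a \<beta> where a: "a \<bullet> p < \<beta>" "!!q. q \<in> convex hull limit_set u x ==> a \<bullet> q > \<beta>" by blast
 define e where "e = - a"
 \<comment> \<open>The squared radius: after scaling by n + 1 the deviation is still at most 1/(n +
   1), so the directions \<open>q n\<close> tend to e.\<close>
 have "\<exists>z\<in>D. dist z (x + e /\<^sub>R real (Suc n)) < inverse (real (Suc n)) ^ 2" for n
  using D[of "ball (x + e /\<^sub>R real (Suc n)) (inverse (real (Suc n)) ^ 2)"]
  by (force simp: dist_commute)
 then obtain z where z: "!!n. z n \<in> D" "!!n. dist (z n) (x + e /\<^sub>R real (Suc n)) < inverse (real (Suc n)) ^ 2" by metis
 define q where "q = (\<lambda>n. real (Suc n) *\<^sub>R (z n - x))"
 have q: "q \<longlonglongrightarrow> e"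
 proof -
  have "norm (q n - e) \<le> inverse (real (Suc n))" for n
  proof -
   have "q n - e = real (Suc n) *\<^sub>R (z n - (x + e /\<^sub>R real (Suc n)))"
    by (simp add: q_def scaleR_diff_right scaleR_add_right del: of_nat_Suc)
   then have "norm (q n - e) = real (Suc n) * dist (z n) (x + e /\<^sub>R real (Suc n))"
    by (simp add: dist_norm del: of_nat_Suc)
   also have "\<dots> \<le> real (Suc n) * inverse (real (Suc n)) ^ 2"
    using z(2)[of n] by (intro mult_left_mono) (auto simp del: of_nat_Suc)
   also have "\<dots> = inverse (real (Suc n))" by (simp add: power2_eq_square del: of_nat_Suc)
   finally show ?thesis .
  qed
  then have "(\<lambda>n. q n - e) \<longlonglongrightarrow> 0"
   by (intro Lim_null_comparison[OF always_eventually LIMSEQ_inverse_real_of_nat]) auto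
  then show ?thesis by (simp add: LIM_zero_iff)
 qed
 have zq: "z n = x + q n /\<^sub>R real (Suc n)" for n by (simp add: q_def del: of_nat_Suc)
 have zx: "z \<longlonglongrightarrow> x"
 proof -
  have "(\<lambda>n. x + inverse (real (Suc n)) *\<^sub>R q n) \<longlonglongrightarrow> x + 0 *\<^sub>R e"
   by (intro tendsto_intros q LIMSEQ_inverse_real_of_nat)
  moreover have "z = (\<lambda>n. x + inverse (real (Suc n)) *\<^sub>R q n)" by (rule ext) (rule zq)
  ultimately show ?thesis by simp
 qed
 obtain l r where r: "strict_mono (r :: nat => nat)" "(\<lambda>n. u (z (r n))) \<longlonglongrightarrow> l" "l \<in> limit_set u x"
  using bounded_limit_subseq[OF g K zx] by blast
 have qr: "(\<lambda>n. q (r n)) \<longlonglongrightarrow> e" using LIMSEQ_subseq_LIMSEQ[OF q r(1)] by (simp add: o_def)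
 have zr: "(\<lambda>n. z (r n)) \<longlonglongrightarrow> x" using LIMSEQ_subseq_LIMSEQ[OF zx r(1)] by (simp add: o_def)
 have "(l - p) \<bullet> e \<ge> 0"
 proof (rule tendsto_le[OF trivial_limit_sequentially])
  show "(\<lambda>n. (u (z (r n)) - p) \<bullet> q (r n)) \<longlonglongrightarrow> (l - p) \<bullet> e" by (intro tendsto_intros r qr)
  have "(\<lambda>n. - C * (norm (q (r n)) * norm (z (r n) - x))) \<longlonglongrightarrow> - C * (norm e * norm (x - x))"
   by (intro tendsto_intros qr zr)
  then show "(\<lambda>n. - C * (norm (q (r n)) * norm (z (r n) - x))) \<longlonglongrightarrow> 0" by simp
  show "\<forall>\<^sub>F n in sequentially. - C * (norm (q (r n)) * norm (z (r n) - x)) \<le> (u (z (r n)) - p) \<bullet> q (r n)"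
  proof (rule always_eventually, rule allI)
   fix n
   have "real (Suc (r n)) * (- C * (norm (z (r n) - x))^2) \<le> real (Suc (r n)) * ((u (z (r n)) - p) \<bullet> (z (r n) - x))"
    by (rule mult_left_mono[OF ineq[OF z(1)]]) simp
   moreover have "norm (q (r n)) = real (Suc (r n)) * norm (z (r n) - x)" by (simp add: q_def del: of_nat_Suc)
   moreover have "(u (z (r n)) - p) \<bullet> q (r n) = real (Suc (r n)) * ((u (z (r n)) - p) \<bullet> (z (r n) - x))"
    by (simp add: q_def del: of_nat_Suc)
   ultimately show "- C * (norm (q (r n)) * norm (z (r n) - x)) \<le> (u (z (r n)) - p) \<bullet> q (r n)"
    by (simp add: power2_eq_square mult.left_commute mult.assoc del: of_nat_Suc)
  qed
 qed
 moreover have "a \<bullet> l > \<beta>" by (rule a(2)[OF hull_inc[OF r(3)]])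
 moreover have "(l - p) \<bullet> e = a \<bullet> p - a \<bullet> l" by (simp add: e_def inner_diff_left inner_diff_right inner_commute)
 ultimately show False using a(1) by linarith
qed

text \<open>Linear growth keeps u bounded along convergent sequences, so a failure of continuity
  would produce a limit point different from u x.\<close>

lemma isCont_of_limit_set:
 fixes u :: "'a::euclidean_space => 'a"
 assumes g: "!!x. norm (u x) \<le> K * (1 + norm x)" and K: "K \<ge> 0"
  and s: "!!l. l \<in> limit_set u x ==> l = u x"
 shows "isCont u x"
 unfolding continuous_at_sequentially o_def
proof (intro allI impI)
 fix y assume y: "y \<longlonglongrightarrow> x"
 show "(\<lambda>n. u (y n)) \<longlonglongrightarrow> u x"
 proof (rule ccontr)
  assume "\<not> (\<lambda>n. u (y n)) \<longlonglongrightarrow> u x"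
  then obtain e where e: "e > 0" and "\<not> (\<forall>\<^sub>F n in sequentially. dist (u (y n)) (u x) < e)"
   by (auto simp: tendsto_iff)
  then have "\<exists>\<^sub>F n in sequentially. \<not> dist (u (y n)) (u x) < e" by (simp add: not_eventually)
  then have "infinite {n. \<not> dist (u (y n)) (u x) < e}" by (simp add: frequently_cofinite cofinite_eq_sequentially[symmetric])
  then obtain r :: "nat => nat" where r: "strict_mono r" "!!n. \<not> dist (u (y (r n))) (u x) < e"
   using infinite_enumerate by blast
  have yr: "(\<lambda>n. y (r n)) \<longlonglongrightarrow> x" using LIMSEQ_subseq_LIMSEQ[OF y r(1)] by (simp add: o_def)
  obtain l r' where r': "strict_mono (r' :: nat => nat)" "(\<lambda>n. u (y (r (r' n)))) \<longlonglongrightarrow> l" "l \<in> limit_set u x"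
   using bounded_limit_subseq[OF g K yr] by blast
  then have "(\<lambda>n. u (y (r (r' n)))) \<longlonglongrightarrow> u x" using s by blast
  from tendstoD[OF this e] r(2) show False by simp
 qed
qed

lemma convex_hull_limit_set_isCont:
 assumes "isCont u x"
 shows "convex hull limit_set u x = {u x}"
proof -
 have "limit_set u x = {u x}"
  using assms limit_set_self[of u x] unfolding limit_set_def continuous_at_sequentially o_def
  by (auto intro: LIMSEQ_unique)
 then show ?thesis by simp
qed

section \<open>Measurable sections and almost everywhere continuity\<close>

lemma borel_measurable_completion_AE:
 fixes f g :: "'a => 'b::topological_space"
 assumes f: "f \<in> borel_measurable (completion M)" and ae: "AE x in M. f x = g x"
 shows "g \<in> borel_measurable (completion M)"
proof (rule measurableI)
 fix A :: "'b set" assume A: "A \<in> sets borel"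
 show "g -` A \<inter> space (completion M) \<in> sets (completion M)"
 proof (rule completion.in_sets_AE)
  show "AE x in completion M. x \<in> f -` A \<inter> space (completion M) \<longleftrightarrow> x \<in> g -` A \<inter> space (completion M)"
   using AE_completion[OF ae] by eventually_elim auto
  show "f -` A \<inter> space (completion M) \<in> sets (completion M)" using f A by (rule measurable_sets)
 qed auto
qed auto

text \<open>A Lebesgue measurable function on the product agrees a.e. with a Borel one, all of whose
  sections are Borel; Fubini for null sets transfers this to almost every section in either
  variable.\<close>

lemma AE_lborel_section_measurable:
 fixes f :: "'a::euclidean_space \<times> 'b::euclidean_space => 'c::euclidean_space"
 assumes f: "f \<in> borel_measurable lebesgue"
 shows "AE x in lborel. (\<lambda>y. f (x, y)) \<in> borel_measurable lebesgue"
  and "AE y in lborel. (\<lambda>x. f (x, y)) \<in> borel_measurable lebesgue"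
proof -
 have "\<exists>f'. \<forall>i\<in>(Basis::'c set). f' i \<in> borel_measurable lborel \<and> (AE x in lborel. f x \<bullet> i = f' i x)"
 proof (rule bchoice, intro ballI)
  fix i :: 'c
  have "(\<lambda>x. f x \<bullet> i) \<in> borel_measurable lebesgue" using f by simp
  from completion_ex_borel_measurable_real[OF this]
  show "\<exists>f'. f' \<in> borel_measurable lborel \<and> (AE x in lborel. f x \<bullet> i = f' x)" by blast
 qed
 then obtain f' where f': "!!i. i \<in> Basis ==> f' i \<in> borel_measurable borel"
   "!!i. i \<in> Basis ==> AE x in lborel. f x \<bullet> i = f' i x" by (auto simp: measurable_lborel1)
 define h where "h = (\<lambda>x. \<Sum>i\<in>Basis. f' i x *\<^sub>R i)"
 have h: "h \<in> borel_measurable borel" unfolding h_def using f'(1) by (intro borel_measurable_sum borel_measurable_scaleR) auto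
 have "AE x in lborel. \<forall>i\<in>Basis. f x \<bullet> i = f' i x"
  by (rule AE_finite_allI) (use f'(2) in auto)
 then have ae: "AE x in lborel. f x = h x"
 proof eventually_elim
  case (elim x)
  then have "h x = (\<Sum>i\<in>Basis. (f x \<bullet> i) *\<^sub>R i)" by (simp add: h_def)
  then show ?case by (simp add: euclidean_representation)
 qed
 then have ae': "AE x in lborel \<Otimes>\<^sub>M lborel. f x = h x"
  by (rule ssubst[OF lborel_prod, where P="\<lambda>M. AE x in M. f x = h x"])
 have 1: "AE x in lborel. AE y in lborel. f (x, y) = h (x, y)"
  using lborel_pair.AE_pair[OF ae'] .
 have 2: "AE y in lborel. AE x in lborel. f (x, y) = h (x, y)"
 proof -
  have "AE p in lborel \<Otimes>\<^sub>M lborel. f (snd p, fst p) = h (snd p, fst p)"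
  proof -
   have "AE p in distr (lborel \<Otimes>\<^sub>M lborel) (lborel \<Otimes>\<^sub>M lborel) (\<lambda>(x, y). (y, x)). f p = h (p :: 'a \<times> 'b)"
    using ae' by (subst lborel_pair.distr_pair_swap[symmetric])
   from AE_distrD[OF _ this] show ?thesis by (simp add: case_prod_beta measurable_pair_swap')
  qed
  from lborel_pair.AE_pair[OF this] show ?thesis by simp
 qed
 have m1: "(\<lambda>y. h (x, y)) \<in> borel_measurable lebesgue" for x
  using measurable_compose[OF measurable_Pair1'[of x borel borel] h[unfolded borel_prod[symmetric]]]
  by (intro measurable_completion) (simp add: o_def)
 have m2: "(\<lambda>x. h (x, y)) \<in> borel_measurable lebesgue" for y
  using measurable_compose[OF measurable_Pair2'[of y borel borel] h[unfolded borel_prod[symmetric]]]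
  by (intro measurable_completion) (simp add: o_def)
 show "AE x in lborel. (\<lambda>y. f (x, y)) \<in> borel_measurable lebesgue"
  using 1 by eventually_elim (rule borel_measurable_completion_AE[OF m1], auto)
 show "AE y in lborel. (\<lambda>x. f (x, y)) \<in> borel_measurable lebesgue"
  using 2 by eventually_elim (rule borel_measurable_completion_AE[OF m2], auto)
qed

lemma osl_monotone_shift:
 assumes "osl C u"
 shows "((u x + C *\<^sub>R x) - (u y + C *\<^sub>R y)) \<bullet> (x - y) \<ge> 0"
proof -
 have "((u x + C *\<^sub>R x) - (u y + C *\<^sub>R y)) \<bullet> (x - y) = (u x - u y) \<bullet> (x - y) + C * (norm (x - y))^2"
  by (simp add: power2_norm_eq_inner inner_diff_left inner_add_left algebra_simps)
 then show ?thesis using assms[unfolded osl_def, rule_format, of x y] by simp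
qed

text \<open>Along lines parallel to e the component v.e is nondecreasing, so its increments over
  steps 1/(n + 1) decrease to a jump \<open>gg\<close>. The integral of \<open>gg\<close> over a box
  is 0: n + 1 copies of it, realised by translates inside one larger box, stay bounded independently
  of n.\<close>

lemma monotone_directional_continuity_AE:
 fixes v :: "'a::euclidean_space => 'a"
 assumes meas: "v \<in> borel_measurable lebesgue" and g: "!!x. norm (v x) \<le> K * (1 + norm x)" and K: "K \<ge> 0"
  and mono: "!!x y. (v x - v y) \<bullet> (x - y) \<ge> 0"
 shows "AE x in lebesgue. (\<lambda>n. v (x + e /\<^sub>R real (Suc n)) \<bullet> e) \<longlonglongrightarrow> v x \<bullet> e"
proof -
 define h where "h = (\<lambda>n. inverse (real (Suc n)))"
 define w where "w = (\<lambda>x. v x \<bullet> e)"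
 have h: "0 < h n" "h n \<le> 1" "h (Suc n) \<le> h n" for n by (auto simp: h_def field_simps)
 have h0: "h \<longlonglongrightarrow> 0" unfolding h_def by (rule LIMSEQ_inverse_real_of_nat)
 have wm: "w \<in> borel_measurable lebesgue" unfolding w_def using meas by simp
 have mono_w: "w (x + s *\<^sub>R e) \<le> w (x + t *\<^sub>R e)" if "s \<le> t" for x s t
 proof (cases "s = t")
  case False
  have "(v (x + t *\<^sub>R e) - v (x + s *\<^sub>R e)) \<bullet> ((x + t *\<^sub>R e) - (x + s *\<^sub>R e)) \<ge> 0" by (rule mono)
  then have "(t - s) * ((v (x + t *\<^sub>R e) - v (x + s *\<^sub>R e)) \<bullet> e) \<ge> 0" by (simp add: scaleR_diff_left[symmetric])
  then show ?thesis using that False by (simp add: zero_le_mult_iff w_def inner_diff_left)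
 qed simp
 define G where "G = (\<lambda>n x. w (x + h n *\<^sub>R e) - w x)"
 have G0: "0 \<le> G n x" for n x using mono_w[of 0 "h n" x] h(1)[of n] by (simp add: G_def)
 have Gdec: "G (Suc n) x \<le> G n x" for n x using mono_w[of "h (Suc n)" "h n" x] h(3)[of n] by (simp add: G_def)
 define gg where "gg = (\<lambda>x. lim (\<lambda>n. G n x))"
 have Glim: "(\<lambda>n. G n x) \<longlonglongrightarrow> gg x" for x
 proof -
  have "decseq (\<lambda>n. G n x)" by (rule decseq_SucI) (rule Gdec)
  then obtain L where "(\<lambda>n. G n x) \<longlonglongrightarrow> L" using decseq_convergent[of "\<lambda>n. G n x" 0] G0 by blast
  then have "convergent (\<lambda>n. G n x)" by (rule convergentI)
  then show ?thesis by (simp add: gg_def convergent_LIMSEQ_iff)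
 qed
 have gg0: "0 \<le> gg x" for x by (rule LIMSEQ_le_const[OF Glim]) (use G0 in auto)
 have ggle: "gg x \<le> G n x" for n x by (rule decseq_ge[OF decseq_SucI Glim]) (rule Gdec)
 have wI: "w integrable_on cbox c d" for c d
 proof -
  obtain R where R: "!!x. x \<in> cbox c d ==> norm x \<le> R" using bounded_cbox[of c d] unfolding bounded_iff by blast
  have wb: "norm (w x) \<le> K * (1 + R) * norm e" if "x \<in> cbox c d" for x
  proof -
   have "norm (w x) \<le> norm (v x) * norm e" unfolding w_def by (metis Cauchy_Schwarz_ineq2 real_norm_def)
   also have "\<dots> \<le> (K * (1 + norm x)) * norm e" by (rule mult_right_mono[OF g]) simp
   also have "\<dots> \<le> (K * (1 + R)) * norm e" using R[OF that] K by (intro mult_right_mono mult_left_mono) auto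
   finally show ?thesis .
  qed
  show ?thesis
   by (rule measurable_bounded_by_integrable_imp_integrable[where g="\<lambda>_. K * (1 + R) * norm e"])
    (use wm wb in \<open>auto intro: measurable_restrict_space1\<close>)
 qed
 have shift: "((\<lambda>x. k (x + s *\<^sub>R e)) has_integral integral (cbox (c + s *\<^sub>R e) (d + s *\<^sub>R e)) k) (cbox c d)"
  if "!!c d. k integrable_on cbox c d" for k :: "'a => real" and s c d
 proof -
  have "((k \<circ> (+) (s *\<^sub>R e)) has_integral integral (cbox (c + s *\<^sub>R e) (d + s *\<^sub>R e)) k) (cbox c d)"
   unfolding has_integral_shift_cbox_iff by (rule integrable_integral[OF that])
  then show ?thesis by (simp add: o_def add.commute)
 qed
 have GI: "G n integrable_on cbox c d" for n c d
  unfolding G_def by (intro integrable_diff wI has_integral_integrable[OF shift[OF wI]])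
 have gI: "gg integrable_on cbox c d" for c d
 proof (rule dominated_convergence(1)[where f=G and h="G 0"])
  show "norm (G n x) \<le> G 0 x" for n x using G0[of n x] decseqD[OF decseq_SucI[of "\<lambda>n. G n x"], OF Gdec, of 0 n] by simp
 qed (use GI Glim in auto)
 have box: "negligible {x \<in> cbox a b. gg x \<noteq> 0}" for a b
 proof -
  obtain R where R: "!!x. x \<in> cbox a b ==> norm x \<le> R" using bounded_cbox[of a b] unfolding bounded_iff by blast
  \<comment> \<open>Large enough to contain the box moved back by any s e with 0 <= s <= 1.\<close>
  obtain c d where L: "cball 0 (R + norm e) \<subseteq> cbox c (d::'a)"
   by (metis bounded_cball bounded_subset_cbox_symmetric)
  have sub: "cbox a b \<subseteq> cbox (c + s *\<^sub>R e) (d + s *\<^sub>R e)" if "0 \<le> s" "s \<le> 1" for s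
  proof
   fix y assume "y \<in> cbox a b"
   moreover have "norm (s *\<^sub>R e) \<le> norm e" using that by (simp add: mult_left_le_one_le)
   ultimately have "norm (y - s *\<^sub>R e) \<le> R + norm e" using R[of y] norm_triangle_ineq4[of y "s *\<^sub>R e"] by linarith
   then have "y - s *\<^sub>R e \<in> cbox c d" using L by auto
   then show "y \<in> cbox (c + s *\<^sub>R e) (d + s *\<^sub>R e)" by (auto simp: mem_box inner_diff_left inner_add_left)
  qed
  \<comment> \<open>\<open>gg\<close> is the jump of \<open>w\<close> in direction \<open>e\<close>: the jumps at the points \<open>x + (k / (n + 1)) *\<^sub>R e\<close> add up to at most \<open>w (x + e) - w x\<close>.\<close>
  have le: "real (Suc n) * integral (cbox a b) gg \<le> integral (cbox c d) (G 0)" for n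
  proof -
   have hk: "0 \<le> real k * h n" "real k * h n \<le> 1" if "k < Suc n" for k using that by (auto simp: h_def field_simps)
   have "real (Suc n) * integral (cbox a b) gg = (\<Sum>k<Suc n. integral (cbox a b) gg)" by simp
   also have "\<dots> \<le> (\<Sum>k<Suc n. integral (cbox c d) (\<lambda>x. gg (x + (real k * h n) *\<^sub>R e)))"
   proof (rule sum_mono)
    fix k assume "k \<in> {..<Suc n}"
    then have "integral (cbox a b) gg \<le> integral (cbox (c + (real k * h n) *\<^sub>R e) (d + (real k * h n) *\<^sub>R e)) gg"
     by (intro integral_subset_le sub hk gI) (use gg0 in auto)
    then show "integral (cbox a b) gg \<le> integral (cbox c d) (\<lambda>x. gg (x + (real k * h n) *\<^sub>R e))"
     using integral_unique[OF shift[OF gI]] by simp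
   qed
   also have "\<dots> = integral (cbox c d) (\<lambda>x. \<Sum>k<Suc n. gg (x + (real k * h n) *\<^sub>R e))"
    by (rule Henstock_Kurzweil_Integration.integral_sum[symmetric]) (use has_integral_integrable[OF shift[OF gI]] in auto)
   also have "\<dots> \<le> integral (cbox c d) (G 0)"
   proof (rule integral_le)
    show "(\<lambda>x. \<Sum>k<Suc n. gg (x + (real k * h n) *\<^sub>R e)) integrable_on cbox c d"
     by (intro integrable_sum has_integral_integrable[OF shift[OF gI]]) auto
    fix x
    have "(\<Sum>k<Suc n. gg (x + (real k * h n) *\<^sub>R e)) \<le> (\<Sum>k<Suc n. w (x + (real (Suc k) * h n) *\<^sub>R e) - w (x + (real k * h n) *\<^sub>R e))"
    proof (rule sum_mono)
     fix k
     show "gg (x + (real k * h n) *\<^sub>R e) \<le> w (x + (real (Suc k) * h n) *\<^sub>R e) - w (x + (real k * h n) *\<^sub>R e)"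
      using ggle[of "x + (real k * h n) *\<^sub>R e" n] by (simp add: G_def algebra_simps)
    qed
    also have "\<dots> = w (x + (real (Suc n) * h n) *\<^sub>R e) - w (x + (real 0 * h n) *\<^sub>R e)"
     by (rule sum_lessThan_telescope)
    finally show "(\<Sum>k<Suc n. gg (x + (real k * h n) *\<^sub>R e)) \<le> G 0 x" by (simp add: G_def h_def)
   qed (rule GI)
   finally show ?thesis .
  qed
  have "integral (cbox a b) gg \<le> 0"
  proof (rule ccontr)
   assume pos: "\<not> ?thesis"
   then obtain n where "integral (cbox c d) (G 0) < real n * integral (cbox a b) gg" using reals_Archimedean3 by (meson not_le)
   also have "\<dots> \<le> real (Suc n) * integral (cbox a b) gg" using pos by (intro mult_right_mono) auto
   finally show False using le[of n] by linarith
  qed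
  moreover have "0 \<le> integral (cbox a b) gg" by (rule Henstock_Kurzweil_Integration.integral_nonneg[OF gI]) (rule gg0)
  ultimately have I0: "integral (cbox a b) gg = 0" by simp
  define f where "f = (\<lambda>x. if x \<in> cbox a b then gg x else 0)"
  have "gg absolutely_integrable_on cbox a b"
   using gI gg0 by (intro nonnegative_absolutely_integrable_1) auto
  then have fI: "integrable lebesgue f"
   unfolding f_def using absolutely_integrable_restrict_UNIV[of "cbox a b" gg] by (simp add: set_integrable_def)
  have "integral\<^sup>L lebesgue f = integral UNIV f" using integral_lebesgue[OF fI] by simp
  also have "\<dots> = 0" unfolding f_def integral_restrict_UNIV by (rule I0)
  finally have "AE x in lebesgue. f x = 0"
   using integral_nonneg_eq_0_iff_AE[OF fI] gg0 by (auto simp: f_def)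
  then have "{x. f x \<noteq> 0} \<in> null_sets lebesgue" by (simp add: completion.AE_iff_null_sets)
  moreover have "{x \<in> cbox a b. gg x \<noteq> 0} = {x. f x \<noteq> 0}" by (auto simp: f_def)
  ultimately show ?thesis by (simp add: negligible_iff_null_sets)
 qed
 have "negligible {x. gg x \<noteq> 0}"
  unfolding negligible_on_intervals[of "{x. gg x \<noteq> 0}"] using box by (auto simp: Int_def conj_commute)
 then have "AE x in lebesgue. gg x = 0"
  by (simp add: completion.AE_iff_null_sets negligible_iff_null_sets)
 then show ?thesis
 proof eventually_elim
  case (elim x)
  then have "(\<lambda>n. w (x + h n *\<^sub>R e) - w x) \<longlonglongrightarrow> 0" using Glim[of x] by (simp add: G_def)
  then show ?case by (simp add: LIM_zero_iff w_def h_def)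
 qed
qed

text \<open>Adding C x makes u monotone. At almost every x the one-sided limits in a countable dense
  set of directions e agree with the value. There, monotonicity against the points x + e/(n + 1)
  gives l.e <= v(x).e for every limit point l, and density of the directions forces l =
  v(x).\<close>

theorem osl_isCont_AE:
 fixes u :: "'a::euclidean_space => 'a"
 assumes meas: "u \<in> borel_measurable lebesgue" and g: "!!x. norm (u x) \<le> K * (1 + norm x)" and K: "K \<ge> 0"
  and o: "osl C u"
 shows "AE x in lebesgue. isCont u x"
proof -
 define v where "v = (\<lambda>x. u x + C *\<^sub>R x)"
 have vg: "norm (v x) \<le> (K + \<bar>C\<bar>) * (1 + norm x)" for x
 proof -
  have "norm (v x) \<le> norm (u x) + \<bar>C\<bar> * norm x" unfolding v_def by (metis norm_triangle_ineq norm_scaleR)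
  also have "\<dots> \<le> (K + \<bar>C\<bar>) * (1 + norm x)" using g[of x] by (simp add: algebra_simps)
  finally show ?thesis .
 qed
 have vK: "K + \<bar>C\<bar> \<ge> 0" using K by simp
 have vm: "v \<in> borel_measurable lebesgue" unfolding v_def
  by (intro borel_measurable_add meas measurable_completion) simp
 have mono: "(v x - v y) \<bullet> (x - y) \<ge> 0" for x y unfolding v_def by (rule osl_monotone_shift[OF o])
 obtain E :: "'a set" where E: "countable E" "!!X. open X ==> X \<noteq> {} ==> \<exists>d \<in> E. d \<in> X"
  using countable_dense_setE by blast
 have "AE x in lebesgue. \<forall>e\<in>E. (\<lambda>n. v (x + e /\<^sub>R real (Suc n)) \<bullet> e) \<longlonglongrightarrow> v x \<bullet> e"
  by (subst AE_ball_countable[OF E(1)]) (use monotone_directional_continuity_AE[OF vm vg vK mono] in blast)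
 then show ?thesis
 proof eventually_elim
  case (elim x)
  have "l = v x" if l: "l \<in> limit_set v x" for l
  proof -
   have le: "l \<bullet> e \<le> v x \<bullet> e" if e: "e \<in> E" for e
   proof -
    obtain y where y: "y \<longlonglongrightarrow> x" "(\<lambda>n. v (y n)) \<longlonglongrightarrow> l" using l by (auto simp: limit_set_def)
    have "l \<bullet> e \<le> v (x + e /\<^sub>R real (Suc n)) \<bullet> e" for n
    proof -
     let ?z = "x + e /\<^sub>R real (Suc n)"
     have "0 \<le> (l - v ?z) \<bullet> (x - ?z)"
     proof (rule tendsto_le[OF trivial_limit_sequentially _ tendsto_const])
      show "(\<lambda>k. (v (y k) - v ?z) \<bullet> (y k - ?z)) \<longlonglongrightarrow> (l - v ?z) \<bullet> (x - ?z)" by (intro tendsto_intros y)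
     qed (use mono in auto)
     then have "0 \<le> inverse (real (Suc n)) * ((v ?z - l) \<bullet> e)"
      by (simp add: inner_diff_left algebra_simps del: of_nat_Suc)
     then show ?thesis by (simp add: zero_le_mult_iff inner_diff_left del: of_nat_Suc)
    qed
    then show ?thesis by (intro LIMSEQ_le_const[OF bspec[OF elim e]]) blast
   qed
   show ?thesis
   proof (rule ccontr)
    assume "l \<noteq> v x"
    then have "(l - v x) \<bullet> (l - v x) > 0" by simp
    then have "{e. (l - v x) \<bullet> e > 0} \<noteq> {}" by blast
    from E(2)[OF open_halfspace_gt this] obtain e where "e \<in> E" "(l - v x) \<bullet> e > 0" by auto
    then show False using le[of e] by (simp add: inner_diff_left)
   qed
  qed
  then have "isCont v x" by (rule isCont_of_limit_set[OF vg vK])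
  then have "isCont (\<lambda>x. v x - C *\<^sub>R x) x" by (intro continuous_intros)
  then show ?case by (simp add: v_def)
 qed
qed

section \<open>Stability of flow lines\<close>

lemma increments_le_integral:
 fixes w :: "real => real"
 assumes ab: "a \<le> b" and w: "dom_increments a b k w" and q: "q integrable_on {a..b}" and N: "negligible N"
  and der: "!!t d. t \<in> {a<..<b} ==> t \<notin> N ==> (w has_vector_derivative d) (at t) ==> d \<le> q t"
 shows "w b - w a \<le> integral {a..b} q"
proof -
 obtain p N1 where p: "p absolutely_integrable_on {a..b}" "negligible N1"
  "!!s t. a \<le> s ==> s \<le> t ==> t \<le> b ==> integral {s..t} p = w t - w s"
  "!!t. t \<in> {a<..<b} ==> t \<notin> N1 ==> (w has_vector_derivative p t) (at t)"
  using dom_increments_FTC_ex[OF w] by blast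
 let ?Z = "N \<union> N1 \<union> {a,b}"
 have Z: "negligible ?Z" using N p(2) by auto
 have pI: "p integrable_on {a..b}" using p(1) by (simp add: absolutely_integrable_on_def)
 have "w b - w a = integral {a..b} p" using p(3)[of a b] ab by simp
 also have "\<dots> = integral {a..b} (\<lambda>t. if t \<in> ?Z then q t else p t)"
  by (rule integral_spike[OF Z]) auto
 also have "\<dots> \<le> integral {a..b} q"
  by (rule integral_le[OF integrable_spike[OF pI Z] q]) (use der p(4) in auto)
 finally show ?thesis .
qed

text \<open>The half-space argument once more, now at y, with p already in the hull at x.\<close>

lemma osl_convex_hull2:
 assumes o: "osl C u" and p: "p \<in> convex hull limit_set u x" and q: "q \<in> convex hull limit_set u y"
 shows "(q - p) \<bullet> (y - x) \<ge> - C * (norm (y - x))^2"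
proof -
 let ?H = "{q. (x - y) \<bullet> q \<le> (x - y) \<bullet> p + C * (norm (y - x))^2}"
 have "convex hull limit_set u y \<subseteq> ?H"
 proof (rule hull_minimal)
  show "convex ?H" by (rule convex_halfspace_le)
  show "limit_set u y \<subseteq> ?H"
  proof
   fix l assume "l \<in> limit_set u y"
   then obtain z where z: "z \<longlonglongrightarrow> y" "(\<lambda>n. u (z n)) \<longlonglongrightarrow> l" by (auto simp: limit_set_def)
   have "(l - p) \<bullet> (y - x) \<ge> - C * (norm (y - x))^2"
   proof (rule tendsto_le[OF trivial_limit_sequentially])
    show "(\<lambda>n. (u (z n) - p) \<bullet> (z n - x)) \<longlonglongrightarrow> (l - p) \<bullet> (y - x)" by (intro tendsto_intros z)
    show "(\<lambda>n. - C * (norm (z n - x))^2) \<longlonglongrightarrow> - C * (norm (y - x))^2" by (intro tendsto_intros z)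
   qed (use osl_convex_hull[OF o p] in auto)
   then show "l \<in> ?H" by (simp add: inner_diff_left inner_diff_right inner_commute algebra_simps)
  qed
 qed
 then show ?thesis using q by (auto simp: inner_diff_left inner_diff_right inner_commute algebra_simps)
qed

lemma abs_continuous_on_imp_continuous_on:
 assumes "abs_continuous_on {a..b} c"
 shows "continuous_on {a..b} c"
 unfolding continuous_on_iff
proof safe
 fix s e :: real assume s: "s \<in> {a..b}" and e: "e > 0"
 obtain d where d0: "d > 0" and d: "!!(I::nat set) u v.
    finite I ==> (\<forall>i\<in>I. u i \<le> v i \<and> {u i..v i} \<subseteq> {a..b}) ==>
    disjoint_family_on (\<lambda>i. {u i<..<v i}) I ==> (\<Sum>i\<in>I. v i - u i) < d
    ==> (\<Sum>i\<in>I. dist (c (u i)) (c (v i))) < e"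
  using assms e unfolding abs_continuous_on_def by meson
 have one: "dist (c u) (c v) < e" if "u \<le> v" "a \<le> u" "v \<le> b" "v - u < d" for u v
  using d[of "{0}" "\<lambda>_. u" "\<lambda>_. v"] that by (auto simp: disjoint_family_on_def)
 show "\<exists>d>0. \<forall>t\<in>{a..b}. dist t s < d --> dist (c t) (c s) < e"
 proof (intro exI[of _ d] conjI ballI impI d0)
  fix t assume t: "t \<in> {a..b}" "dist t s < d"
  show "dist (c t) (c s) < e"
   using one[of t s] one[of s t] t s by (cases "t \<le> s") (auto simp: dist_real_def dist_commute)
 qed
qed

lemma AE_lebesgue_on_Icc_negligible:
 fixes a b :: real
 assumes "AE s in lebesgue_on {a..b}. P s"
 obtains N where "negligible N" "!!s. s \<in> {a..b} ==> s \<notin> N ==> P s"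
proof -
 have "AE s in lebesgue. s \<in> {a..b} --> P s"
  using assms by (simp add: AE_restrict_space_iff)
 then have "{s. \<not> (s \<in> {a..b} --> P s)} \<in> null_sets lebesgue" by (simp add: completion.AE_iff_null_sets)
 then show thesis by (intro that[of "{s. \<not> (s \<in> {a..b} --> P s)}"]) (auto simp: negligible_iff_null_sets)
qed

lemma AE_lebesgue_on_Icc_negligibleI:
 fixes a b :: real
 assumes "negligible N" "!!s. s \<in> {a..b} ==> s \<notin> N ==> P s"
 shows "AE s in lebesgue_on {a..b}. P s"
proof -
 have "AE s in lebesgue. s \<notin> N" using assms(1) by (auto simp: negligible_iff_null_sets intro: AE_not_in)
 then have "AE s in lebesgue. s \<in> {a..b} --> P s" by eventually_elim (use assms(2) in auto)
 then show ?thesis by (simp add: AE_restrict_space_iff)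
qed

locale compressive =
 fixes T :: real and b :: "real => 'a::euclidean_space => 'a" and C0 C1 :: "real => real"
 assumes T: "T > 0"
  and bmeas: "(\<lambda>(t, x). b t x) \<in> borel_measurable (lebesgue_on ({0..T} \<times> UNIV))"
  and C0int: "integrable (lebesgue_on {0..T}) C0" and C0nn: "!!t. t \<in> {0..T} ==> 0 \<le> C0 t"
  and C1int: "integrable (lebesgue_on {0..T}) C1" and C1nn: "!!t. t \<in> {0..T} ==> 0 \<le> C1 t"
  and growth: "!!t x. t \<in> {0..T} ==> norm (b t x) \<le> C0 t * (1 + norm x)"
  and one_sided: "!!t x y. t \<in> {0..T} ==> (b t x - b t y) \<bullet> (x - y) \<ge> - C1 t * (norm (x - y))^2"
begin

lemma osl: "t \<in> {0..T} ==> osl (C1 t) (b t)"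
 using one_sided by (simp add: osl_def)

lemma C0I: "C0 integrable_on {0..T}" and C1I: "C1 integrable_on {0..T}"
 using integrable_on_lebesgue_on[OF C0int] integrable_on_lebesgue_on[OF C1int] by auto

lemma C0Is: "0 \<le> s ==> t \<le> T ==> C0 integrable_on {s..t}" and C1Is: "0 \<le> s ==> t \<le> T ==> C1 integrable_on {s..t}"
 by (auto intro: integrable_on_subinterval[OF C0I] integrable_on_subinterval[OF C1I])

lemma IC0_nonneg: "0 \<le> s ==> t \<le> T ==> 0 \<le> integral {s..t} C0"
 and IC1_nonneg: "0 \<le> s ==> t \<le> T ==> 0 \<le> integral {s..t} C1"
 using C0nn C1nn by (auto intro!: Henstock_Kurzweil_Integration.integral_nonneg C0Is C1Is)

lemma IC0_le: "0 \<le> s ==> s \<le> s' ==> t' \<le> t ==> t \<le> T ==> integral {s'..t'} C0 \<le> integral {s..t} C0"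
 and IC1_le: "0 \<le> s ==> s \<le> s' ==> t' \<le> t ==> t \<le> T ==> integral {s'..t'} C1 \<le> integral {s..t} C1"
 using C0nn C1nn by (auto intro!: integral_subset_le C0Is C1Is)

lemma b_hat_norm: "t \<in> {0..T} ==> p \<in> b_hat b t x ==> norm p \<le> C0 t * (1 + norm x)"
 using convex_hull_limit_set_bounded[OF growth] by (simp add: b_hat_eq)

text \<open>Extension by zero off the strip yields a Lebesgue measurable function on the whole
  product, of which sections can be taken.\<close>

lemma b_measurable_ext:
 "(\<lambda>p. if p \<in> {0..T} \<times> UNIV then (\<lambda>(t, x). b t x) p else 0) \<in> borel_measurable lebesgue"
 proof (rule borel_measurable_if_I[OF bmeas])
 have "closed ({0..T} \<times> UNIV :: (real \<times> 'a) set)" by (intro closed_Times) auto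
 from borel_closed[OF this] show "{0..T} \<times> UNIV \<in> sets (lebesgue :: (real \<times> 'a) measure)"
  by (simp add: sets_completionI_sets)
qed

lemma b_section_measurable_AE:
 obtains N where "negligible N" "!!t. t \<in> {0..T} ==> t \<notin> N ==> b t \<in> borel_measurable lebesgue"
proof -
 let ?B = "\<lambda>p. if p \<in> {0..T} \<times> UNIV then (\<lambda>(t, x). b t x) p else 0"
 have "AE t in lebesgue. (\<lambda>x. ?B (t, x)) \<in> borel_measurable lebesgue"
  by (rule AE_completion[OF AE_lborel_section_measurable(1)[OF b_measurable_ext]])
 then have n: "{t. \<not> (\<lambda>x. ?B (t, x)) \<in> borel_measurable lebesgue} \<in> null_sets lebesgue"
  by (simp add: completion.AE_iff_null_sets)
 show thesis
 proof (rule that[of "{t. \<not> (\<lambda>x. ?B (t, x)) \<in> borel_measurable lebesgue}"])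
  show "negligible {t. \<not> (\<lambda>x. ?B (t, x)) \<in> borel_measurable lebesgue}" using n by (simp only: negligible_iff_null_sets)
  fix t assume t: "t \<in> {0..T}" "t \<notin> {t. \<not> (\<lambda>x. ?B (t, x)) \<in> borel_measurable lebesgue}"
  moreover have "(\<lambda>x. ?B (t, x)) = b t" using t(1) by auto
  ultimately show "b t \<in> borel_measurable lebesgue" by auto
 qed
qed

text \<open>Almost every z has a measurable time section, so such z meet every nonempty open set;
  one is chosen in each nonempty member of a countable basis. Euler paths freeze the space variable
  at these points, and unions of null sets over them remain null.\<close>

lemma dense_measurable_points_ex:
 "\<exists>D. countable D \<and> (\<forall>X. open X --> X \<noteq> {} --> (\<exists>z\<in>D. z \<in> X)) \<and>
  (\<forall>z\<in>D. (\<lambda>t. b t z) \<in> borel_measurable (lebesgue_on {0..T}))"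
proof -
 let ?B = "\<lambda>p. if p \<in> {0..T} \<times> UNIV then (\<lambda>(t, x). b t x) p else 0"
 define Z where "Z = {z. (\<lambda>t. ?B (t, z)) \<in> borel_measurable lebesgue}"
 have "AE z in lebesgue. z \<in> Z"
  unfolding Z_def mem_Collect_eq by (rule AE_completion[OF AE_lborel_section_measurable(2)[OF b_measurable_ext]])
 then have n: "negligible (- Z)"
  unfolding negligible_iff_null_sets by (simp add: completion.AE_iff_null_sets Compl_eq)
 have ex: "\<exists>z. z \<in> X \<and> z \<in> Z" if "open X" "X \<noteq> {}" for X
 proof (rule ccontr)
  assume "\<not> ?thesis"
  then have "X \<subseteq> - Z" by auto
  then have "negligible X" using n negligible_subset by blast
  then show False using open_not_negligible that by blast
 qed
 obtain BB :: "'a set set" where BB: "countable BB" "topological_basis BB"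
  using ex_countable_basis by blast
 define D where "D = (\<lambda>X. SOME z. z \<in> X \<and> z \<in> Z) ` (BB - {{}})"
 have BBo: "open X" if "X \<in> BB" for X using BB(2) that topological_basis_open by blast
 have pick: "(SOME z. z \<in> X \<and> z \<in> Z) \<in> X \<and> (SOME z. z \<in> X \<and> z \<in> Z) \<in> Z" if "X \<in> BB" "X \<noteq> {}" for X
  by (rule someI_ex[OF ex[OF BBo[OF that(1)] that(2)]])
 show ?thesis
 proof (intro exI[of _ D] conjI allI impI ballI)
  show "countable D" using BB(1) by (simp add: D_def)
  fix X :: "'a set" assume X: "open X" "X \<noteq> {}"
  then obtain x where "x \<in> X" by blast
  then obtain Y where Y: "Y \<in> BB" "x \<in> Y" "Y \<subseteq> X"
   using topological_basisE[OF BB(2) X(1)] by blast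
  then show "\<exists>z\<in>D. z \<in> X" using pick[of Y] unfolding D_def by blast
 next
  fix z assume "z \<in> D"
  then have "z \<in> Z" using pick unfolding D_def by blast
  moreover have "(\<lambda>t. ?B (t, z)) = (\<lambda>t. if t \<in> {0..T} then b t z else 0)" by auto
  ultimately have "(\<lambda>t. if t \<in> {0..T} then b t z else 0) \<in> borel_measurable lebesgue" unfolding Z_def by auto
  then show "(\<lambda>t. b t z) \<in> borel_measurable (lebesgue_on {0..T})"
   by (rule borel_measurable_if_D)
 qed
qed

text \<open>Chosen once, so that all exceptional sets of times refer to the same countable
  family.\<close>

definition D :: "'a set" where
 "D = (SOME D. countable D \<and> (\<forall>X. open X --> X \<noteq> {} --> (\<exists>z\<in>D. z \<in> X)) \<and>
  (\<forall>z\<in>D. (\<lambda>t. b t z) \<in> borel_measurable (lebesgue_on {0..T})))"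

lemma D: "countable D" "!!X. open X ==> X \<noteq> {} ==> \<exists>z\<in>D. z \<in> X"
  "!!z. z \<in> D ==> (\<lambda>t. b t z) \<in> borel_measurable (lebesgue_on {0..T})"
 using someI_ex[OF dense_measurable_points_ex] unfolding D_def[symmetric] by blast+

lemma b_point_integrable:
 assumes "z \<in> D" "0 \<le> s" "t \<le> T"
 shows "(\<lambda>r. b r z) absolutely_integrable_on {s..t}"
proof (rule measurable_bounded_by_integrable_imp_absolutely_integrable[where g="\<lambda>r. C0 r * (1 + norm z)"])
 show "(\<lambda>r. b r z) \<in> borel_measurable (lebesgue_on {s..t})"
  by (rule measurable_restrict_mono[OF D(3)[OF assms(1)]]) (use assms in auto)
 show "(\<lambda>r. C0 r * (1 + norm z)) integrable_on {s..t}" using C0Is assms by (intro integrable_on_mult_left) auto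
qed (use assms growth in auto)

text \<open>Compactness bounds the path first; the growth condition then makes a multiple of
  \<open>C0\<close> a majorant of its speed.\<close>

lemma flow_line_increments_ex:
 assumes fl: "flow_line b T t x c" and t: "0 \<le> t" "t \<le> T"
 shows "\<exists>m N. dom_increments t T m c \<and> negligible N \<and>
  (\<forall>s. s \<in> {t..T} --> s \<notin> N --> (\<exists>v. (c has_vector_derivative v) (at s within {t..T}) \<and> - v \<in> b_hat b s (c s)))"
proof -
 have ac: "abs_continuous_on {t..T} c" using fl by (simp add: flow_line_def)
 have ae: "AE s in lebesgue_on {t..T}. \<exists>v. (c has_vector_derivative v) (at s within {t..T}) \<and> - v \<in> b_hat b s (c s)"
  using fl by (simp add: flow_line_def)
 obtain N where N: "negligible N" "!!s. s \<in> {t..T} ==> s \<notin> N ==>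
   \<exists>v. (c has_vector_derivative v) (at s within {t..T}) \<and> - v \<in> b_hat b s (c s)"
  using AE_lebesgue_on_Icc_negligible[OF ae] by blast
 have "bounded (c ` {t..T})"
  by (intro compact_imp_bounded compact_continuous_image abs_continuous_on_imp_continuous_on ac) auto
 then obtain B where B: "!!s. s \<in> {t..T} ==> norm (c s) \<le> B" by (metis bounded_iff imageI)
 have B0: "B \<ge> 0" using order_trans[OF norm_ge_zero B[of t]] t by simp
 have "dom_increments t T (\<lambda>s. C0 s * (1 + B)) c"
 proof (rule dom_increments_of_abs_continuous[OF ac _ _ N(1)])
  show "(\<lambda>s. C0 s * (1 + B)) integrable_on {t..T}" using C0Is t by (intro integrable_on_mult_left) auto
  show "0 \<le> C0 s * (1 + B)" if "s \<in> {t..T}" for s using C0nn that t B0 by auto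
  fix s assume s: "s \<in> {t..T}" "s \<notin> N"
  then obtain v where v: "(c has_vector_derivative v) (at s within {t..T})" "- v \<in> b_hat b s (c s)" using N(2) by blast
  have "norm v \<le> C0 s * (1 + norm (c s))" using b_hat_norm[OF _ v(2)] s t by auto
  also have "\<dots> \<le> C0 s * (1 + B)" using B[OF s(1)] C0nn s t by (intro mult_left_mono) auto
  finally show "\<exists>v. (c has_vector_derivative v) (at s within {t..T}) \<and> norm v \<le> C0 s * (1 + B)" using v(1) by blast
 qed
 then show ?thesis using N by blast
qed

lemma flow_line_obtain:
 assumes fl: "flow_line b T t x c" and t: "0 \<le> t" "t \<le> T"
 obtains m N where "dom_increments t T m c" "negligible N"
  "!!s. s \<in> {t<..<T} ==> s \<notin> N ==> \<exists>v. (c has_vector_derivative v) (at s) \<and> - v \<in> b_hat b s (c s)"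
proof -
 obtain m N where mN: "dom_increments t T m c" "negligible N"
  "!!s. s \<in> {t..T} ==> s \<notin> N ==> \<exists>v. (c has_vector_derivative v) (at s within {t..T}) \<and> - v \<in> b_hat b s (c s)"
  using flow_line_increments_ex[OF assms] by blast
 have "\<exists>v. (c has_vector_derivative v) (at s) \<and> - v \<in> b_hat b s (c s)" if s: "s \<in> {t<..<T}" "s \<notin> N" for s
 proof -
  have "at s within {t..T} = at s" using s(1) by (intro at_within_interior) auto
  then show ?thesis using mN(3)[of s] s by auto
 qed
 then show thesis using that mN by blast
qed

text \<open>Gronwall for 1 + |p|^2 in both time directions: \<open>w'\<close> gives the forward
  estimate and \<open>w\<close> = -(1 + |p|^2) the backward one. The backward estimate stands in for
  the missing inverse flow when supports are traced back in time.\<close>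

lemma flow_line_bound_aux:
 assumes fl: "flow_line b T t x p" and t: "0 \<le> t" "t \<le> r" "r \<le> s" "s \<le> T"
 shows "1 + (norm (p s))^2 \<le> (1 + (norm (p r))^2) * exp (4 * integral {r..s} C0)"
  and "1 + (norm (p r))^2 \<le> (1 + (norm (p s))^2) * exp (4 * integral {r..s} C0)"
proof -
 obtain m N where mN: "dom_increments t T m p" "negligible N"
  "!!s. s \<in> {t<..<T} ==> s \<notin> N ==> \<exists>v. (p has_vector_derivative v) (at s) \<and> - v \<in> b_hat b s (p s)"
  by (rule flow_line_obtain[OF fl]) (use t in auto)
 have d: "dom_increments r s m p" by (rule dom_increments_subinterval[OF mN(1)]) (use t in auto)
 obtain k where k: "dom_increments r s k (\<lambda>t. p t \<bullet> p t)"
  by (rule dom_increments_bilinear[OF d d bounded_bilinear_inner])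
 have cst: "dom_increments r s (\<lambda>_. 0) (\<lambda>_. c::real)" for c
  by (auto simp: dom_increments_def intro: has_integral_integrable[OF has_integral_0])
 define w where "w = (\<lambda>t. - 1 - p t \<bullet> p t)"
 define w' where "w' = (\<lambda>t. p t \<bullet> p t - (- 1))"
 have w: "dom_increments r s (\<lambda>t. 0 + k t) w" unfolding w_def by (rule dom_increments_diff[OF cst k])
 have w': "dom_increments r s (\<lambda>t. k t + 0) w'" unfolding w'_def by (rule dom_increments_diff[OF k cst])
 \<comment> \<open>2 |p| |v| <= 2 C0 (1 + |p|)^2 <= 4 C0 (1 + |p|^2): the origin of the constant
   4.\<close>
 have der: "\<bar>d\<bar> \<le> 4 * C0 q * (1 + p q \<bullet> p q)" if q: "q \<in> {r<..<s}" "q \<notin> N" and d: "((\<lambda>t. p t \<bullet> p t) has_vector_derivative d) (at q)" for q d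
 proof -
  obtain v where v: "(p has_vector_derivative v) (at q)" "- v \<in> b_hat b q (p q)" using mN(3)[of q] q t by auto
  have "((\<lambda>t. p t \<bullet> p t) has_vector_derivative (p q \<bullet> v + v \<bullet> p q)) (at q)"
   by (rule bounded_bilinear.has_vector_derivative[OF bounded_bilinear_inner v(1) v(1)])
  then have deq: "d = 2 * (p q \<bullet> v)" using d vector_derivative_unique_at inner_commute by (metis mult_2)
  have c0: "0 \<le> C0 q" using C0nn q t by auto
  have nv: "norm v \<le> C0 q * (1 + norm (p q))" using b_hat_norm[OF _ v(2)] q t by auto
  have "\<bar>d\<bar> \<le> 2 * (norm (p q) * norm v)" unfolding deq using Cauchy_Schwarz_ineq2[of "p q" v] by (simp add: abs_mult)
  also have "\<dots> \<le> 2 * ((1 + norm (p q)) * (C0 q * (1 + norm (p q))))"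
   by (intro mult_left_mono mult_mono nv) auto
  also have "\<dots> = 2 * C0 q * (1 + norm (p q))^2" by (simp add: power2_eq_square)
  also have "\<dots> \<le> 2 * C0 q * (2 * (1 + (norm (p q))^2))"
  proof (rule mult_left_mono)
   show "(1 + norm (p q))^2 \<le> 2 * (1 + (norm (p q))^2)"
    using sum_squares_bound[of 1 "norm (p q)"] by (simp add: power2_sum)
  qed (use c0 in auto)
  finally show ?thesis by (simp add: power2_norm_eq_inner algebra_simps)
 qed
 have cA: "(\<lambda>q. c * C0 q) absolutely_integrable_on {r..s}" for c
  using nonnegative_absolutely_integrable_1[OF C0Is, of r s] C0nn t by (intro set_integrable_mult_right) auto
 have "w s * exp (- integral {r..s} (\<lambda>q. - 4 * C0 q)) \<le> w r + exp (integral {r..s} (\<lambda>q. \<bar>- 4 * C0 q\<bar>)) * integral {r..s} (\<lambda>_. 0)"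
 proof (rule gronwall_increments[OF t(3) w cA _ _ mN(2) _ order_refl])
  fix q d assume q: "q \<in> {r<..<s}" "q \<notin> N" "(w has_vector_derivative d) (at q)"
  have "((\<lambda>t. - 1 - w t) has_vector_derivative 0 - d) (at q)"
   by (intro has_vector_derivative_diff has_vector_derivative_const q)
  then have "\<bar>0 - d\<bar> \<le> 4 * C0 q * (1 + p q \<bullet> p q)" by (intro der q(1,2)) (simp add: w_def)
  then show "d \<le> - 4 * C0 q * w q + 0" by (simp add: w_def algebra_simps)
 qed auto
 then show "1 + (norm (p r))^2 \<le> (1 + (norm (p s))^2) * exp (4 * integral {r..s} C0)"
  by (simp add: w_def power2_norm_eq_inner algebra_simps)
 have "w' s * exp (- integral {r..s} (\<lambda>q. 4 * C0 q)) \<le> w' r + exp (integral {r..s} (\<lambda>q. \<bar>4 * C0 q\<bar>)) * integral {r..s} (\<lambda>_. 0)"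
 proof (rule gronwall_increments[OF t(3) w' cA _ _ mN(2) _ order_refl])
  fix q d assume q: "q \<in> {r<..<s}" "q \<notin> N" "(w' has_vector_derivative d) (at q)"
  have "((\<lambda>t. w' t + (- 1)) has_vector_derivative d + 0) (at q)"
   by (intro has_vector_derivative_add has_vector_derivative_const q)
  then have "\<bar>d + 0\<bar> \<le> 4 * C0 q * (1 + p q \<bullet> p q)" by (intro der q(1,2)) (simp add: w'_def)
  then show "d \<le> 4 * C0 q * w' q + 0" by (simp add: w'_def algebra_simps)
 qed auto
 then have "w' s * exp (- (4 * integral {r..s} C0)) \<le> w' r" by simp
 then have "w' s * exp (- (4 * integral {r..s} C0)) * exp (4 * integral {r..s} C0) \<le> w' r * exp (4 * integral {r..s} C0)"
  by (rule mult_right_mono) simp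
 then have "w' s \<le> w' r * exp (4 * integral {r..s} C0)"
  by (simp add: mult.assoc exp_add[symmetric])
 then show "1 + (norm (p s))^2 \<le> (1 + (norm (p r))^2) * exp (4 * integral {r..s} C0)"
  by (simp add: w'_def power2_norm_eq_inner algebra_simps)
qed

text \<open>A flow line that is in the ball of radius R at one of its times is in the ball of radius
  \<open>rad R\<close> at all of them, earlier or later.\<close>

definition rad :: "real => real" where
 "rad R = sqrt ((1 + R\<^sup>2) * exp (4 * integral {0..T} C0))"

lemma rad_ge: "0 \<le> R ==> R \<le> rad R" and rad_nonneg: "0 \<le> rad R"
proof -
 have "1 \<le> exp (4 * integral {0..T} C0)" using IC0_nonneg[of 0 T] by simp
 then have "(1 + R\<^sup>2) * 1 \<le> (1 + R\<^sup>2) * exp (4 * integral {0..T} C0)" by (intro mult_left_mono) auto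
 then have "R\<^sup>2 \<le> (1 + R\<^sup>2) * exp (4 * integral {0..T} C0)" by simp
 then show "0 \<le> R ==> R \<le> rad R" unfolding rad_def by (rule real_le_rsqrt)
qed (simp add: rad_def)

lemma flow_line_rad:
 assumes fl: "flow_line b T t x c" and t: "0 \<le> t" "r \<in> {t..T}" "s \<in> {t..T}" and n: "norm (c r) \<le> R"
 shows "norm (c s) \<le> rad R"
proof -
 have "1 + (norm (c s))^2 \<le> (1 + (norm (c r))^2) * exp (4 * integral {0..T} C0)"
 proof (cases "r \<le> s")
  case True
  have "1 + (norm (c s))^2 \<le> (1 + (norm (c r))^2) * exp (4 * integral {r..s} C0)"
   by (rule flow_line_bound_aux(1)[OF fl]) (use t True in auto)
  also have "\<dots> \<le> (1 + (norm (c r))^2) * exp (4 * integral {0..T} C0)"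
   using IC0_le[of 0 r s T] t by (intro mult_left_mono) auto
  finally show ?thesis .
 next
  case False
  have "1 + (norm (c s))^2 \<le> (1 + (norm (c r))^2) * exp (4 * integral {s..r} C0)"
   by (rule flow_line_bound_aux(2)[OF fl]) (use t False in auto)
  also have "\<dots> \<le> (1 + (norm (c r))^2) * exp (4 * integral {0..T} C0)"
   using IC0_le[of 0 s r T] t by (intro mult_left_mono) auto
  finally show ?thesis .
 qed
 also have "\<dots> \<le> (1 + R\<^sup>2) * exp (4 * integral {0..T} C0)"
  using n by (intro mult_right_mono add_left_mono power_mono) auto
 finally have "(norm (c s))^2 \<le> (1 + R\<^sup>2) * exp (4 * integral {0..T} C0)" by simp
 then show ?thesis unfolding rad_def by (rule real_le_rsqrt)
qed

lemma flow_line_speed: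
 assumes fl: "flow_line b T t x c" and t: "0 \<le> t" "t \<le> r" "r \<le> s" "s \<le> T" and n: "norm (c q) \<le> R" "q \<in> {t..T}"
 shows "norm (c s - c r) \<le> (1 + rad R) * integral {r..s} C0"
proof -
 obtain N where N: "negligible N" "!!s. s \<in> {t..T} ==> s \<notin> N ==>
   \<exists>v. (c has_vector_derivative v) (at s within {t..T}) \<and> - v \<in> b_hat b s (c s)"
  using flow_line_increments_ex[OF fl] t by auto
 have ac: "abs_continuous_on {t..T} c" using fl by (simp add: flow_line_def)
 have "dom_increments t T (\<lambda>s. C0 s * (1 + rad R)) c"
 proof (rule dom_increments_of_abs_continuous[OF ac _ _ N(1)])
  show "(\<lambda>s. C0 s * (1 + rad R)) integrable_on {t..T}" using C0Is t by (intro integrable_on_mult_left) auto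
  show "0 \<le> C0 s * (1 + rad R)" if "s \<in> {t..T}" for s using C0nn that t rad_nonneg by auto
  fix s assume s: "s \<in> {t..T}" "s \<notin> N"
  then obtain v where v: "(c has_vector_derivative v) (at s within {t..T})" "- v \<in> b_hat b s (c s)" using N(2) by blast
  have "norm v \<le> C0 s * (1 + norm (c s))" using b_hat_norm[OF _ v(2)] s t by auto
  also have "\<dots> \<le> C0 s * (1 + rad R)" using flow_line_rad[OF fl t(1) n(2) s(1) n(1)] C0nn s t by (intro mult_left_mono) auto
  finally show "\<exists>v. (c has_vector_derivative v) (at s within {t..T}) \<and> norm v \<le> C0 s * (1 + rad R)" using v(1) by blast
 qed
 from dom_incrementsD(3)[OF this, of r s] t show ?thesis by (simp add: mult.commute)
qed

text \<open>A Lipschitz constant common to all the flow maps.\<close>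

definition lam :: real where "lam = exp (integral {0..T} C1)"

lemma lam_pos: "0 < lam" by (simp add: lam_def)

text \<open>Velocities lie in minus \<open>b_hat\<close>, so the one-sided lower bound turns into
  the upper bound 2 C1 |c - \<eta>|^2 for the derivative of the squared distance. This controls the
  distance forward in time only.\<close>

lemma flow_line_contraction:
 assumes f1: "flow_line b T t x c" and f2: "flow_line b T t y \<eta>" and t: "0 \<le> t" "t \<le> s" "s \<le> T"
 shows "norm (c s - \<eta> s) \<le> lam * norm (x - y)"
proof -
 have tT: "t \<le> T" using t by simp
 obtain m N where mN: "dom_increments t T m c" "negligible N"
  "!!s. s \<in> {t<..<T} ==> s \<notin> N ==> \<exists>v. (c has_vector_derivative v) (at s) \<and> - v \<in> b_hat b s (c s)"
  using flow_line_obtain[OF f1 t(1) tT] by blast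
 obtain n N' where nN: "dom_increments t T n \<eta>" "negligible N'"
  "!!s. s \<in> {t<..<T} ==> s \<notin> N' ==> \<exists>v. (\<eta> has_vector_derivative v) (at s) \<and> - v \<in> b_hat b s (\<eta> s)"
  using flow_line_obtain[OF f2 t(1) tT] by blast
 have d: "dom_increments t s (\<lambda>t. m t + n t) (\<lambda>t. c t - \<eta> t)"
  by (rule dom_increments_subinterval[OF dom_increments_diff[OF mN(1) nN(1)]]) (use t in auto)
 define w where "w = (\<lambda>t. (c t - \<eta> t) \<bullet> (c t - \<eta> t))"
 obtain k where k: "dom_increments t s k w"
  unfolding w_def by (rule dom_increments_bilinear[OF d d bounded_bilinear_inner])
 have cA: "(\<lambda>q. 2 * C1 q) absolutely_integrable_on {t..s}"
  using nonnegative_absolutely_integrable_1[OF C1Is, of t s] C1nn t by (intro set_integrable_mult_right) auto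
 have "w s * exp (- integral {t..s} (\<lambda>q. 2 * C1 q)) \<le> w t + exp (integral {t..s} (\<lambda>q. \<bar>2 * C1 q\<bar>)) * integral {t..s} (\<lambda>_. 0)"
 proof (rule gronwall_increments[OF t(2) k cA, of _ "N \<union> N'"])
  fix q d assume q: "q \<in> {t<..<s}" "q \<notin> N \<union> N'" "(w has_vector_derivative d) (at q)"
  obtain v where v: "(c has_vector_derivative v) (at q)" "- v \<in> b_hat b q (c q)" using mN(3)[of q] q t by auto
  obtain u where u: "(\<eta> has_vector_derivative u) (at q)" "- u \<in> b_hat b q (\<eta> q)" using nN(3)[of q] q t by auto
  have vu: "((\<lambda>t. c t - \<eta> t) has_vector_derivative v - u) (at q)"
   by (rule has_vector_derivative_diff[OF v(1) u(1)])
  have "(w has_vector_derivative ((c q - \<eta> q) \<bullet> (v - u) + (v - u) \<bullet> (c q - \<eta> q))) (at q)"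
   unfolding w_def by (rule bounded_bilinear.has_vector_derivative[OF bounded_bilinear_inner vu vu])
  then have deq: "d = 2 * ((v - u) \<bullet> (c q - \<eta> q))" using q(3) vector_derivative_unique_at inner_commute by (metis mult_2)
  have "(- v - (- u)) \<bullet> (c q - \<eta> q) \<ge> - C1 q * (norm (c q - \<eta> q))^2"
   by (rule osl_convex_hull2[OF osl]) (use v u q t in \<open>auto simp: b_hat_eq\<close>)
  then show "d \<le> 2 * C1 q * w q + 0"
   by (simp add: deq w_def power2_norm_eq_inner inner_diff_left algebra_simps)
 qed (use mN(2) nN(2) in auto)
 then have "w s * exp (- (2 * integral {t..s} C1)) \<le> w t" by simp
 then have "w s * exp (- (2 * integral {t..s} C1)) * exp (2 * integral {t..s} C1) \<le> w t * exp (2 * integral {t..s} C1)"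
  by (rule mult_right_mono) simp
 then have "w s \<le> w t * exp (2 * integral {t..s} C1)" by (simp add: mult.assoc exp_add[symmetric])
 also have "\<dots> \<le> w t * exp (2 * integral {0..T} C1)"
  using IC1_le[of 0 t s T] t by (intro mult_left_mono) (auto simp: w_def)
 also have "\<dots> = (lam * norm (x - y))^2"
  using f1 f2 by (simp add: w_def lam_def flow_line_def power_mult_distrib exp_double power2_norm_eq_inner)
 finally have "(norm (c s - \<eta> s))^2 \<le> (lam * norm (x - y))^2" by (simp add: w_def power2_norm_eq_inner)
 then show ?thesis by (rule power2_le_imp_le) (use lam_pos in auto)
qed

lemma flow_line_unique:
 assumes "flow_line b T t x c" "flow_line b T t x \<eta>" "0 \<le> t" "t \<le> s" "s \<le> T"
 shows "c s = \<eta> s"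
 using flow_line_contraction[OF assms] by simp

end

section \<open>Existence of flow lines\<close>

context compressive
begin

text \<open>Bounds \<open>2 + norm\<close> along Euler paths. The 2 in place of the 1 of the growth
  condition leaves room for the distance, at most 1, between the path and the point at which b is
  frozen.\<close>

definition RR :: "'a => real" where
 "RR x = (2 + norm x) * exp (integral {0..T} C0)"

lemma RR_nonneg: "0 \<le> RR x" by (simp add: RR_def)

text \<open>An Euler path up to time s: its velocity is that of a point \<open>y r\<close> within e
  of the path. The bound in multiplicative exponential form is reproduced when pieces are
  joined.\<close>

definition approx :: "real => 'a => real => real => (real => 'a) => bool" where
 "approx t x e s c \<longleftrightarrow> c t = x \<and> dom_increments t s (\<lambda>r. C0 r * RR x) c \<and>
  (\<forall>r\<in>{t..s}. norm (c r) + 2 \<le> (2 + norm x) * exp (integral {t..r} C0)) \<and>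
  (\<exists>y N. negligible N \<and> (\<forall>r\<in>{t..s}. norm (c r - y r) \<le> e) \<and>
    (\<forall>r. r \<in> {t<..<s} --> r \<notin> N --> (c has_vector_derivative - b r (y r)) (at r)))"

lemma exp_C0_le: "0 \<le> t ==> r \<le> T ==> (2 + norm x) * exp (integral {t..r} C0) \<le> RR x"
 unfolding RR_def using IC0_le[of 0 t r T] by (intro mult_left_mono) auto

lemma C0_combine: "0 \<le> t ==> t \<le> s ==> s \<le> r ==> r \<le> T ==> integral {t..s} C0 + integral {s..r} C0 = integral {t..r} C0"
 by (rule Henstock_Kurzweil_Integration.integral_combine) (auto intro: C0Is)

lemma approx_step:
 assumes t: "0 \<le> t" "t \<le> s" "s \<le> s'" "s' \<le> T" and e: "0 < e" "e \<le> 1"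
  and ap: "approx t x e s c" and small: "RR x * integral {s..s'} C0 \<le> e / 2"
 shows "\<exists>c'. approx t x e s' c'"
proof -
 have ap1: "c t = x" and ap2: "dom_increments t s (\<lambda>r. C0 r * RR x) c"
  and ap3: "!!r. r \<in> {t..s} ==> norm (c r) + 2 \<le> (2 + norm x) * exp (integral {t..r} C0)"
  using ap by (auto simp: approx_def)
 obtain y N where yN: "negligible N" "!!r. r \<in> {t..s} ==> norm (c r - y r) \<le> e"
  "!!r. r \<in> {t<..<s} ==> r \<notin> N ==> (c has_vector_derivative - b r (y r)) (at r)"
  using ap unfolding approx_def by blast
 have "ball (c s) (e / 2) \<noteq> {}" using e by simp
 \<comment> \<open>Freezing at a point of \<open>D\<close> makes the velocity integrable in time.
   Half of e is spent here and half on the displacement during the step.\<close>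
 from D(2)[OF open_ball this] obtain z where z: "z \<in> D" "norm (c s - z) < e / 2" by (auto simp: dist_norm)
 have nz: "1 + norm z \<le> 2 + norm (c s)"
  using z(2) e norm_triangle_ineq2[of z "c s"] by (simp add: norm_minus_commute)
 have sR: "2 + norm (c s) \<le> RR x" using ap3[of s] exp_C0_le[of t s x] t by auto
 have bzA: "(\<lambda>q. b q z) absolutely_integrable_on {s..s'}" by (rule b_point_integrable[OF z(1)]) (use t in auto)
 have bzI: "(\<lambda>q. b q z) integrable_on {s..s'}" using bzA by (simp add: absolutely_integrable_on_def)
 define g where "g = (\<lambda>r. integral {s..r} (\<lambda>q. b q z))"
 define c' where "c' = (\<lambda>r. if r \<le> s then c r else c s - g r)"
 define y' where "y' = (\<lambda>r. if r \<le> s then y r else z)"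
 have g's: "c' r = c s - g r" if "s \<le> r" for r using that by (cases "r = s") (auto simp: c'_def g_def)
 have inc: "norm (c' r2 - c' r1) \<le> integral {r1..r2} C0 * (2 + norm (c s))" if r: "s \<le> r1" "r1 \<le> r2" "r2 \<le> s'" for r1 r2
 proof -
  have gI: "g r1 + integral {r1..r2} (\<lambda>q. b q z) = g r2"
   unfolding g_def by (rule Henstock_Kurzweil_Integration.integral_combine) (use r in \<open>auto intro: integrable_on_subinterval[OF bzI]\<close>)
  then have "c' r2 - c' r1 = - integral {r1..r2} (\<lambda>q. b q z)"
   using g's[of r1] g's[of r2] r by (simp add: gI[symmetric])
  then have "norm (c' r2 - c' r1) = norm (integral {r1..r2} (\<lambda>q. b q z))" by simp
  also have "\<dots> \<le> integral {r1..r2} (\<lambda>q. C0 q * (2 + norm (c s)))"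
  proof (rule integral_norm_bound_integral)
   show "(\<lambda>q. b q z) integrable_on {r1..r2}" using r by (auto intro: integrable_on_subinterval[OF bzI])
   show "(\<lambda>q. C0 q * (2 + norm (c s))) integrable_on {r1..r2}" using C0Is[of r1 r2] r t by (intro integrable_on_mult_left) auto
   fix q assume q: "q \<in> {r1..r2}"
   then have "q \<in> {0..T}" using r t by auto
   then have "norm (b q z) \<le> C0 q * (1 + norm z)" "0 \<le> C0 q" using growth C0nn by auto
   then show "norm (b q z) \<le> C0 q * (2 + norm (c s))" using nz by (meson mult_left_mono order_trans)
  qed
  finally show ?thesis by simp
 qed
 have incR: "norm (c' r2 - c' r1) \<le> integral {r1..r2} C0 * RR x" if r: "t \<le> r1" "r1 \<le> r2" "r2 \<le> s'" for r1 r2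
 proof -
  have late: "norm (c' r2 - c' r1) \<le> integral {r1..r2} C0 * RR x" if "s \<le> r1" "r1 \<le> r2" "r2 \<le> s'" for r1 r2
   using inc[OF that] sR IC0_nonneg[of r1 r2] that t by (meson mult_left_mono order_trans)
  have early: "norm (c' r2 - c' r1) \<le> integral {r1..r2} C0 * RR x" if "t \<le> r1" "r1 \<le> r2" "r2 \<le> s" for r1 r2
   using dom_incrementsD(3)[OF ap2, of r1 r2] that by (simp add: c'_def)
  show ?thesis
  proof (cases "r2 \<le> s \<or> s \<le> r1")
   case True then show ?thesis using late[of r1 r2] early[of r1 r2] r by auto
  next
   case False
   then have *: "r1 \<le> s" "s \<le> r2" by auto
   have "norm (c' r2 - c' r1) \<le> norm (c' r2 - c' s) + norm (c' s - c' r1)"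
    using norm_triangle_ineq[of "c' r2 - c' s" "c' s - c' r1"] by simp
   also have "\<dots> \<le> integral {s..r2} C0 * RR x + integral {r1..s} C0 * RR x"
    by (intro add_mono late early) (use * r in auto)
   also have "\<dots> = integral {r1..r2} C0 * RR x" using C0_combine[of r1 s r2] * r t by (simp add: distrib_right[symmetric] add.commute)
   finally show ?thesis .
  qed
 qed
 obtain N2 where N2: "negligible N2" "!!r. r \<in> {s<..<s'} ==> r \<notin> N2 ==> (g has_vector_derivative b r z) (at r)"
  unfolding g_def using Lebesgue_point_ex[OF bzI] by blast
 have "approx t x e s' c'"
  unfolding approx_def
 proof (intro conjI ballI)
  show "c' t = x" using t ap1 by (simp add: c'_def)
  show "dom_increments t s' (\<lambda>r. C0 r * RR x) c'"
   unfolding dom_increments_def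
  proof (intro conjI ballI allI impI)
   show "(\<lambda>r. C0 r * RR x) integrable_on {t..s'}" using C0Is[of t s'] t by (intro integrable_on_mult_left) auto
   show "0 \<le> C0 r * RR x" if "r \<in> {t..s'}" for r using C0nn[of r] RR_nonneg that t by auto
  qed (use incR in simp)
  fix r assume r: "r \<in> {t..s'}"
  show "norm (c' r) + 2 \<le> (2 + norm x) * exp (integral {t..r} C0)"
  proof (cases "r \<le> s")
   case True then show ?thesis using ap3[of r] r by (simp add: c'_def)
  next
   case False
   then have sr: "s \<le> r" by simp
   have "norm (c' r) \<le> norm (c' s) + norm (c' r - c' s)" using norm_triangle_sub by blast
   also have "\<dots> \<le> norm (c s) + integral {s..r} C0 * (2 + norm (c s))"
    using inc[of s r] sr r by (simp add: c'_def)
   finally have "norm (c' r) + 2 \<le> (2 + norm (c s)) * (1 + integral {s..r} C0)" by (simp add: algebra_simps)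
   \<comment> \<open>1 + u <= exp u brings the growth over one step into the exponential form that
     can be concatenated.\<close>
   also have "\<dots> \<le> (2 + norm (c s)) * exp (integral {s..r} C0)" by (intro mult_left_mono exp_ge_add_one_self) auto
   also have "\<dots> \<le> ((2 + norm x) * exp (integral {t..s} C0)) * exp (integral {s..r} C0)"
    using ap3[of s] t by (intro mult_right_mono) auto
   also have "\<dots> = (2 + norm x) * exp (integral {t..r} C0)"
    using C0_combine[of t s r] t sr r by (simp add: exp_add[symmetric] mult.assoc)
   finally show ?thesis .
  qed
 next
  show "\<exists>y N. negligible N \<and> (\<forall>r\<in>{t..s'}. norm (c' r - y r) \<le> e) \<and>
    (\<forall>r. r \<in> {t<..<s'} --> r \<notin> N --> (c' has_vector_derivative - b r (y r)) (at r))"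
  proof (intro exI[of _ y'] exI[of _ "N \<union> N2 \<union> {s}"] conjI ballI allI impI)
   show "negligible (N \<union> N2 \<union> {s})" using yN(1) N2(1) by auto
   fix r assume r: "r \<in> {t..s'}"
   show "norm (c' r - y' r) \<le> e"
   proof (cases "r \<le> s")
    case True then show ?thesis using yN(2)[of r] r by (simp add: c'_def y'_def)
   next
    case False
    then have sr: "s \<le> r" by simp
    have "norm (c' r - z) \<le> norm (c' r - c' s) + norm (c s - z)"
     using norm_triangle_ineq[of "c' r - c' s" "c s - z"] by (simp add: c'_def)
    also have "norm (c' r - c' s) \<le> integral {s..r} C0 * RR x" using incR[of s r] sr r t by auto
    also have "\<dots> \<le> integral {s..s'} C0 * RR x" using IC0_le[of s s r s'] r t RR_nonneg by (intro mult_right_mono) auto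
    finally show ?thesis using small z(2) False by (simp add: y'_def mult.commute)
   qed
  next
   fix r assume r: "r \<in> {t<..<s'}" "r \<notin> N \<union> N2 \<union> {s}"
   show "(c' has_vector_derivative - b r (y' r)) (at r)"
   proof (cases "r < s")
    case True
    then have "(c has_vector_derivative - b r (y r)) (at r)" using yN(3)[of r] r by auto
    then have "(c' has_vector_derivative - b r (y r)) (at r)"
     by (rule has_vector_derivative_transform_within_open[where S="{..<s}"]) (use True in \<open>auto simp: c'_def\<close>)
    then show ?thesis using True by (simp add: y'_def)
   next
    case False
    then have rs: "s < r" using r by auto
    have "((\<lambda>r. c s - g r) has_vector_derivative 0 - b r z) (at r)"
     by (intro has_vector_derivative_diff has_vector_derivative_const N2(2)) (use r rs in auto)
    then have "(c' has_vector_derivative 0 - b r z) (at r)"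
     by (rule has_vector_derivative_transform_within_open[where S="{s<..}"]) (use rs in \<open>auto simp: c'_def\<close>)
    then show ?thesis using rs by (simp add: y'_def)
   qed
  qed
 qed
 then show ?thesis by blast
qed

text \<open>Uniform continuity of the primitive of \<open>C0\<close> makes one step length
  admissible everywhere: \<open>RR x\<close> bounds the speed factor along the whole path, so later
  steps need not become shorter.\<close>

lemma approx_exists:
 assumes t: "0 \<le> t" "t \<le> T" and e: "0 < e" "e \<le> 1"
 shows "\<exists>c. approx t x e T c"
proof -
 define M where "M = (\<lambda>s. integral {0..s} C0)"
 have "continuous_on {0..T} M" unfolding M_def by (rule indefinite_integral_continuous_1[OF C0I])
 then have "uniformly_continuous_on {0..T} M" by (intro compact_uniformly_continuous) auto
 moreover have "e / 2 / (RR x + 1) > 0" using e RR_nonneg[of x] by simp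
 ultimately obtain d where d: "d > 0" "!!s s'. s \<in> {0..T} ==> s' \<in> {0..T} ==> dist s' s < d ==> dist (M s') (M s) < e / 2 / (RR x + 1)"
  unfolding uniformly_continuous_on_def by metis
 have small: "RR x * integral {s..s'} C0 \<le> e / 2" if s: "0 \<le> s" "s \<le> s'" "s' \<le> T" "s' - s < d" for s s'
 proof -
  have "integral {s..s'} C0 = M s' - M s" using C0_combine[of 0 s s'] s by (simp add: M_def)
  also have "\<dots> \<le> e / 2 / (RR x + 1)" using d(2)[of s s'] s by (auto simp: dist_real_def)
  finally have "RR x * integral {s..s'} C0 \<le> RR x * (e / 2 / (RR x + 1))" by (intro mult_left_mono RR_nonneg)
  also have "\<dots> = (RR x / (RR x + 1)) * (e / 2)" by simp
  also have "\<dots> \<le> 1 * (e / 2)" using RR_nonneg[of x] e by (intro mult_right_mono) auto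
  finally show ?thesis by simp
 qed
 obtain n :: nat where n: "(T - t) / d < real n" using reals_Archimedean2 by blast
 define h where "h = (T - t) / real (Suc n)"
 have h0: "0 \<le> h" using t by (simp add: h_def)
 have hd: "h < d"
 proof -
  have "T - t < d * real n" using n d(1) by (simp add: field_simps)
  also have "\<dots> \<le> d * real (Suc n)" using d(1) by simp
  finally show ?thesis by (simp add: h_def field_simps)
 qed
 have "\<exists>c. approx t x e (t + real k * h) c" if "k \<le> Suc n" for k
  using that
 proof (induction k)
  case 0
  have "approx t x e t (\<lambda>_. x)"
   unfolding approx_def
  proof (intro conjI)
   show "dom_increments t t (\<lambda>r. C0 r * RR x) (\<lambda>_. x)"
    unfolding dom_increments_def
   proof (intro conjI ballI allI impI)
    show "(\<lambda>r. C0 r * RR x) integrable_on {t..t}" using C0Is[of t t] t by (intro integrable_on_mult_left) auto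
    show "0 \<le> C0 r * RR x" if "r \<in> {t..t}" for r using C0nn[of r] RR_nonneg[of x] t that by auto
    fix s r assume "t \<le> s" "s \<le> r" "r \<le> t"
    then show "norm (x - x) \<le> integral {s..r} (\<lambda>r. C0 r * RR x)"
     using IC0_nonneg[of s r] RR_nonneg[of x] t by simp
   qed
   show "\<exists>y N. negligible N \<and> (\<forall>r\<in>{t..t}. norm (x - y r) \<le> e) \<and>
    (\<forall>r. r \<in> {t<..<t} --> r \<notin> N --> ((\<lambda>_. x) has_vector_derivative - b r (y r)) (at r))"
    using e by (intro exI[of _ "\<lambda>_. x"] exI[of _ "{}"]) auto
  qed auto
  then show ?case by auto
 next
  case (Suc k)
  then obtain c where g: "approx t x e (t + real k * h) c" by auto
  have le: "t + real (Suc k) * h \<le> T"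
  proof -
   have "real (Suc k) * h \<le> real (Suc n) * h" using Suc.prems h0 by (intro mult_right_mono) auto
   also have "\<dots> = T - t" by (simp add: h_def)
   finally show ?thesis by simp
  qed
  show ?case
   by (rule approx_step[OF t(1) _ _ le e g small])
    (use t h0 hd le in \<open>auto simp: algebra_simps\<close>)
 qed
 from this[of "Suc n"] have "\<exists>c. approx t x e (t + real (Suc n) * h) c" by simp
 moreover have "t + real (Suc n) * h = T" by (simp add: h_def)
 ultimately show ?thesis by simp
qed

text \<open>The one-sided inequality is applied at the points \<open>y\<close>, \<open>y'\<close>
  where the velocities are taken; their difference deviates from that of the paths by at most E = e
  + e'. Gronwall for the squared distance then leaves an error linear in E.\<close>

lemma approx_close:
 assumes t: "0 \<le> t" "t \<le> T" and e: "0 < e" "e \<le> 1" "0 < e'" "e' \<le> 1"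
  and g: "approx t x e T p" and h: "approx t x e' T \<eta>" and s: "s \<in> {t..T}"
 shows "(norm (p s - \<eta> s))^2 \<le> (e + e') * (exp (8 * integral {0..T} C1) * (8 * integral {0..T} C1 + 4 * RR x * integral {0..T} C0))"
proof -
 have g1: "p t = x" and g2: "dom_increments t T (\<lambda>r. C0 r * RR x) p"
  and g3: "!!r. r \<in> {t..T} ==> norm (p r) + 2 \<le> (2 + norm x) * exp (integral {t..r} C0)"
  using g by (auto simp: approx_def)
 obtain y N where yN: "negligible N" "!!r. r \<in> {t..T} ==> norm (p r - y r) \<le> e"
  "!!r. r \<in> {t<..<T} ==> r \<notin> N ==> (p has_vector_derivative - b r (y r)) (at r)"
  using g unfolding approx_def by blast
 have h1: "\<eta> t = x" and h2: "dom_increments t T (\<lambda>r. C0 r * RR x) \<eta>"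
  and h3: "!!r. r \<in> {t..T} ==> norm (\<eta> r) + 2 \<le> (2 + norm x) * exp (integral {t..r} C0)"
  using h by (auto simp: approx_def)
 obtain y' N' where yN': "negligible N'" "!!r. r \<in> {t..T} ==> norm (\<eta> r - y' r) \<le> e'"
  "!!r. r \<in> {t<..<T} ==> r \<notin> N' ==> (\<eta> has_vector_derivative - b r (y' r)) (at r)"
  using h unfolding approx_def by blast
 have speed: "norm (b r q) \<le> C0 r * RR x"
  if "norm (G r - q) \<le> c" "c \<le> 1" "norm (G r) + 2 \<le> (2 + norm x) * exp (integral {t..r} C0)" "r \<in> {t..T}" for G :: "real => 'a" and q r c
 proof -
  have "norm q \<le> norm (G r) + 1" using that(1,2) norm_triangle_ineq3[of "G r" q] by linarith
  then have "1 + norm q \<le> RR x" using that(3,4) exp_C0_le[of t r x] t by auto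
  moreover have "norm (b r q) \<le> C0 r * (1 + norm q)" "0 \<le> C0 r" using growth C0nn that(4) t by auto
  ultimately show ?thesis by (meson mult_left_mono order_trans)
 qed
 have nby: "norm (b r (y r)) \<le> C0 r * RR x" if "r \<in> {t..T}" for r by (rule speed[where G=p, OF yN(2)[OF that] e(2) g3[OF that] that])
 have nby': "norm (b r (y' r)) \<le> C0 r * RR x" if "r \<in> {t..T}" for r by (rule speed[where G=\<eta>, OF yN'(2)[OF that] e(4) h3[OF that] that])
 have ts: "t \<le> s" using s by simp
 have d: "dom_increments t s (\<lambda>r. C0 r * RR x + C0 r * RR x) (\<lambda>t. p t - \<eta> t)"
  by (rule dom_increments_subinterval[OF dom_increments_diff[OF g2 h2]]) (use s in auto)
 define w where "w = (\<lambda>t. (p t - \<eta> t) \<bullet> (p t - \<eta> t))"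
 obtain k where k: "dom_increments t s k w"
  unfolding w_def by (rule dom_increments_bilinear[OF d d bounded_bilinear_inner])
 have cA: "(\<lambda>q. 4 * C1 q) absolutely_integrable_on {t..s}"
  using nonnegative_absolutely_integrable_1[OF C1Is, of t s] C1nn s t by (intro set_integrable_mult_right) auto
 define E where "E = e + e'"
 have E: "0 < E" "E \<le> 2" using e by (auto simp: E_def)
 have I: "C0 integrable_on {t..s}" "C1 integrable_on {t..s}" using C0Is C1Is s t by auto
 have "w s * exp (- integral {t..s} (\<lambda>q. 4 * C1 q)) \<le> w t + exp (4 * integral {0..T} C1) * integral {t..s} (\<lambda>q. E * (8 * C1 q + 4 * RR x * C0 q))"
 proof (rule gronwall_increments[OF ts k cA, of _ "N \<union> N'"])
  fix q d assume q: "q \<in> {t<..<s}" "q \<notin> N \<union> N'" "(w has_vector_derivative d) (at q)"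
  have qT: "q \<in> {0..T}" "q \<in> {t..T}" using q s t by auto
  have v: "(p has_vector_derivative - b q (y q)) (at q)" using yN(3)[of q] q s by auto
  have u: "(\<eta> has_vector_derivative - b q (y' q)) (at q)" using yN'(3)[of q] q s by auto
  have vu: "((\<lambda>t. p t - \<eta> t) has_vector_derivative (- b q (y q)) - (- b q (y' q))) (at q)"
   by (rule has_vector_derivative_diff[OF v u])
  let ?a = "p q - \<eta> q" let ?a' = "y q - y' q" let ?\<beta> = "b q (y q) - b q (y' q)"
  have "(w has_vector_derivative (?a \<bullet> ((- b q (y q)) - (- b q (y' q))) + ((- b q (y q)) - (- b q (y' q))) \<bullet> ?a)) (at q)"
   unfolding w_def by (rule bounded_bilinear.has_vector_derivative[OF bounded_bilinear_inner vu vu])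
  then have "d = ?a \<bullet> ((- b q (y q)) - (- b q (y' q))) + ((- b q (y q)) - (- b q (y' q))) \<bullet> ?a"
   using q(3) vector_derivative_unique_at by blast
  then have deq: "d = - 2 * (?\<beta> \<bullet> ?a)" by (simp add: inner_commute inner_diff_left inner_diff_right algebra_simps)
  have flux: "norm (?a' - ?a) \<le> E"
  proof -
   have "?a' - ?a = (\<eta> q - y' q) - (p q - y q)" by simp
   then have "norm (?a' - ?a) \<le> norm (\<eta> q - y' q) + norm (p q - y q)" by (metis norm_triangle_ineq4)
   then show ?thesis using yN(2)[OF qT(2)] yN'(2)[OF qT(2)] by (simp add: E_def)
  qed
  have c1: "0 \<le> C1 q" using C1nn qT by auto
  have "- (?\<beta> \<bullet> ?a') \<le> C1 q * (norm ?a')^2" using one_sided[OF qT(1), of "y q" "y' q"] by simp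
  \<comment> \<open>Squaring |a| + E costs a factor 2, whence 4 C1 rather than 2 C1 in Gronwall; E
    <= 2 makes the remaining E^2 linear.\<close>
  also have "\<dots> \<le> C1 q * (2 * w q + 4 * E)"
  proof (rule mult_left_mono[OF _ c1])
   have "norm ?a' \<le> norm ?a + E" using norm_triangle_sub[of ?a' ?a] flux by linarith
   then have "(norm ?a')^2 \<le> (norm ?a + E)^2" by (intro power_mono) auto
   also have "\<dots> \<le> 2 * (norm ?a)^2 + 2 * E\<^sup>2" using sum_squares_bound[of "norm ?a" E] by (simp add: power2_sum)
   also have "2 * E\<^sup>2 \<le> 4 * E" using E by (simp add: power2_eq_square)
   finally show "(norm ?a')^2 \<le> 2 * w q + 4 * E" by (simp add: w_def power2_norm_eq_inner)
  qed
  finally have 1: "- (?\<beta> \<bullet> ?a') \<le> C1 q * (2 * w q + 4 * E)" .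
  have 2: "?\<beta> \<bullet> (?a' - ?a) \<le> 2 * (C0 q * RR x) * E"
  proof -
   have "?\<beta> \<bullet> (?a' - ?a) \<le> norm ?\<beta> * norm (?a' - ?a)" by (rule norm_cauchy_schwarz)
   also have "\<dots> \<le> 2 * (C0 q * RR x) * E"
   proof (rule mult_mono[OF _ flux])
    show "norm ?\<beta> \<le> 2 * (C0 q * RR x)"
     using norm_triangle_ineq4[of "b q (y q)" "b q (y' q)"] nby[OF qT(2)] nby'[OF qT(2)] by linarith
    show "0 \<le> 2 * (C0 q * RR x)" using C0nn[OF qT(1)] RR_nonneg by simp
   qed auto
   finally show ?thesis .
  qed
  have "?\<beta> \<bullet> ?a = ?\<beta> \<bullet> ?a' - ?\<beta> \<bullet> (?a' - ?a)" by (simp add: inner_diff_right)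
  then have "d \<le> 2 * (C1 q * (2 * w q + 4 * E)) + 2 * (2 * (C0 q * RR x) * E)" using deq 1 2 by linarith
  then show "d \<le> 4 * C1 q * w q + E * (8 * C1 q + 4 * RR x * C0 q)" by (simp add: algebra_simps)
 next
  have "integral {t..s} (\<lambda>t. \<bar>4 * C1 t\<bar>) = integral {t..s} (\<lambda>q. 4 * C1 q)"
   by (rule integral_cong) (use C1nn s t in auto)
  then show "integral {t..s} (\<lambda>t. \<bar>4 * C1 t\<bar>) \<le> 4 * integral {0..T} C1"
   using IC1_le[of 0 t s T] s t by simp
  show "(\<lambda>q. E * (8 * C1 q + 4 * RR x * C0 q)) integrable_on {t..s}"
   using I by (intro integrable_on_mult_right integrable_add)
  show "0 \<le> E * (8 * C1 q + 4 * RR x * C0 q)" if "q \<in> {t..s}" for q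
   using E C1nn[of q] C0nn[of q] RR_nonneg[of x] that s t by auto
 qed (use yN yN' in auto)
 also have "w t = 0" by (simp add: w_def g1 h1)
 also have "integral {t..s} (\<lambda>q. E * (8 * C1 q + 4 * RR x * C0 q)) = E * (8 * integral {t..s} C1 + 4 * RR x * integral {t..s} C0)"
  by (rule integral_unique) (intro has_integral_mult_right has_integral_add integrable_integral I)
 also have "\<dots> \<le> E * (8 * integral {0..T} C1 + 4 * RR x * integral {0..T} C0)"
  using IC1_le[of 0 t s T] IC0_le[of 0 t s T] s t E RR_nonneg[of x] by (intro mult_left_mono add_mono) auto
 finally have *: "w s * exp (- (4 * integral {t..s} C1)) \<le> exp (4 * integral {0..T} C1) * (E * (8 * integral {0..T} C1 + 4 * RR x * integral {0..T} C0))"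
  by simp
 let ?X = "E * (8 * integral {0..T} C1 + 4 * RR x * integral {0..T} C0)"
 have X0: "0 \<le> ?X" using E IC0_nonneg[of 0 T] IC1_nonneg[of 0 T] RR_nonneg[of x] by auto
 have "w s = w s * exp (- (4 * integral {t..s} C1)) * exp (4 * integral {t..s} C1)"
  by (simp add: mult.assoc exp_add[symmetric])
 also have "\<dots> \<le> (exp (4 * integral {0..T} C1) * ?X) * exp (4 * integral {t..s} C1)"
  using * by (rule mult_right_mono) simp
 also have "\<dots> \<le> (exp (4 * integral {0..T} C1) * ?X) * exp (4 * integral {0..T} C1)"
  using IC1_le[of 0 t s T] s t X0 by (intro mult_left_mono) auto
 also have "\<dots> = ?X * exp (8 * integral {0..T} C1)"
 proof -
  have "exp (4 * integral {0..T} C1) * exp (4 * integral {0..T} C1) = exp (8 * integral {0..T} C1)"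
   by (simp add: exp_add[symmetric])
  then show ?thesis by (simp add: mult.assoc mult.left_commute)
 qed
 finally show ?thesis by (simp add: w_def power2_norm_eq_inner E_def mult_ac)
qed

end

section \<open>The limit of Euler paths is a flow line\<close>

context compressive
begin

text \<open>The rate in the evolution variational inequality: half the squared distance from a flow
  line to z grows at most at this rate. Only the value of b at the fixed point z occurs.\<close>

definition evi_rhs :: "(real => 'a) => 'a => real => real" where
 "evi_rhs c z r = b r z \<bullet> (z - c r) + C1 r * (norm (z - c r))^2"

lemma integrable_bounded_mult:
 fixes c g :: "real => real"
 assumes c: "c integrable_on {s..t}" "!!r. r \<in> {s..t} ==> 0 \<le> c r" and g: "continuous_on {s..t} g"
 shows "(\<lambda>r. c r * g r) integrable_on {s..t}"
proof -
 have "bounded (g ` {s..t})" by (intro compact_imp_bounded compact_continuous_image g) auto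
 then obtain B where B: "!!r. r \<in> {s..t} ==> \<bar>g r\<bar> \<le> B" by (metis bounded_iff imageI real_norm_def)
 show ?thesis
 proof (rule measurable_bounded_by_integrable_imp_integrable_real[where g="\<lambda>r. c r * B"])
  show "(\<lambda>r. c r * g r) \<in> borel_measurable (lebesgue_on {s..t})"
   by (intro borel_measurable_times integrable_imp_measurable c continuous_imp_measurable_on_sets_lebesgue g) auto
  show "(\<lambda>r. c r * B) integrable_on {s..t}" by (rule integrable_on_mult_left[OF c(1)])
  show "\<bar>c r * g r\<bar> \<le> c r * B" if "r \<in> {s..t}" for r
   using c(2)[OF that] B[OF that] by (simp add: abs_mult mult_left_mono)
 qed auto
qed

lemma evi_rhs_integrable:
 assumes z: "z \<in> D" and g: "continuous_on {s..t} c" and t: "0 \<le> s" "t \<le> T"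
 shows "evi_rhs c z integrable_on {s..t}"
proof -
 have bI: "(\<lambda>r. b r z) absolutely_integrable_on {s..t}" by (rule b_point_integrable[OF z t])
 have "bounded ((\<lambda>r. z - c r) ` {s..t})" by (intro compact_imp_bounded compact_continuous_image continuous_intros g) auto
 then obtain B where B: "!!r. r \<in> {s..t} ==> norm (z - c r) \<le> B" by (metis bounded_iff imageI)
 have "(\<lambda>r. b r z \<bullet> (z - c r)) integrable_on {s..t}"
 proof (rule measurable_bounded_by_integrable_imp_integrable_real[where g="\<lambda>r. norm (b r z) * B"])
  have "(\<lambda>r. b r z) \<in> borel_measurable (lebesgue_on {s..t})"
   using bI by (intro integrable_imp_measurable) (simp add: absolutely_integrable_on_def)
  moreover have "(\<lambda>r. z - c r) \<in> borel_measurable (lebesgue_on {s..t})"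
   by (intro continuous_imp_measurable_on_sets_lebesgue continuous_intros g) auto
  ultimately show "(\<lambda>r. b r z \<bullet> (z - c r)) \<in> borel_measurable (lebesgue_on {s..t})" by (rule borel_measurable_inner)
  show "(\<lambda>r. norm (b r z) * B) integrable_on {s..t}"
   using bI by (intro integrable_on_mult_left) (simp add: absolutely_integrable_on_def)
  show "\<bar>b r z \<bullet> (z - c r)\<bar> \<le> norm (b r z) * B" if "r \<in> {s..t}" for r
   using Cauchy_Schwarz_ineq2[of "b r z" "z - c r"] mult_left_mono[OF B[OF that], of "norm (b r z)"] by simp
 qed auto
 moreover have "(\<lambda>r. C1 r * (norm (z - c r))^2) integrable_on {s..t}"
  by (rule integrable_bounded_mult) (use C1Is C1nn t in \<open>auto intro!: continuous_intros g\<close>)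
 ultimately show ?thesis unfolding evi_rhs_def by (rule integrable_add)
qed

text \<open>Euler paths form a Cauchy sequence, but for discontinuous b their velocities cannot be
  followed to the limit. What does pass to the limit is the integrated variational inequality at
  each z in \<open>D\<close>. Its derivative at almost every time, together with Minty's argument,
  puts the velocity of the limit path into minus \<open>b_hat\<close>.\<close>

lemma flow_line_exists:
 assumes t: "0 \<le> t" "t \<le> T"
 shows "\<exists>c. flow_line b T t x c"
proof -
 define e where "e = (\<lambda>n. inverse (real (Suc n)))"
 have e: "0 < e n" "e n \<le> 1" for n by (auto simp: e_def field_simps)
 have e0: "e \<longlonglongrightarrow> 0" unfolding e_def by (rule LIMSEQ_inverse_real_of_nat)
 obtain G where G: "!!n. approx t x (e n) T (G n)" using approx_exists[OF t e] by metis
 define K where "K = exp (8 * integral {0..T} C1) * (8 * integral {0..T} C1 + 4 * RR x * integral {0..T} C0)"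
 have K0: "0 \<le> K" unfolding K_def using IC0_nonneg[of 0 T] IC1_nonneg[of 0 T] RR_nonneg[of x] by auto
 have close: "(norm (G n s - G m s))^2 \<le> (e n + e m) * K" if "s \<in> {t..T}" for n m s
  unfolding K_def by (rule approx_close[OF t e e G G that])
 have "Cauchy (\<lambda>n. G n s)" if s: "s \<in> {t..T}" for s
 proof (rule metric_CauchyI)
  fix \<epsilon> :: real assume \<epsilon>: "\<epsilon> > 0"
  have "(\<lambda>n. e n * (2 * K)) \<longlonglongrightarrow> 0 * (2 * K)" by (intro tendsto_intros e0)
  then have "\<forall>\<^sub>F n in sequentially. e n * (2 * K) < \<epsilon>\<^sup>2" using \<epsilon> by (intro order_tendstoD(2)) auto
  then obtain M where M: "!!n. n \<ge> M ==> e n * (2 * K) < \<epsilon>\<^sup>2" by (auto simp: eventually_sequentially)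
  show "\<exists>M. \<forall>m\<ge>M. \<forall>n\<ge>M. dist (G m s) (G n s) < \<epsilon>"
  proof (intro exI[of _ M] allI impI)
   fix m n assume mn: "m \<ge> M" "n \<ge> M"
   have "(norm (G m s - G n s))^2 \<le> (e m + e n) * K" by (rule close[OF s])
   also have "\<dots> < \<epsilon>\<^sup>2" using M[OF mn(1)] M[OF mn(2)] by (simp add: algebra_simps)
   finally show "dist (G m s) (G n s) < \<epsilon>" using \<epsilon> by (simp add: dist_norm power_less_imp_less_base)
  qed
 qed
 then have "\<forall>s. \<exists>l. s \<in> {t..T} --> (\<lambda>n. G n s) \<longlonglongrightarrow> l"
  using Cauchy_convergent_iff by (auto simp: convergent_def)
 then obtain c where c: "!!s. s \<in> {t..T} ==> (\<lambda>n. G n s) \<longlonglongrightarrow> c s" by metis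
 have lim_close: "(norm (G n s - c s))^2 \<le> e n * K" if s: "s \<in> {t..T}" for n s
 proof (rule tendsto_le[OF trivial_limit_sequentially])
  show "(\<lambda>m. (e n + e m) * K) \<longlonglongrightarrow> e n * K"
   using tendsto_mult[OF tendsto_add[OF tendsto_const e0] tendsto_const, of "e n" K] by simp
  show "(\<lambda>m. (norm (G n s - G m s))^2) \<longlonglongrightarrow> (norm (G n s - c s))^2" by (intro tendsto_intros c s)
 qed (use close[OF s] in auto)
 have Gt: "G n t = x" and Gd: "dom_increments t T (\<lambda>r. C0 r * RR x) (G n)"
  and Gb: "!!r. r \<in> {t..T} ==> norm (G n r) + 2 \<le> (2 + norm x) * exp (integral {t..r} C0)" for n
  using G[of n] by (auto simp: approx_def)
 have Gb': "norm (G n r) + 2 \<le> RR x" if "r \<in> {t..T}" for n r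
  using Gb[OF that, of n] exp_C0_le[of t r x] that t by auto
 have "\<exists>y N. negligible N \<and> (\<forall>r\<in>{t..T}. norm (G n r - y r) \<le> e n) \<and>
    (\<forall>r. r \<in> {t<..<T} --> r \<notin> N --> (G n has_vector_derivative - b r (y r)) (at r))" for n
  using G[of n] unfolding approx_def by blast
 then obtain Y NN where Y: "!!n. negligible (NN n)" "!!n r. r \<in> {t..T} ==> norm (G n r - Y n r) \<le> e n"
  "!!n r. r \<in> {t<..<T} ==> r \<notin> NN n ==> (G n has_vector_derivative - b r (Y n r)) (at r)" by metis
 have ct: "c t = x" using c[of t] Gt t LIMSEQ_unique[OF _ tendsto_const] by auto
 have cd: "dom_increments t T (\<lambda>r. C0 r * RR x) c"
  unfolding dom_increments_def
 proof (intro conjI ballI allI impI)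
  show "(\<lambda>r. C0 r * RR x) integrable_on {t..T}" by (rule dom_incrementsD(1)[OF Gd])
  show "0 \<le> C0 r * RR x" if "r \<in> {t..T}" for r using dom_incrementsD(2)[OF Gd] that by auto
  fix r s assume rs: "t \<le> r" "r \<le> s" "s \<le> T"
  show "norm (c s - c r) \<le> integral {r..s} (\<lambda>r. C0 r * RR x)"
  proof (rule tendsto_le[OF trivial_limit_sequentially tendsto_const])
   show "(\<lambda>n. norm (G n s - G n r)) \<longlonglongrightarrow> norm (c s - c r)" by (intro tendsto_intros c) (use rs in auto)
  qed (use dom_incrementsD(3)[OF Gd rs] in auto)
 qed
 have cc: "continuous_on {t..T} c" by (rule dom_increments_continuous[OF cd])
 have cb: "norm (c r) \<le> RR x" if "r \<in> {t..T}" for r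
  by (rule tendsto_le[OF trivial_limit_sequentially tendsto_const tendsto_norm[OF c[OF that]]])
   (use Gb'[OF that] in \<open>auto intro!: always_eventually\<close>, smt (verit) Gb' that)
 \<comment> \<open>Bounds the distance from the freezing point \<open>Y n r\<close> to the limit
   path: e n to the Euler path, and the square root of e n K from there on.\<close>
 define \<eta> where "\<eta> = (\<lambda>n. e n + sqrt (e n * K))"
 have \<eta>0: "\<eta> \<longlonglongrightarrow> 0"
 proof -
  have "(\<lambda>n. e n + sqrt (e n * K)) \<longlonglongrightarrow> 0 + sqrt (0 * K)" by (intro tendsto_intros e0)
  then show ?thesis by (simp add: \<eta>_def)
 qed
 have Yg: "norm (Y n r - c r) \<le> \<eta> n" if r: "r \<in> {t..T}" for n r
 proof -
  have "norm (G n r - c r) \<le> sqrt (e n * K)" by (rule real_le_rsqrt[OF lim_close[OF r]])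
  moreover have "norm (Y n r - c r) \<le> norm (G n r - Y n r) + norm (G n r - c r)"
   by (metis norm_triangle_sub norm_minus_commute add.commute diff_add_cancel norm_triangle_ineq4 norm_diff_triangle_ineq order_refl dist_norm dist_triangle3 dist_commute)
  ultimately show ?thesis using Y(2)[OF r, of n] by (simp add: \<eta>_def)
 qed
 have evi: "(norm (c s - z))^2 / 2 - (norm (c r - z))^2 / 2 \<le> integral {r..s} (evi_rhs c z)"
  if z: "z \<in> D" and rs: "t \<le> r" "r \<le> s" "s \<le> T" for z r s
 proof -
  define B where "B = norm z + RR x"
  \<comment> \<open>The first summand pays for replacing \<open>Y n q\<close> by the limit
    \<open>c q\<close>, the second for replacing \<open>G n q\<close> by \<open>Y n q\<close> in the
    product with the velocity.\<close>
  define err where "err = (\<lambda>n q. \<eta> n * (C0 q * (1 + norm z) + C1 q * (2 * B + \<eta> n)) + e n * (C0 q * RR x))"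
  have \<eta>p: "0 \<le> \<eta> n" for n using e[of n] K0 by (simp add: \<eta>_def less_imp_le)
  have I: "C0 integrable_on {r..s}" "C1 integrable_on {r..s}" using C0Is C1Is rs t by auto
  have qI: "evi_rhs c z integrable_on {r..s}"
   by (rule evi_rhs_integrable[OF z continuous_on_subset[OF cc]]) (use rs t in auto)
  define ei where "ei = (\<lambda>n. \<eta> n * (integral {r..s} C0 * (1 + norm z) + integral {r..s} C1 * (2 * B + \<eta> n)) + e n * (integral {r..s} C0 * RR x))"
  have errI: "(err n has_integral ei n) {r..s}" for n
   unfolding err_def ei_def by (intro has_integral_mult_right has_integral_mult_left has_integral_add integrable_integral I)
  have step: "(norm (G n s - z))^2 / 2 - (norm (G n r - z))^2 / 2 \<le> integral {r..s} (evi_rhs c z) + ei n" for n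
  proof -
   have dG: "dom_increments r s (\<lambda>r. C0 r * RR x) (G n)" by (rule dom_increments_subinterval[OF Gd]) (use rs in auto)
   have dz: "dom_increments r s (\<lambda>_. 0) (\<lambda>_. z)"
    by (auto simp: dom_increments_def intro: has_integral_integrable[OF has_integral_0])
   note dGz = dom_increments_diff[OF dG dz]
   obtain k where k: "dom_increments r s k (\<lambda>q. ((1/2) *\<^sub>R (G n q - z)) \<bullet> (G n q - z))"
   proof -
    have bb: "bounded_bilinear (\<lambda>x y :: 'a. ((1/2::real) *\<^sub>R x) \<bullet> y)"
     by (rule bounded_bilinear.comp1[OF bounded_bilinear_inner bounded_linear_scaleR_right])
    show thesis by (rule dom_increments_bilinear[OF dGz dGz bb]) (rule that)
   qed
   have "((1/2) *\<^sub>R (G n s - z)) \<bullet> (G n s - z) - ((1/2) *\<^sub>R (G n r - z)) \<bullet> (G n r - z) \<le> integral {r..s} (\<lambda>q. evi_rhs c z q + err n q)"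
   proof (rule increments_le_integral[OF rs(2) k _ Y(1)[of n]])
    show "(\<lambda>q. evi_rhs c z q + err n q) integrable_on {r..s}"
     by (intro integrable_add qI has_integral_integrable[OF errI])
    fix q d assume q: "q \<in> {r<..<s}" "q \<notin> NN n" and d: "((\<lambda>q. ((1/2) *\<^sub>R (G n q - z)) \<bullet> (G n q - z)) has_vector_derivative d) (at q)"
    have qT: "q \<in> {t..T}" "q \<in> {0..T}" using q rs t by auto
    have dv: "((\<lambda>q. G n q - z) has_vector_derivative - b q (Y n q) - 0) (at q)"
     by (intro has_vector_derivative_diff has_vector_derivative_const Y(3)) (use q rs in auto)
    have dv2: "((\<lambda>q. (1/2) *\<^sub>R (G n q - z)) has_vector_derivative (1/2) *\<^sub>R (- b q (Y n q) - 0)) (at q)"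
     by (rule bounded_linear.has_vector_derivative[OF bounded_linear_scaleR_right dv])
    have "((\<lambda>q. ((1/2) *\<^sub>R (G n q - z)) \<bullet> (G n q - z)) has_vector_derivative
     (((1/2) *\<^sub>R (G n q - z)) \<bullet> (- b q (Y n q) - 0) + ((1/2) *\<^sub>R (- b q (Y n q) - 0)) \<bullet> (G n q - z))) (at q)"
     by (rule bounded_bilinear.has_vector_derivative[OF bounded_bilinear_inner dv2 dv])
    then have "d = ((1/2) *\<^sub>R (G n q - z)) \<bullet> (- b q (Y n q) - 0) + ((1/2) *\<^sub>R (- b q (Y n q) - 0)) \<bullet> (G n q - z)"
     using d vector_derivative_unique_at by blast
    also have "\<dots> = - (b q (Y n q) \<bullet> (G n q - z))" by (simp add: inner_commute)
    also have "\<dots> = - (b q (Y n q) \<bullet> (Y n q - z)) - b q (Y n q) \<bullet> (G n q - Y n q)"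
     by (simp add: inner_diff_right)
    finally have deq: "d = - (b q (Y n q) \<bullet> (Y n q - z)) - b q (Y n q) \<bullet> (G n q - Y n q)" .
    have c0: "0 \<le> C0 q" "0 \<le> C1 q" using C0nn C1nn qT by auto
    have 1: "- (b q (Y n q) \<bullet> (G n q - Y n q)) \<le> e n * (C0 q * RR x)"
    proof -
     have "norm (Y n q) \<le> norm (G n q) + 1" using Y(2)[OF qT(1), of n] e(2)[of n] norm_triangle_ineq3[of "G n q" "Y n q"] by linarith
     then have "1 + norm (Y n q) \<le> RR x" using Gb'[OF qT(1), of n] by auto
     then have "C0 q * (1 + norm (Y n q)) \<le> C0 q * RR x" using c0 by (intro mult_left_mono)
     then have "norm (b q (Y n q)) \<le> C0 q * RR x" using growth[OF qT(2), of "Y n q"] by linarith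
     moreover have "- (b q (Y n q) \<bullet> (G n q - Y n q)) \<le> norm (b q (Y n q)) * norm (G n q - Y n q)"
      using Cauchy_Schwarz_ineq2[of "b q (Y n q)" "G n q - Y n q"] by linarith
     moreover have "norm (b q (Y n q)) * norm (G n q - Y n q) \<le> (C0 q * RR x) * e n"
      by (rule mult_mono) (use calculation(1) Y(2)[OF qT(1), of n] c0 RR_nonneg[of x] in auto)
     ultimately show ?thesis by (simp add: mult.commute)
    qed
    have "(b q (Y n q) - b q z) \<bullet> (Y n q - z) \<ge> - C1 q * (norm (Y n q - z))^2" by (rule one_sided[OF qT(2)])
    then have 2: "- (b q (Y n q) \<bullet> (Y n q - z)) \<le> b q z \<bullet> (z - Y n q) + C1 q * (norm (Y n q - z))^2"
     by (simp add: inner_diff_left inner_diff_right)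
    have 3: "b q z \<bullet> (z - Y n q) \<le> b q z \<bullet> (z - c q) + \<eta> n * (C0 q * (1 + norm z))"
    proof -
     have "b q z \<bullet> (z - Y n q) - b q z \<bullet> (z - c q) = - (b q z \<bullet> (Y n q - c q))" by (simp add: inner_diff_right)
     also have "\<dots> \<le> norm (b q z) * norm (Y n q - c q)" using Cauchy_Schwarz_ineq2[of "b q z" "Y n q - c q"] by linarith
     also have "\<dots> \<le> (C0 q * (1 + norm z)) * \<eta> n" by (rule mult_mono) (use growth[OF qT(2)] Yg[OF qT(1)] c0 in auto)
     finally show ?thesis by (simp add: mult.commute)
    qed
    have 4: "C1 q * (norm (Y n q - z))^2 \<le> C1 q * (norm (z - c q))^2 + \<eta> n * (C1 q * (2 * B + \<eta> n))"
    proof -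
     have "norm (Y n q - z) \<le> norm (Y n q - c q) + norm (c q - z)"
      using norm_triangle_ineq[of "Y n q - c q" "c q - z"] by simp
     then have "norm (Y n q - z) \<le> \<eta> n + norm (z - c q)"
      using Yg[OF qT(1), of n] by (simp add: norm_minus_commute)
     then have "(norm (Y n q - z))^2 \<le> (\<eta> n + norm (z - c q))^2" by (intro power_mono) auto
     also have "\<dots> = (norm (z - c q))^2 + \<eta> n * (2 * norm (z - c q) + \<eta> n)" by (simp add: power2_eq_square algebra_simps)
     also have "\<dots> \<le> (norm (z - c q))^2 + \<eta> n * (2 * B + \<eta> n)"
      using cb[OF qT(1)] norm_triangle_ineq4[of z "c q"] \<eta>p[of n]
      by (intro add_left_mono mult_left_mono add_right_mono) (auto simp: B_def)
     finally have "C1 q * (norm (Y n q - z))^2 \<le> C1 q * ((norm (z - c q))^2 + \<eta> n * (2 * B + \<eta> n))"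
      using c0 by (intro mult_left_mono)
     then show ?thesis by (simp add: algebra_simps)
    qed
    show "d \<le> evi_rhs c z q + err n q"
     using deq 1 2 3 4 by (simp add: evi_rhs_def err_def distrib_left)
   qed
   also have "integral {r..s} (\<lambda>q. evi_rhs c z q + err n q) = integral {r..s} (evi_rhs c z) + ei n"
    by (rule integral_unique) (intro has_integral_add integrable_integral qI errI)
   finally show ?thesis by (simp add: power2_norm_eq_inner)
  qed
  show ?thesis
  proof (rule tendsto_le[OF trivial_limit_sequentially])
   have "ei \<longlonglongrightarrow> 0 * (integral {r..s} C0 * (1 + norm z) + integral {r..s} C1 * (2 * B + 0)) + 0 * (integral {r..s} C0 * RR x)"
    unfolding ei_def by (intro tendsto_intros \<eta>0 e0)
   then have "ei \<longlonglongrightarrow> 0" by simp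
   then show "(\<lambda>n. integral {r..s} (evi_rhs c z) + ei n) \<longlonglongrightarrow> integral {r..s} (evi_rhs c z)"
    using tendsto_add[OF tendsto_const, of ei 0] by simp
   show "(\<lambda>n. (norm (G n s - z))^2 / 2 - (norm (G n r - z))^2 / 2) \<longlonglongrightarrow> (norm (c s - z))^2 / 2 - (norm (c r - z))^2 / 2"
    by (intro tendsto_intros c) (use rs in auto)
  qed (use step in auto)
 qed
 obtain p N0 where p: "negligible N0" "!!r. r \<in> {t<..<T} ==> r \<notin> N0 ==> (c has_vector_derivative p r) (at r)"
  using dom_increments_FTC_ex[OF cd] by blast
 have "\<forall>z\<in>D. \<exists>N. negligible N \<and> (\<forall>r. r \<in> {t<..<T} --> r \<notin> N -->
  ((\<lambda>u. integral {t..u} (evi_rhs c z)) has_vector_derivative evi_rhs c z r) (at r))"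
  using Lebesgue_point_ex[OF evi_rhs_integrable[OF _ cc]] t by (metis order_refl)
 then obtain NZ where NZ: "!!z. z \<in> D ==> negligible (NZ z)"
  "!!z r. z \<in> D ==> r \<in> {t<..<T} ==> r \<notin> NZ z ==>
  ((\<lambda>u. integral {t..u} (evi_rhs c z)) has_vector_derivative evi_rhs c z r) (at r)" by metis
 define NN' where "NN' = N0 \<union> (\<Union>z\<in>D. NZ z) \<union> {t, T}"
 have neg: "negligible NN'"
 proof -
  have "negligible (\<Union>(NZ ` D))" by (rule negligible_countable_Union) (use D(1) NZ(1) in auto)
  then show ?thesis using p(1) by (auto simp: NN'_def)
 qed
 have main: "\<exists>v. (c has_vector_derivative v) (at r within {t..T}) \<and> - v \<in> b_hat b r (c r)" if r: "r \<in> {t..T}" "r \<notin> NN'" for r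
 proof (intro exI[of _ "p r"] conjI)
  have r': "r \<in> {t<..<T}" "r \<notin> N0" using r by (auto simp: NN'_def)
  have rT: "r \<in> {0..T}" using r t by auto
  show dr: "(c has_vector_derivative p r) (at r within {t..T})"
   using p(2)[OF r'] by (rule has_vector_derivative_at_within)
  show "- p r \<in> b_hat b r (c r)"
   unfolding b_hat_eq
  proof (rule in_convex_hull_limit_set[OF growth[OF rT] C0nn[OF rT] D(2)])
   fix z assume z: "z \<in> D"
   \<comment> \<open>\<open>evi\<close> makes F nondecreasing; the sign of its derivative at r is
     the pointwise inequality that Minty's argument asks for.\<close>
   define F where "F = (\<lambda>u. integral {t..u} (evi_rhs c z) - (norm (c u - z))^2 / 2)"
   have "mono_on {t..T} F"
   proof (rule mono_onI)
    fix u v assume uv: "u \<in> {t..T}" "v \<in> {t..T}" "u \<le> v"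
    have "evi_rhs c z integrable_on {t..v}"
     by (rule evi_rhs_integrable[OF z continuous_on_subset[OF cc]]) (use uv t in auto)
    then have "integral {t..u} (evi_rhs c z) + integral {u..v} (evi_rhs c z) = integral {t..v} (evi_rhs c z)"
     by (intro Henstock_Kurzweil_Integration.integral_combine) (use uv in auto)
    then show "F u \<le> F v" using evi[OF z, of u v] uv by (simp add: F_def)
   qed
   moreover have "(F has_real_derivative evi_rhs c z r - p r \<bullet> (c r - z)) (at r)"
   proof -
    have d1: "((\<lambda>u. integral {t..u} (evi_rhs c z)) has_real_derivative evi_rhs c z r) (at r)"
     unfolding has_real_derivative_iff_has_vector_derivative using NZ(2)[OF z r'(1)] r z by (auto simp: NN'_def)
    have dv: "((\<lambda>q. c q - z) has_vector_derivative p r - 0) (at r)"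
     by (intro has_vector_derivative_diff has_vector_derivative_const p(2) r')
    have "((\<lambda>q. (c q - z) \<bullet> (c q - z)) has_vector_derivative ((c r - z) \<bullet> (p r - 0) + (p r - 0) \<bullet> (c r - z))) (at r)"
     by (rule bounded_bilinear.has_vector_derivative[OF bounded_bilinear_inner dv dv])
    then have "((\<lambda>q. (c q - z) \<bullet> (c q - z)) has_real_derivative 2 * (p r \<bullet> (c r - z))) (at r)"
     unfolding has_real_derivative_iff_has_vector_derivative by (simp add: inner_commute)
    from DERIV_diff[OF d1 DERIV_cdivide[OF this, of 2]] show ?thesis
     by (simp add: F_def power2_norm_eq_inner)
   qed
   moreover have "r \<in> interior {t..T}" using r'(1) by simp
   ultimately have "0 \<le> evi_rhs c z r - p r \<bullet> (c r - z)" by (rule mono_on_imp_deriv_nonneg)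
   then show "(b r z - - p r) \<bullet> (z - c r) \<ge> - C1 r * (norm (z - c r))^2"
    by (simp add: evi_rhs_def inner_add_left inner_diff_right inner_diff_left algebra_simps)
  qed
 qed
 have "AE r in lebesgue_on {t..T}. \<exists>v. (c has_vector_derivative v) (at r within {t..T}) \<and> - v \<in> b_hat b r (c r)"
  by (rule AE_lebesgue_on_Icc_negligibleI[OF neg]) (rule main)
 then have "flow_line b T t x c"
  unfolding flow_line_def using abs_continuous_of_dom_increments[OF cd] ct by blast
 then show ?thesis by blast
qed

end

section \<open>Derivative of the flow\<close>

lemma LIMSEQ_of_subsequences:
 fixes Q :: "nat => 'a::euclidean_space"
 assumes b: "bounded (range Q)" and s: "!!r l. strict_mono (r :: nat => nat) ==> (\<lambda>n. Q (r n)) \<longlonglongrightarrow> l ==> l = p"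
 shows "Q \<longlonglongrightarrow> p"
proof (rule ccontr)
 assume "\<not> Q \<longlonglongrightarrow> p"
 then obtain e where e: "e > 0" and "\<not> (\<forall>\<^sub>F n in sequentially. dist (Q n) p < e)"
  by (auto simp: tendsto_iff)
 then have "\<exists>\<^sub>F n in sequentially. \<not> dist (Q n) p < e" by (simp add: not_eventually)
 then have "infinite {n. \<not> dist (Q n) p < e}" by (simp add: frequently_cofinite cofinite_eq_sequentially[symmetric])
 then obtain r :: "nat => nat" where r: "strict_mono r" "!!n. \<not> dist (Q (r n)) p < e"
  using infinite_enumerate by blast
 have "bounded (range (\<lambda>n. Q (r n)))" using b by (rule bounded_subset) auto
 then obtain l r' where r': "strict_mono (r' :: nat => nat)" "((\<lambda>n. Q (r n)) \<circ> r') \<longlonglongrightarrow> l"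
  using bounded_imp_convergent_subsequence by blast
 have "(\<lambda>n. Q ((r \<circ> r') n)) \<longlonglongrightarrow> l" using r'(2) by (simp add: o_def)
 moreover have "l = p" by (rule s[OF strict_mono_o[OF r(1) r'(1)] \<open>(\<lambda>n. Q ((r \<circ> r') n)) \<longlonglongrightarrow> l\<close>])
 ultimately have "(\<lambda>n. Q (r (r' n))) \<longlonglongrightarrow> p" by simp
 from tendstoD[OF this e] r(2) show False by simp
qed

text \<open>Averages to the right of t, because the flow is followed forward.\<close>

definition Lpoint :: "(real => 'b::euclidean_space) => real => bool" where
 "Lpoint f t \<longleftrightarrow> ((\<lambda>h. integral {t..t + h} f /\<^sub>R h) \<longlongrightarrow> f t) (at_right 0)"

lemma Lpoint_seq:
 assumes "Lpoint f t" "h \<longlonglongrightarrow> 0" "!!n. h n > 0"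
 shows "(\<lambda>n. integral {t..t + h n} f /\<^sub>R h n) \<longlonglongrightarrow> f t"
proof -
 have "h n \<noteq> 0" for n using assms(3)[of n] by simp
 then have "filterlim h (at_right 0) sequentially"
  using assms(2,3) by (auto simp: filterlim_at)
 from filterlim_compose[OF assms(1)[unfolded Lpoint_def] this] show ?thesis .
qed

context compressive
begin

lemma flow_line_restrict:
 assumes fl: "flow_line b T t x c" and t: "0 \<le> t" "t \<le> r" "r \<le> T"
 shows "flow_line b T r (c r) c"
proof -
 obtain N where N: "negligible N" "!!s. s \<in> {t..T} ==> s \<notin> N ==>
   \<exists>v. (c has_vector_derivative v) (at s within {t..T}) \<and> - v \<in> b_hat b s (c s)"
  using flow_line_increments_ex[OF fl] t by auto
 have sub: "{r..T} \<subseteq> {t..T}" using t by auto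
 have "AE s in lebesgue_on {r..T}. \<exists>v. (c has_vector_derivative v) (at s within {r..T}) \<and> - v \<in> b_hat b s (c s)"
 proof (rule AE_lebesgue_on_Icc_negligibleI[OF N(1)])
  fix s assume s: "s \<in> {r..T}" "s \<notin> N"
  then obtain v where "(c has_vector_derivative v) (at s within {t..T})" "- v \<in> b_hat b s (c s)"
   using N(2)[of s] sub by auto
  then show "\<exists>v. (c has_vector_derivative v) (at s within {r..T}) \<and> - v \<in> b_hat b s (c s)"
   using has_vector_derivative_within_subset[OF _ sub] by blast
 qed
 moreover have "abs_continuous_on {r..T} c"
  using fl abs_continuous_on_subset[OF _ sub] unfolding flow_line_def by blast
 ultimately show ?thesis by (simp add: flow_line_def)
qed

lemma flow_eq:
 assumes fl: "flow_line b T t x c" and t: "0 \<le> t" "t \<le> s" "s \<le> T"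
 shows "flow b T t s x = c s"
 unfolding flow_def
proof (rule the_equality)
 show "\<exists>c'. flow_line b T t x c' \<and> c' s = c s" using fl by blast
 show "!!y. \<exists>c. flow_line b T t x c \<and> c s = y ==> y = c s"
  using flow_line_unique[OF _ fl t] by blast
qed

lemma flow_self: "0 \<le> t ==> t \<le> T ==> flow b T t t x = x"
 using flow_line_exists[of t x] flow_eq[of t x _ t] by (auto simp: flow_line_def)

lemma flow_Lipschitz:
 assumes t: "0 \<le> t" "t \<le> s" "s \<le> T"
 shows "norm (flow b T t s x - flow b T t s y) \<le> lam * norm (x - y)"
proof -
 obtain c \<eta> where *: "flow_line b T t x c" "flow_line b T t y \<eta>" using flow_line_exists t by (meson order_trans)
 show ?thesis using flow_line_contraction[OF * t] flow_eq[OF *(1) t] flow_eq[OF *(2) t] by simp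
qed

lemma flow_continuous:
 assumes t: "0 \<le> t" "t \<le> s" "s \<le> T"
 shows "continuous_on UNIV (flow b T t s)"
proof (rule lipschitz_on_continuous_on[of lam])
 show "lam-lipschitz_on UNIV (flow b T t s)"
  using flow_Lipschitz[OF t] lam_pos by (auto intro!: lipschitz_onI simp: dist_norm)
qed

lemma flow_semigroup:
 assumes t: "0 \<le> t" "t \<le> r" "r \<le> s" "s \<le> T"
 shows "flow b T r s (flow b T t r x) = flow b T t s x"
proof -
 obtain c where g: "flow_line b T t x c" using flow_line_exists[of t x] t by auto
 have r: "flow b T t r x = c r" by (rule flow_eq[OF g]) (use t in auto)
 have s: "flow b T t s x = c s" by (rule flow_eq[OF g]) (use t in auto)
 have "flow_line b T r (c r) c" by (rule flow_line_restrict[OF g]) (use t in auto)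
 then have "flow b T r s (c r) = c s" by (rule flow_eq) (use t in auto)
 then show ?thesis by (simp add: r s)
qed

lemma flow_rad:
 assumes t: "0 \<le> t" "r \<in> {t..T}" "s \<in> {t..T}" and n: "norm (flow b T t r x) \<le> R"
 shows "norm (flow b T t s x) \<le> rad R"
proof -
 obtain c where g: "flow_line b T t x c" using flow_line_exists[of t x] t by auto
 have "flow b T t q x = c q" if "q \<in> {t..T}" for q by (rule flow_eq[OF g]) (use t that in auto)
 then show ?thesis using flow_line_rad[OF g t] n t by simp
qed

lemma flow_speed:
 assumes t: "0 \<le> t" "t \<le> r" "r \<le> s" "s \<le> T" and n: "norm (flow b T t q x) \<le> R" "q \<in> {t..T}"
 shows "norm (flow b T t s x - flow b T t r x) \<le> (1 + rad R) * integral {r..s} C0"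
proof -
 obtain c where g: "flow_line b T t x c" using flow_line_exists[of t x] t by auto
 have e: "flow b T t q x = c q" if "q \<in> {t..T}" for q by (rule flow_eq[OF g]) (use t that in auto)
 show ?thesis using flow_line_speed[OF g t, of q R] n e[of q] e[of r] e[of s] t by simp
qed

lemma flow_displacement:
 assumes t: "0 \<le> t" "t \<le> s" "s \<le> T" and n: "norm x \<le> R"
 shows "norm (flow b T t s x - x) \<le> (1 + rad R) * integral {t..s} C0"
 using flow_speed[of t t s t x R] flow_self[of t x] t n by simp

text \<open>The variational inequality over [t,s] with the moving point replaced by the starting
  point y, from which it departs by at most \<delta>. The last term collects speed times
  displacement, 1 + norm z from b(r,z) and 1 + rad R from the path. After division by s - t every
  term has a limit at Lebesgue points.\<close>

lemma evi_increment:
 assumes t: "0 \<le> t" "t \<le> s" "s \<le> T" and n: "norm y \<le> R" and z: "z \<in> D"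
  and \<delta>: "\<delta> = (1 + rad R) * integral {t..s} C0"
 shows "(flow b T t s y - y) \<bullet> (y - z) \<le> integral {t..s} (\<lambda>r. b r z) \<bullet> (z - y)
  + (norm (z - y) + \<delta>)^2 * integral {t..s} C1 + \<delta> * (2 + norm z + rad R) * integral {t..s} C0"
proof -
 have tT: "t \<le> T" using t by simp
 obtain c where fl: "flow_line b T t y c" using flow_line_exists[of t y] t by auto
 have ct: "c t = y" using fl by (simp add: flow_line_def)
 obtain m N where mN: "dom_increments t T m c" "negligible N"
  "!!s. s \<in> {t<..<T} ==> s \<notin> N ==> \<exists>v. (c has_vector_derivative v) (at s) \<and> - v \<in> b_hat b s (c s)"
  using flow_line_obtain[OF fl t(1) tT] by blast
 have n': "norm (c t) \<le> R" using n ct by simp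
 have near: "norm (c r - y) \<le> \<delta>" if r: "r \<in> {t..s}" for r
 proof -
  have "norm (c r - c t) \<le> (1 + rad R) * integral {t..r} C0"
   by (rule flow_line_speed[OF fl]) (use r t n' in auto)
  also have "\<dots> \<le> \<delta>" unfolding \<delta> using IC0_le[of t t r s] r t rad_nonneg[of R] by (intro mult_left_mono) auto
  finally show ?thesis by (simp add: ct)
 qed
 have d: "dom_increments t s m c" by (rule dom_increments_subinterval[OF mN(1)]) (use t in auto)
 have dc: "dom_increments t s (\<lambda>_. 0) (\<lambda>_. y - z)"
  by (auto simp: dom_increments_def intro: has_integral_integrable[OF has_integral_0])
 obtain k where k: "dom_increments t s k (\<lambda>r. c r \<bullet> (y - z))"
  by (rule dom_increments_bilinear[OF d dc bounded_bilinear_inner])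
 define q where "q = (\<lambda>r. b r z \<bullet> (z - y) + (norm (z - y) + \<delta>)^2 * C1 r + \<delta> * (2 + norm z + rad R) * C0 r)"
 have bI: "(\<lambda>r. b r z) integrable_on {t..s}"
  using b_point_integrable[OF z t(1,3)] by (simp add: absolutely_integrable_on_def)
 have qI: "(q has_integral (integral {t..s} (\<lambda>r. b r z) \<bullet> (z - y)
  + (norm (z - y) + \<delta>)^2 * integral {t..s} C1 + \<delta> * (2 + norm z + rad R) * integral {t..s} C0)) {t..s}"
 proof -
  have "((\<lambda>r. b r z \<bullet> (z - y)) has_integral (integral {t..s} (\<lambda>r. b r z) \<bullet> (z - y))) {t..s}"
   using has_integral_linear[OF integrable_integral[OF bI] bounded_linear_inner_left[of "z - y"]] by (simp add: o_def)
  then show ?thesis unfolding q_def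
   by (intro has_integral_add has_integral_mult_right integrable_integral C0Is C1Is t)
 qed
 have "c s \<bullet> (y - z) - c t \<bullet> (y - z) \<le> integral {t..s} q"
 proof (rule increments_le_integral[OF t(2) k has_integral_integrable[OF qI] mN(2)])
  fix r d assume r: "r \<in> {t<..<s}" "r \<notin> N" and d: "((\<lambda>r. c r \<bullet> (y - z)) has_vector_derivative d) (at r)"
  have rT: "r \<in> {0..T}" "r \<in> {t..s}" "r \<in> {t..T}" using r t by auto
  obtain v where v: "(c has_vector_derivative v) (at r)" "- v \<in> b_hat b r (c r)" using mN(3)[of r] r t by auto
  have "((\<lambda>r. c r \<bullet> (y - z)) has_vector_derivative v \<bullet> (y - z)) (at r)"
   by (rule bounded_linear.has_vector_derivative[OF bounded_linear_inner_left v(1)])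
  then have deq: "d = v \<bullet> (y - z)" using d vector_derivative_unique_at by blast
  have c0: "0 \<le> C0 r" "0 \<le> C1 r" using C0nn C1nn rT by auto
  have "(b r z - - v) \<bullet> (z - c r) \<ge> - C1 r * (norm (z - c r))^2"
   by (rule osl_convex_hull[OF osl[OF rT(1)]]) (use v(2) in \<open>simp add: b_hat_eq\<close>)
  then have 1: "v \<bullet> (c r - z) \<le> b r z \<bullet> (z - c r) + C1 r * (norm (z - c r))^2"
   by (simp add: inner_add_left inner_diff_right inner_diff_left algebra_simps)
  have 2: "C1 r * (norm (z - c r))^2 \<le> (norm (z - y) + \<delta>)^2 * C1 r"
  proof -
   have "norm (z - c r) \<le> norm (z - y) + norm (c r - y)"
    using norm_triangle_ineq4[of "z - y" "c r - y"] by simp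
   then have "norm (z - c r) \<le> norm (z - y) + \<delta>" using near[OF rT(2)] by linarith
   then have "(norm (z - c r))^2 \<le> (norm (z - y) + \<delta>)^2" by (intro power_mono) auto
   then show ?thesis using c0 by (simp add: mult.commute mult_left_mono)
  qed
  have 3: "b r z \<bullet> (y - c r) \<le> (C0 r * (1 + norm z)) * \<delta>"
  proof -
   have "b r z \<bullet> (y - c r) \<le> norm (b r z) * norm (y - c r)" by (rule norm_cauchy_schwarz)
   also have "\<dots> \<le> (C0 r * (1 + norm z)) * \<delta>"
    by (rule mult_mono) (use growth[OF rT(1)] near[OF rT(2)] c0 in \<open>auto simp: norm_minus_commute\<close>)
   finally show ?thesis .
  qed
  have 4: "v \<bullet> (y - c r) \<le> (C0 r * (1 + rad R)) * \<delta>"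
  proof -
   have gr: "norm (c r) \<le> rad R" by (rule flow_line_rad[OF fl t(1) _ rT(3) n']) (use tT in auto)
   have "norm v \<le> C0 r * (1 + norm (c r))" using b_hat_norm[OF rT(1) v(2)] by simp
   also have "\<dots> \<le> C0 r * (1 + rad R)" using gr c0 by (intro mult_left_mono) auto
   finally have nv: "norm v \<le> C0 r * (1 + rad R)" .
   have "v \<bullet> (y - c r) \<le> norm v * norm (y - c r)" by (rule norm_cauchy_schwarz)
   also have "\<dots> \<le> (C0 r * (1 + rad R)) * \<delta>"
    by (rule mult_mono[OF nv]) (use near[OF rT(2)] c0 rad_nonneg[of R] in \<open>auto simp: norm_minus_commute\<close>)
   finally show ?thesis .
  qed
  have "d = v \<bullet> (c r - z) + v \<bullet> (y - c r)" by (simp add: deq inner_diff_right)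
  also have "\<dots> \<le> b r z \<bullet> (z - c r) + (norm (z - y) + \<delta>)^2 * C1 r + (C0 r * (1 + rad R)) * \<delta>"
   using 1 2 4 by linarith
  also have "b r z \<bullet> (z - c r) = b r z \<bullet> (z - y) + b r z \<bullet> (y - c r)" by (simp add: inner_diff_right)
  finally have "d \<le> b r z \<bullet> (z - y) + (C0 r * (1 + norm z)) * \<delta> + (norm (z - y) + \<delta>)^2 * C1 r + (C0 r * (1 + rad R)) * \<delta>"
   using 3 by linarith
  then show "d \<le> q r" by (simp add: q_def algebra_simps)
 qed
 then show ?thesis using integral_unique[OF qI] flow_eq[OF fl t] ct by (simp add: inner_diff_left)
qed

text \<open>Times at which the averages of all relevant functions converge. Countably many functions
  are involved, so almost every time is good; the condition does not mention the point x from which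
  the flow starts, so one null set serves all x.\<close>

definition good :: "real => bool" where
 "good t \<longleftrightarrow> t \<in> {0<..<T} \<and> b t \<in> borel_measurable lebesgue \<and> Lpoint C0 t \<and> Lpoint C1 t \<and>
  (\<forall>z\<in>D. Lpoint (\<lambda>r. b r z) t)"

lemma good_AE:
 obtains N where "negligible N" "!!t. t \<in> {0<..<T} ==> t \<notin> N ==> good t"
proof -
 obtain N0 where N0: "negligible N0" "!!t. t \<in> {0..T} ==> t \<notin> N0 ==> b t \<in> borel_measurable lebesgue"
  using b_section_measurable_AE by blast
 obtain N1 where N1: "negligible N1" "!!t. t \<in> {0<..<T} ==> t \<notin> N1 ==> Lpoint C0 t"
  using Lebesgue_point_ex[OF C0I] unfolding Lpoint_def by blast
 obtain N2 where N2: "negligible N2" "!!t. t \<in> {0<..<T} ==> t \<notin> N2 ==> Lpoint C1 t"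
  using Lebesgue_point_ex[OF C1I] unfolding Lpoint_def by blast
 have "\<forall>z\<in>D. \<exists>N. negligible N \<and> (\<forall>t. t \<in> {0<..<T} --> t \<notin> N --> Lpoint (\<lambda>r. b r z) t)"
 proof
  fix z assume "z \<in> D"
  then have "(\<lambda>r. b r z) integrable_on {0..T}" using b_point_integrable[of z 0 T] by (simp add: absolutely_integrable_on_def)
  from Lebesgue_point_ex[OF this] show "\<exists>N. negligible N \<and> (\<forall>t. t \<in> {0<..<T} --> t \<notin> N --> Lpoint (\<lambda>r. b r z) t)"
   unfolding Lpoint_def by blast
 qed
 then obtain NZ where NZ: "!!z. z \<in> D ==> negligible (NZ z)"
  "!!z t. z \<in> D ==> t \<in> {0<..<T} ==> t \<notin> NZ z ==> Lpoint (\<lambda>r. b r z) t" by metis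
 have "negligible (\<Union>(NZ ` D))" by (rule negligible_countable_Union) (use D(1) NZ(1) in auto)
 then have "negligible (N0 \<union> N1 \<union> N2 \<union> \<Union>(NZ ` D))" using N0(1) N1(1) N2(1) by simp
 then show thesis
  by (rule that) (use N0(2) N1(2) N2(2) NZ(2) in \<open>auto simp: good_def\<close>)
qed

text \<open>Convergent averages of \<open>C0\<close> are bounded, and this bounds the difference
  quotients of the flow uniformly on balls. The bound is the dominating function in later limits
  under integrals.\<close>

lemma good_displacement_bounded:
 assumes g: "good t" and h: "!!n. h n > 0" "!!n. t + h n \<le> T" "h \<longlonglongrightarrow> 0"
 obtains K where "K \<ge> 0" "!!n. integral {t..t + h n} C0 / h n \<le> K"
  "!!n y R. norm y \<le> R ==> norm ((flow b T t (t + h n) y - y) /\<^sub>R h n) \<le> (1 + rad R) * K"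
proof -
 have t: "0 \<le> t" using g by (auto simp: good_def)
 have "(\<lambda>n. integral {t..t + h n} C0 /\<^sub>R h n) \<longlonglongrightarrow> C0 t"
  using g h by (intro Lpoint_seq) (auto simp: good_def)
 from convergent_imp_bounded[OF this] obtain K where K: "!!n. \<bar>integral {t..t + h n} C0 / h n\<bar> \<le> K"
  by (auto simp: bounded_iff divide_inverse_commute)
 have K0: "K \<ge> 0" using K[of 0] by linarith
 have K': "integral {t..t + h n} C0 / h n \<le> K" for n using K[of n] by linarith
 show thesis
 proof (rule that[OF K0 K'])
  fix n R and y :: 'a assume n: "norm y \<le> R"
  have "norm ((flow b T t (t + h n) y - y) /\<^sub>R h n) = norm (flow b T t (t + h n) y - y) / h n"
   using h(1)[of n] by (simp add: divide_inverse_commute)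
  also have "\<dots> \<le> ((1 + rad R) * integral {t..t + h n} C0) / h n"
   using flow_displacement[OF t _ h(2) n, of n] h(1)[of n] by (intro divide_right_mono) auto
  also have "\<dots> = (1 + rad R) * (integral {t..t + h n} C0 / h n)" by simp
  also have "\<dots> \<le> (1 + rad R) * K" using K' rad_nonneg[of R] by (intro mult_left_mono) auto
  finally show "norm ((flow b T t (t + h n) y - y) /\<^sub>R h n) \<le> (1 + rad R) * K" .
 qed
qed

text \<open>The variational inequality, divided by h n, passes to every cluster point l of the
  quotients at all z in \<open>D\<close>. So -l is in the hull of the limit points, a singleton
  where b(t,.) is continuous. Here t is fixed before y, so the limit may be integrated in y against
  f(t).\<close>

theorem flow_derivative:
 assumes g: "good t" and y: "isCont (b t) y"
  and h: "!!n. h n > 0" "!!n. t + h n \<le> T" "h \<longlonglongrightarrow> 0"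
 shows "(\<lambda>n. (flow b T t (t + h n) y - y) /\<^sub>R h n) \<longlonglongrightarrow> - b t y"
proof -
 have t: "0 \<le> t" "t \<in> {0..T}" using g by (auto simp: good_def)
 define R where "R = norm y"
 obtain K where K: "K \<ge> 0" "!!n. integral {t..t + h n} C0 / h n \<le> K"
  "!!n y R. norm y \<le> R ==> norm ((flow b T t (t + h n) y - y) /\<^sub>R h n) \<le> (1 + rad R) * K"
  using good_displacement_bounded[OF g h] by blast
 define \<delta> where "\<delta> = (\<lambda>n. (1 + rad R) * integral {t..t + h n} C0)"
 have "Lpoint C0 t" "Lpoint C1 t" using g by (auto simp: good_def)
 then have c0: "(\<lambda>n. integral {t..t + h n} C0 /\<^sub>R h n) \<longlonglongrightarrow> C0 t"
  and c1: "(\<lambda>n. integral {t..t + h n} C1 /\<^sub>R h n) \<longlonglongrightarrow> C1 t"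
  by (auto intro!: Lpoint_seq h simp del: real_scaleR_def)
 have \<delta>0: "\<delta> \<longlonglongrightarrow> 0"
 proof -
  have "(\<lambda>n. (1 + rad R) * (h n *\<^sub>R (integral {t..t + h n} C0 /\<^sub>R h n))) \<longlonglongrightarrow> (1 + rad R) * (0 *\<^sub>R C0 t)"
   by (intro tendsto_intros h(3) c0)
  moreover have "h n *\<^sub>R (integral {t..t + h n} C0 /\<^sub>R h n) = integral {t..t + h n} C0" for n using h(1)[of n] by simp
  ultimately show ?thesis unfolding \<delta>_def by (simp only: mult_zero_right scaleR_zero_left)
 qed
 define Q where "Q = (\<lambda>n. (flow b T t (t + h n) y - y) /\<^sub>R h n)"
 have "Q \<longlonglongrightarrow> - b t y"
 proof (rule LIMSEQ_of_subsequences)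
  show "bounded (range Q)" using K(3)[of y R] unfolding Q_def R_def by (auto simp: bounded_iff)
  fix r :: "nat => nat" and l assume r: "strict_mono r" and l: "(\<lambda>n. Q (r n)) \<longlonglongrightarrow> l"
  have sub: "(\<lambda>n. X (r n)) \<longlonglongrightarrow> L" if "X \<longlonglongrightarrow> L" for X :: "nat => 'c::topological_space" and L
   using LIMSEQ_subseq_LIMSEQ[OF that r] by (simp add: o_def)
  have "- l \<in> convex hull limit_set (b t) y"
  proof (rule in_convex_hull_limit_set[OF growth[OF t(2)] C0nn[OF t(2)] D(2)])
   fix z assume z: "z \<in> D"
   have cz: "(\<lambda>n. integral {t..t + h n} (\<lambda>r. b r z) /\<^sub>R h n) \<longlonglongrightarrow> b t z"
    using g h z by (intro Lpoint_seq) (auto simp: good_def)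
   have "l \<bullet> (y - z) \<le> b t z \<bullet> (z - y) + (norm (z - y) + 0)^2 * C1 t + 0 * (2 + norm z + rad R) * C0 t"
   proof (rule tendsto_le[OF trivial_limit_sequentially])
    show "(\<lambda>n. Q (r n) \<bullet> (y - z)) \<longlonglongrightarrow> l \<bullet> (y - z)" by (intro tendsto_intros l)
    let ?X = "\<lambda>n. (integral {t..t + h n} (\<lambda>r. b r z) /\<^sub>R h n) \<bullet> (z - y)
     + (norm (z - y) + \<delta> n)^2 * (integral {t..t + h n} C1 /\<^sub>R h n) + \<delta> n * (2 + norm z + rad R) * (integral {t..t + h n} C0 /\<^sub>R h n)"
    have "?X \<longlonglongrightarrow> b t z \<bullet> (z - y) + (norm (z - y) + 0)^2 * C1 t + 0 * (2 + norm z + rad R) * C0 t"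
     by (intro tendsto_intros cz c0 c1 \<delta>0)
    then show "(\<lambda>n. ?X (r n)) \<longlonglongrightarrow> b t z \<bullet> (z - y) + (norm (z - y) + 0)^2 * C1 t + 0 * (2 + norm z + rad R) * C0 t"
     by (rule sub)
    have "Q n \<bullet> (y - z) \<le> ?X n" for n
    proof -
     have hn: "h n > 0" by (rule h)
     have "(flow b T t (t + h n) y - y) \<bullet> (y - z) \<le> integral {t..t + h n} (\<lambda>r. b r z) \<bullet> (z - y)
      + (norm (z - y) + \<delta> n)^2 * integral {t..t + h n} C1 + \<delta> n * (2 + norm z + rad R) * integral {t..t + h n} C0"
      by (rule evi_increment[OF t(1) _ h(2) _ z]) (use hn in \<open>auto simp: \<delta>_def R_def\<close>)
     then have "inverse (h n) * ((flow b T t (t + h n) y - y) \<bullet> (y - z)) \<le> inverse (h n) * (integral {t..t + h n} (\<lambda>r. b r z) \<bullet> (z - y)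
      + (norm (z - y) + \<delta> n)^2 * integral {t..t + h n} C1 + \<delta> n * (2 + norm z + rad R) * integral {t..t + h n} C0)"
      using hn by (intro mult_left_mono) auto
     then show ?thesis by (simp add: Q_def distrib_left mult_ac)
    qed
    then show "\<forall>\<^sub>F n in sequentially. Q (r n) \<bullet> (y - z) \<le> ?X (r n)" by (intro always_eventually) blast
   qed
   then show "(b t z - - l) \<bullet> (z - y) \<ge> - C1 t * (norm (z - y))^2"
    by (simp add: inner_add_left inner_diff_right inner_diff_left algebra_simps)
  qed
  then have "- l = b t y" using convex_hull_limit_set_isCont[OF y] by simp
  then show "l = - b t y" by (metis minus_minus)
 qed
 then show ?thesis by (simp add: Q_def)
qed

lemma good_isCont_AE:
 assumes "good t"
 shows "AE x in lebesgue. isCont (b t) x"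
proof -
 have t: "t \<in> {0..T}" "b t \<in> borel_measurable lebesgue" using assms by (auto simp: good_def)
 show ?thesis by (rule osl_isCont_AE[OF t(2) growth[OF t(1)] C0nn[OF t(1)] osl[OF t(1)]])
qed

text \<open>b(t,.) need not be Borel, but its continuity points form a Borel set on which it is
  continuous, so this truncation is Borel. At good times it equals b(t,.) almost everywhere for
  Lebesgue measure and, in \<open>measure_path\<close>, for both parts of f(t).\<close>

definition bc :: "real => 'a => 'a" where
 "bc t x = (if isCont (b t) x then b t x else 0)"

lemma bc_measurable: "bc t \<in> borel_measurable borel"
proof -
 have "continuous_on {x. isCont (b t) x} (b t)" by (auto intro: continuous_at_imp_continuous_on)
 then have "(\<lambda>x. indicator {x. isCont (b t) x} x *\<^sub>R b t x) \<in> borel_measurable borel"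
  by (intro borel_measurable_continuous_on_indicator isCont_borel)
 moreover have "(\<lambda>x. indicator {x. isCont (b t) x} x *\<^sub>R b t x) = bc t"
  by (auto simp: bc_def indicator_def fun_eq_iff)
 ultimately show ?thesis by simp
qed

lemma bc_bound:
 assumes "t \<in> {0..T}"
 shows "norm (bc t x) \<le> C0 t * (1 + norm x)"
 using growth[OF assms, of x] C0nn[OF assms] by (auto simp: bc_def)

end

section \<open>Integration against signed Radon measures\<close>

lemma CcI:
 assumes "continuous_on UNIV g" "!!x. norm x > R ==> g x = 0"
 shows "g \<in> Cc"
proof -
 have sub: "{x. g x \<noteq> 0} \<subseteq> cball 0 R" using assms(2) by (auto simp: not_less[symmetric])
 then have "closure {x. g x \<noteq> 0} \<subseteq> cball 0 R" by (intro closure_minimal) auto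
 then have "bounded (closure {x. g x \<noteq> 0})" using bounded_cball bounded_subset by blast
 then have "compact (closure {x. g x \<noteq> 0})" by (simp add: compact_eq_bounded_closed)
 with assms(1) show ?thesis by (simp add: Cc_def)
qed

lemma CcD:
 assumes "g \<in> Cc"
 shows "continuous_on UNIV g" "g \<in> borel_measurable borel"
  and "\<exists>R B. 0 \<le> R \<and> 0 \<le> B \<and> (\<forall>x. norm x > R --> g x = 0) \<and> (\<forall>x. \<bar>g x\<bar> \<le> B)"
proof -
 show c: "continuous_on UNIV g" using assms by (simp add: Cc_def)
 then show "g \<in> borel_measurable borel" by (rule borel_measurable_continuous_onI)
 let ?K = "closure {x. g x \<noteq> 0}"
 have K: "compact ?K" using assms by (simp add: Cc_def)
 have sub: "x \<in> ?K" if "g x \<noteq> 0" for x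
  using that closure_subset[of "{x. g x \<noteq> 0}"] by auto
 obtain R where R: "R > 0" "!!x. x \<in> ?K ==> norm x \<le> R" using compact_imp_bounded[OF K] by (auto simp: bounded_pos)
 have "bounded (g ` ?K)" using K c by (intro compact_imp_bounded compact_continuous_image continuous_on_subset[OF c]) auto
 then obtain B where B: "B > 0" "!!x. x \<in> ?K ==> \<bar>g x\<bar> \<le> B" by (auto simp: bounded_pos)
 have "\<bar>g x\<bar> \<le> B" for x using B sub[of x] by (cases "g x = 0") auto
 moreover have "g x = 0" if "norm x > R" for x using R(2)[of x] sub[of x] that by fastforce
 ultimately show "\<exists>R B. 0 \<le> R \<and> 0 \<le> B \<and> (\<forall>x. norm x > R --> g x = 0) \<and> (\<forall>x. \<bar>g x\<bar> \<le> B)"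
  using R(1) B(1) less_imp_le by blast
qed

text \<open>The margin 1: two points closer than 1 either both lie in the ball of radius R + 1, or
  both lie outside the ball of radius R, where g vanishes.\<close>

lemma uniformly_continuous_of_bounded_support:
 fixes g :: "'a::euclidean_space => 'b::real_normed_vector"
 assumes g: "continuous_on UNIV g" and z: "!!x. norm x > R ==> g x = 0" and e: "0 < e"
 shows "\<exists>\<delta>>0. \<forall>x y. norm (x - y) < \<delta> --> norm (g x - g y) < e"
proof -
 have "uniformly_continuous_on (cball 0 (R + 1)) g"
  by (intro compact_uniformly_continuous continuous_on_subset[OF g]) auto
 then obtain d where d: "d > 0" "!!u v. u \<in> cball 0 (R + 1) ==> v \<in> cball 0 (R + 1) ==> dist v u < d ==> dist (g v) (g u) < e"
  using e unfolding uniformly_continuous_on_def by metis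
 have "norm (g x - g y) < e" if xy: "norm (x - y) < min d 1" for x y
 proof (cases "norm x \<le> R + 1 \<and> norm y \<le> R + 1")
  case True
  then show ?thesis using d(2)[of y x] xy by (simp add: dist_norm)
 next
  case False
  then have "norm x > R" "norm y > R"
   using xy norm_triangle_ineq2[of x y] norm_triangle_ineq2[of y x] norm_minus_commute[of x y] by auto
  then show ?thesis using z e by simp
 qed
 moreover have "0 < min d 1" using d(1) by simp
 ultimately show ?thesis by blast
qed

lemma lfb_sets: "locally_finite_borel M ==> sets M = sets borel"
 and lfb_space: "locally_finite_borel M ==> space M = UNIV"
 and lfb_cball: "locally_finite_borel M ==> emeasure M (cball (x::'a::euclidean_space) r) < \<infinity>"
 by (auto simp: locally_finite_borel_def dest: sets_eq_imp_space_eq)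

lemma lfb_measurable: "locally_finite_borel M ==> borel_measurable M = borel_measurable borel"
 by (intro measurable_cong_sets lfb_sets refl)

lemma lfb_measurableI: "locally_finite_borel M ==> f \<in> borel_measurable borel ==> f \<in> borel_measurable M"
 by (simp add: lfb_measurable)

lemma lfb_sigma_finite:
 fixes M :: "'a::euclidean_space measure"
 assumes "locally_finite_borel M"
 shows "sigma_finite_measure M"
proof
 show "\<exists>A. countable A \<and> A \<subseteq> sets M \<and> \<Union>A = space M \<and> (\<forall>a\<in>A. emeasure M a \<noteq> \<infinity>)"
 proof (intro exI[of _ "range (\<lambda>n::nat. cball (0::'a) (real n))"] conjI ballI)
  show "range (\<lambda>n::nat. cball (0::'a) (real n)) \<subseteq> sets M" by (auto simp: lfb_sets[OF assms])
  show "\<Union>(range (\<lambda>n::nat. cball (0::'a) (real n))) = space M"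
   by (auto simp: lfb_space[OF assms] intro: real_arch_simple)
  fix a assume "a \<in> range (\<lambda>n::nat. cball (0::'a) (real n))"
  then show "emeasure M a \<noteq> \<infinity>" using lfb_cball[OF assms] by (auto simp: less_top)
 qed auto
qed

lemma lfb_integrable:
 fixes M :: "'a::euclidean_space measure" and g :: "'a => real"
 assumes M: "locally_finite_borel M" and g: "g \<in> borel_measurable borel"
  and R: "!!x. norm x > R ==> g x = 0" and B: "!!x. \<bar>g x\<bar> \<le> B"
 shows "integrable M g" "\<bar>integral\<^sup>L M g\<bar> \<le> B * measure M (cball 0 R)"
proof -
 have i: "integrable M (\<lambda>x. B * indicator (cball 0 R) x)"
  using lfb_cball[OF M, of 0 R] by (intro integrable_mult_right integrable_real_indicator) (auto simp: lfb_sets[OF M])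
 have le: "\<bar>g x\<bar> \<le> B * indicator (cball 0 R) x" for x using R[of x] B[of x] by (auto simp: indicator_def not_le)
 show gi: "integrable M g"
  by (rule Bochner_Integration.integrable_bound[OF i]) (use g le lfb_measurable[OF M] in \<open>auto intro!: AE_I2 intro: order_trans[OF _ abs_ge_self]\<close>)
 have "\<bar>integral\<^sup>L M g\<bar> \<le> (LINT x|M. \<bar>g x\<bar>)" by (rule integral_abs_bound)
 also have "\<dots> \<le> (LINT x|M. B * indicator (cball 0 R) x)"
  by (rule integral_mono) (use gi i le in auto)
 also have "\<dots> = B * measure M (cball 0 R)" by (simp add: lfb_space[OF M])
 finally show "\<bar>integral\<^sup>L M g\<bar> \<le> B * measure M (cball 0 R)" .
qed

lemma signed_radon_parts:
 "locally_finite_borel (pos_part \<mu>)" "locally_finite_borel (neg_part \<mu>)" "mutually_singular (pos_part \<mu>) (neg_part \<mu>)"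
 using Rep_signed_radon[of \<mu>] by (auto simp: pos_part_def neg_part_def case_prod_beta)

lemma integral_completion_AE:
 fixes g g' :: "'a => real"
 assumes "g' \<in> borel_measurable M" "AE x in M. g x = g' x"
 shows "integral\<^sup>L (completion M) g = integral\<^sup>L M g'"
proof -
 have g': "g' \<in> borel_measurable (completion M)" by (rule measurable_completion[OF assms(1)])
 have "AE x in M. g' x = g x" using assms(2) by eventually_elim auto
 from borel_measurable_completion_AE[OF g' this] have g: "g \<in> borel_measurable (completion M)" .
 have "integral\<^sup>L (completion M) g = integral\<^sup>L (completion M) g'"
  by (rule integral_cong_AE[OF g g' AE_completion[OF assms(2)]])
 also have "\<dots> = integral\<^sup>L M g'" by (rule integral_completion[OF assms(1)])
 finally show ?thesis .
qed

text \<open>An integrand containing b itself need not be Borel; by completion it may be exchanged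
  for a Borel function equal to it almost everywhere for both parts.\<close>

lemma signed_integral_AE:
 assumes "g' \<in> borel_measurable borel" "AE x in pos_part \<mu>. g x = g' x" "AE x in neg_part \<mu>. g x = g' x"
 shows "signed_integral \<mu> g = integral\<^sup>L (pos_part \<mu>) g' - integral\<^sup>L (neg_part \<mu>) g'"
 unfolding signed_integral_def
 using integral_completion_AE[OF lfb_measurableI[OF signed_radon_parts(1) assms(1)] assms(2)]
  integral_completion_AE[OF lfb_measurableI[OF signed_radon_parts(2) assms(1)] assms(3)] by simp

lemma signed_integral_borel:
 assumes "g \<in> borel_measurable borel"
 shows "signed_integral \<mu> g = integral\<^sup>L (pos_part \<mu>) g - integral\<^sup>L (neg_part \<mu>) g"
 by (rule signed_integral_AE[OF assms]) auto

lemma signed_integral_diff: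
 fixes g g' :: "'a::euclidean_space => real"
 assumes "g \<in> borel_measurable borel" "!!x. norm x > R ==> g x = 0" "!!x. \<bar>g x\<bar> \<le> B"
  "g' \<in> borel_measurable borel" "!!x. norm x > R' ==> g' x = 0" "!!x. \<bar>g' x\<bar> \<le> B'"
 shows "signed_integral \<mu> (\<lambda>x. g x - g' x) = signed_integral \<mu> g - signed_integral \<mu> g'"
proof -
 note i = lfb_integrable(1)[OF signed_radon_parts(1)[of \<mu>]] lfb_integrable(1)[OF signed_radon_parts(2)[of \<mu>]]
 have "(LINT x|pos_part \<mu>. g x - g' x) = integral\<^sup>L (pos_part \<mu>) g - integral\<^sup>L (pos_part \<mu>) g'"
  by (rule Bochner_Integration.integral_diff) (use i(1)[OF assms(1-3)] i(1)[OF assms(4-6)] in auto)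
 moreover have "(LINT x|neg_part \<mu>. g x - g' x) = integral\<^sup>L (neg_part \<mu>) g - integral\<^sup>L (neg_part \<mu>) g'"
  by (rule Bochner_Integration.integral_diff) (use i(2)[OF assms(1-3)] i(2)[OF assms(4-6)] in auto)
 ultimately show ?thesis
  using assms(1,4) by (subst signed_integral_borel) (auto simp: signed_integral_borel)
qed

text \<open>The total variation on a ball, since the two parts are mutually singular.\<close>

definition mass :: "'a::euclidean_space signed_radon => real => real" where
 "mass \<mu> R = measure (pos_part \<mu>) (cball 0 R) + measure (neg_part \<mu>) (cball 0 R)"

lemma mass_nonneg: "0 \<le> mass \<mu> R" by (simp add: mass_def)

lemma signed_integral_bound:
 fixes g :: "'a::euclidean_space => real"
 assumes "g \<in> borel_measurable borel" "!!x. norm x > R ==> g x = 0" "!!x. \<bar>g x\<bar> \<le> B"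
 shows "\<bar>signed_integral \<mu> g\<bar> \<le> B * mass \<mu> R"
proof -
 have "\<bar>integral\<^sup>L (pos_part \<mu>) g\<bar> \<le> B * measure (pos_part \<mu>) (cball 0 R)"
  by (rule lfb_integrable(2)[OF signed_radon_parts(1) assms])
 moreover have "\<bar>integral\<^sup>L (neg_part \<mu>) g\<bar> \<le> B * measure (neg_part \<mu>) (cball 0 R)"
  by (rule lfb_integrable(2)[OF signed_radon_parts(2) assms])
 ultimately show ?thesis
  unfolding signed_integral_borel[OF assms(1)] mass_def distrib_left by linarith
qed

lemma signed_integral_dominated_convergence:
 fixes g :: "nat => 'a::euclidean_space => real"
 assumes g: "!!n. g n \<in> borel_measurable borel" "!!n x. norm x > R ==> g n x = 0" "!!n x. \<bar>g n x\<bar> \<le> B"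
  and g': "g' \<in> borel_measurable borel"
  and lim: "AE x in pos_part \<mu>. (\<lambda>n. g n x) \<longlonglongrightarrow> g' x" "AE x in neg_part \<mu>. (\<lambda>n. g n x) \<longlonglongrightarrow> g' x"
 shows "(\<lambda>n. signed_integral \<mu> (g n)) \<longlonglongrightarrow> integral\<^sup>L (pos_part \<mu>) g' - integral\<^sup>L (neg_part \<mu>) g'"
proof -
 have "(\<lambda>n. integral\<^sup>L M (g n)) \<longlonglongrightarrow> integral\<^sup>L M g'"
  if M: "locally_finite_borel M" and l: "AE x in M. (\<lambda>n. g n x) \<longlonglongrightarrow> g' x" for M :: "'a measure"
 proof (rule integral_dominated_convergence[where w="\<lambda>x. B * indicator (cball 0 R) x"])
  show "integrable M (\<lambda>x. B * indicator (cball 0 R) x)"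
   using lfb_cball[OF M, of 0 R] by (intro integrable_mult_right integrable_real_indicator) (auto simp: lfb_sets[OF M])
  show "AE x in M. norm (g n x) \<le> B * indicator (cball 0 R) x" for n
   by (rule AE_I2) (auto simp: indicator_def not_le g(2) intro: g(3))
  show "g n \<in> borel_measurable M" for n by (rule lfb_measurableI[OF M g(1)])
  show "g' \<in> borel_measurable M" by (rule lfb_measurableI[OF M g'])
 qed (rule l)
 from this[OF signed_radon_parts(1) lim(1)] this[OF signed_radon_parts(2) lim(2)] show ?thesis
  using g(1) by (simp add: signed_integral_borel tendsto_diff)
qed

text \<open>The density gives both parts the same value on bounded Borel subsets of the Lebesgue
  null set Z. Where the negative part vanishes the positive part therefore vanishes on Z as well,
  and conversely. Z is exhausted by bounded pieces because \<open>L1_loc\<close> tests bounded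
  sets.\<close>

lemma L1_loc_AE:
 fixes \<mu> :: "'a::euclidean_space signed_radon"
 assumes mu: "\<mu> \<in> L1_loc" and P: "AE x in lebesgue. P x" and S: "{x. P x} \<in> sets borel"
 shows "AE x in pos_part \<mu>. P x" "AE x in neg_part \<mu>. P x"
proof -
 let ?P = "pos_part \<mu>" and ?N = "neg_part \<mu>"
 note p = signed_radon_parts[of \<mu>]
 define Z where "Z = {x. \<not> P x}"
 have Zb: "Z \<in> sets borel" using sets.compl_sets[OF S] by (simp add: Z_def Collect_neg_eq Compl_eq_Diff_UNIV)
 have Z0: "Z \<in> null_sets lebesgue" using P by (simp add: completion.AE_iff_null_sets Z_def)
 obtain h where h: "!!A. A \<in> sets borel ==> bounded A ==> measure ?P A - measure ?N A = (LINT x:A|lebesgue. h x)"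
  using mu by (auto simp: L1_loc_def)
 have eq: "measure ?P A = measure ?N A" if A: "A \<in> sets borel" "bounded A" "A \<subseteq> Z" for A
 proof -
  have A0: "A \<in> null_sets lebesgue" using null_sets_subset[OF Z0 _ A(3)] A(1) by (simp add: sets_completionI_sets)
  have "(LINT x:A|lebesgue. h x) = (LINT x|(lebesgue :: 'a measure). 0)"
   unfolding set_lebesgue_integral_def
  proof (rule integral_cong_AE)
   have "AE x in lebesgue. x \<notin> A" using A0 by (rule AE_not_in)
   then show ae: "AE x in lebesgue. indicator A x *\<^sub>R h x = 0" by eventually_elim (auto simp: indicator_def)
   have "AE x in lborel. 0 = indicator A x *\<^sub>R h x"
    using ae unfolding AE_completion_iff by eventually_elim auto
   then show "(\<lambda>x. indicator A x *\<^sub>R h x) \<in> borel_measurable lebesgue"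
    by (rule borel_measurable_completion_AE[rotated]) auto
  qed auto
  then show ?thesis using h[OF A(1,2)] by simp
 qed
 obtain E where E: "E \<in> sets borel" "emeasure ?P E = 0" "emeasure ?N (- E) = 0"
  using p(3) by (auto simp: mutually_singular_def)
 have Ec: "- E \<in> sets borel" using E(1) by auto
 have fin: "emeasure M A \<noteq> \<infinity>" if "locally_finite_borel M" "bounded A" "A \<in> sets borel" for M :: "'a measure" and A
 proof -
  obtain R where "!!x. x \<in> A ==> norm x \<le> R" using \<open>bounded A\<close> by (auto simp: bounded_pos)
  then have "A \<subseteq> cball 0 R" by auto
  then have "emeasure M A \<le> emeasure M (cball 0 R)" using lfb_sets[OF that(1)] by (intro emeasure_mono) auto
  then show ?thesis using lfb_cball[OF that(1), of 0 R] by auto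
 qed
 define A where "A = (\<lambda>n::nat. Z \<inter> - E \<inter> cball 0 (real n))"
 define A' where "A' = (\<lambda>n::nat. Z \<inter> E \<inter> cball 0 (real n))"
 have Ab: "A n \<in> sets borel" "A' n \<in> sets borel" for n using Zb E(1) Ec by (auto simp: A_def A'_def)
 have Abd: "bounded (A n)" "bounded (A' n)" for n unfolding A_def A'_def by (auto intro: bounded_Int)
 have "emeasure ?P (A n) = 0" for n
 proof -
  have "emeasure ?N (A n) \<le> emeasure ?N (- E)" by (rule emeasure_mono) (use Ec lfb_sets[OF p(2)] in \<open>auto simp: A_def\<close>)
  then have "measure ?N (A n) = 0" using E(3) by (simp add: measure_def)
  moreover have "A n \<subseteq> Z" by (auto simp: A_def)
  ultimately have "measure ?P (A n) = 0" using eq[OF Ab(1) Abd(1), of n] by simp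
  then show ?thesis using fin[OF p(1) Abd(1) Ab(1), of n] emeasure_eq_ennreal_measure[of ?P "A n"] by simp
 qed
 then have "(\<Union>n. A n) \<in> null_sets ?P"
  using Ab lfb_sets[OF p(1)] by (intro null_sets_UN) (auto simp: null_sets_def)
 moreover have "(\<Union>n. A n) = Z \<inter> - E" by (auto simp: A_def intro: real_arch_simple)
 ultimately have 1: "Z \<inter> - E \<in> null_sets ?P" by simp
 have "E \<in> null_sets ?P" using E(1,2) lfb_sets[OF p(1)] by (auto simp: null_sets_def)
 then have "(Z \<inter> - E) \<union> E \<in> null_sets ?P" using 1 by (rule null_sets.Un[rotated])
 then have "AE x in ?P. x \<notin> (Z \<inter> - E) \<union> E" by (rule AE_not_in)
 then show "AE x in ?P. P x" by eventually_elim (auto simp: Z_def)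
 have "emeasure ?N (A' n) = 0" for n
 proof -
  have "emeasure ?P (A' n) \<le> emeasure ?P E" by (rule emeasure_mono) (use E(1) lfb_sets[OF p(1)] in \<open>auto simp: A'_def\<close>)
  then have "measure ?P (A' n) = 0" using E(2) by (simp add: measure_def)
  moreover have "A' n \<subseteq> Z" by (auto simp: A'_def)
  ultimately have "measure ?N (A' n) = 0" using eq[OF Ab(2) Abd(2), of n] by simp
  then show ?thesis using fin[OF p(2) Abd(2) Ab(2), of n] emeasure_eq_ennreal_measure[of ?N "A' n"] by simp
 qed
 then have "(\<Union>n. A' n) \<in> null_sets ?N"
  using Ab lfb_sets[OF p(2)] by (intro null_sets_UN) (auto simp: null_sets_def)
 moreover have "(\<Union>n. A' n) = Z \<inter> E" by (auto simp: A'_def intro: real_arch_simple)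
 ultimately have 2: "Z \<inter> E \<in> null_sets ?N" by simp
 have "- E \<in> null_sets ?N" using Ec E(3) lfb_sets[OF p(2)] by (auto simp: null_sets_def)
 then have "(Z \<inter> E) \<union> - E \<in> null_sets ?N" using 2 by (rule null_sets.Un[rotated])
 then have "AE x in ?N. x \<notin> (Z \<inter> E) \<union> - E" by (rule AE_not_in)
 then show "AE x in ?N. P x" by eventually_elim (auto simp: Z_def)
qed

text \<open>The approximating functions depend on K alone, so the four Jordan parts of two signed
  measures can be compared along the same sequence.\<close>

lemma compact_measure_limit:
 fixes K :: "'a::euclidean_space set"
 assumes K: "compact K" "K \<noteq> {}"
 obtains g :: "nat => 'a => real" where "!!n. g n \<in> Cc"
  "!!M. locally_finite_borel M ==> (\<lambda>n. integral\<^sup>L M (g n)) \<longlonglongrightarrow> measure M K"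
proof -
 define g where "g = (\<lambda>(n::nat) x. max 0 (1 - real (Suc n) * infdist x K))"
 obtain R where R: "R > 0" "!!x. x \<in> K ==> norm x \<le> R" using compact_imp_bounded[OF K(1)] by (auto simp: bounded_pos)
 have cl: "closed K" using K(1) by (rule compact_imp_closed)
 have c: "continuous_on UNIV (g n)" for n unfolding g_def by (intro continuous_intros)
 have z: "g n x = 0" if "norm x > R + 1" for n x
 proof -
  obtain y where y: "y \<in> K" "infdist x K = dist x y" using infdist_attains_inf[OF cl K(2)] by blast
  have "dist x y \<ge> norm x - norm y" by (simp add: dist_norm norm_triangle_ineq2)
  then have "infdist x K \<ge> 1" using y R(2)[OF y(1)] that by linarith
  then have "real (Suc n) * infdist x K \<ge> 1 * 1" by (intro mult_mono) auto
  then show ?thesis by (simp add: g_def)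
 qed
 have b: "\<bar>g n x\<bar> \<le> 1" for n x using infdist_nonneg[of x K] by (auto simp: g_def)
 have l: "(\<lambda>n. g n x) \<longlonglongrightarrow> indicator K x" for x
 proof (cases "x \<in> K")
  case True then show ?thesis by (simp add: g_def)
 next
  case False
  then have pos: "infdist x K > 0" using cl K(2) by (simp add: infdist_pos_not_in_closed)
  obtain N :: nat where N: "1 / infdist x K < real N" using reals_Archimedean2 by blast
  have "g n x = 0" if "n \<ge> N" for n
  proof -
   have "1 < real N * infdist x K" using N pos by (simp add: field_simps)
   also have "\<dots> \<le> real (Suc n) * infdist x K" using that pos by (intro mult_right_mono) auto
   finally show ?thesis by (simp add: g_def)
  qed
  then have "\<forall>\<^sub>F n in sequentially. g n x = indicator K x"
   using False by (intro eventually_sequentiallyI[of N]) auto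
  then show ?thesis by (rule tendsto_eventually)
 qed
 show thesis
 proof (rule that)
  show "g n \<in> Cc" for n by (rule CcI[OF c z])
  fix M :: "'a measure" assume M: "locally_finite_borel M"
  have "(\<lambda>n. integral\<^sup>L M (g n)) \<longlonglongrightarrow> integral\<^sup>L M (indicator K)"
  proof (rule integral_dominated_convergence[where w="\<lambda>x. indicator (cball 0 (R + 1)) x"])
   show "integrable M (indicat_real (cball 0 (R + 1)))"
    using lfb_cball[OF M, of 0 "R + 1"] by (intro integrable_real_indicator) (auto simp: lfb_sets[OF M])
   show "AE x in M. norm (g n x) \<le> indicat_real (cball 0 (R + 1)) x" for n
    by (rule AE_I2) (use b z in \<open>auto simp: indicator_def not_le\<close>)
   show "g n \<in> borel_measurable M" for n
    by (rule lfb_measurableI[OF M borel_measurable_continuous_onI[OF c]])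
   show "indicat_real K \<in> borel_measurable M" 
    by (rule lfb_measurableI[OF M]) (use cl in \<open>simp add: borel_closed\<close>)
  qed (use l in auto)
  then show "(\<lambda>n. integral\<^sup>L M (g n)) \<longlonglongrightarrow> measure M K" by (simp add: lfb_space[OF M])
 qed
qed

text \<open>Equal integrals give P1 + N2 = P2 + N1 on compact sets and hence on Borel sets. Mutual
  singularity then separates the parts: intersecting with the complement of E, where P1 is
  concentrated and N1 vanishes, leaves P1 <= P2. The other inequalities follow in the same
  way.\<close>

theorem signed_radon_eqI:
 fixes \<mu> c :: "'a::euclidean_space signed_radon"
 assumes eq: "!!g. g \<in> Cc ==> signed_integral \<mu> g = signed_integral c g"
 shows "\<mu> = c"
proof -
 let ?P1 = "pos_part \<mu>" and ?N1 = "neg_part \<mu>" and ?P2 = "pos_part c" and ?N2 = "neg_part c"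
 note p = signed_radon_parts[of \<mu>] and q = signed_radon_parts[of c]
 note s = lfb_sets[OF p(1)] lfb_sets[OF p(2)] lfb_sets[OF q(1)] lfb_sets[OF q(2)]
 have em: "emeasure M K = ennreal (measure M K)" if "locally_finite_borel M" "compact K" for M :: "'a measure" and K
  using that by (intro emeasure_eq_ennreal_measure) (auto simp: locally_finite_borel_def less_top)
 have cpt: "emeasure ?P1 K + emeasure ?N2 K = emeasure ?P2 K + emeasure ?N1 K" if K: "compact K" for K
 proof (cases "K = {}")
  case False
  obtain g :: "nat => 'a => real" where g: "!!n. g n \<in> Cc"
   "!!M. locally_finite_borel M ==> (\<lambda>n. integral\<^sup>L M (g n)) \<longlonglongrightarrow> measure M K"
   using compact_measure_limit[OF K False] by blast
  have "integral\<^sup>L ?P1 (g n) + integral\<^sup>L ?N2 (g n) = integral\<^sup>L ?P2 (g n) + integral\<^sup>L ?N1 (g n)" for n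
   using eq[OF g(1)[of n]] CcD(2)[OF g(1)[of n]] by (simp add: signed_integral_borel)
  then have "(\<lambda>n. integral\<^sup>L ?P1 (g n) + integral\<^sup>L ?N2 (g n)) \<longlonglongrightarrow> measure ?P2 K + measure ?N1 K"
   using tendsto_add[OF g(2)[OF q(1)] g(2)[OF p(2)]] by simp
  then have "measure ?P1 K + measure ?N2 K = measure ?P2 K + measure ?N1 K"
   using tendsto_add[OF g(2)[OF p(1)] g(2)[OF q(2)]] LIMSEQ_unique by blast
  then show ?thesis using em[OF p(1) K] em[OF p(2) K] em[OF q(1) K] em[OF q(2) K] by (simp add: ennreal_plus[symmetric] del: ennreal_plus)
 qed simp
 have sum_eq: "add_measure ?P1 ?N2 = add_measure ?P2 ?N1"
 proof (rule measure_eqI_generator_eq[where E="Collect compact" and \<Omega>=UNIV and A="\<lambda>n. cball 0 (real n)"])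
  show "Int_stable (Collect compact :: 'a set set)" by (auto simp: Int_stable_def intro: compact_Int)
  show "emeasure (add_measure ?P1 ?N2) X = emeasure (add_measure ?P2 ?N1) X" if "X \<in> Collect compact" for X
   using cpt[of X] that s by (subst (1 2) emeasure_add_measure) (auto intro: borel_compact)
  have sg: "sets borel = sigma_sets UNIV (Collect compact :: 'a set set)"
  proof
   have "sigma_sets UNIV (Collect closed) \<subseteq> sigma_sets UNIV (Collect compact :: 'a set set)"
   proof (rule sigma_sets_mono)
    show "Collect closed \<subseteq> sigma_sets UNIV (Collect compact :: 'a set set)"
    proof
     fix C :: "'a set" assume "C \<in> Collect closed"
     then have "C \<inter> cball 0 (real n) \<in> Collect compact" for n by (simp add: closed_Int_compact)
     then have "(\<Union>n. C \<inter> cball 0 (real n)) \<in> sigma_sets UNIV (Collect compact)"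
      by (intro sigma_sets.Union) auto
     moreover have "(\<Union>n. C \<inter> cball 0 (real n)) = C" by (auto intro: real_arch_simple)
     ultimately show "C \<in> sigma_sets UNIV (Collect compact)" by simp
    qed
   qed
   then show "sets borel \<subseteq> sigma_sets UNIV (Collect compact :: 'a set set)" by (simp add: borel_eq_closed)
   show "sigma_sets UNIV (Collect compact :: 'a set set) \<subseteq> sets borel"
    by (rule sets.sigma_sets_subset[of _ borel, simplified]) (auto intro: borel_compact)
  qed
  show "sets (add_measure ?P1 ?N2) = sigma_sets UNIV (Collect compact)" "sets (add_measure ?P2 ?N1) = sigma_sets UNIV (Collect compact)"
   using sg s by simp_all
  show "(\<Union>n. cball 0 (real n)) = (UNIV :: 'a set)" by (auto intro: real_arch_simple)
  show "emeasure (add_measure ?P1 ?N2) (cball 0 (real n)) \<noteq> \<infinity>" for n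
   using lfb_cball[OF p(1), of 0 n] lfb_cball[OF q(2), of 0 n] s by (subst emeasure_add_measure) auto
 qed auto
 have sum: "emeasure ?P1 A + emeasure ?N2 A = emeasure ?P2 A + emeasure ?N1 A" if "A \<in> sets borel" for A
  using arg_cong[OF sum_eq, of "\<lambda>M. emeasure M A"] that s by (simp add: emeasure_add_measure)
 \<comment> \<open>Stated for abstract measures, as it is used four times with the roles of the
   parts and of the two signed measures exchanged.\<close>
 have le: "emeasure P A \<le> emeasure P' A"
  if "A \<in> sets borel" "E \<in> sets borel" "emeasure P E = 0" "emeasure N (- E) = 0" "sets P = sets borel" "sets N = sets borel" "sets P' = sets borel"
   and sm: "!!A. A \<in> sets borel ==> emeasure P A + emeasure N' A = emeasure P' A + emeasure N A"
  for A E and P P' N N' :: "'a measure"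
 proof -
  let ?B = "A \<inter> - E"
  have B: "?B \<in> sets borel" using that(1,2) by auto
  have "E \<in> null_sets P" using that by (auto simp: null_sets_def)
  then have "emeasure P A = emeasure P (A - E)" using that by (intro emeasure_Diff_null_set[symmetric]) auto
  also have "A - E = ?B" by auto
  also have "emeasure P ?B \<le> emeasure P ?B + emeasure N' ?B" by simp
  also have "\<dots> = emeasure P' ?B + emeasure N ?B" by (rule sm[OF B])
  also have "emeasure N ?B = 0"
   using emeasure_mono[of ?B "- E" N] that by auto
  also have "emeasure P' ?B + 0 \<le> emeasure P' A" using that by (auto intro!: emeasure_mono)
  finally show ?thesis .
 qed
 obtain E where E: "E \<in> sets borel" "emeasure ?P1 E = 0" "emeasure ?N1 (- E) = 0"
  using p(3) by (auto simp: mutually_singular_def)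
 obtain E' where E': "E' \<in> sets borel" "emeasure ?P2 E' = 0" "emeasure ?N2 (- E') = 0"
  using q(3) by (auto simp: mutually_singular_def)
 have "?P1 = ?P2"
 proof (rule measure_eqI)
  fix A assume "A \<in> sets ?P1"
  then have A: "A \<in> sets borel" using s by simp
  show "emeasure ?P1 A = emeasure ?P2 A"
  proof (rule antisym)
   show "emeasure ?P1 A \<le> emeasure ?P2 A" by (rule le[OF A E s(1,2,3)]) (rule sum)
   show "emeasure ?P2 A \<le> emeasure ?P1 A" by (rule le[OF A E' s(3,4,1)]) (rule sum[symmetric])
  qed
 qed (use s in simp)
 moreover have "?N1 = ?N2"
 proof (rule measure_eqI)
  fix A assume "A \<in> sets ?N1"
  then have A: "A \<in> sets borel" using s by simp
  have cE: "- E \<in> sets borel" "emeasure ?P1 (- (- E)) = 0" "- E' \<in> sets borel" "emeasure ?P2 (- (- E')) = 0" using E E' by auto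
  show "emeasure ?N1 A = emeasure ?N2 A"
  proof (rule antisym)
   show "emeasure ?N1 A \<le> emeasure ?N2 A"
    by (rule le[where N'="?P2", OF A cE(1) E(3) cE(2) s(2,1,4)]) (metis add.commute sum)
   show "emeasure ?N2 A \<le> emeasure ?N1 A"
    by (rule le[where N'="?P1", OF A cE(3) E'(3) cE(4) s(4,3,2)]) (metis add.commute sum)
  qed
 qed (use s in simp)
 ultimately have "Rep_signed_radon \<mu> = Rep_signed_radon c"
  by (simp add: pos_part_def neg_part_def prod_eq_iff)
 then show ?thesis by (simp add: Rep_signed_radon_inject)
qed

section \<open>Difference quotients along sequences and properties of test functions\<close>

lemma has_derivative_sequentially:
 fixes F :: "'a::euclidean_space => 'b::euclidean_space"
 assumes d: "(F has_derivative F') (at p)" and h: "!!n. h n > 0" "h \<longlonglongrightarrow> 0"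
  and q: "(\<lambda>n. (q n - p) /\<^sub>R h n) \<longlonglongrightarrow> w"
 shows "(\<lambda>n. (F (q n) - F p) /\<^sub>R h n) \<longlonglongrightarrow> F' w"
proof -
 define v where "v = (\<lambda>n. (q n - p) /\<^sub>R h n)"
 have bl: "bounded_linear F'" using d by (rule has_derivative_bounded_linear)
 have hv: "q n - p = h n *\<^sub>R v n" for n using h(1)[of n] by (simp add: v_def)
 have v: "v \<longlonglongrightarrow> w" using q by (simp add: v_def)
 have qp: "q \<longlonglongrightarrow> p"
 proof -
  have "(\<lambda>n. p + h n *\<^sub>R v n) \<longlonglongrightarrow> p + 0 *\<^sub>R w" by (intro tendsto_intros h v)
  moreover have "(\<lambda>n. p + h n *\<^sub>R v n) = q" using hv by (auto simp: fun_eq_iff algebra_simps)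
  ultimately show ?thesis by simp
 qed
 \<comment> \<open>The remainder is set to 0 at p, since \<open>q n\<close> may be equal to
   p.\<close>
 define e where "e = (\<lambda>y. if y = p then 0 else (F y - F p - F' (y - p)) /\<^sub>R norm (y - p))"
 have "((\<lambda>y. (F y - F p - F' (y - p)) /\<^sub>R norm (y - p)) \<longlongrightarrow> 0) (at p)"
  using d by (simp add: has_derivative_at_within)
 then have "(e \<longlongrightarrow> 0) (at p)"
  by (rule Lim_transform_eventually) (auto simp: e_def eventually_at_filter)
 then have "isCont e p" by (simp add: isCont_def e_def)
 then have e0: "(\<lambda>n. e (q n)) \<longlonglongrightarrow> 0" using isCont_tendsto_compose[OF _ qp, of e] by (simp add: e_def)
 have dec: "(F (q n) - F p) /\<^sub>R h n = F' (v n) + norm (v n) *\<^sub>R e (q n)" for n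
 proof -
  have "F (q n) - F p = F' (q n - p) + norm (q n - p) *\<^sub>R e (q n)"
   using linear_0[OF bounded_linear.linear[OF bl]] by (auto simp: e_def)
  also have "\<dots> = h n *\<^sub>R (F' (v n) + norm (v n) *\<^sub>R e (q n))"
   using h(1)[of n] by (simp add: hv linear_scale[OF bounded_linear.linear[OF bl]] scaleR_add_right)
  finally show ?thesis using h(1)[of n] by simp
 qed
 have "(\<lambda>n. F' (v n) + norm (v n) *\<^sub>R e (q n)) \<longlonglongrightarrow> F' w + norm w *\<^sub>R 0"
  by (intro tendsto_intros v e0 bounded_linear.tendsto[OF bl])
 then show ?thesis by (simp add: dec)
qed

lemma test_function_props:
 fixes \<psi> :: "real \<times> 'a::euclidean_space => real"
 assumes "\<psi> \<in> test_functions T"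
 shows "!!p. (\<psi> has_derivative frechet_derivative \<psi> (at p)) (at p)"
  "!!v. continuous_on UNIV (\<lambda>p. frechet_derivative \<psi> (at p) v)"
  "continuous_on UNIV \<psi>"
  "\<exists>R L. 0 \<le> R \<and> 0 \<le> L \<and> (\<forall>t x. \<psi> (t, x) \<noteq> 0 --> 0 < t \<and> t < T \<and> norm x \<le> R) \<and>
   (\<forall>t x v. frechet_derivative \<psi> (at (t, x)) v \<noteq> 0 --> norm x \<le> R) \<and>
   (\<forall>p v. \<bar>frechet_derivative \<psi> (at p) v\<bar> \<le> L * norm v) \<and> (\<forall>p q. \<bar>\<psi> p - \<psi> q\<bar> \<le> L * norm (p - q))"
proof -
 let ?D = "\<lambda>p. frechet_derivative \<psi> (at p)"
 have Ck1: "Ck (Suc 0) \<psi>" and K: "compact (closure {p. \<psi> p \<noteq> 0})" and sub: "closure {p. \<psi> p \<noteq> 0} \<subseteq> {0<..<T} \<times> UNIV"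
  using assms by (auto simp: test_functions_def simp del: Ck.simps)
 show der: "(\<psi> has_derivative ?D p) (at p)" for p
  using Ck1 unfolding Ck.simps(2) differentiable_on_eq_differentiable_at[OF open_UNIV] frechet_derivative_works by blast
 show cont: "continuous_on UNIV (\<lambda>p. ?D p v)" for v
  using Ck1 unfolding Ck.simps by blast
 show c: "continuous_on UNIV \<psi>" using der by (auto intro!: has_derivative_continuous continuous_at_imp_continuous_on)
 let ?K = "closure {p. \<psi> p \<noteq> 0}"
 obtain R where R: "R > 0" "!!p. p \<in> ?K ==> norm p \<le> R" using compact_imp_bounded[OF K] by (auto simp: bounded_pos)
 have out: "?D p v = 0" if "p \<notin> ?K" for p v
 proof -
  have "((\<lambda>_. 0) has_derivative (\<lambda>_. 0)) (at p)" by simp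
  then have "(\<psi> has_derivative (\<lambda>_. 0)) (at p)"
   by (rule has_derivative_transform_within_open[where s="- ?K"]) (use that closure_subset[of "{p. \<psi> p \<noteq> 0}"] in auto)
  then have "?D p = (\<lambda>_. 0)" using der has_derivative_unique by blast
  then show ?thesis by simp
 qed
 have "\<exists>B. \<forall>p. \<bar>?D p v\<bar> \<le> B" for v
 proof -
  have "bounded ((\<lambda>p. ?D p v) ` ?K)"
   using K by (intro compact_imp_bounded compact_continuous_image continuous_on_subset[OF cont]) auto
  then obtain B where B: "B > 0" "!!p. p \<in> ?K ==> \<bar>?D p v\<bar> \<le> B" by (auto simp: bounded_pos)
  have "\<bar>?D p v\<bar> \<le> B" for p using B out[of p v] by (cases "p \<in> ?K") auto
  then show ?thesis by blast
 qed
 then obtain B where B: "!!v p. \<bar>?D p v\<bar> \<le> B v" by metis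
 define L where "L = (\<Sum>i\<in>Basis. B i)"
 have B0: "0 \<le> B v" for v using B[of undefined v] abs_ge_zero order_trans by blast
 have L0: "0 \<le> L" unfolding L_def by (intro sum_nonneg B0)
 have DL: "\<bar>?D p v\<bar> \<le> L * norm v" for p v
 proof -
  have lin: "linear (?D p)" using der[of p] by (rule has_derivative_linear)
  have "?D p v = ?D p (\<Sum>i\<in>Basis. (v \<bullet> i) *\<^sub>R i)" by (simp add: euclidean_representation)
  also have "\<dots> = (\<Sum>i\<in>Basis. (v \<bullet> i) *\<^sub>R ?D p i)" by (simp add: linear_sum[OF lin] linear_scale[OF lin])
  finally have "\<bar>?D p v\<bar> \<le> (\<Sum>i\<in>Basis. \<bar>(v \<bullet> i) *\<^sub>R ?D p i\<bar>)" using sum_abs by metis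
  also have "\<dots> \<le> (\<Sum>i\<in>Basis. norm v * B i)"
  proof (rule sum_mono)
   fix i :: "real \<times> 'a" assume "i \<in> Basis"
   then have "\<bar>v \<bullet> i\<bar> \<le> norm v" by (rule Basis_le_norm)
   then show "\<bar>(v \<bullet> i) *\<^sub>R ?D p i\<bar> \<le> norm v * B i" using B[of p i] by (simp add: abs_mult mult_mono)
  qed
  finally show ?thesis by (simp add: L_def sum_distrib_left mult.commute)
 qed
 have lip: "\<bar>\<psi> p - \<psi> q\<bar> \<le> L * norm (p - q)" for p q
 proof -
  have "norm (\<psi> p - \<psi> q) \<le> L * norm (p - q)"
  proof (rule differentiable_bound[of UNIV \<psi> "\<lambda>p. ?D p"])
   show "onorm (?D p) \<le> L" for p by (rule onorm_bound[OF L0]) (use DL in auto)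
  qed (use der in auto)
  then show ?thesis by simp
 qed
 have inK: "norm x \<le> R \<and> 0 < t \<and> t < T" if "(t, x) \<in> ?K" for t and x :: 'a
 proof -
  have "norm x \<le> norm (t, x)" by (rule norm_snd_le)
  moreover have "norm (t, x) \<le> R" using R(2)[OF that] .
  ultimately show ?thesis using subsetD[OF sub that] by auto
 qed
 have "(t, x) \<in> ?K" if "\<psi> (t, x) \<noteq> 0" for t x using that closure_subset[of "{p. \<psi> p \<noteq> 0}"] by auto
 then show "\<exists>R L. 0 \<le> R \<and> 0 \<le> L \<and> (\<forall>t x. \<psi> (t, x) \<noteq> 0 --> 0 < t \<and> t < T \<and> norm x \<le> R) \<and>
   (\<forall>t x v. ?D (t, x) v \<noteq> 0 --> norm x \<le> R) \<and>
   (\<forall>p v. \<bar>?D p v\<bar> \<le> L * norm v) \<and> (\<forall>p q. \<bar>\<psi> p - \<psi> q\<bar> \<le> L * norm (p - q))"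
  using inK out DL lip L0 R(1) by (intro exI[of _ R] exI[of _ L]) (meson less_imp_le)
qed

section \<open>From duality to the weak form\<close>

lemma vanishing_steps:
 fixes t s :: real
 assumes "t < s"
 obtains h :: "nat => real" where "!!n. 0 < h n" "!!n. t + h n < s" "h \<longlonglongrightarrow> 0"
\<comment> \<open>\<open>Suc (Suc n)\<close> keeps the factor strictly below 1, so that t + h n
  stays below s.\<close>
proof (rule that[of "\<lambda>n. (s - t) * inverse (real (Suc (Suc n)))"])
 show "(\<lambda>n. (s - t) * inverse (real (Suc (Suc n)))) \<longlonglongrightarrow> 0"
  using tendsto_mult[OF tendsto_const LIMSEQ_Suc[OF LIMSEQ_inverse_real_of_nat], of "s - t"] by simp
 have "(s - t) * inverse (real (Suc (Suc n))) < (s - t) * 1" for n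
  using assms by (intro mult_strict_left_mono) (auto simp: inverse_less_1_iff)
 then show "t + (s - t) * inverse (real (Suc (Suc n))) < s" for n by (simp add: less_diff_eq add.commute)
qed (use assms in auto)

lemma signed_integral_cmult:
 assumes "g \<in> borel_measurable borel"
 shows "signed_integral \<mu> (\<lambda>x. c * g x) = c * signed_integral \<mu> g"
proof -
 have "(\<lambda>x. c * g x) \<in> borel_measurable borel" using assms by simp
 then show ?thesis by (simp add: signed_integral_borel assms right_diff_distrib)
qed

text \<open>Expanding the direction in the basis leaves coordinates of c and derivatives in fixed
  directions, which are continuous.\<close>

lemma spatial_derivative_measurable:
 fixes \<psi> :: "real \<times> 'a::euclidean_space => real"
 assumes der: "!!p. (\<psi> has_derivative frechet_derivative \<psi> (at p)) (at p)"
  and cont: "!!v. continuous_on UNIV (\<lambda>p. frechet_derivative \<psi> (at p) v)"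
  and c: "c \<in> borel_measurable borel"
 shows "(\<lambda>x. frechet_derivative \<psi> (at (t, x)) (a, c x)) \<in> borel_measurable borel"
proof -
 have eq: "frechet_derivative \<psi> (at (t, x)) (a, w) = a * frechet_derivative \<psi> (at (t, x)) (1, 0)
   + (\<Sum>i\<in>Basis. (w \<bullet> i) * frechet_derivative \<psi> (at (t, x)) (0, i))" for x w
 proof -
  have lin: "linear (frechet_derivative \<psi> (at (t, x)))" using der by (rule has_derivative_linear)
  have "(a, w) = a *\<^sub>R (1, 0) + (\<Sum>i\<in>Basis. (w \<bullet> i) *\<^sub>R (0::real, i))"
  proof -
   have "(\<Sum>i\<in>Basis. (w \<bullet> i) *\<^sub>R (0::real, i)) = (0, w)"
    by (simp add: sum_prod[symmetric] prod_eq_iff fst_sum snd_sum euclidean_representation)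
   then show ?thesis by simp
  qed
  then show ?thesis
   by (simp add: linear_add[OF lin] linear_scale[OF lin] linear_sum[OF lin] del: scaleR_Pair)
 qed
 have m: "(\<lambda>x. frechet_derivative \<psi> (at (t, x)) v) \<in> borel_measurable borel" for v
  by (intro borel_measurable_continuous_onI continuous_on_compose2[OF cont]) (auto intro!: continuous_intros)
 show ?thesis unfolding eq
  by (intro borel_measurable_add borel_measurable_sum borel_measurable_times m borel_measurable_const borel_measurable_inner c)
qed

lemma has_bochner_integral_lebesgue_onI:
 fixes p q :: "real => real"
 assumes p: "p absolutely_integrable_on {a..b}" and N: "negligible N" and eq: "!!t. t \<in> {a..b} ==> t \<notin> N ==> q t = p t"
 shows "has_bochner_integral (lebesgue_on {a..b}) q (integral {a..b} p)"
proof -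
 have q: "q absolutely_integrable_on {a..b}" by (rule absolutely_integrable_spike[OF p N]) (use eq in auto)
 have i: "integrable (lebesgue_on {a..b}) q" by (rule absolutely_integrable_imp_integrable[OF q]) auto
 have "(q has_integral integral\<^sup>L (lebesgue_on {a..b}) q) {a..b}"
  by (rule has_integral_integral_lebesgue_on[OF i]) auto
 then have "integral {a..b} q = integral\<^sup>L (lebesgue_on {a..b}) q" by (rule integral_unique)
 moreover have "integral {a..b} p = integral {a..b} q" by (rule integral_spike[OF N]) (use eq in auto)
 ultimately show ?thesis using i by (simp add: has_bochner_integral_iff)
qed

context compressive
begin

text \<open>The backward growth bound: a starting point is controlled by its image, which makes g
  composed with the flow compactly supported.\<close>

lemma flow_support:
 assumes t: "0 \<le> s" "s \<le> t" "t \<le> T" and n: "norm (flow b T s t x) \<le> R"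
 shows "norm x \<le> rad R"
 using flow_rad[of s t s x R] flow_self[of s x] t n by auto

lemma Cc_flow:
 assumes g: "g \<in> Cc" and t: "0 \<le> s" "s \<le> t" "t \<le> T"
 shows "(\<lambda>x. g (flow b T s t x)) \<in> Cc"
proof -
 obtain R where R: "!!x. norm x > R ==> g x = 0" using CcD(3)[OF g] by blast
 show ?thesis
 proof (rule CcI)
  show "continuous_on UNIV (\<lambda>x. g (flow b T s t x))"
   by (rule continuous_on_compose2[OF CcD(1)[OF g] flow_continuous[OF t]]) auto
  show "g (flow b T s t x) = 0" if "norm x > rad R" for x
   using R[of "flow b T s t x"] flow_support[OF t, of x R] that by fastforce
 qed
qed

end

text \<open>The two alternatives of the theorem enter only through their common consequence
  \<open>conc_pos\<close>, \<open>conc_neg\<close>: at good times both parts of f(t) are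
  concentrated on continuity points of b(t,.).\<close>

locale measure_path = compressive T b C0 C1 for T and b :: "real => 'a::euclidean_space => 'a" and C0 C1 +
 fixes f :: "real => 'a signed_radon"
 assumes fC: "f \<in> C_weak T"
  and conc_pos: "!!t. good t ==> AE x in pos_part (f t). isCont (b t) x"
  and conc_neg: "!!t. good t ==> AE x in neg_part (f t). isCont (b t) x"
begin

lemma signed_integral_bc:
 assumes "good t" "(\<lambda>x. F x (bc t x)) \<in> borel_measurable borel"
 shows "signed_integral (f t) (\<lambda>x. F x (b t x)) = signed_integral (f t) (\<lambda>x. F x (bc t x))"
proof -
 have "AE x in pos_part (f t). F x (b t x) = F x (bc t x)"
  using conc_pos[OF assms(1)] by eventually_elim (simp add: bc_def)
 moreover have "AE x in neg_part (f t). F x (b t x) = F x (bc t x)"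
  using conc_neg[OF assms(1)] by eventually_elim (simp add: bc_def)
 ultimately show ?thesis
  using signed_integral_AE[OF assms(2), where \<mu>="f t" and g="\<lambda>x. F x (b t x)"] signed_integral_borel[OF assms(2), where \<mu>="f t"] by simp
qed

text \<open>By duality, \<open>G\<close> is the integral against f(0) of psi along the flow, so it
  is absolutely continuous. Its derivative is computed at fixed t against f(t) and turns out to be
  the integrand of the weak form.\<close>

theorem weak_form_of_duality:
 assumes dual: "!!t g. t \<in> {0..T} ==> g \<in> Cc ==> signed_integral (f t) g = signed_integral (f 0) (\<lambda>x. g (flow b T 0 t x))"
  and psi: "\<psi> \<in> test_functions T"
 shows "has_bochner_integral (lebesgue_on {0..T})
  (\<lambda>t. signed_integral (f t) (\<lambda>x. frechet_derivative \<psi> (at (t, x)) (1, 0) - frechet_derivative \<psi> (at (t, x)) (0, b t x))) 0"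
proof -
 let ?D = "\<lambda>p. frechet_derivative \<psi> (at p)"
 note der = test_function_props(1)[OF psi] and Dcont = test_function_props(2)[OF psi] and cont = test_function_props(3)[OF psi]
 obtain R L where RL: "0 \<le> R" "0 \<le> L" "!!t x. \<psi> (t, x) \<noteq> 0 ==> 0 < t \<and> t < T \<and> norm x \<le> R"
  "!!t x v. ?D (t, x) v \<noteq> 0 ==> norm x \<le> R"
  "!!p v. \<bar>?D p v\<bar> \<le> L * norm v" "!!p q. \<bar>\<psi> p - \<psi> q\<bar> \<le> L * norm (p - q)"
  using test_function_props(4)[OF psi] by blast
 have lin: "linear (?D p)" for p using der by (rule has_derivative_linear)
 have \<psi>c: "continuous_on UNIV (\<lambda>x. \<psi> (t, x))" for t
  by (rule continuous_on_compose2[OF cont]) (auto intro!: continuous_intros)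
 have \<psi>0: "\<psi> (t, x) = 0" if "norm x > R" for t x using RL(3)[of t x] that by fastforce
 have \<psi>Cc: "(\<lambda>x. \<psi> (t, x)) \<in> Cc" for t by (rule CcI[OF \<psi>c \<psi>0])
 define G where "G = (\<lambda>t. signed_integral (f t) (\<lambda>x. \<psi> (t, x)))"
 define R1 where "R1 = rad R"
 have R1: "R \<le> R1" "0 \<le> R1" using rad_ge[OF RL(1)] rad_nonneg by (auto simp: R1_def)
 have pair: "\<bar>\<psi> (t, y) - \<psi> (s, z)\<bar> \<le> L * (\<bar>t - s\<bar> + norm (y - z))" for t s y z
 proof -
  have "norm ((t, y) - (s, z)) \<le> \<bar>t - s\<bar> + norm (y - z)" using norm_Pair_le[of "t - s" "y - z"] by simp
  then have "L * norm ((t, y) - (s, z)) \<le> L * (\<bar>t - s\<bar> + norm (y - z))" by (rule mult_left_mono[OF _ RL(2)])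
  then show ?thesis using RL(6)[of "(t, y)" "(s, z)"] by linarith
 qed
 define V where "V = mass (f 0) R1"
 have V0: "0 \<le> V" by (simp add: V_def mass_nonneg)
 define m where "m = (\<lambda>r. L * V * (1 + (1 + rad R1) * C0 r))"
 have Gd: "dom_increments 0 T m G"
  unfolding dom_increments_def
 proof (intro conjI ballI allI impI)
  show "m integrable_on {0..T}" unfolding m_def by (intro integrable_on_mult_right integrable_add C0I) auto
  show "0 \<le> m t" if "t \<in> {0..T}" for t
   using C0nn[OF that] rad_nonneg[of R1] RL(2) V0 unfolding m_def by (intro mult_nonneg_nonneg add_nonneg_nonneg) auto
  fix s t assume st: "0 \<le> s" "s \<le> t" "t \<le> T"
  define u where "u = (\<lambda>r x. \<psi> (r, flow b T 0 r x))"
  have uCc: "u r \<in> Cc" if "0 \<le> r" "r \<le> T" for r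
   unfolding u_def by (rule Cc_flow[OF \<psi>Cc]) (use that in auto)
  have G_eq: "G r = signed_integral (f 0) (u r)" if "0 \<le> r" "r \<le> T" for r
   unfolding G_def u_def by (rule dual[OF _ \<psi>Cc]) (use that in auto)
  have u0: "u r x = 0" if "0 \<le> r" "r \<le> T" "norm x > R1" for r x
   using \<psi>0[of "flow b T 0 r x" r] flow_support[of 0 r x R] that by (fastforce simp: u_def R1_def)
  define B where "B = L * ((t - s) + (1 + rad R1) * integral {s..t} C0)"
  have B0: "0 \<le> B" unfolding B_def
   by (intro mult_nonneg_nonneg add_nonneg_nonneg RL(2) IC0_nonneg) (use st rad_nonneg[of R1] in auto)
  have ub: "\<bar>u t x - u s x\<bar> \<le> B" for x
  proof (cases "norm x > R1")
   case True then show ?thesis using u0[of t x] u0[of s x] st B0 by simp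
  next
   case False
   have "norm (flow b T 0 t x - flow b T 0 s x) \<le> (1 + rad R1) * integral {s..t} C0"
    by (rule flow_speed[of 0 s t 0]) (use st False flow_self[of 0 x] T in auto)
   then have "L * (\<bar>t - s\<bar> + norm (flow b T 0 t x - flow b T 0 s x)) \<le> B"
    unfolding B_def using RL(2) st by (intro mult_left_mono) auto
   then show ?thesis using pair[of t "flow b T 0 t x" s "flow b T 0 s x"] by (simp add: u_def)
  qed
  have Cc1: "u t \<in> Cc" "u s \<in> Cc" using uCc st by auto
  obtain Bt Bs where Bts: "!!x. \<bar>u t x\<bar> \<le> Bt" "!!x. \<bar>u s x\<bar> \<le> Bs" using CcD(3)[OF Cc1(1)] CcD(3)[OF Cc1(2)] by blast
  have "G t - G s = signed_integral (f 0) (\<lambda>x. u t x - u s x)"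
   using G_eq[of t] G_eq[of s] st
    signed_integral_diff[OF CcD(2)[OF Cc1(1)] _ Bts(1) CcD(2)[OF Cc1(2)] _ Bts(2), of R1 R1 "f 0"] u0 by simp
  also have "\<bar>\<dots>\<bar> \<le> B * mass (f 0) R1"
   by (rule signed_integral_bound) (use CcD(2)[OF Cc1(1)] CcD(2)[OF Cc1(2)] u0 st ub in auto)
  also have "\<dots> = integral {s..t} m"
  proof -
   have "(m has_integral (L * V * ((t - s) + (1 + rad R1) * integral {s..t} C0))) {s..t}"
    unfolding m_def using has_integral_const_real[of "1::real" s t] st
    by (intro has_integral_mult_right has_integral_add integrable_integral C0Is) auto
   then show ?thesis by (simp add: integral_unique B_def V_def mult_ac)
  qed
  finally show "norm (G t - G s) \<le> integral {s..t} m" by simp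
 qed
 obtain p N1 where p: "p absolutely_integrable_on {0..T}" "negligible N1"
  "!!s t. 0 \<le> s ==> s \<le> t ==> t \<le> T ==> integral {s..t} p = G t - G s"
  "!!t. t \<in> {0<..<T} ==> t \<notin> N1 ==> (G has_vector_derivative p t) (at t)"
  using dom_increments_FTC_ex[OF Gd] by blast
 obtain N2 where N2: "negligible N2" "!!t. t \<in> {0<..<T} ==> t \<notin> N2 ==> good t"
  using good_AE by blast
 \<comment> \<open>The semigroup property rewrites the pairing at time t + h n as the integral of
   \<open>u n\<close> against f(t), so only the integrand depends on n and dominated convergence
   applies.\<close>
 have key: "signed_integral (f t) (\<lambda>x. ?D (t, x) (1, 0) - ?D (t, x) (0, b t x)) = d"
  if g: "good t" and d: "(G has_vector_derivative d) (at t)" for t d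
 proof -
  have t: "0 < t" "t < T" "t \<in> {0..T}" using g by (auto simp: good_def)
  obtain h :: "nat => real" where hh: "!!n. h n > 0" "!!n. t + h n < T" and h0: "h \<longlonglongrightarrow> 0"
   using vanishing_steps[OF t(2)] by blast
  have h: "h n > 0" "t + h n \<le> T" for n using hh[of n] by auto
  obtain K where K: "K \<ge> 0" "!!n. integral {t..t + h n} C0 / h n \<le> K"
   "!!n y R. norm y \<le> R ==> norm ((flow b T t (t + h n) y - y) /\<^sub>R h n) \<le> (1 + rad R) * K"
   using good_displacement_bounded[OF g h(1,2) h0] by blast
  define u where "u = (\<lambda>n y. \<psi> (t + h n, flow b T t (t + h n) y))"
  define q where "q = (\<lambda>n y. inverse (h n) * (u n y - \<psi> (t, y)))"
  have le: "t \<le> t + h n" "0 \<le> t + h n" for n using h(1)[of n] t by auto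
  have uCc: "u n \<in> Cc" for n unfolding u_def by (rule Cc_flow[OF \<psi>Cc]) (use t h le in auto)
  have u0: "u n y = 0" if "norm y > R1" for n y
   using \<psi>0[of "flow b T t (t + h n) y" "t + h n"] flow_support[of t "t + h n" y R] that h(2) le(1) t
   by (fastforce simp: u_def R1_def)
  have Gq: "(G (t + h n) - G t) /\<^sub>R h n = signed_integral (f t) (q n)" for n
  proof -
   have "G (t + h n) = signed_integral (f 0) (\<lambda>x. \<psi> (t + h n, flow b T 0 (t + h n) x))"
    unfolding G_def by (rule dual[OF _ \<psi>Cc]) (use h(2) le in auto)
   also have "\<dots> = signed_integral (f 0) (\<lambda>x. u n (flow b T 0 t x))"
    unfolding u_def by (subst flow_semigroup) (use h(2) le t in auto)
   also have "\<dots> = signed_integral (f t) (u n)" by (rule dual[OF t(3) uCc, symmetric])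
   finally have 1: "G (t + h n) = signed_integral (f t) (u n)" .
   obtain Bt Bs where Bts: "!!x. \<bar>u n x\<bar> \<le> Bt" "!!x. \<bar>\<psi> (t, x)\<bar> \<le> Bs" using CcD(3)[OF uCc[of n]] CcD(3)[OF \<psi>Cc[of t]] by blast
   have "signed_integral (f t) (\<lambda>y. u n y - \<psi> (t, y)) = signed_integral (f t) (u n) - signed_integral (f t) (\<lambda>y. \<psi> (t, y))"
    by (rule signed_integral_diff[OF CcD(2)[OF uCc] u0 Bts(1) CcD(2)[OF \<psi>Cc] \<psi>0 Bts(2)])
   then have "G (t + h n) - G t = signed_integral (f t) (\<lambda>y. u n y - \<psi> (t, y))" unfolding 1 by (simp add: G_def)
   moreover have "(\<lambda>y. u n y - \<psi> (t, y)) \<in> borel_measurable borel"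
    using CcD(2)[OF uCc[of n]] CcD(2)[OF \<psi>Cc[of t]] by (rule borel_measurable_diff)
   ultimately show ?thesis unfolding q_def by (simp add: signed_integral_cmult)
  qed
  define g' where "g' = (\<lambda>y. ?D (t, y) (1, 0) - ?D (t, y) (0, bc t y))"
  have g'm: "g' \<in> borel_measurable borel"
   unfolding g'_def by (intro borel_measurable_diff spatial_derivative_measurable[OF der Dcont] bc_measurable borel_measurable_const)
  have lim: "(\<lambda>n. q n y) \<longlonglongrightarrow> g' y" if y: "isCont (b t) y" for y
  proof -
   have "(\<lambda>n. (\<psi> (t + h n, flow b T t (t + h n) y) - \<psi> (t, y)) /\<^sub>R h n) \<longlonglongrightarrow> ?D (t, y) (1, - b t y)"
   proof (rule has_derivative_sequentially[OF der h(1) h0])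
    have "(\<lambda>n. (1::real, (flow b T t (t + h n) y - y) /\<^sub>R h n)) \<longlonglongrightarrow> (1, - b t y)"
     by (intro tendsto_Pair tendsto_const flow_derivative[OF g y h(1,2) h0])
    moreover have "((t + h n, flow b T t (t + h n) y) - (t, y)) /\<^sub>R h n = (1, (flow b T t (t + h n) y - y) /\<^sub>R h n)" for n
     using h(1)[of n] by simp
    ultimately show "(\<lambda>n. ((t + h n, flow b T t (t + h n) y) - (t, y)) /\<^sub>R h n) \<longlonglongrightarrow> (1, - b t y)" by simp
   qed
   moreover have "?D (t, y) (1, - b t y) = g' y"
   proof -
    have "?D (t, y) (1, - b t y) = ?D (t, y) ((1, 0) - (0, b t y))" by simp
    then show ?thesis using y by (simp only: linear_diff[OF lin]) (simp add: g'_def bc_def)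
   qed
   ultimately show ?thesis by (simp add: q_def u_def)
  qed
  have "(\<lambda>n. signed_integral (f t) (q n)) \<longlonglongrightarrow> integral\<^sup>L (pos_part (f t)) g' - integral\<^sup>L (neg_part (f t)) g'"
  proof (rule signed_integral_dominated_convergence[where R=R1 and B="L * (1 + (1 + rad R1) * K)"])
   show "q n \<in> borel_measurable borel" for n
    unfolding q_def by (intro borel_measurable_times borel_measurable_const borel_measurable_diff CcD(2) uCc \<psi>Cc)
   show q0: "q n x = 0" if "norm x > R1" for n x using u0[OF that] \<psi>0[of x t] that R1 by (simp add: q_def)
   show "\<bar>q n x\<bar> \<le> L * (1 + (1 + rad R1) * K)" for n x
   proof (cases "norm x > R1")
    case True then show ?thesis using q0[of x n] RL(2) K(1) rad_nonneg[of R1] by simp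
   next
    case False
    have hn: "h n > 0" by (rule h)
    have "\<bar>q n x\<bar> = inverse (h n) * \<bar>\<psi> (t + h n, flow b T t (t + h n) x) - \<psi> (t, x)\<bar>"
     using hn by (simp add: q_def u_def abs_mult)
    also have "\<dots> \<le> inverse (h n) * (L * (\<bar>t + h n - t\<bar> + norm (flow b T t (t + h n) x - x)))"
     using hn by (intro mult_left_mono pair) auto
    also have "\<dots> = L * (1 + norm ((flow b T t (t + h n) x - x) /\<^sub>R h n))"
    proof -
     have "norm ((flow b T t (t + h n) x - x) /\<^sub>R h n) = inverse (h n) * norm (flow b T t (t + h n) x - x)"
      using hn by simp
     moreover have "inverse (h n) * h n = 1" using hn by simp
     ultimately show ?thesis using hn by (simp add: distrib_left mult.left_commute)
    qed
    also have "\<dots> \<le> L * (1 + (1 + rad R1) * K)"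
     using K(3)[of x R1 n] False RL(2) by (intro mult_left_mono add_left_mono) auto
    finally show ?thesis .
   qed
   show "AE x in pos_part (f t). (\<lambda>n. q n x) \<longlonglongrightarrow> g' x" using conc_pos[OF g] by eventually_elim (rule lim)
   show "AE x in neg_part (f t). (\<lambda>n. q n x) \<longlonglongrightarrow> g' x" using conc_neg[OF g] by eventually_elim (rule lim)
  qed (rule g'm)
  then have 1: "(\<lambda>n. (G (t + h n) - G t) /\<^sub>R h n) \<longlonglongrightarrow> signed_integral (f t) g'"
   unfolding Gq signed_integral_borel[OF g'm] .
  have "(\<lambda>n. (G (t + h n) - G t) /\<^sub>R h n) \<longlonglongrightarrow> 1 *\<^sub>R d"
   by (rule has_derivative_sequentially[OF d[unfolded has_vector_derivative_def] h(1) h0])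
    (use h(1) in \<open>simp add: less_imp_neq[symmetric]\<close>)
  then have "d = signed_integral (f t) g'" using LIMSEQ_unique[OF 1] by simp
  also have "\<dots> = signed_integral (f t) (\<lambda>x. ?D (t, x) (1, 0) - ?D (t, x) (0, b t x))"
   using signed_integral_bc[OF g, of "\<lambda>x w. ?D (t, x) (1, 0) - ?D (t, x) (0, w)"] g'm by (simp add: g'_def)
  finally show ?thesis by simp
 qed
 have "has_bochner_integral (lebesgue_on {0..T})
  (\<lambda>t. signed_integral (f t) (\<lambda>x. ?D (t, x) (1, 0) - ?D (t, x) (0, b t x))) (integral {0..T} p)"
 proof (rule has_bochner_integral_lebesgue_onI[OF p(1)])
  show "negligible (N1 \<union> N2 \<union> {0, T})" using p(2) N2(1) by auto
  fix t assume "t \<in> {0..T}" "t \<notin> N1 \<union> N2 \<union> {0, T}"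
  then have t: "t \<in> {0<..<T}" "t \<notin> N1" "t \<notin> N2" by auto
  show "signed_integral (f t) (\<lambda>x. ?D (t, x) (1, 0) - ?D (t, x) (0, b t x)) = p t"
   by (rule key[OF N2(2)[OF t(1,3)] p(4)[OF t(1,2)]])
 qed
 \<comment> \<open>psi is supported inside the open time interval, so \<open>G\<close> vanishes at
   both ends.\<close>
 moreover have "integral {0..T} p = 0"
 proof -
  have z: "\<psi> (t, x) = 0" if "t = 0 \<or> t = T" for t x using RL(3)[of t x] that by fastforce
  have "G 0 = signed_integral (f 0) (\<lambda>x. 0)" "G T = signed_integral (f T) (\<lambda>x. 0)" unfolding G_def by (simp_all add: z)
  then have "G 0 = 0" "G T = 0" by (simp_all add: signed_integral_borel)
  then show ?thesis using p(3)[of 0 T] T by simp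
 qed
 ultimately show ?thesis by simp
qed

end

section \<open>Smooth test functions\<close>

lemma Ck_Suc_imp: "Ck (Suc k) f ==> Ck k f"
proof (induction k arbitrary: f)
 case 0
 then show ?case by (simp add: differentiable_imp_continuous_on del: split_paired_All)
next
 case (Suc k)
 then show ?case unfolding Ck.simps(2)[of "Suc k"] Ck.simps(2)[of k] by blast
qed

lemma Ck_SucI:
 fixes f :: "'a::euclidean_space => real"
 assumes d: "!!p. (f has_derivative f' p) (at p)" and c: "!!v. Ck k (\<lambda>p. f' p v)"
 shows "Ck (Suc k) f"
proof -
 have "frechet_derivative f (at p) = f' p" for p using frechet_derivative_at[OF d] by simp
 moreover have "f differentiable_on UNIV"
  using d by (auto simp: differentiable_on_eq_differentiable_at differentiable_def)
 ultimately show ?thesis using c by (simp del: split_paired_All)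
qed

lemma CkD:
 fixes f :: "'a::euclidean_space => real"
 assumes "Ck (Suc k) f"
 shows "(f has_derivative frechet_derivative f (at p)) (at p)" "Ck k (\<lambda>p. frechet_derivative f (at p) v)"
 using assms unfolding Ck.simps(2) differentiable_on_eq_differentiable_at[OF open_UNIV] frechet_derivative_works by blast+

lemma Ck_const: "Ck k (\<lambda>_::'a::euclidean_space. c)"
proof (induction k arbitrary: c)
 case (Suc k)
 show ?case by (rule Ck_SucI[where f'="\<lambda>_ _. 0"]) (auto intro: Suc)
qed simp

lemma Ck_linear: "bounded_linear f ==> Ck k (f :: 'a::euclidean_space => real)"
proof (cases k)
 case 0
 assume "bounded_linear f"
 then show ?thesis using 0 linear_continuous_on by auto
next
 case (Suc k)
 assume "bounded_linear f"
 then show ?thesis unfolding Suc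
  by (intro Ck_SucI[where f'="\<lambda>_. f"]) (auto intro: bounded_linear_imp_has_derivative Ck_const)
qed

lemma Ck_add: "Ck k f ==> Ck k g ==> Ck k (\<lambda>x::'a::euclidean_space. f x + g x)"
proof (induction k arbitrary: f g)
 case 0 then show ?case by (auto intro: continuous_intros)
next
 case (Suc k)
 show ?case
  by (rule Ck_SucI[OF has_derivative_add[OF CkD(1)[OF Suc.prems(1)] CkD(1)[OF Suc.prems(2)]]])
   (rule Suc.IH[OF CkD(2)[OF Suc.prems(1)] CkD(2)[OF Suc.prems(2)]])
qed

lemma Ck_mult: "Ck k f ==> Ck k g ==> Ck k (\<lambda>x::'a::euclidean_space. f x * g x)"
proof (induction k arbitrary: f g)
 case 0 then show ?case by (auto intro: continuous_intros)
next
 case (Suc k)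
 note f = CkD[OF Suc.prems(1)] Ck_Suc_imp[OF Suc.prems(1)] and g = CkD[OF Suc.prems(2)] Ck_Suc_imp[OF Suc.prems(2)]
 show ?case
  by (rule Ck_SucI[OF has_derivative_mult[OF f(1) g(1)]]) (intro Ck_add Suc.IH f(2,3) g(2,3))
qed

lemma Ck_sum: "(!!i. i \<in> I ==> Ck k (f i)) ==> Ck k (\<lambda>x::'a::euclidean_space. \<Sum>i\<in>I. f i x)"
 by (induction I rule: infinite_finite_induct) (auto intro: Ck_const Ck_add)

lemma Ck_diff: "Ck k f ==> Ck k g ==> Ck k (\<lambda>x::'a::euclidean_space. f x - g x)"
 using Ck_add[of k f "\<lambda>x. (- 1) * g x"] Ck_mult[OF Ck_const[of k "-1"], of g] by simp

lemma Ck_compose: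
 fixes u :: "'a::euclidean_space => real" and h :: "real => real"
 shows "Ck k h ==> Ck k u ==> Ck k (\<lambda>p. h (u p))"
proof (induction k arbitrary: h)
 case 0 then show ?case by (auto intro: continuous_on_compose2)
next
 case (Suc k)
 note h = CkD[OF Suc.prems(1)] and u = CkD[OF Suc.prems(2)] Ck_Suc_imp[OF Suc.prems(2)]
 show ?case
 proof (rule Ck_SucI)
  show "((\<lambda>p. h (u p)) has_derivative (\<lambda>v. frechet_derivative h (at (u p)) 1 * frechet_derivative u (at p) v)) (at p)" for p
  proof -
   have eq: "frechet_derivative h (at (u p)) x = frechet_derivative h (at (u p)) 1 * x" for x
    using linear_scale[OF has_derivative_linear[OF h(1)], of "u p" x 1] by (simp add: mult.commute)
   show ?thesis
    by (rule has_derivative_eq_rhs[OF has_derivative_compose[OF u(1) h(1)]]) (rule ext, rule eq)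
  qed
  show "Ck k (\<lambda>p. frechet_derivative h (at (u p)) 1 * frechet_derivative u (at p) v)" for v
   by (rule Ck_mult[OF Suc.IH[OF h(2) u(3)] u(2)])
 qed
qed

lemma Ck_real_derivative:
 fixes f :: "real => real"
 assumes "!!x. (f has_real_derivative f' x) (at x)" "Ck k f'"
 shows "Ck (Suc k) f"
 by (rule Ck_SucI[where f'="\<lambda>x v. f' x * v"])
  (use assms in \<open>auto simp: has_field_derivative_def intro: Ck_mult Ck_const\<close>)

section \<open>Smooth functions of one variable vanishing on a half-line\<close>

definition flat_exp :: "nat => real => real" where
 "flat_exp j u = (if u > 0 then exp (- inverse u) * inverse u ^ j else 0)"

lemma flat_exp_tendsto_0: "((\<lambda>u. flat_exp j u) \<longlongrightarrow> 0) (at_right 0)"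
proof -
 have "((\<lambda>x::real. x ^ j / exp x) \<longlongrightarrow> 0) at_top" by (rule tendsto_power_div_exp_0)
 from filterlim_compose[OF this filterlim_inverse_at_top_right]
 have "((\<lambda>u::real. inverse u ^ j / exp (inverse u)) \<longlongrightarrow> 0) (at_right 0)" .
 then show ?thesis
  by (rule Lim_transform_eventually)
   (auto simp: eventually_at_right_field flat_exp_def exp_minus divide_inverse mult.commute intro: exI[of _ 1])
qed

text \<open>The powers of 1/u make the family closed under differentiation, so smoothness follows by
  an induction over all j at once. At 0 the right difference quotient of index j is the function of
  index j + 1.\<close>

lemma flat_exp_DERIV: "(flat_exp j has_real_derivative (flat_exp (j + 2) x - real j * flat_exp (j + 1) x)) (at x)"
proof (cases x "0::real" rule: linorder_cases)
 case less
 have "((\<lambda>_. 0) has_real_derivative 0) (at x)" by simp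
 then have "(flat_exp j has_real_derivative 0) (at x)"
  by (rule has_field_derivative_transform_within_open[where S="{..<0}"]) (use less in \<open>auto simp: flat_exp_def\<close>)
 then show ?thesis using less by (simp add: flat_exp_def)
next
 case greater
 have "((\<lambda>u. exp (- inverse u) * inverse u ^ j) has_real_derivative (flat_exp (j + 2) x - real j * flat_exp (j + 1) x)) (at x)"
  using greater
  by (auto intro!: derivative_eq_intros simp: flat_exp_def power2_eq_square algebra_simps)
   (cases j; simp add: power2_eq_square algebra_simps)
 then show ?thesis
  by (rule has_field_derivative_transform_within_open[where S="{0<..}"]) (use greater in \<open>auto simp: flat_exp_def\<close>)
next
 case equal
 have q: "((\<lambda>h. (flat_exp j (0 + h) - flat_exp j 0) / h) \<longlongrightarrow> 0) (at 0)"
 proof -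
  have r: "((\<lambda>h. (flat_exp j (0 + h) - flat_exp j 0) / h) \<longlongrightarrow> 0) (at_right 0)"
   by (rule Lim_transform_eventually[OF flat_exp_tendsto_0[of "Suc j"]])
    (auto simp: eventually_at_right_field flat_exp_def divide_inverse intro: exI[of _ 1])
  have l: "((\<lambda>h. (flat_exp j (0 + h) - flat_exp j 0) / h) \<longlongrightarrow> 0) (at_left 0)"
   by (rule Lim_transform_eventually[OF tendsto_const])
    (auto simp: eventually_at_left_field flat_exp_def intro: exI[of _ "-1"])
  show ?thesis using l r by (simp add: filterlim_split_at)
 qed
 then have "(flat_exp j has_real_derivative 0) (at 0)" by (simp add: DERIV_def)
 then show ?thesis using equal by (simp add: flat_exp_def)
qed

lemma flat_exp_Ck: "Ck k (flat_exp j)"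
proof (induction k arbitrary: j)
 case 0
 have "isCont (flat_exp j) x" for x by (rule DERIV_isCont[OF flat_exp_DERIV])
 then show ?case by (simp add: continuous_at_imp_continuous_on)
next
 case (Suc k)
 show ?case
  by (rule Ck_real_derivative[OF flat_exp_DERIV]) (intro Ck_diff Ck_mult Ck_const Suc)
qed

lemma flat_exp_props: "0 \<le> flat_exp j u" "u > 0 ==> 0 < flat_exp j u" "u \<le> 0 ==> flat_exp j u = 0"
 by (auto simp: flat_exp_def)

lemma flat_exp_continuous: "continuous_on UNIV (flat_exp j)"
 using flat_exp_Ck[of 0 j] by simp

definition step_raw :: "real => real" where "step_raw s = flat_exp 0 s * flat_exp 0 (1 - s)"

lemma step_raw_props: "0 \<le> step_raw s" "0 < s ==> s < 1 ==> 0 < step_raw s" "s \<le> 0 ==> step_raw s = 0" "1 \<le> s ==> step_raw s = 0"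
 by (auto simp: step_raw_def flat_exp_props)

lemma step_raw_continuous: "continuous_on S step_raw"
 unfolding step_raw_def by (intro continuous_intros continuous_on_compose2[OF flat_exp_continuous]) auto

lemma step_raw_Ck: "Ck k step_raw"
proof -
 have "Ck k (\<lambda>s. flat_exp 0 (1 - s))"
  by (rule Ck_compose[OF flat_exp_Ck]) (intro Ck_diff Ck_const Ck_linear bounded_linear_ident)
 then show ?thesis unfolding step_raw_def by (intro Ck_mult flat_exp_Ck)
qed

definition step_total :: real where "step_total = integral {0..1} step_raw"

lemma step_total_pos: "0 < step_total"
proof -
 have "step_total \<noteq> 0"
 proof
  assume "step_total = 0"
  then have "\<forall>x\<in>{0..1}. step_raw x = 0"
   using integral_eq_0_iff[of 0 1 step_raw] step_raw_continuous step_raw_props by (auto simp: step_total_def)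
  then show False using step_raw_props(2)[of "1/2"] by force
 qed
 moreover have "0 \<le> step_total" unfolding step_total_def
  by (rule Henstock_Kurzweil_Integration.integral_nonneg) (auto intro: integrable_continuous_interval step_raw_continuous step_raw_props)
 ultimately show ?thesis by simp
qed

text \<open>The normalised primitive of \<open>step_raw\<close>: 0 up to 0, and 1 from 1 on.
  Integration from -1 places every s >= 0 in the interior of the interval on which the derivative is
  taken.\<close>

definition smooth_step :: "real => real" where "smooth_step s = integral {-1..s} step_raw / step_total"

lemma step_raw_integrable: "step_raw integrable_on {a..b}"
 by (intro integrable_continuous_interval step_raw_continuous)

lemma smooth_step_0: "s \<le> 0 ==> smooth_step s = 0"
proof -
 assume s: "s \<le> 0"
 have "integral {-1..s} step_raw = integral {-1..s} (\<lambda>_::real. 0::real)" by (rule integral_cong) (use s in \<open>auto simp: step_raw_props\<close>)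
 then show ?thesis by (simp add: smooth_step_def)
qed

lemma smooth_step_1: "1 \<le> s ==> smooth_step s = 1"
proof -
 assume s: "1 \<le> s"
 have 1: "integral {-1..0} step_raw + integral {0..s} step_raw = integral {-1..s} step_raw"
  by (rule Henstock_Kurzweil_Integration.integral_combine) (use s step_raw_integrable in auto)
 have 2: "integral {0..1} step_raw + integral {1..s} step_raw = integral {0..s} step_raw"
  by (rule Henstock_Kurzweil_Integration.integral_combine) (use s step_raw_integrable in auto)
 have 3: "integral {-1..0} step_raw = integral {-1..0} (\<lambda>_::real. 0::real)" by (rule integral_cong) (auto simp: step_raw_props)
 have 4: "integral {1..s} step_raw = integral {1..s} (\<lambda>_::real. 0::real)" by (rule integral_cong) (auto simp: step_raw_props)
 show ?thesis using 1 2 3 4 step_total_pos by (simp add: smooth_step_def step_total_def)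
qed

lemma smooth_step_DERIV: "(smooth_step has_real_derivative step_raw s / step_total) (at s)"
proof (cases "s < 0")
 case True
 have "((\<lambda>_. 0) has_real_derivative 0) (at s)" by simp
 then have "(smooth_step has_real_derivative 0) (at s)"
  by (rule has_field_derivative_transform_within_open[where S="{..<0}"]) (use True smooth_step_0 in auto)
 then show ?thesis using True by (simp add: step_raw_props)
next
 case False
 have "((\<lambda>u. integral {-1..u} step_raw) has_real_derivative step_raw s) (at s within {-1..s + 1})"
  by (rule integral_has_real_derivative[OF step_raw_continuous]) (use False in auto)
 moreover have "at s within {-1..s + 1} = at s" by (rule at_within_interior) (use False in auto)
 ultimately show ?thesis unfolding smooth_step_def by (auto intro!: DERIV_cdivide)
qed

lemma smooth_step_bounds: "0 \<le> smooth_step s" "smooth_step s \<le> 1"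
proof -
 have mono: "smooth_step u \<le> smooth_step v" if "u \<le> v" for u v
 proof (rule DERIV_nonneg_imp_nondecreasing[OF that])
  fix x
  show "\<exists>y. (smooth_step has_real_derivative y) (at x) \<and> 0 \<le> y"
   by (intro exI[of _ "step_raw x / step_total"] conjI smooth_step_DERIV divide_nonneg_pos step_raw_props(1) step_total_pos)
 qed
 show "0 \<le> smooth_step s" using mono[of "min s 0" s] smooth_step_0[of "min s 0"] by simp
 show "smooth_step s \<le> 1" using mono[of s "max s 1"] smooth_step_1[of "max s 1"] by simp
qed

lemma smooth_step_Ck: "Ck k smooth_step"
proof (cases k)
 case 0
 have "isCont smooth_step x" for x by (rule DERIV_isCont[OF smooth_step_DERIV])
 then show ?thesis using 0 by (simp add: continuous_at_imp_continuous_on)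
next
 case (Suc k)
 have "Ck k (\<lambda>s. step_raw s * (1 / step_total))" by (intro Ck_mult step_raw_Ck Ck_const)
 then show ?thesis unfolding Suc by (intro Ck_real_derivative[OF smooth_step_DERIV]) simp
qed

section \<open>The radial kernel and separated test functions\<close>

definition bump :: "real => 'a::euclidean_space => real" where
 "bump r z = flat_exp 0 (r\<^sup>2 - (norm z)^2)"

text \<open>The gradient of \<open>bump\<close>. Index 2 appears because the derivative of
  \<open>flat_exp 0\<close> is \<open>flat_exp 2\<close>, the term with factor j = 0 being zero;
  dependence on the squared norm avoids the singularity of the norm at 0.\<close>

definition bump_grad :: "real => 'a::euclidean_space => 'a" where
 "bump_grad r z = (- 2 * flat_exp 2 (r\<^sup>2 - (norm z)^2)) *\<^sub>R z"

lemma bump_has_derivative: "(bump r has_derivative (\<lambda>v. bump_grad r z \<bullet> v)) (at z)"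
proof -
 have "((\<lambda>z. r\<^sup>2 - (norm z)^2) has_derivative (\<lambda>v. 0 - 2 * (z \<bullet> v))) (at z)"
  unfolding power2_norm_eq_inner
  by (rule has_derivative_diff[OF has_derivative_const])
   (auto intro!: derivative_eq_intros simp: inner_commute)
 moreover have "(flat_exp 0 has_derivative (\<lambda>x. flat_exp 2 (r\<^sup>2 - (norm z)^2) * x)) (at (r\<^sup>2 - (norm z)^2))"
  using flat_exp_DERIV[of 0 "r\<^sup>2 - (norm z)^2"] by (simp add: has_field_derivative_def numeral_2_eq_2)
 ultimately have "((\<lambda>z. flat_exp 0 (r\<^sup>2 - (norm z)^2)) has_derivative
  (\<lambda>v. flat_exp 2 (r\<^sup>2 - (norm z)^2) * (0 - 2 * (z \<bullet> v)))) (at z)"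
  by (rule has_derivative_compose)
 then show ?thesis by (simp add: bump_def[abs_def] bump_grad_def mult_ac)
qed

lemma bump_continuous: "continuous_on S (bump r)" and bump_grad_continuous: "continuous_on S (bump_grad r)"
 unfolding bump_def[abs_def] bump_grad_def[abs_def]
 by (intro continuous_intros continuous_on_compose2[OF flat_exp_continuous]; auto)+

lemma bump_outside:
 assumes "0 \<le> r" "r \<le> norm z"
 shows "bump r z = 0" "bump_grad r z = 0"
proof -
 have "r\<^sup>2 \<le> (norm z)^2" using assms by (intro power_mono) auto
 then show "bump r z = 0" "bump_grad r z = 0" by (auto simp: bump_def bump_grad_def flat_exp_props)
qed

lemma bump_nonneg: "0 \<le> bump r z" by (simp add: bump_def flat_exp_props)

text \<open>The time factor approximates the indicator of the interval from t1 to t2, with ramps of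
  length 1/n beginning at t1 and at t2. As n grows, the weak form becomes an identity integrated
  between these two times.\<close>

definition sep_test :: "real => real => real => real => 'a::euclidean_space => real \<times> 'a => real" where
 "sep_test n t1 t2 r y p = (smooth_step (n * (fst p - t1)) - smooth_step (n * (fst p - t2))) * bump r (snd p - y)"

lemma sep_test_Ck: "Ck k (sep_test n t1 t2 r y)"
proof -
 have lin: "Ck k (\<lambda>p::real \<times> 'a. n * (fst p - t))" for t
  by (intro Ck_mult Ck_const Ck_diff Ck_linear[OF bounded_linear_fst])
 have st: "Ck k (\<lambda>p::real \<times> 'a. smooth_step (n * (fst p - t)))" for t
  by (rule Ck_compose[OF smooth_step_Ck lin])
 have inn: "Ck k (\<lambda>p::real \<times> 'a. snd p \<bullet> i)" for i
  by (rule Ck_linear) (rule bounded_linear_compose[OF bounded_linear_inner_left bounded_linear_snd])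
 have "Ck k (\<lambda>p::real \<times> 'a. r\<^sup>2 - (\<Sum>i\<in>Basis. (snd p \<bullet> i - y \<bullet> i) * (snd p \<bullet> i - y \<bullet> i)))"
  by (intro Ck_diff Ck_const Ck_sum Ck_mult inn)
 moreover have "(\<Sum>i\<in>Basis. (snd p \<bullet> i - y \<bullet> i) * (snd p \<bullet> i - y \<bullet> i)) = (norm (snd p - y))^2" for p :: "real \<times> 'a"
  unfolding power2_norm_eq_inner
  by (subst euclidean_inner[of "snd p - y" "snd p - y"]) (simp add: inner_diff_left)
 ultimately have "Ck k (\<lambda>p::real \<times> 'a. bump r (snd p - y))"
  unfolding bump_def using Ck_compose[OF flat_exp_Ck] by simp
 then show ?thesis unfolding sep_test_def[abs_def] by (intro Ck_mult Ck_diff st)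
qed

lemma sep_test_test_function:
 assumes n: "n > 0" and t: "0 < t1" "t1 \<le> t2" "t2 + 1 / n < T" and r: "0 < r"
 shows "sep_test n t1 t2 r y \<in> test_functions T"
proof -
 have sub: "{p. sep_test n t1 t2 r y p \<noteq> 0} \<subseteq> {t1..t2 + 1 / n} \<times> cball y r"
 proof
  fix p assume "p \<in> {p. sep_test n t1 t2 r y p \<noteq> 0}"
  then have nz: "smooth_step (n * (fst p - t1)) - smooth_step (n * (fst p - t2)) \<noteq> 0" "bump r (snd p - y) \<noteq> 0"
   by (auto simp: sep_test_def)
  have "t1 \<le> fst p"
  proof (rule ccontr)
   assume "\<not> t1 \<le> fst p"
   then have "n * (fst p - t1) \<le> 0" "n * (fst p - t2) \<le> 0" using n t by (auto intro!: mult_nonneg_nonpos)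
   then show False using nz by (simp add: smooth_step_0)
  qed
  moreover have "fst p \<le> t2 + 1 / n"
  proof (rule ccontr)
   assume "\<not> fst p \<le> t2 + 1 / n"
   then have *: "fst p - t2 \<ge> 1 / n" "fst p - t1 \<ge> 1 / n" using t by auto
   have "1 \<le> n * (fst p - t2)" "1 \<le> n * (fst p - t1)"
    using n * by (simp_all add: pos_divide_le_eq mult.commute)
   then show False using nz n by (simp add: smooth_step_1)
  qed
  moreover have "norm (snd p - y) \<le> r" using bump_outside(1)[of r "snd p - y"] nz(2) r by linarith
  ultimately show "p \<in> {t1..t2 + 1 / n} \<times> cball y r" by (auto simp: mem_Times_iff dist_norm norm_minus_commute)
 qed
 have cpt: "compact ({t1..t2 + 1 / n} \<times> cball y r)" by (intro compact_Times) auto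
 then have cl: "closure {p. sep_test n t1 t2 r y p \<noteq> 0} \<subseteq> {t1..t2 + 1 / n} \<times> cball y r"
  using sub by (intro closure_minimal compact_imp_closed)
 have A: "compact (closure {p. sep_test n t1 t2 r y p \<noteq> 0})"
  using cpt cl by (meson closed_closure compact_imp_bounded bounded_subset compact_eq_bounded_closed)
 have "{t1..t2 + 1 / n} \<times> cball y r \<subseteq> {0<..<T} \<times> UNIV"
  using t by (intro Sigma_mono) auto
 then have B: "closure {p. sep_test n t1 t2 r y p \<noteq> 0} \<subseteq> {0<..<T} \<times> UNIV"
  by (rule order_trans[OF cl])
 show ?thesis unfolding test_functions_def mem_Collect_eq by (intro conjI allI A B sep_test_Ck)
qed

lemma sep_test_derivative:
 "frechet_derivative (sep_test n t1 t2 r y) (at (t, x)) (a, v) =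
  a * (n * step_raw (n * (t - t1)) / step_total - n * step_raw (n * (t - t2)) / step_total) * bump r (x - y)
  + (smooth_step (n * (t - t1)) - smooth_step (n * (t - t2))) * (bump_grad r (x - y) \<bullet> v)"
proof -
 have st: "((\<lambda>p::real \<times> 'a. smooth_step (n * (fst p - c))) has_derivative (\<lambda>w. step_raw (n * (t - c)) / step_total * (n * fst w))) (at (t, x))" for c
 proof -
  have 1: "((\<lambda>p::real \<times> 'a. n * (fst p - c)) has_derivative (\<lambda>w. n * fst w)) (at (t, x))"
   by (auto intro!: derivative_eq_intros)
  have 2: "(smooth_step has_derivative (\<lambda>x. step_raw (n * (t - c)) / step_total * x)) (at (n * (fst (t, x) - c)))"
   using smooth_step_DERIV[of "n * (t - c)"] unfolding has_field_derivative_def fst_conv .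
  show ?thesis by (rule has_derivative_compose[OF 1 2])
 qed
 have bp: "((\<lambda>p::real \<times> 'a. bump r (snd p - y)) has_derivative (\<lambda>w. bump_grad r (x - y) \<bullet> snd w)) (at (t, x))"
 proof -
  have 1: "((\<lambda>p::real \<times> 'a. snd p - y) has_derivative (\<lambda>w. snd w)) (at (t, x))"
   by (auto intro!: derivative_eq_intros)
  have 2: "(bump r has_derivative (\<lambda>v. bump_grad r (x - y) \<bullet> v)) (at (snd (t, x) - y))"
   using bump_has_derivative[of r "x - y"] by simp
  show ?thesis by (rule has_derivative_compose[OF 1 2])
 qed
 have "(sep_test n t1 t2 r y has_derivative (\<lambda>w. (smooth_step (n * (fst (t, x) - t1)) - smooth_step (n * (fst (t, x) - t2))) * (bump_grad r (x - y) \<bullet> snd w)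
  + (step_raw (n * (t - t1)) / step_total * (n * fst w) - step_raw (n * (t - t2)) / step_total * (n * fst w)) * bump r (snd (t, x) - y))) (at (t, x))"
  unfolding sep_test_def[abs_def] by (intro has_derivative_mult has_derivative_diff st bp)
 from fun_cong[OF frechet_derivative_at[OF this, symmetric], of "(a, v)"]
 have eq: "frechet_derivative (sep_test n t1 t2 r y) (at (t, x)) (a, v) =
  (smooth_step (n * (t - t1)) - smooth_step (n * (t - t2))) * (bump_grad r (x - y) \<bullet> v)
  + (step_raw (n * (t - t1)) / step_total * (n * a) - step_raw (n * (t - t2)) / step_total * (n * a)) * bump r (x - y)"
  by (simp only: fst_conv snd_conv)
 have "step_raw (n * (t - t1)) / step_total * (n * a) - step_raw (n * (t - t2)) / step_total * (n * a)
  = a * (n * step_raw (n * (t - t1)) / step_total - n * step_raw (n * (t - t2)) / step_total)"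
  by (simp add: divide_inverse algebra_simps)
 then show ?thesis unfolding eq by (simp only: add.commute)
qed

section \<open>Local boundedness of the mass\<close>

text \<open>By Baire, some set on which all functionals are bounded by n contains a ball of radius
  r. The values at its centre and at distance r/2 in direction u differ by at most 2 n, whence the
  constant 4 n / r.\<close>

theorem uniform_boundedness:
 fixes L :: "'i => 'b::{real_normed_vector,complete_space} => real"
 assumes bl: "!!i. i \<in> I ==> bounded_linear (L i)" and pw: "!!u. \<exists>B. \<forall>i\<in>I. \<bar>L i u\<bar> \<le> B"
 shows "\<exists>B\<ge>0. \<forall>i\<in>I. \<forall>u. \<bar>L i u\<bar> \<le> B * norm u"
proof -
 define F where "F = (\<lambda>n::nat. {u. \<forall>i\<in>I. \<bar>L i u\<bar> \<le> real n})"
 have cl: "closed (F n)" for n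
 proof -
  have "F n = (\<Inter>i\<in>I. {u. \<bar>L i u\<bar> \<le> real n})" by (auto simp: F_def)
  moreover have "closed {u. \<bar>L i u\<bar> \<le> real n}" if "i \<in> I" for i
   by (intro closed_Collect_le continuous_intros linear_continuous_on bl that)
  ultimately show ?thesis by auto
 qed
 have un: "(\<Union>n. F n) = UNIV"
 proof safe
  fix u :: 'b
  obtain B where B: "\<forall>i\<in>I. \<bar>L i u\<bar> \<le> B" using pw by blast
  obtain n :: nat where "B \<le> real n" using real_arch_simple by blast
  then have "u \<in> F n" using B by (force simp: F_def)
  then show "u \<in> (\<Union>n. F n)" by blast
 qed auto
 have "\<exists>n. interior (F n) \<noteq> {}"
 proof (rule ccontr)
  assume "\<not> ?thesis"
  then have "euclidean interior_of \<Union> (range F) = {}"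
   by (intro Baire_category_alt) (use cl completely_metrizable_space_euclidean in auto)
  then show False using un by simp
 qed
 then obtain n x where "x \<in> interior (F n)" by blast
 then obtain r where r: "r > 0" "ball x r \<subseteq> F n" by (meson mem_interior)
 show ?thesis
 proof (intro exI[of _ "4 * real n / r"] conjI ballI allI)
  show "0 \<le> 4 * real n / r" using r by simp
  fix i u assume i: "i \<in> I"
  interpret bounded_linear "L i" by (rule bl[OF i])
  show "\<bar>L i u\<bar> \<le> 4 * real n / r * norm u"
  proof (cases "u = 0")
   case True then show ?thesis by (simp add: zero)
  next
   case False
   define c where "c = r / (2 * norm u)"
   have c: "c > 0" using r False by (simp add: c_def)
   have "x + c *\<^sub>R u \<in> ball x r" "x \<in> ball x r" using r False by (auto simp: dist_norm c_def)
   then have "x + c *\<^sub>R u \<in> F n" "x \<in> F n" using r(2) by (blast, blast)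
   then have "\<bar>L i (x + c *\<^sub>R u)\<bar> \<le> real n" "\<bar>L i x\<bar> \<le> real n" using i unfolding F_def by (blast, blast)
   then have "\<bar>c * L i u\<bar> \<le> 2 * real n" by (simp add: add scaleR)
   then have "\<bar>L i u\<bar> \<le> 2 * real n / c" using c by (simp add: abs_mult field_simps)
   also have "\<dots> = 4 * real n / r * norm u" using r False by (simp add: c_def field_simps)
   finally show ?thesis .
  qed
 qed
qed

text \<open>Restricted to a ball the measure is finite, so inner regularity of finite Borel measures
  applies.\<close>

lemma inner_regular_bounded:
 fixes M :: "'a::euclidean_space measure"
 assumes M: "locally_finite_borel M" and A: "A \<in> sets borel" "A \<subseteq> cball 0 r" and e: "0 < e"
 obtains K where "compact K" "K \<subseteq> A" "measure M A \<le> measure M K + e"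
proof -
 let ?C = "cball (0::'a) r"
 define M' where "M' = density M (indicator ?C)"
 have C: "?C \<in> sets M" using lfb_sets[OF M] by simp
 have e': "emeasure M' X = emeasure M (?C \<inter> X)" if "X \<in> sets borel" for X
  unfolding M'_def by (rule emeasure_restricted[OF C]) (use that lfb_sets[OF M] in simp)
 have s: "sets M' = sets borel" using lfb_sets[OF M] by (simp add: M'_def)
 have fin: "emeasure M' (space M') \<noteq> \<infinity>"
  using lfb_cball[OF M, of 0 r] e'[of UNIV] sets_eq_imp_space_eq[OF s] by simp
 have eqA: "emeasure M X = ennreal (measure M X)" if "X \<subseteq> ?C" "X \<in> sets borel" for X
 proof -
  have "emeasure M X \<le> emeasure M ?C" by (rule emeasure_mono[OF that(1) C])
  then have "emeasure M X < \<infinity>" using lfb_cball[OF M, of 0 r] by (rule le_less_trans)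
  then show ?thesis by (intro emeasure_eq_ennreal_measure) auto
 qed
 have ir: "emeasure M' A = (SUP K \<in> {K. K \<subseteq> A \<and> compact K}. emeasure M' K)"
  by (rule inner_regular[OF s fin A(1)])
 show thesis
 proof (cases "measure M A \<le> e")
  case True
  show ?thesis by (rule that[of "{}"]) (use True in auto)
 next
  case False
  have "ennreal (measure M A - e) < emeasure M' A"
   using False e A by (subst e'[OF A(1)]) (simp add: Int_absorb1 eqA ennreal_less_iff)
  then have "\<exists>K\<in>{K. K \<subseteq> A \<and> compact K}. ennreal (measure M A - e) < emeasure M' K"
   unfolding ir less_SUP_iff .
  then obtain K where K: "K \<subseteq> A" "compact K" "ennreal (measure M A - e) < emeasure M' K" by blast
  have Kb: "K \<in> sets borel" using K(2) by (rule borel_compact)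
  have "emeasure M' K = ennreal (measure M K)"
   using K(1) A(2) Kb by (subst e'[OF Kb]) (simp add: Int_absorb1 eqA)
  then have "measure M A - e < measure M K" using K(3) False by (simp add: ennreal_less_iff)
  then show ?thesis using that K by auto
 qed
qed

definition cutoff :: "real => 'a::euclidean_space => real" where
 "cutoff R x = max 0 (min 1 (R + 1 - norm x))"

lemma cutoff_props: "0 \<le> cutoff R x" "cutoff R x \<le> 1" "norm x \<le> R ==> cutoff R x = 1" "norm x > R + 1 ==> cutoff R x = 0"
 by (auto simp: cutoff_def)

lemma cutoff_continuous: "continuous_on S (cutoff R)"
 unfolding cutoff_def[abs_def] by (intro continuous_intros)

text \<open>The variation is a dual norm. A Urysohn function that is 1 on a compact set carrying
  almost all of the positive part, and -1 on one carrying almost all of the negative part, nearly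
  attains it.\<close>

lemma mass_le_dual:
 fixes \<mu> :: "'a::euclidean_space signed_radon"
 assumes B: "!!u. continuous_on UNIV u ==> (!!x. \<bar>u x\<bar> \<le> 1) ==> \<bar>signed_integral \<mu> (\<lambda>x. u x * cutoff R x)\<bar> \<le> B"
 shows "mass \<mu> R \<le> B"
proof (rule field_le_epsilon)
 fix e :: real assume e: "0 < e"
 let ?P = "pos_part \<mu>" and ?N = "neg_part \<mu>" and ?C = "cball (0::'a) (R + 1)"
 note p = signed_radon_parts[of \<mu>]
 obtain E where E: "E \<in> sets borel" "emeasure ?P E = 0" "emeasure ?N (- E) = 0"
  using p(3) by (auto simp: mutually_singular_def)
 \<comment> \<open>Off its compact set the integrand may fall by 2, so each part loses at most 2 d;
   together this is 4 d = e.\<close>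
 define d where "d = e / 4"
 have d: "0 < d" using e by (simp add: d_def)
 have b1: "?C - E \<in> sets borel" "?C \<inter> E \<in> sets borel" using E(1) by auto
 obtain K1 where K1: "compact K1" "K1 \<subseteq> ?C - E" "measure ?P (?C - E) \<le> measure ?P K1 + d"
  using inner_regular_bounded[OF p(1) b1(1) Diff_subset d] by blast
 obtain K2 where K2: "compact K2" "K2 \<subseteq> ?C \<inter> E" "measure ?N (?C \<inter> E) \<le> measure ?N K2 + d"
  using inner_regular_bounded[OF p(2) b1(2) Int_lower1 d] by blast
 have disj: "K1 \<inter> K2 = {}" using K1 K2 by auto
 obtain u :: "'a => real" where u: "continuous_on UNIV u" "!!x. u x \<in> closed_segment 1 (-1)"
  "!!x. x \<in> K1 ==> u x = 1" "!!x. x \<in> K2 ==> u x = -1"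
  using Urysohn[OF compact_imp_closed[OF K1(1)] compact_imp_closed[OF K2(1)] disj] by metis
 have u1: "\<bar>u x\<bar> \<le> 1" for x using u(2)[of x] by (auto simp: closed_segment_eq_real_ivl split: if_splits)
 define w where "w = (\<lambda>x. u x * cutoff R x)"
 have wb: "w \<in> borel_measurable borel"
  unfolding w_def by (intro borel_measurable_continuous_onI continuous_intros u(1) cutoff_continuous)
 have w0: "w x = 0" if "norm x > R + 1" for x using that by (simp add: w_def cutoff_props)
 have w1: "\<bar>w x\<bar> \<le> 1" for x using u1[of x] cutoff_props(1,2)[of R x] by (simp add: w_def abs_mult mult_le_one)
 have cb: "cutoff R \<in> borel_measurable borel" by (intro borel_measurable_continuous_onI cutoff_continuous)
 have est: "measure M (cball 0 R) - 2 * d \<le> (LINT x|M. s * w x)"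
  if M: "locally_finite_borel M" and A: "A \<in> sets borel" "A \<subseteq> ?C" "emeasure M (?C - A) = 0"
   and K: "compact K" "K \<subseteq> A" "measure M A \<le> measure M K + d" and s: "\<bar>s\<bar> = 1" "!!x. x \<in> K ==> s * u x = 1"
  for M :: "'a measure" and A K s
 proof -
  have sM: "sets M = sets borel" by (rule lfb_sets[OF M])
  have Kb: "K \<in> sets borel" using K(1) by (rule borel_compact)
  have fin: "emeasure M X \<noteq> \<infinity>" if "X \<subseteq> ?C" "X \<in> sets borel" for X
   using emeasure_mono[OF that(1), of M] lfb_cball[OF M, of 0 "R + 1"] sM by (auto simp: top_unique)
  have mC: "measure M ?C = measure M A"
  proof -
   have "measure M ?C = measure M (A \<union> (?C - A))" using A(2) by (simp add: Un_absorb1)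
   also have "\<dots> = measure M A + measure M (?C - A)"
    by (rule measure_Union) (use A fin[of A] fin[of "?C - A"] sM in auto)
   finally show ?thesis using A(3) by (simp add: measure_def)
  qed
  have ciI: "integrable M (cutoff R)"
   by (rule lfb_integrable(1)[OF M cb, where R="R+1" and B=1]) (auto simp: cutoff_def)
  have indI: "integrable M (indicat_real X)" if "X \<subseteq> ?C" "X \<in> sets borel" for X
   using fin[OF that] that(2) sM by (intro integrable_real_indicator) (auto simp: less_top)
  have swI: "integrable M (\<lambda>x. s * w x)"
   by (intro integrable_mult_right lfb_integrable(1)[OF M wb w0 w1])
  have KC: "K \<subseteq> ?C" using K(2) A(2) by blast
  have lower: "cutoff R x - 2 * (indicat_real ?C x - indicat_real K x) \<le> s * w x" for x
  proof (cases "x \<in> K")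
   case True
   then show ?thesis using s(2)[OF True] KC by (auto simp: w_def indicator_def mult.assoc[symmetric])
  next
   case False
   show ?thesis
   proof (cases "x \<in> ?C")
    case True
    have "\<bar>s * w x\<bar> \<le> 1" using w1[of x] s(1) by (simp add: abs_mult)
    then have "-1 \<le> s * w x" by linarith
    then show ?thesis using False True cutoff_props(2)[of R x] by (simp add: indicator_def)
   next
    case False
    then show ?thesis using w0[of x] cutoff_props(4)[of R x] KC by (auto simp: indicator_def not_le)
   qed
  qed
  have a1: "measure M (cball 0 R) \<le> integral\<^sup>L M (cutoff R)"
  proof -
   have "integral\<^sup>L M (indicat_real (cball 0 R)) \<le> integral\<^sup>L M (cutoff R)"
    by (rule integral_mono[OF indI ciI]) (auto simp: cutoff_def indicator_def)
   then show ?thesis using lfb_space[OF M] by simp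
  qed
  have a2: "integral\<^sup>L M (cutoff R) - 2 * (measure M ?C - measure M K) \<le> (LINT x|M. s * w x)"
  proof -
   have "(LINT x|M. cutoff R x - 2 * (indicat_real ?C x - indicat_real K x)) \<le> (LINT x|M. s * w x)"
    by (rule integral_mono) (use ciI indI[of ?C] indI[OF KC Kb] swI lower in auto)
   moreover have "(LINT x|M. cutoff R x - 2 * (indicat_real ?C x - indicat_real K x))
    = integral\<^sup>L M (cutoff R) - 2 * (measure M ?C - measure M K)"
    using ciI indI[of ?C] indI[OF KC Kb] lfb_space[OF M] by simp
   ultimately show ?thesis by simp
  qed
  have "2 * (measure M ?C - measure M K) \<le> 2 * d" using K(3) unfolding mC by simp
  then show ?thesis using a1 a2 by linarith
 qed
 have PA: "emeasure ?P (?C - (?C - E)) = 0"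
 proof -
  have "emeasure ?P (?C - (?C - E)) \<le> emeasure ?P E" by (rule emeasure_mono) (use E(1) lfb_sets[OF p(1)] in auto)
  then show ?thesis using E(2) by simp
 qed
 have NA: "emeasure ?N (?C - (?C \<inter> E)) = 0"
 proof -
  have "emeasure ?N (?C - (?C \<inter> E)) \<le> emeasure ?N (- E)" by (rule emeasure_mono) (use E(1) lfb_sets[OF p(2)] in auto)
  then show ?thesis using E(3) by simp
 qed
 have 1: "measure ?P (cball 0 R) - 2 * d \<le> integral\<^sup>L ?P (\<lambda>x. 1 * w x)"
  by (rule est[OF p(1) b1(1) Diff_subset PA K1]) (use u(3) in auto)
 have 2: "measure ?N (cball 0 R) - 2 * d \<le> integral\<^sup>L ?N (\<lambda>x. (-1) * w x)"
  by (rule est[OF p(2) b1(2) Int_lower1 NA K2]) (use u(4) in auto)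
 have "mass \<mu> R - 4 * d \<le> signed_integral \<mu> w"
  using 1 2 by (simp add: mass_def signed_integral_borel[OF wb])
 also have "\<dots> \<le> B" using B[OF u(1) u1] by (simp add: w_def)
 finally show "mass \<mu> R \<le> B + e" by (simp add: d_def)
qed

lemma signed_integral_add:
 fixes g g' :: "'a::euclidean_space => real"
 assumes "g \<in> borel_measurable borel" "!!x. norm x > R ==> g x = 0" "!!x. \<bar>g x\<bar> \<le> B"
  "g' \<in> borel_measurable borel" "!!x. norm x > R' ==> g' x = 0" "!!x. \<bar>g' x\<bar> \<le> B'"
 shows "signed_integral \<mu> (\<lambda>x. g x + g' x) = signed_integral \<mu> g + signed_integral \<mu> g'"
proof -
 have m: "(\<lambda>x. (-1) * g' x) \<in> borel_measurable borel" using assms(4) by simp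
 have "signed_integral \<mu> (\<lambda>x. g x - (-1) * g' x) = signed_integral \<mu> g - signed_integral \<mu> (\<lambda>x. (-1) * g' x)"
  by (rule signed_integral_diff[where R=R and B=B and R'=R' and B'=B']) (use assms m in auto)
 also have "signed_integral \<mu> (\<lambda>x. (-1) * g' x) = (-1) * signed_integral \<mu> g'" by (rule signed_integral_cmult[OF assms(4)])
 finally show ?thesis by simp
qed

text \<open>Integration of u times a cutoff is a bounded functional of u in the Banach space of
  bounded continuous functions. Weak continuity on the compact interval bounds these functionals
  pointwise, hence uniformly, and \<open>mass_le_dual\<close> turns the uniform bound into one for
  the mass.\<close>

theorem mass_bounded:
 fixes f :: "real => 'a::euclidean_space signed_radon"
 assumes f: "f \<in> C_weak T"
 shows "\<exists>M\<ge>0. \<forall>t\<in>{0..T}. mass (f t) R \<le> M"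
proof -
 define L where "L = (\<lambda>t (u :: 'a \<Rightarrow>\<^sub>C real). signed_integral (f t) (\<lambda>x. apply_bcontfun u x * cutoff R x))"
 have cu: "continuous_on UNIV (\<lambda>x. apply_bcontfun u x * cutoff R x)" for u :: "'a \<Rightarrow>\<^sub>C real"
  by (intro continuous_intros cutoff_continuous continuous_on_apply_bcontfun)
 have bu: "(\<lambda>x. apply_bcontfun u x * cutoff R x) \<in> borel_measurable borel" for u :: "'a \<Rightarrow>\<^sub>C real"
  by (rule borel_measurable_continuous_onI[OF cu])
 have zu: "apply_bcontfun u x * cutoff R x = 0" if "norm x > R + 1" for u :: "'a \<Rightarrow>\<^sub>C real" and x
  using that by (simp add: cutoff_props)
 have nu: "\<bar>apply_bcontfun u x * cutoff R x\<bar> \<le> norm u" for u :: "'a \<Rightarrow>\<^sub>C real" and x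
 proof -
  have "\<bar>apply_bcontfun u x * cutoff R x\<bar> \<le> \<bar>apply_bcontfun u x\<bar> * 1"
   using cutoff_props(1,2)[of R x] by (simp add: abs_mult mult_left_le)
  also have "\<dots> \<le> norm u" using norm_bounded[of u x] by simp
  finally show ?thesis .
 qed
 have "\<exists>B\<ge>0. \<forall>t\<in>{0..T}. \<forall>u. \<bar>L t u\<bar> \<le> B * norm u"
 proof (rule uniform_boundedness[where L=L and I="{0..T}"])
  fix t assume "t \<in> {0..T}"
  show "bounded_linear (L t)"
  proof (rule bounded_linear_intro[where K="mass (f t) (R + 1)"])
   show "L t (u + v) = L t u + L t v" for u v
   proof -
    have "signed_integral (f t) (\<lambda>x. apply_bcontfun u x * cutoff R x + apply_bcontfun v x * cutoff R x) = L t u + L t v"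
     unfolding L_def by (rule signed_integral_add[OF bu zu nu bu zu nu])
    then show ?thesis unfolding L_def by (simp add: plus_bcontfun.rep_eq distrib_right)
   qed
   show "L t (c *\<^sub>R u) = c *\<^sub>R L t u" for c u
   proof -
    have "signed_integral (f t) (\<lambda>x. c * (apply_bcontfun u x * cutoff R x)) = c * L t u"
     unfolding L_def by (rule signed_integral_cmult[OF bu])
    then show ?thesis unfolding L_def by (simp add: scaleR_bcontfun.rep_eq mult.assoc)
   qed
   show "norm (L t u) \<le> norm u * mass (f t) (R + 1)" for u
    unfolding L_def using signed_integral_bound[OF bu zu nu] by simp
  qed
 next
  fix u :: "'a \<Rightarrow>\<^sub>C real"
  have "(\<lambda>x. apply_bcontfun u x * cutoff R x) \<in> Cc" by (rule CcI[OF cu zu])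
  then have "continuous_on {0..T} (\<lambda>t. L t u)" unfolding L_def using f C_weak_iff by blast
  then have "bounded ((\<lambda>t. L t u) ` {0..T})" by (intro compact_imp_bounded compact_continuous_image) auto
  then show "\<exists>B. \<forall>t\<in>{0..T}. \<bar>L t u\<bar> \<le> B" by (metis bounded_iff imageI real_norm_def)
 qed
 then obtain B where B: "B \<ge> 0" "!!t u. t \<in> {0..T} ==> \<bar>L t u\<bar> \<le> B * norm u" by blast
 have "mass (f t) R \<le> B" if t: "t \<in> {0..T}" for t
 proof (rule mass_le_dual)
  fix u :: "'a => real" assume u: "continuous_on UNIV u" "!!x. \<bar>u x\<bar> \<le> 1"
  have "u \<in> bcontfun" unfolding bcontfun_def using u by (auto simp: bounded_iff)
  then have U: "apply_bcontfun (Bcontfun u) = u" by (rule Bcontfun_inverse)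
  have "norm (Bcontfun u) \<le> 1" by (rule norm_bound) (use u U in auto)
  then have "B * norm (Bcontfun u) \<le> B * 1" by (intro mult_left_mono B)
  then show "\<bar>signed_integral (f t) (\<lambda>x. u x * cutoff R x)\<bar> \<le> B" using B(2)[OF t, of "Bcontfun u"] by (simp add: L_def U)
 qed
 then show ?thesis using B(1) by blast
qed

section \<open>Mollified solutions\<close>

text \<open>Each kernel is supported in [s, s + 1/(n + 1)], to the right of s, so it eventually lies
  in [0,T] with full mass even when s = 0.\<close>

lemma step_raw_approx_identity:
 fixes g :: "real => real"
 assumes g: "continuous_on {0..T} g" and s: "0 \<le> s" "s < T"
 shows "(\<lambda>n. integral {0..T} (\<lambda>t. (real (Suc n) * step_raw (real (Suc n) * (t - s)) / step_total) * g t)) \<longlonglongrightarrow> g s"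
proof (rule LIMSEQ_I)
 fix e :: real assume e: "0 < e"
 define c where "c = (\<lambda>n t. real (Suc n) * step_raw (real (Suc n) * (t - s)) / step_total)"
 have cc: "continuous_on S (c n)" for S n unfolding c_def
  by (intro continuous_intros continuous_on_compose2[OF step_raw_continuous[of UNIV]]) (use step_total_pos in auto)
 have c0: "0 \<le> c n t" for n t using step_total_pos step_raw_props(1) by (simp add: c_def)
 have cz: "c n t = 0" if "t \<notin> {s..s + 1 / real (Suc n)}" for n t
 proof (cases "t < s")
  case True
  then have "real (Suc n) * (t - s) \<le> 0" by (intro mult_nonneg_nonpos) auto
  then show ?thesis by (simp add: c_def step_raw_props(3))
 next
  case False
  then have "1 \<le> real (Suc n) * (t - s)" using that by (auto simp: field_simps)
  then show ?thesis by (simp add: c_def step_raw_props(4))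
 qed
 have cI: "(c n has_integral 1) {0..T}" if n: "1 / real (Suc n) \<le> T - s" for n
 proof -
  have "((\<lambda>t. smooth_step (real (Suc n) * (t - s))) has_vector_derivative c n t) (at t within {0..T})" for t
  proof -
   have "((\<lambda>t. smooth_step (real (Suc n) * (t - s))) has_real_derivative c n t) (at t within {0..T})"
    unfolding c_def
   proof (rule DERIV_cong[OF DERIV_chain2[OF smooth_step_DERIV, where g="\<lambda>t. real (Suc n) * (t - s)"]])
    show "((\<lambda>t. real (Suc n) * (t - s)) has_real_derivative real (Suc n)) (at t within {0..T})"
     by (auto intro!: derivative_eq_intros)
   qed (simp only: mult_ac times_divide_eq_left times_divide_eq_right)
   then show ?thesis by (simp add: has_real_derivative_iff_has_vector_derivative)
  qed
  then have "(c n has_integral (smooth_step (real (Suc n) * (T - s)) - smooth_step (real (Suc n) * (0 - s)))) {0..T}"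
   using s by (intro fundamental_theorem_of_calculus) auto
  moreover have "1 \<le> real (Suc n) * (T - s)" using n by (simp add: field_simps)
  moreover have "real (Suc n) * (0 - s) \<le> 0" using s by (intro mult_nonneg_nonpos) auto
  ultimately show ?thesis using smooth_step_1 smooth_step_0 by simp
 qed
 \<comment> \<open>Clamping extends g continuously to the line, which treats s = 0 like interior
   points.\<close>
 have "isCont (\<lambda>t. g (max 0 (min T t))) s"
 proof -
  have "continuous_on UNIV (\<lambda>t. g (max 0 (min T t)))"
   by (rule continuous_on_compose2[OF g]) (use s in \<open>auto intro!: continuous_intros\<close>)
  then show ?thesis by (simp add: continuous_on_eq_continuous_at)
 qed
 moreover have "0 < e / 2" using e by simp
 ultimately obtain \<delta> where \<delta>: "\<delta> > 0" "!!t. dist t s < \<delta> ==> dist (g (max 0 (min T t))) (g (max 0 (min T s))) < e / 2"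
  unfolding continuous_at_eps_delta by blast
 have gs: "\<bar>g t - g s\<bar> \<le> e / 2" if "t \<in> {0..T}" "dist t s < \<delta>" for t
  using \<delta>(2)[OF that(2)] that(1) s by (simp add: dist_real_def max_def min_def split: if_splits)
 have dd: "0 < min \<delta> (T - s)" using \<delta>(1) s by simp
 obtain n0 :: nat where n0: "inverse (real (Suc n0)) < min \<delta> (T - s)" using reals_Archimedean[OF dd] by blast
 show "\<exists>no. \<forall>n\<ge>no. norm (integral {0..T} (\<lambda>t. (real (Suc n) * step_raw (real (Suc n) * (t - s)) / step_total) * g t) - g s) < e"
 proof (intro exI allI impI)
  fix n assume n: "n0 \<le> n"
  have "1 / real (Suc n) \<le> 1 / real (Suc n0)" using n by (intro divide_left_mono) auto
  then have nn: "1 / real (Suc n) < \<delta>" "1 / real (Suc n) \<le> T - s" using n0 by (auto simp: inverse_eq_divide)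
  have ig: "(\<lambda>t. c n t * g t) integrable_on {0..T}"
   by (intro integrable_continuous_interval continuous_intros cc g)
  have ik: "c n integrable_on {0..T}" using cI[OF nn(2)] by blast
  have "integral {0..T} (\<lambda>t. c n t * g t) - g s = integral {0..T} (\<lambda>t. c n t * g t) - integral {0..T} (\<lambda>t. c n t * g s)"
   using integral_unique[OF cI[OF nn(2)]] by simp
  also have "\<dots> = integral {0..T} (\<lambda>t. c n t * (g t - g s))"
   using ig integrable_on_mult_left[OF ik, of "g s"] by (subst Henstock_Kurzweil_Integration.integral_diff[symmetric]) (auto simp: algebra_simps)
  finally have eq: "integral {0..T} (\<lambda>t. c n t * g t) - g s = integral {0..T} (\<lambda>t. c n t * (g t - g s))" .
  have "norm (integral {0..T} (\<lambda>t. c n t * (g t - g s))) \<le> integral {0..T} (\<lambda>t. c n t * (e / 2))"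
  proof (rule integral_norm_bound_integral)
   show "(\<lambda>t. c n t * (g t - g s)) integrable_on {0..T}"
    by (intro integrable_continuous_interval continuous_intros cc g)
   show "(\<lambda>t. c n t * (e / 2)) integrable_on {0..T}" by (rule integrable_on_mult_left[OF ik])
   fix t assume t: "t \<in> {0..T}"
   show "norm (c n t * (g t - g s)) \<le> c n t * (e / 2)"
   proof (cases "t \<in> {s..s + 1 / real (Suc n)}")
    case True
    then have "dist t s < \<delta>" using nn by (auto simp: dist_real_def)
    then show ?thesis using mult_left_mono[OF gs[OF t] c0[of n t]] c0[of n t] by (simp add: abs_mult)
   qed (use cz in simp)
  qed
  also have "\<dots> = e / 2" using integral_unique[OF cI[OF nn(2)]] by simp
  finally have "norm (integral {0..T} (\<lambda>t. c n t * g t) - g s) < e" unfolding eq using e by linarith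
  then show "norm (integral {0..T} (\<lambda>t. (real (Suc n) * step_raw (real (Suc n) * (t - s)) / step_total) * g t) - g s) < e"
   by (simp only: c_def)
 qed
qed

text \<open>Test functions live in the open time interval, so estimates come first there. The
  contraction \<open>q n\<close> towards T/2 maps [0,T] into the open interval and tends to the
  identity; continuity of D and of the primitive of m gives the closed interval.\<close>

lemma increment_bound_closure:
 fixes D :: "real => real"
 assumes T: "0 < T" and D: "continuous_on {0..T} D" and m: "m integrable_on {0..T}"
  and le: "!!s t. 0 < s ==> s \<le> t ==> t < T ==> \<bar>D t - D s\<bar> \<le> integral {s..t} m"
  and st: "0 \<le> s" "s \<le> t" "t \<le> T"
 shows "\<bar>D t - D s\<bar> \<le> integral {s..t} m"
proof -
 define H where "H = (\<lambda>t. integral {0..t} m)"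
 have H: "continuous_on {0..T} H" unfolding H_def by (rule indefinite_integral_continuous_1[OF m])
 have Hd: "H t - H s = integral {s..t} m" if "0 \<le> s" "s \<le> t" "t \<le> T" for s t
 proof -
  have "m integrable_on {0..t}" by (rule integrable_on_subinterval[OF m]) (use that in auto)
  then have "integral {0..s} m + integral {s..t} m = integral {0..t} m"
   using that by (intro Henstock_Kurzweil_Integration.integral_combine) auto
  then show ?thesis by (simp add: H_def)
 qed
 define q where "q = (\<lambda>n (u::real). u + (T / 2 - u) * inverse (real (Suc (Suc n))))"
 have ql: "(\<lambda>n. q n u) \<longlonglongrightarrow> u" for u
 proof -
  have "(\<lambda>n. u + (T / 2 - u) * inverse (real (Suc (Suc n)))) \<longlonglongrightarrow> u + (T / 2 - u) * 0"
   by (intro tendsto_intros LIMSEQ_Suc[OF LIMSEQ_inverse_real_of_nat])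
  then show ?thesis by (simp add: q_def)
 qed
 have qi: "0 < q n u" "q n u < T" "q n u \<in> {0..T}" if "0 \<le> u" "u \<le> T" for n u
 proof -
  define l where "l = inverse (real (Suc (Suc n)))"
  have l: "0 < l" "l < 1" by (auto simp: l_def inverse_less_1_iff)
  have e: "q n u = (1 - l) * u + l * (T / 2)" by (simp add: q_def l_def algebra_simps)
  have "0 \<le> (1 - l) * u" "0 < l * (T / 2)" using l that T by auto
  then show "0 < q n u" unfolding e by linarith
  have "(1 - l) * u \<le> (1 - l) * T" "l * (T / 2) < l * T" using l that T by auto
  then show "q n u < T" unfolding e by (simp add: algebra_simps)
  then show "q n u \<in> {0..T}" using \<open>0 < q n u\<close> by simp
 qed
 have qm: "q n s \<le> q n t" for n
 proof -
  define l where "l = inverse (real (Suc (Suc n)))"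
  have l: "0 < l" "l < 1" by (auto simp: l_def inverse_less_1_iff)
  have e: "q n u = (1 - l) * u + l * (T / 2)" for u by (simp add: q_def l_def algebra_simps)
  have "(1 - l) * s \<le> (1 - l) * t" using l st by (intro mult_left_mono) auto
  then show ?thesis unfolding e by simp
 qed
 have seq: "(\<lambda>n. E (q n u)) \<longlonglongrightarrow> E u" if "continuous_on {0..T} E" "0 \<le> u" "u \<le> T" for E :: "real => real" and u
  using that qi(3) ql by (intro continuous_on_tendsto_compose[OF that(1)]) auto
 have "(\<lambda>n. \<bar>D (q n t) - D (q n s)\<bar>) \<longlonglongrightarrow> \<bar>D t - D s\<bar>"
  using st by (intro tendsto_intros seq D) auto
 moreover have "(\<lambda>n. H (q n t) - H (q n s)) \<longlonglongrightarrow> H t - H s"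
  using st by (intro tendsto_intros seq H) auto
 moreover have "\<bar>D (q n t) - D (q n s)\<bar> \<le> H (q n t) - H (q n s)" for n
  using le[OF qi(1) qm qi(2)] Hd[OF _ qm] qi[of s n] qi[of t n] st by fastforce
 ultimately have "\<bar>D t - D s\<bar> \<le> H t - H s" by (intro LIMSEQ_le) auto
 then show ?thesis using Hd st by simp
qed

lemma bump_le_1: "bump r z \<le> 1"
 by (simp add: bump_def flat_exp_def)

lemma bump_grad_bounded_ex:
 fixes r :: real
 assumes "0 < r"
 shows "\<exists>C\<ge>0. \<forall>z::'a::euclidean_space. norm (bump_grad r z) \<le> C"
proof -
 have "compact (bump_grad r ` cball (0::'a) r)"
  by (intro compact_continuous_image bump_grad_continuous compact_cball)
 then obtain C where C: "!!z::'a. z \<in> cball 0 r ==> norm (bump_grad r z) \<le> C"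
  by (meson bounded_iff compact_imp_bounded imageI)
 have "0 \<le> C" using C[of 0] assms by (metis centre_in_cball less_imp_le norm_ge_zero order_trans)
 moreover have "norm (bump_grad r z) \<le> C" for z :: 'a
  using C[of z] bump_outside(2)[of r z] assms \<open>0 \<le> C\<close> by (cases "norm z \<le> r") auto
 ultimately show ?thesis by blast
qed

lemma bump_grad_uniformly_continuous:
 assumes r: "0 < r" and e: "0 < e"
 shows "\<exists>\<delta>>0. \<forall>z z' :: 'a::euclidean_space. norm (z - z') < \<delta> --> norm (bump_grad r z - bump_grad r z') < e"
 by (rule uniformly_continuous_of_bounded_support[OF bump_grad_continuous _ e, of r]) (use r in \<open>auto simp: bump_outside\<close>)

lemma bump_shift_Cc:
 assumes "0 < r"
 shows "(\<lambda>x. bump r (x - y)) \<in> Cc"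
proof (rule CcI)
 show "continuous_on UNIV (\<lambda>x. bump r (x - y))"
  by (rule continuous_on_compose2[OF bump_continuous[of UNIV]]) (auto intro!: continuous_intros)
 show "bump r (x - y) = 0" if "norm x > norm y + r" for x
  using that assms norm_triangle_ineq2[of x y] by (intro bump_outside) auto
qed

section \<open>The mollified solution and its flux\<close>

locale weak_path = measure_path +
 assumes weak: "\<psi> \<in> test_functions T ==> has_bochner_integral (lebesgue_on {0..T})
  (\<lambda>t. signed_integral (f t) (\<lambda>x. frechet_derivative \<psi> (at (t, x)) (1, 0) - frechet_derivative \<psi> (at (t, x)) (0, b t x))) 0"
begin

text \<open>A bound uniform in time exists by \<open>mass_bounded\<close>; one is fixed so that it
  depends on R alone.\<close>

definition massB :: "real => real" where
 "massB R = (SOME M. 0 \<le> M \<and> (\<forall>t\<in>{0..T}. mass (f t) R \<le> M))"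

lemma massB: "0 \<le> massB R" "t \<in> {0..T} ==> mass (f t) R \<le> massB R"
proof -
 have "\<exists>M. 0 \<le> M \<and> (\<forall>t\<in>{0..T}. mass (f t) R \<le> M)" using mass_bounded[OF fC, of R] by blast
 from someI_ex[OF this] show "0 \<le> massB R" "t \<in> {0..T} ==> mass (f t) R \<le> massB R"
  unfolding massB_def by blast+
qed

definition moll :: "real => 'a => real => real" where
 "moll r y t = signed_integral (f t) (\<lambda>x. bump r (x - y))"

text \<open>The mollified equation says that the time derivative of \<open>moll\<close> is minus
  this quantity. With \<open>bc\<close> in place of b the integrand is Borel.\<close>

definition flux :: "real => 'a => real => real" where
 "flux r y t = signed_integral (f t) (\<lambda>x. bump_grad r (x - y) \<bullet> bc t x)"

lemma moll_continuous: "0 < r ==> continuous_on {0..T} (moll r y)"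
 unfolding moll_def using fC bump_shift_Cc C_weak_iff by blast

lemma grad_measurable: "(\<lambda>x. bump_grad r (x - y) \<bullet> bc t x) \<in> borel_measurable borel"
proof -
 have "(\<lambda>x. bump_grad r (x - y)) \<in> borel_measurable borel"
  by (intro borel_measurable_continuous_onI continuous_on_compose2[OF bump_grad_continuous[of UNIV]]) (auto intro!: continuous_intros)
 then show ?thesis using bc_measurable[of t] by simp
qed

lemma grad_outside: "0 < r ==> r \<le> 1 ==> norm y \<le> R ==> norm x > R + 1 ==> bump r (x - y) = 0 \<and> bump_grad r (x - y) = 0"
 using norm_triangle_ineq2[of x y] by (auto intro!: bump_outside)

lemma grad_le:
 assumes t: "t \<in> {0..T}" and x: "norm x \<le> R + 1" and k: "norm k \<le> C"
 shows "\<bar>k \<bullet> bc t x\<bar> \<le> C * (C0 t * (2 + R))"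
proof -
 have C: "0 \<le> C" using k norm_ge_zero[of k] by linarith
 have "\<bar>k \<bullet> bc t x\<bar> \<le> norm k * norm (bc t x)" by (rule Cauchy_Schwarz_ineq2)
 also have "\<dots> \<le> C * (C0 t * (1 + norm x))" using k bc_bound[OF t] C by (intro mult_mono) auto
 also have "\<dots> \<le> C * (C0 t * (2 + R))" using C C0nn[OF t] x by (intro mult_left_mono) auto
 finally show ?thesis .
qed

lemma flux_bound:
 assumes r: "0 < r" "r \<le> 1" and y: "norm y \<le> R" and C: "!!z::'a. norm (bump_grad r z) \<le> C" and t: "t \<in> {0..T}"
 shows "\<bar>flux r y t\<bar> \<le> C * (C0 t * (2 + R)) * massB (R + 1)"
proof -
 have C0: "0 \<le> C" using C[of 0] norm_ge_zero[of "bump_grad r (0::'a)"] by linarith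
 have R0: "0 \<le> R" using y norm_ge_zero[of y] by linarith
 have z: "bump_grad r (x - y) \<bullet> bc t x = 0" if "norm x > R + 1" for x using grad_outside[OF r y that] by simp
 have pos: "0 \<le> C * (C0 t * (2 + R))" using C0 C0nn[OF t] R0 by simp
 have "\<bar>flux r y t\<bar> \<le> C * (C0 t * (2 + R)) * mass (f t) (R + 1)"
  unfolding flux_def
 proof (rule signed_integral_bound[OF grad_measurable z])
  show "\<bar>bump_grad r (x - y) \<bullet> bc t x\<bar> \<le> C * (C0 t * (2 + R))" for x
   using z[of x] grad_le[OF t _ C, of x R "x - y"] pos by (cases "norm x > R + 1") auto
 qed
 also have "\<dots> \<le> C * (C0 t * (2 + R)) * massB (R + 1)" using massB(2)[OF t] pos by (rule mult_left_mono)
 finally show ?thesis .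
qed

text \<open>y enters only through the kernel gradient, which is uniformly continuous; thus limits at
  points of \<open>D\<close> extend to all y.\<close>

lemma flux_diff:
 assumes r: "0 < r" "r \<le> 1" and y: "norm y \<le> R" "norm y' \<le> R" and t: "t \<in> {0..T}"
  and e: "0 \<le> e" "!!x. norm x \<le> R + 1 ==> norm (bump_grad r (x - y) - bump_grad r (x - y')) \<le> e"
 shows "\<bar>flux r y t - flux r y' t\<bar> \<le> e * (C0 t * (2 + R)) * massB (R + 1)"
proof -
 obtain C where C: "C \<ge> 0" "!!z::'a. norm (bump_grad r z) \<le> C" using bump_grad_bounded_ex[OF r(1)] by blast
 have R0: "0 \<le> R" using y(1) norm_ge_zero[of y] by linarith
 define u where "u = (\<lambda>y x. bump_grad r (x - y) \<bullet> bc t x)"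
 have z: "u z x = 0" if "norm z \<le> R" "norm x > R + 1" for x z using grad_outside[OF r that] by (simp add: u_def)
 have ub: "\<bar>u z x\<bar> \<le> C * (C0 t * (2 + R))" if "norm z \<le> R" for x z
  using z[OF that, of x] grad_le[OF t _ C(2), of x R "x - z"] C(1) C0nn[OF t] R0 by (cases "norm x > R + 1") (auto simp: u_def)
 have um: "u z \<in> borel_measurable borel" for z unfolding u_def by (rule grad_measurable)
 have pos: "0 \<le> e * (C0 t * (2 + R))" using e C0nn[OF t] R0 by simp
 have "flux r y t - flux r y' t = signed_integral (f t) (\<lambda>x. u y x - u y' x)"
  unfolding flux_def u_def
  by (rule signed_integral_diff[OF um z[OF y(1)] ub[OF y(1)] um z[OF y(2)] ub[OF y(2)], unfolded u_def, symmetric])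
 also have "\<bar>\<dots>\<bar> \<le> e * (C0 t * (2 + R)) * mass (f t) (R + 1)"
 proof (rule signed_integral_bound)
  show "(\<lambda>x. u y x - u y' x) \<in> borel_measurable borel" using um by simp
  show "u y x - u y' x = 0" if "norm x > R + 1" for x using z that y by simp
  show "\<bar>u y x - u y' x\<bar> \<le> e * (C0 t * (2 + R))" for x
  proof (cases "norm x > R + 1")
   case True then show ?thesis using z y pos by simp
  next
   case False
   then show ?thesis using grad_le[OF t _ e(2), of x R x] by (simp add: u_def inner_diff_left)
  qed
 qed
 also have "\<dots> \<le> e * (C0 t * (2 + R)) * massB (R + 1)" using massB(2)[OF t] pos by (rule mult_left_mono)
 finally show ?thesis .
qed

lemma sep_test_weak:
 assumes r: "0 < r" "r \<le> 1" and n: "n > 0" and t: "0 < t1" "t1 \<le> t2" "t2 + 1 / n < T"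
 shows "((\<lambda>t. (n * step_raw (n * (t - t1)) / step_total - n * step_raw (n * (t - t2)) / step_total) * moll r y t
  - (smooth_step (n * (t - t1)) - smooth_step (n * (t - t2))) * flux r y t) has_integral 0) {0..T}"
proof -
 define \<psi> where "\<psi> = sep_test n t1 t2 r y"
 have tf: "\<psi> \<in> test_functions T" unfolding \<psi>_def by (rule sep_test_test_function[OF n t r(1)])
 let ?q = "\<lambda>t. signed_integral (f t) (\<lambda>x. frechet_derivative \<psi> (at (t, x)) (1, 0) - frechet_derivative \<psi> (at (t, x)) (0, b t x))"
 define c where "c = (\<lambda>t. n * step_raw (n * (t - t1)) / step_total - n * step_raw (n * (t - t2)) / step_total)"
 define p where "p = (\<lambda>t. smooth_step (n * (t - t1)) - smooth_step (n * (t - t2)))"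
 obtain C where C: "C \<ge> 0" "!!z::'a. norm (bump_grad r z) \<le> C" using bump_grad_bounded_ex[OF r(1)] by blast
 have q: "?q t = c t * moll r y t - p t * flux r y t" if g: "good t" for t
 proof -
  have t: "t \<in> {0..T}" using g by (auto simp: good_def)
  have bm: "(\<lambda>x. bump r (x - y)) \<in> borel_measurable borel" by (rule CcD(2)[OF bump_shift_Cc[OF r(1)]])
  have m1: "(\<lambda>x. c t * bump r (x - y)) \<in> borel_measurable borel" using bm by simp
  have m2: "(\<lambda>x. p t * (bump_grad r (x - y) \<bullet> bc t x)) \<in> borel_measurable borel" using grad_measurable by simp
  have z1: "c t * bump r (x - y) = 0" if "norm x > norm y + 1" for x using grad_outside[OF r order_refl that] by simp
  have z2: "p t * (bump_grad r (x - y) \<bullet> bc t x) = 0" if "norm x > norm y + 1" for x using grad_outside[OF r order_refl that] by simp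
  have b1: "\<bar>c t * bump r (x - y)\<bar> \<le> \<bar>c t\<bar>" for x
   using bump_le_1[of r "x - y"] bump_nonneg[of r "x - y"] by (simp add: abs_mult mult_left_le)
  have b2: "\<bar>p t * (bump_grad r (x - y) \<bullet> bc t x)\<bar> \<le> \<bar>p t\<bar> * (C * (C0 t * (2 + norm y)))" for x
  proof (cases "norm x > norm y + 1")
   case True
   have "0 \<le> \<bar>p t\<bar> * (C * (C0 t * (2 + norm y)))" using C0nn[OF t] C(1) by simp
   then show ?thesis by (subst z2[OF True]) simp
  next
   case False
   then show ?thesis using grad_le[OF t _ C(2), of x "norm y" "x - y"] by (auto simp: abs_mult intro: mult_left_mono)
  qed
  have "?q t = signed_integral (f t) (\<lambda>x. c t * bump r (x - y) - p t * (bump_grad r (x - y) \<bullet> b t x))"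
   unfolding \<psi>_def sep_test_derivative by (simp add: c_def p_def)
  also have "\<dots> = signed_integral (f t) (\<lambda>x. c t * bump r (x - y) - p t * (bump_grad r (x - y) \<bullet> bc t x))"
   using signed_integral_bc[OF g, of "\<lambda>x w. c t * bump r (x - y) - p t * (bump_grad r (x - y) \<bullet> w)"] m1 m2 by simp
  also have "\<dots> = signed_integral (f t) (\<lambda>x. c t * bump r (x - y)) - signed_integral (f t) (\<lambda>x. p t * (bump_grad r (x - y) \<bullet> bc t x))"
   by (rule signed_integral_diff[OF m1 z1 b1 m2 z2 b2])
  also have "\<dots> = c t * moll r y t - p t * flux r y t"
   using signed_integral_cmult[OF bm] signed_integral_cmult[OF grad_measurable] by (simp add: moll_def flux_def)
  finally show ?thesis .
 qed
 obtain N where N: "negligible N" "!!t. t \<in> {0<..<T} ==> t \<notin> N ==> good t" using good_AE by blast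
 have hb: "has_bochner_integral (lebesgue_on {0..T}) ?q 0" by (rule weak[OF tf])
 then have "(?q has_integral 0) {0..T}"
  using has_integral_integral_lebesgue_on[of "{0..T}" ?q] by (auto simp: has_bochner_integral_iff)
 then have "((\<lambda>t. c t * moll r y t - p t * flux r y t) has_integral 0) {0..T}"
  by (rule has_integral_spike[where S="N \<union> {0, T}", rotated 2]) (use N q in auto)
 then show ?thesis by (simp add: c_def p_def)
qed

text \<open>Let the ramps of \<open>sep_test\<close> shrink: their derivatives are approximate
  identities and pick out the values of \<open>moll\<close> at t1 and t2, and the time weights
  converge boundedly to the indicator of the interval between.\<close>

lemma flux_has_integral:
 assumes r: "0 < r" "r \<le> 1" and t: "0 < t1" "t1 \<le> t2" "t2 < T"
 shows "(flux r y has_integral (moll r y t1 - moll r y t2)) {t1..t2}"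
proof -
 obtain C where C: "C \<ge> 0" "!!z::'a. norm (bump_grad r z) \<le> C" using bump_grad_bounded_ex[OF r(1)] by blast
 have "0 < T - t2" using t by simp
 then obtain k0 :: nat where k0: "inverse (real (Suc k0)) < T - t2" using reals_Archimedean by blast
 \<comment> \<open>The offset k0 keeps the ramp that begins at t2 below T.\<close>
 define p where "p = (\<lambda>k::nat. real (Suc (k + k0)))"
 have p: "p k > 0" "t2 + 1 / p k < T" for k
 proof -
  show "p k > 0" by (simp add: p_def)
  have "1 / p k \<le> 1 / real (Suc k0)" unfolding p_def by (intro divide_left_mono) auto
  then show "t2 + 1 / p k < T" using k0 by (simp add: inverse_eq_divide)
 qed
 define c where "c = (\<lambda>s k t. p k * step_raw (p k * (t - s)) / step_total)"
 define w where "w = (\<lambda>k t. smooth_step (p k * (t - t1)) - smooth_step (p k * (t - t2)))"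
 have ci: "(\<lambda>t. c s k t * moll r y t) integrable_on {0..T}" for s k
  unfolding c_def
  by (intro integrable_continuous_interval continuous_intros moll_continuous r(1) continuous_on_compose2[OF step_raw_continuous[of UNIV]])
   (use step_total_pos in auto)
 have lim: "(\<lambda>k. integral {0..T} (\<lambda>t. c s k t * moll r y t)) \<longlonglongrightarrow> moll r y s" if "0 \<le> s" "s < T" for s
  using LIMSEQ_ignore_initial_segment[OF step_raw_approx_identity[OF moll_continuous[OF r(1)] that], of k0]
  by (simp only: c_def p_def)
 have wI: "((\<lambda>t. w k t * flux r y t) has_integral
   (integral {0..T} (\<lambda>t. c t1 k t * moll r y t) - integral {0..T} (\<lambda>t. c t2 k t * moll r y t))) {0..T}" for k
 proof -
  have 1: "((\<lambda>t. (c t1 k t - c t2 k t) * moll r y t - w k t * flux r y t) has_integral 0) {0..T}"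
   unfolding c_def w_def by (rule sep_test_weak[OF r p(1) t(1,2) p(2)])
  have "((\<lambda>t. (c t1 k t * moll r y t - c t2 k t * moll r y t) - ((c t1 k t - c t2 k t) * moll r y t - w k t * flux r y t)) has_integral
   ((integral {0..T} (\<lambda>t. c t1 k t * moll r y t) - integral {0..T} (\<lambda>t. c t2 k t * moll r y t)) - 0)) {0..T}"
   by (intro has_integral_diff integrable_integral ci 1)
  then show ?thesis by (simp add: algebra_simps)
 qed
 \<comment> \<open>Half-open, because \<open>smooth_step\<close> is 0 at 0 and the rescaled steps
   tend to 1 strictly to the right.\<close>
 define g where "g = (\<lambda>t. if t1 < t \<and> t \<le> t2 then flux r y t else 0)"
 define m where "m = (\<lambda>t. C * (C0 t * (2 + norm y)) * massB (norm y + 1))"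
 have mi: "m integrable_on {0..T}" unfolding m_def
  by (intro integrable_on_mult_left integrable_on_mult_right C0I)
 have dom: "norm (w k t * flux r y t) \<le> m t" if "t \<in> {0..T}" for k t
 proof -
  have "\<bar>w k t\<bar> \<le> 1" using smooth_step_bounds[of "p k * (t - t1)"] smooth_step_bounds[of "p k * (t - t2)"] by (simp add: w_def abs_le_iff)
  then have "\<bar>w k t\<bar> * \<bar>flux r y t\<bar> \<le> 1 * \<bar>flux r y t\<bar>" by (intro mult_right_mono) auto
  also have "\<dots> \<le> m t" using flux_bound[OF r order_refl C(2) that] by (simp add: m_def)
  finally show ?thesis by (simp add: abs_mult)
 qed
 have pw: "(\<lambda>k. w k t * flux r y t) \<longlonglongrightarrow> g t" for t
 proof -
  have ev: "eventually (\<lambda>k. smooth_step (p k * (t - s)) = (if t \<le> s then 0 else 1)) sequentially" for s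
  proof (cases "t \<le> s")
   case True
   have "p k * (t - s) \<le> 0" for k using True p(1)[of k] by (intro mult_nonneg_nonpos) auto
   then show ?thesis using True smooth_step_0 by simp
  next
   case False
   then have "0 < t - s" by simp
   then obtain k1 :: nat where k1: "inverse (real (Suc k1)) < t - s" using reals_Archimedean by blast
   have "smooth_step (p k * (t - s)) = 1" if "k1 \<le> k" for k
   proof (rule smooth_step_1)
    have "1 \<le> real (Suc k1) * (t - s)" using k1 by (simp add: field_simps)
    also have "\<dots> \<le> p k * (t - s)" using that False by (intro mult_right_mono) (auto simp: p_def)
    finally show "1 \<le> p k * (t - s)" .
   qed
   then show ?thesis using False eventually_sequentially by auto
  qed
  have "eventually (\<lambda>k. w k t * flux r y t = g t) sequentially"
   using ev[of t1] ev[of t2] by eventually_elim (use t in \<open>auto simp: w_def g_def\<close>)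
  then show ?thesis by (rule tendsto_eventually)
 qed
 note dc = dominated_convergence[OF has_integral_integrable[OF wI] mi dom pw]
 have "(\<lambda>k. integral {0..T} (\<lambda>t. c t1 k t * moll r y t) - integral {0..T} (\<lambda>t. c t2 k t * moll r y t)) \<longlonglongrightarrow> moll r y t1 - moll r y t2"
  by (intro tendsto_diff lim) (use t in auto)
 then have "integral {0..T} g = moll r y t1 - moll r y t2"
  using dc(2) unfolding integral_unique[OF wI] by (rule LIMSEQ_unique[symmetric])
 then have "(g has_integral (moll r y t1 - moll r y t2)) {0..T}" using dc(1) by (metis integrable_integral)
 then have "((\<lambda>t. if t \<in> {t1..t2} then flux r y t else 0) has_integral (moll r y t1 - moll r y t2)) {0..T}"
  by (rule has_integral_spike[where S="{t1}", rotated 2]) (auto simp: g_def)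
 moreover have "{t1..t2} \<subseteq> {0..T}" using t by auto
 ultimately show ?thesis by (simp only: has_integral_restrict)
qed

text \<open>A factor by which \<open>C0\<close> dominates the flux uniformly over a ball of centres
  y, fixed because several majorants share it.\<close>

definition speed :: "real => real => real" where
 "speed r R = (SOME S. 0 \<le> S \<and> (\<forall>y. norm y \<le> R --> (\<forall>t\<in>{0..T}. \<bar>flux r y t\<bar> \<le> S * C0 t)))"

lemma speed:
 assumes r: "0 < r" "r \<le> 1" and R: "0 \<le> R"
 shows "0 \<le> speed r R" "norm y \<le> R ==> t \<in> {0..T} ==> \<bar>flux r y t\<bar> \<le> speed r R * C0 t"
proof -
 obtain C where C: "C \<ge> 0" "!!z::'a. norm (bump_grad r z) \<le> C" using bump_grad_bounded_ex[OF r(1)] by blast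
 have "0 \<le> C * (2 + R) * massB (R + 1)" using C(1) R massB(1) by (intro mult_nonneg_nonneg) auto
 moreover have "\<bar>flux r y t\<bar> \<le> C * (2 + R) * massB (R + 1) * C0 t" if "norm y \<le> R" "t \<in> {0..T}" for y t
  using flux_bound[OF r that(1) C(2) that(2)] by (simp add: mult_ac)
 ultimately have ex: "\<exists>S. 0 \<le> S \<and> (\<forall>y. norm y \<le> R --> (\<forall>t\<in>{0..T}. \<bar>flux r y t\<bar> \<le> S * C0 t))" by blast
 from someI_ex[OF ex] show "0 \<le> speed r R" "norm y \<le> R ==> t \<in> {0..T} ==> \<bar>flux r y t\<bar> \<le> speed r R * C0 t"
  unfolding speed_def[symmetric] by blast+
qed

end

context weak_path
begin

lemma moll_increment:
 assumes r: "0 < r" "r \<le> 1" and y: "norm y \<le> R" and st: "0 \<le> s" "s \<le> t" "t \<le> T"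
 shows "\<bar>moll r y t - moll r y s\<bar> \<le> integral {s..t} (\<lambda>u. speed r R * C0 u)"
proof (rule increment_bound_closure[OF T moll_continuous[OF r(1)] _ _ st])
 have R: "0 \<le> R" using y norm_ge_zero[of y] by linarith
 show "(\<lambda>u. speed r R * C0 u) integrable_on {0..T}" by (intro integrable_on_mult_right C0I)
 fix s t :: real assume st: "0 < s" "s \<le> t" "t < T"
 note a = flux_has_integral[OF r st, of y]
 have "norm (integral {s..t} (flux r y)) \<le> integral {s..t} (\<lambda>u. speed r R * C0 u)"
 proof (rule integral_norm_bound_integral)
  show "flux r y integrable_on {s..t}" using a by blast
  show "(\<lambda>u. speed r R * C0 u) integrable_on {s..t}" by (intro integrable_on_mult_right C0Is) (use st in auto)
  show "norm (flux r y u) \<le> speed r R * C0 u" if "u \<in> {s..t}" for u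
   using speed(2)[OF r R y, of u] that st by simp
 qed
 then show "\<bar>moll r y t - moll r y s\<bar> \<le> integral {s..t} (\<lambda>u. speed r R * C0 u)"
  using integral_unique[OF a] by simp
qed

text \<open>Extends integrability to the endpoints 0 and T: exhaust the open interval and use the
  multiple of \<open>C0\<close> as a common majorant.\<close>

lemma flux_integrable:
 assumes r: "0 < r" "r \<le> 1"
 shows "flux r y integrable_on {0..T}"
proof -
 define q where "q = (\<lambda>k::nat. T * inverse (real (Suc (Suc (Suc k)))))"
 define G where "G = (\<lambda>k t. if t \<in> {q k..T - q k} then flux r y t else 0)"
 have q: "0 < q k" "q k \<le> T - q k" "T - q k < T" for k
 proof -
  have "inverse (real (Suc (Suc (Suc k)))) \<le> 1 / 2" by (simp add: field_simps)
  then have "q k \<le> T * (1 / 2)" unfolding q_def using T by (intro mult_left_mono) auto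
  then show "q k \<le> T - q k" by simp
  show "0 < q k" using T by (simp add: q_def)
  then show "T - q k < T" by simp
 qed
 have q0: "q \<longlonglongrightarrow> 0"
  unfolding q_def using tendsto_mult[OF tendsto_const LIMSEQ_Suc[OF LIMSEQ_Suc[OF LIMSEQ_inverse_real_of_nat]], of T] by simp
 define g where "g = (\<lambda>t. if 0 < t \<and> t < T then flux r y t else 0)"
 have "g integrable_on {0..T}"
 proof (rule dominated_convergence(1)[where f=G and h="\<lambda>t. speed r (norm y) * C0 t"])
  show "G k integrable_on {0..T}" for k
  proof -
   have "flux r y integrable_on {q k..T - q k}" using flux_has_integral[OF r q] by blast
   then show ?thesis using q[of k] integrable_restrict_Int[of "{q k..T - q k}" "flux r y" "{0..T}"] by (simp add: G_def Int_absorb2)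
  qed
  show "(\<lambda>t. speed r (norm y) * C0 t) integrable_on {0..T}" by (intro integrable_on_mult_right C0I)
  show "norm (G k t) \<le> speed r (norm y) * C0 t" if "t \<in> {0..T}" for k t
   using speed[OF r, of "norm y"] C0nn[OF that] that by (auto simp: G_def)
  show "(\<lambda>k. G k t) \<longlonglongrightarrow> g t" for t
  proof (cases "0 < t \<and> t < T")
   case True
   then have "0 < min t (T - t)" by simp
   from order_tendstoD(2)[OF q0 this] have "eventually (\<lambda>k. G k t = g t) sequentially"
    by eventually_elim (use True in \<open>auto simp: G_def g_def\<close>)
   then show ?thesis by (rule tendsto_eventually)
  next
   case False
   have "G k t = g t" for k using False q(1)[of k] by (auto simp: G_def g_def)
   then show ?thesis by simp
  qed
 qed
 then show ?thesis by (rule integrable_spike[where S="{0, T}"]) (auto simp: g_def)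
qed

text \<open>One null set must serve all y, because the limit is later integrated in y at fixed t.
  Lebesgue points are taken for y in \<open>D\<close> only, and \<open>flux_diff\<close> carries the
  limit to every y, as it bounds the change in y of the flux and of the time quotients.\<close>

theorem moll_derivative_AE:
 assumes r: "0 < r" "r \<le> 1"
 shows "\<exists>N. negligible N \<and> (\<forall>t\<in>{0<..<T} - N. good t \<and> (\<forall>y h. (\<forall>n. h n > 0 \<and> t + h n < T) --> h \<longlonglongrightarrow> 0 -->
  (\<lambda>n. (moll r y (t + h n) - moll r y t) / h n) \<longlonglongrightarrow> - flux r y t))"
proof -
 have "\<exists>N. negligible N \<and> (\<forall>t. t \<in> {0<..<T} --> t \<notin> N --> Lpoint (flux r z) t)" for z
  using Lebesgue_point_ex[OF flux_integrable[OF r, of z]] unfolding Lpoint_def by blast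
 then obtain Nz where Nz: "!!z. negligible (Nz z)" "!!z t. t \<in> {0<..<T} ==> t \<notin> Nz z ==> Lpoint (flux r z) t"
  by metis
 obtain N0 where N0: "negligible N0" "!!t. t \<in> {0<..<T} ==> t \<notin> N0 ==> good t" using good_AE by blast
 have neg: "negligible (N0 \<union> (\<Union>z\<in>D. Nz z))"
 proof (rule negligible_Un[OF N0(1)])
  have "negligible (\<Union> (Nz ` D))" by (rule negligible_countable_Union) (use D(1) Nz in auto)
  then show "negligible (\<Union>z\<in>D. Nz z)" .
 qed
 show ?thesis
 proof (intro exI[of _ "N0 \<union> (\<Union>z\<in>D. Nz z)"] conjI ballI allI impI neg)
  fix t assume t: "t \<in> {0<..<T} - (N0 \<union> (\<Union>z\<in>D. Nz z))"
  then have t': "0 < t" "t < T" "t \<in> {0..T}" by auto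
  show g: "good t" using t N0 by blast
  fix y :: 'a and h :: "nat => real" assume hh: "\<forall>n. h n > 0 \<and> t + h n < T" and h0: "h \<longlonglongrightarrow> 0"
  have h: "h n > 0" "t + h n < T" "t + h n \<le> T" for n using hh less_imp_le by auto
  obtain K where K: "K \<ge> 0" "!!n. integral {t..t + h n} C0 / h n \<le> K"
   using good_displacement_bounded[OF g h(1,3) h0] by metis
  define R where "R = norm y + 1"
  have R: "0 \<le> R" "norm y \<le> R" by (auto simp: R_def)
  define Q where "Q = (\<lambda>z n. (moll r z (t + h n) - moll r z t) / h n)"
  have QI: "Q z n = - (integral {t..t + h n} (flux r z) /\<^sub>R h n)" for z n
  proof -
   have "integral {t..t + h n} (flux r z) = moll r z t - moll r z (t + h n)"
    using flux_has_integral[OF r t'(1) _ h(2), of n z] h(1)[of n] by (intro integral_unique) simp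
   then have "moll r z (t + h n) - moll r z t = - integral {t..t + h n} (flux r z)" by simp
   then show ?thesis unfolding Q_def by (simp add: divide_inverse mult.commute)
  qed
  have QD: "(\<lambda>n. Q z n) \<longlonglongrightarrow> - flux r z t" if "z \<in> D" for z
  proof -
   have "Lpoint (flux r z) t" using Nz(2)[of t z] t that by blast
   from Lpoint_seq[OF this h0 h(1)] show ?thesis unfolding QI by (rule tendsto_minus)
  qed
  define c where "c = (2 + R) * massB (R + 1)"
  have c: "0 \<le> c" using R massB by (simp add: c_def)
  have "(\<lambda>n. Q y n) \<longlonglongrightarrow> - flux r y t"
  proof (rule LIMSEQ_I)
   fix e0 :: real assume e0: "0 < e0"
   \<comment> \<open>Passing from y to z costs the factor K in the quotients and \<open>C0 t\<close>
     in the flux at t; each of these errors must stay below e0/3, and the limit at z takes the last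
     third.\<close>
   define e where "e = e0 / (3 * (1 + c * (K + C0 t)))"
   have kc: "0 \<le> c * (K + C0 t)" using c K(1) C0nn[OF t'(3)] by simp
   have e: "0 < e" using e0 kc by (simp add: e_def)
   have ece: "e * (c * (K + C0 t)) < e0 / 3"
   proof -
    have "e * (c * (K + C0 t)) < e * (1 + c * (K + C0 t))" using e by simp
    also have "\<dots> = e0 / 3" using kc by (simp add: e_def field_simps)
    finally show ?thesis .
   qed
   obtain \<delta> where \<delta>: "\<delta> > 0" "!!u v :: 'a. norm (u - v) < \<delta> ==> norm (bump_grad r u - bump_grad r v) < e"
    using bump_grad_uniformly_continuous[OF r(1) e] by blast
   have "open (ball y (min \<delta> 1))" "ball y (min \<delta> 1) \<noteq> {}" using \<delta>(1) by auto
   then obtain z where z: "z \<in> D" "z \<in> ball y (min \<delta> 1)" using D(2) by blast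
   have zR: "norm z \<le> R" using z(2) norm_triangle_ineq2[of z y] by (simp add: R_def dist_norm norm_minus_commute)
   have close: "norm (bump_grad r (x - y) - bump_grad r (x - z)) \<le> e" for x
    using \<delta>(2)[of "x - y" "x - z"] z(2) by (simp add: dist_norm norm_minus_commute)
   have ad: "\<bar>flux r y u - flux r z u\<bar> \<le> e * c * C0 u" if "u \<in> {0..T}" for u
    using flux_diff[OF r R(2) zR that less_imp_le[OF e] close] by (simp add: c_def mult_ac)
   have qd: "\<bar>Q y n - Q z n\<bar> \<le> e * c * K" for n
   proof -
    have I: "flux r w integrable_on {t..t + h n}" for w
     using flux_has_integral[OF r t'(1) _ h(2), of n w] h(1)[of n] by (auto simp: integrable_on_def)
    have "norm (integral {t..t + h n} (\<lambda>u. flux r y u - flux r z u)) \<le> integral {t..t + h n} (\<lambda>u. e * c * C0 u)"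
    proof (rule integral_norm_bound_integral)
     show "(\<lambda>u. flux r y u - flux r z u) integrable_on {t..t + h n}" by (intro integrable_diff I)
     show "(\<lambda>u. e * c * C0 u) integrable_on {t..t + h n}" by (intro integrable_on_mult_right C0Is) (use t' h in auto)
     show "norm (flux r y u - flux r z u) \<le> e * c * C0 u" if "u \<in> {t..t + h n}" for u
      using ad[of u] that t' h(3)[of n] by simp
    qed
    also have "\<dots> = e * c * (integral {t..t + h n} C0)" by simp
    also have "\<dots> \<le> e * c * (K * h n)" using K(2)[of n] h(1)[of n] e c by (intro mult_left_mono) (auto simp: field_simps)
    finally have "\<bar>integral {t..t + h n} (flux r y) - integral {t..t + h n} (flux r z)\<bar> \<le> e * c * K * h n"
     using Henstock_Kurzweil_Integration.integral_diff[OF I[of y] I[of z]] by (simp add: mult_ac)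
    moreover have "Q y n - Q z n = - (integral {t..t + h n} (flux r y) - integral {t..t + h n} (flux r z)) / h n"
     unfolding QI using h(1)[of n] by (simp add: field_simps)
    ultimately show ?thesis using h(1)[of n] by (simp add: abs_divide divide_le_eq abs_minus_commute)
   qed
   obtain n0 where n0: "!!n. n \<ge> n0 ==> norm (Q z n - - flux r z t) < e0 / 3"
    using LIMSEQ_D[OF QD[OF z(1)], of "e0 / 3"] e0 by auto
   have "norm (Q y n - - flux r y t) < e0" if "n \<ge> n0" for n
   proof -
    have "e * c * K \<le> e * (c * (K + C0 t))" "e * c * C0 t \<le> e * (c * (K + C0 t))"
     using e c K(1) C0nn[OF t'(3)] by (auto simp: algebra_simps)
    then have "\<bar>Q y n - Q z n\<bar> < e0 / 3" "\<bar>flux r y t - flux r z t\<bar> < e0 / 3"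
     using qd[of n] ad[OF t'(3)] ece by linarith+
    then show ?thesis using n0[OF that] unfolding real_norm_def by linarith
   qed
   then show "\<exists>no. \<forall>n\<ge>no. norm (Q y n - - flux r y t) < e0" by blast
  qed
  then show "(\<lambda>n. (moll r y (t + h n) - moll r y t) / h n) \<longlonglongrightarrow> - flux r y t" by (simp add: Q_def)
 qed
qed

end

section \<open>Averages over small balls\<close>

lemma lfb_lborel: "locally_finite_borel (lborel :: 'a::euclidean_space measure)"
 using emeasure_compact_finite by (auto simp: locally_finite_borel_def)

lemma integral_lborel_translation:
 fixes u :: "'a::euclidean_space => real"
 assumes "u \<in> borel_measurable borel"
 shows "(LBINT y. u (y - c)) = integral\<^sup>L lborel u"
proof -
 have "integral\<^sup>L (distr lborel borel ((+) (- c))) u = (LBINT y. u (- c + y))"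
  by (rule integral_distr) (use assms in auto)
 then show ?thesis by (simp add: lborel_distr_plus)
qed

lemma bump_minus: "bump r (x - y) = bump r (y - x)"
 by (simp add: bump_def norm_minus_commute)

lemma bump_measurable [measurable]: "bump r \<in> borel_measurable borel"
 and bump_grad_measurable [measurable]: "bump_grad r \<in> borel_measurable borel"
 by (intro borel_measurable_continuous_onI bump_continuous bump_grad_continuous)+

text \<open>The normalising constant of the kernel, with a type argument that fixes the dimension.
  The kernel itself stays unnormalised; the division takes place in the limits of vanishing
  scale.\<close>

definition bumpI :: "'a::euclidean_space itself => real => real" where
 "bumpI _ r = integral\<^sup>L lborel (bump r :: 'a => real)"

lemma bump_shift_integral:
 fixes x :: "'a::euclidean_space"
 assumes "0 < r"
 shows "integrable lborel (\<lambda>y. bump r (x - y))" "(LBINT y. bump r (x - y)) = bumpI TYPE('a) r"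
proof -
 have "integrable lborel (\<lambda>y. bump r (y - x))"
 proof (rule lfb_integrable(1)[OF lfb_lborel, where R="norm x + r" and B=1])
  show "\<bar>bump r (y - x)\<bar> \<le> 1" for y using bump_nonneg[of r "y - x"] bump_le_1[of r "y - x"] by simp
  show "bump r (y - x) = 0" if "norm y > norm x + r" for y
   using that assms norm_triangle_ineq2[of y x] by (intro bump_outside) auto
 qed measurable
 then show "integrable lborel (\<lambda>y. bump r (x - y))" by (simp add: bump_minus[of r x])
 show "(LBINT y. bump r (x - y)) = bumpI TYPE('a) r"
  unfolding bump_minus[of r x] bumpI_def by (rule integral_lborel_translation) simp
qed

lemma bumpI_pos:
 assumes "0 < r"
 shows "0 < bumpI TYPE('a::euclidean_space) r"
proof -
 have i: "integrable lborel (bump r :: 'a => real)" using bump_shift_integral(1)[OF assms, of 0] unfolding bump_minus[of r 0] by simp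
 have "0 \<le> bumpI TYPE('a) r" unfolding bumpI_def by (simp add: bump_nonneg)
 moreover have "bumpI TYPE('a) r \<noteq> 0"
 proof
  assume "bumpI TYPE('a) r = 0"
  then have "AE z in lborel. bump r (z::'a) = 0"
   using integral_nonneg_eq_0_iff_AE[OF i] by (simp add: bumpI_def bump_nonneg)
  then obtain N where N: "{z \<in> space lborel. bump r (z::'a) \<noteq> 0} \<subseteq> N" "emeasure lborel N = 0" "N \<in> sets lborel"
   by (rule AE_E)
  have "N \<in> null_sets lebesgue" using N(2,3) by (intro null_sets_completionI) auto
  then have "negligible N" by (simp add: negligible_iff_null_sets)
  moreover have "ball (0::'a) r \<subseteq> N"
  proof
   fix z :: 'a assume "z \<in> ball 0 r"
   then have "(norm z)^2 < r\<^sup>2" by (intro power_strict_mono) auto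
   then have "bump r z > 0" unfolding bump_def by (intro flat_exp_props(2)) simp
   then show "z \<in> N" using N(1) by auto
  qed
  ultimately have "negligible (ball (0::'a) r)" by (rule negligible_subset)
  then show False using open_not_negligible[of "ball (0::'a) r"] assms by simp
 qed
 ultimately show ?thesis by simp
qed

text \<open>A bounded kernel that vanishes off a product of balls is integrable for the product
  measure, both factors being finite there.\<close>

lemma fubini_locally_finite:
 fixes M :: "'a::euclidean_space measure" and k :: "'a => 'a => real"
 assumes M: "locally_finite_borel M" and k: "(\<lambda>p. k (fst p) (snd p)) \<in> borel_measurable (borel \<Otimes>\<^sub>M borel)"
  and z: "!!x y. norm x > R ==> k x y = 0" "!!x y. norm y > R' ==> k x y = 0" and B: "!!x y. \<bar>k x y\<bar> \<le> B"
 shows "integrable lborel (\<lambda>y. (LINT x|M. k x y))"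
  "(LINT x|M. (LBINT y. k x y)) = (LBINT y. (LINT x|M. k x y))"
proof -
 interpret M: sigma_finite_measure M by (rule lfb_sigma_finite[OF M])
 interpret pair_sigma_finite M lborel ..
 have s: "sets (M \<Otimes>\<^sub>M lborel) = sets (borel \<Otimes>\<^sub>M borel)"
  by (rule sets_pair_measure_cong) (simp_all add: lfb_sets[OF M])
 have km: "(\<lambda>p. k (fst p) (snd p)) \<in> borel_measurable (M \<Otimes>\<^sub>M lborel)"
  using k by (subst measurable_cong_sets[OF s refl])
 have C: "cball 0 R \<times> cball 0 R' \<in> sets (M \<Otimes>\<^sub>M lborel)"
  by (intro pair_measureI) (auto simp: lfb_sets[OF M])
 have i: "integrable (M \<Otimes>\<^sub>M lborel) (\<lambda>p. k (fst p) (snd p))"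
 proof (rule integrableI_bounded_set[where A="cball 0 R \<times> cball 0 R'" and B=B])
  have "emeasure (M \<Otimes>\<^sub>M lborel) (cball 0 R \<times> cball (0::'a) R') = emeasure M (cball 0 R) * emeasure lborel (cball (0::'a) R')"
   by (rule lborel.emeasure_pair_measure_Times) (auto simp: lfb_sets[OF M])
  also have "\<dots> < \<infinity>" using lfb_cball[OF M, of 0 R] lfb_cball[OF lfb_lborel, of "0::'a" R'] by (simp add: ennreal_mult_less_top)
  finally show "emeasure (M \<Otimes>\<^sub>M lborel) (cball 0 R \<times> cball (0::'a) R') < \<infinity>" .
  show "AE p in M \<Otimes>\<^sub>M lborel. p \<in> cball 0 R \<times> cball 0 R' --> norm (k (fst p) (snd p)) \<le> B" using B by simp
  show "AE p in M \<Otimes>\<^sub>M lborel. p \<notin> cball 0 R \<times> cball 0 R' --> k (fst p) (snd p) = 0"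
  proof (intro AE_I2 impI)
   fix p :: "'a \<times> 'a" assume "p \<notin> cball 0 R \<times> cball 0 R'"
   then have "norm (fst p) > R \<or> norm (snd p) > R'" by (cases p) auto
   then show "k (fst p) (snd p) = 0" using z by blast
  qed
 qed (use km C in auto)
 then have i': "integrable (M \<Otimes>\<^sub>M lborel) (\<lambda>(x, y). k x y)" by (simp add: case_prod_beta')
 show "integrable lborel (\<lambda>y. (LINT x|M. k x y))" by (rule integrable_snd[OF i'])
 show "(LINT x|M. (LBINT y. k x y)) = (LBINT y. (LINT x|M. k x y))"
  by (rule Fubini_integral[OF i', symmetric])
qed

lemma measurable_sections:
 fixes k :: "'a::euclidean_space => 'a => real"
 assumes k: "(\<lambda>p. k (fst p) (snd p)) \<in> borel_measurable (borel \<Otimes>\<^sub>M borel)"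
 shows "(\<lambda>x. (LBINT y. k x y)) \<in> borel_measurable borel" "(\<lambda>x. k x y) \<in> borel_measurable borel" "k x \<in> borel_measurable borel"
proof -
 have "sets (borel \<Otimes>\<^sub>M (lborel :: 'a measure)) = sets (borel \<Otimes>\<^sub>M borel)"
  by (rule sets_pair_measure_cong) auto
 then have "(\<lambda>p. k (fst p) (snd p)) \<in> borel_measurable (borel \<Otimes>\<^sub>M lborel)"
  using k by (subst measurable_cong_sets[OF _ refl])
 then show "(\<lambda>x. (LBINT y. k x y)) \<in> borel_measurable borel"
  by (intro lborel.borel_measurable_lebesgue_integral) (simp add: case_prod_beta')
 show "(\<lambda>x. k x y) \<in> borel_measurable borel"
  using measurable_compose[OF measurable_Pair2'[of y borel borel] k] by simp
 show "k x \<in> borel_measurable borel"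
  using measurable_compose[OF measurable_Pair1'[of x borel borel] k] by simp
qed

lemma fubini_signed:
 fixes \<mu> :: "'a::euclidean_space signed_radon" and k :: "'a => 'a => real"
 assumes k: "(\<lambda>p. k (fst p) (snd p)) \<in> borel_measurable (borel \<Otimes>\<^sub>M borel)"
  and z: "!!x y. norm x > R ==> k x y = 0" "!!x y. norm y > R' ==> k x y = 0" and B: "!!x y. \<bar>k x y\<bar> \<le> B"
 shows "integrable lborel (\<lambda>y. signed_integral \<mu> (\<lambda>x. k x y))"
  "signed_integral \<mu> (\<lambda>x. (LBINT y. k x y)) = (LBINT y. signed_integral \<mu> (\<lambda>x. k x y))"
proof -
 note s = measurable_sections[OF k]
 note P = fubini_locally_finite[OF signed_radon_parts(1)[of \<mu>] k z B] and N = fubini_locally_finite[OF signed_radon_parts(2)[of \<mu>] k z B]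
 have e: "signed_integral \<mu> (\<lambda>x. k x y) = (LINT x|pos_part \<mu>. k x y) - (LINT x|neg_part \<mu>. k x y)" for y
  by (rule signed_integral_borel[OF s(2)])
 show "integrable lborel (\<lambda>y. signed_integral \<mu> (\<lambda>x. k x y))" unfolding e by (rule Bochner_Integration.integrable_diff[OF P(1) N(1)])
 have "signed_integral \<mu> (\<lambda>x. (LBINT y. k x y))
   = (LBINT y. (LINT x|pos_part \<mu>. k x y)) - (LBINT y. (LINT x|neg_part \<mu>. k x y))"
  by (subst signed_integral_borel[OF s(1)]) (simp only: P(2) N(2))
 also have "\<dots> = (LBINT y. signed_integral \<mu> (\<lambda>x. k x y))"
  unfolding e by (rule Bochner_Integration.integral_diff[OF P(1) N(1), symmetric])
 finally show "signed_integral \<mu> (\<lambda>x. (LBINT y. k x y)) = (LBINT y. signed_integral \<mu> (\<lambda>x. k x y))" .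
qed

lemma signed_integral_abs_bound:
 fixes g w :: "'a::euclidean_space => real"
 assumes g: "g \<in> borel_measurable borel" and w: "w \<in> borel_measurable borel" "!!x. norm x > R ==> w x = 0" "!!x. \<bar>w x\<bar> \<le> B"
  and le: "!!x. \<bar>g x\<bar> \<le> w x"
 shows "\<bar>signed_integral \<mu> g\<bar> \<le> integral\<^sup>L (pos_part \<mu>) w + integral\<^sup>L (neg_part \<mu>) w"
proof -
 have "\<bar>integral\<^sup>L M g\<bar> \<le> integral\<^sup>L M w" if M: "locally_finite_borel M" for M :: "'a measure"
 proof -
  have gz: "g x = 0" if "norm x > R" for x using le[of x] w(2)[OF that] by simp
  have gB: "\<bar>g x\<bar> \<le> B" for x using le[of x] w(3)[of x] by linarith
  have "\<bar>integral\<^sup>L M g\<bar> \<le> (LINT x|M. \<bar>g x\<bar>)" by (rule integral_abs_bound)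
  also have "\<dots> \<le> integral\<^sup>L M w"
   by (rule integral_mono) (use le in \<open>auto intro!: lfb_integrable(1)[OF M w] integrable_abs lfb_integrable(1)[OF M g gz gB]\<close>)
  finally show ?thesis .
 qed
 from this[OF signed_radon_parts(1)[of \<mu>]] this[OF signed_radon_parts(2)[of \<mu>]]
 show ?thesis unfolding signed_integral_borel[OF g] by linarith
qed

text \<open>The mean value theorem along the segment; uniformity in z comes from uniform continuity
  of the gradient, and uniformity in v from the bound V. Dividing by V + 1 covers V = 0.\<close>

lemma bump_difference_quotient:
 assumes r: "0 < r" and e: "0 < e" and V: "0 \<le> V"
 obtains \<delta> where "\<delta> > 0" "!!(z::'a::euclidean_space) v h. norm v \<le> V ==> 0 < h ==> h < \<delta> ==>
  \<bar>(bump r z - bump r (z - h *\<^sub>R v)) / h - bump_grad r z \<bullet> v\<bar> \<le> e"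
proof -
 have "0 < e / (V + 1)" using e V by simp
 then obtain d where d: "d > 0" "!!z z' :: 'a. norm (z - z') < d ==> norm (bump_grad r z - bump_grad r z') < e / (V + 1)"
  using bump_grad_uniformly_continuous[OF r] by blast
 show thesis
 proof (rule that[of "d / (V + 1)"])
  show "0 < d / (V + 1)" using d(1) V by simp
  fix z v :: 'a and h :: real assume v: "norm v \<le> V" and h: "0 < h" "h < d / (V + 1)"
  let ?\<theta> = "\<lambda>s. bump r (z - s *\<^sub>R v)"
  have der: "(?\<theta> has_real_derivative - (bump_grad r (z - s *\<^sub>R v) \<bullet> v)) (at s)" for s
  proof -
   have "((\<lambda>s. z - s *\<^sub>R v) has_derivative (\<lambda>k. - (k *\<^sub>R v))) (at s)" by (auto intro!: derivative_eq_intros)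
   from has_derivative_compose[OF this bump_has_derivative[of r]]
   show ?thesis unfolding has_field_derivative_def by (rule has_derivative_eq_rhs) (auto simp: fun_eq_iff)
  qed
  obtain s where s: "0 < s" "s < h" "?\<theta> h - ?\<theta> 0 = (h - 0) * (- (bump_grad r (z - s *\<^sub>R v) \<bullet> v))"
   using MVT2[OF h(1), of ?\<theta> "\<lambda>s. - (bump_grad r (z - s *\<^sub>R v) \<bullet> v)"] der by blast
  have "(bump r z - bump r (z - h *\<^sub>R v)) / h = bump_grad r (z - s *\<^sub>R v) \<bullet> v"
   using s(3) h(1) by (simp add: field_simps)
  then have "\<bar>(bump r z - bump r (z - h *\<^sub>R v)) / h - bump_grad r z \<bullet> v\<bar> = \<bar>(bump_grad r (z - s *\<^sub>R v) - bump_grad r z) \<bullet> v\<bar>"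
   by (simp add: inner_diff_left)
  also have "\<dots> \<le> norm (bump_grad r (z - s *\<^sub>R v) - bump_grad r z) * norm v" by (rule Cauchy_Schwarz_ineq2)
  also have "\<dots> \<le> e / (V + 1) * V"
  proof (intro mult_mono v)
   have "norm ((z - s *\<^sub>R v) - z) = s * norm v" using s(1) by simp
   also have "\<dots> \<le> h * (V + 1)" using s v V by (intro mult_mono) auto
   also have "\<dots> < d" using h V by (simp add: field_simps)
   finally show "norm (bump_grad r (z - s *\<^sub>R v) - bump_grad r z) \<le> e / (V + 1)" by (intro less_imp_le d(2))
  qed (use e V in auto)
  also have "\<dots> \<le> e" using e V by (simp add: field_simps)
  finally show "\<bar>(bump r z - bump r (z - h *\<^sub>R v)) / h - bump_grad r z \<bullet> v\<bar> \<le> e" .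
 qed
qed

lemma mollification_error:
 fixes u :: "'a::euclidean_space => real"
 assumes r: "0 < r" and i: "integrable lborel (\<lambda>y. u y * bump r (x - y))"
  and c: "!!y. norm (x - y) < r ==> \<bar>u y - u x\<bar> \<le> e"
 shows "\<bar>(LBINT y. u y * bump r (x - y)) / bumpI TYPE('a) r - u x\<bar> \<le> e"
proof -
 let ?Z = "bumpI TYPE('a) r" and ?v = "(LBINT y. u y * bump r (x - y))"
 have Z: "0 < ?Z" by (rule bumpI_pos[OF r])
 have j: "integrable lborel (\<lambda>y. u x * bump r (x - y))" and k: "integrable lborel (\<lambda>y. e * bump r (x - y))"
  by (intro integrable_mult_right bump_shift_integral(1) r)+
 have ij: "integrable lborel (\<lambda>y. (u y - u x) * bump r (x - y))"
  using Bochner_Integration.integrable_diff[OF i j] by (simp add: left_diff_distrib)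
 have eq: "?v - u x * ?Z = (LBINT y. (u y - u x) * bump r (x - y))"
  using Bochner_Integration.integral_diff[OF i j] bump_shift_integral[OF r, of x] by (simp add: left_diff_distrib)
 have "\<bar>?v - u x * ?Z\<bar> \<le> (LBINT y. \<bar>(u y - u x) * bump r (x - y)\<bar>)" unfolding eq by (rule integral_abs_bound)
 also have "\<dots> \<le> (LBINT y. e * bump r (x - y))"
 proof (rule integral_mono[OF integrable_abs[OF ij] k])
  fix y
  show "\<bar>(u y - u x) * bump r (x - y)\<bar> \<le> e * bump r (x - y)"
  proof (cases "norm (x - y) < r")
   case True
   then show ?thesis unfolding abs_mult abs_of_nonneg[OF bump_nonneg] by (intro mult_right_mono[OF _ bump_nonneg] c)
  qed (use r in \<open>simp add: bump_outside\<close>)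
 qed
 also have "\<dots> = e * ?Z" using bump_shift_integral(2)[OF r, of x] by simp
 finally have "\<bar>(?v / ?Z - u x) * ?Z\<bar> \<le> e * ?Z" using Z by (simp add: left_diff_distrib)
 then show ?thesis using Z by (simp add: abs_mult)
qed

section \<open>Mean oscillation of the field\<close>

context compressive
begin

text \<open>Unnormalised mean oscillation around x. Stated with \<open>bc\<close>, it is a Borel
  function of x and can be integrated against both parts of f(t).\<close>

definition Osc :: "real => real => 'a => real" where
 "Osc r t x = (LBINT y. norm (bc t x - bc t y) * bump r (x - y))"

lemma Osc_measurable: "Osc r t \<in> borel_measurable borel"
proof -
 have [measurable]: "bc t \<in> borel_measurable borel" by (rule bc_measurable)
 show ?thesis unfolding Osc_def[abs_def]
  by (rule measurable_sections(1)[where k="\<lambda>x y. norm (bc t x - bc t y) * bump r (x - y)"]) measurable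
qed

lemma Osc_integrand_le:
 assumes t: "t \<in> {0..T}" and r: "0 < r" "r \<le> 1" and x: "norm x \<le> R"
 shows "norm (bc t x - bc t y) * bump r (x - y) \<le> (C0 t * (2 * (2 + R))) * bump r (x - y)"
proof (cases "norm y \<le> R + 1")
 case True
 have "norm (bc t x - bc t y) \<le> norm (bc t x) + norm (bc t y)" by (rule norm_triangle_ineq4)
 also have "\<dots> \<le> C0 t * (1 + norm x) + C0 t * (1 + norm y)" by (intro add_mono bc_bound t)
 also have "\<dots> = C0 t * (2 + norm x + norm y)" by (simp add: algebra_simps)
 also have "\<dots> \<le> C0 t * (2 * (2 + R))" using C0nn[OF t] x True by (intro mult_left_mono) auto
 finally show ?thesis by (intro mult_right_mono bump_nonneg)
next
 case False
 then have "bump r (x - y) = 0" using x r norm_triangle_ineq2[of y x] by (intro bump_outside) (auto simp: norm_minus_commute)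
 then show ?thesis by simp
qed

lemma Osc_integrable:
 assumes t: "t \<in> {0..T}" and r: "0 < r" "r \<le> 1"
 shows "integrable lborel (\<lambda>y. norm (bc t x - bc t y) * bump r (x - y))"
proof (rule Bochner_Integration.integrable_bound)
 show "integrable lborel (\<lambda>y. (C0 t * (2 * (2 + norm x))) * bump r (x - y))"
  by (intro integrable_mult_right bump_shift_integral r)
 have [measurable]: "bc t \<in> borel_measurable borel" by (rule bc_measurable)
 show "(\<lambda>y. norm (bc t x - bc t y) * bump r (x - y)) \<in> borel_measurable lborel" by measurable
 have "norm (norm (bc t x - bc t y) * bump r (x - y)) \<le> norm ((C0 t * (2 * (2 + norm x))) * bump r (x - y))" for y
  using Osc_integrand_le[OF t r order_refl, of x y] bump_nonneg[of r "x - y"] C0nn[OF t] by (simp add: abs_mult)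
 then show "AE y in lborel. norm (norm (bc t x - bc t y) * bump r (x - y)) \<le> norm ((C0 t * (2 * (2 + norm x))) * bump r (x - y))" by simp
qed

lemma Osc_bound:
 assumes t: "t \<in> {0..T}" and r: "0 < r" "r \<le> 1" and x: "norm x \<le> R"
 shows "0 \<le> Osc r t x" "Osc r t x \<le> (C0 t * (2 * (2 + R))) * bumpI TYPE('a) r"
proof -
 show "0 \<le> Osc r t x" unfolding Osc_def by (intro Bochner_Integration.integral_nonneg) (simp add: bump_nonneg)
 have "Osc r t x \<le> (LBINT y. (C0 t * (2 * (2 + R))) * bump r (x - y))"
  unfolding Osc_def by (intro integral_mono Osc_integrable integrable_mult_right bump_shift_integral Osc_integrand_le t r x)
 then show "Osc r t x \<le> (C0 t * (2 * (2 + R))) * bumpI TYPE('a) r" using bump_shift_integral(2)[OF r(1), of x] by simp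
qed

text \<open>Near a continuity point x the values of b(t,.) are close to that at x; inside the
  average they may be read as values of \<open>bc\<close>, since almost every y is a continuity
  point too.\<close>

lemma Osc_tendsto:
 assumes g: "good t" and x: "isCont (b t) x" and r: "!!n. 0 < r n" "!!n. r n \<le> 1" "r \<longlonglongrightarrow> 0"
 shows "(\<lambda>n. Osc (r n) t x / bumpI TYPE('a) (r n)) \<longlonglongrightarrow> 0"
proof (rule LIMSEQ_I)
 fix e :: real assume e: "0 < e"
 have t: "t \<in> {0..T}" using g by (auto simp: good_def)
 obtain d where d: "d > 0" "!!y. dist y x < d ==> dist (b t y) (b t x) < e / 2"
  using x e unfolding continuous_at_eps_delta by (meson half_gt_zero)
 obtain n0 where n0: "!!n. n \<ge> n0 ==> r n < d" using order_tendstoD(2)[OF r(3) d(1)] unfolding eventually_sequentially by blast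
 have ae: "AE y in lborel. isCont (b t) y"
  using good_isCont_AE[OF g] by (simp add: AE_completion_iff)
 have "norm (Osc (r n) t x / bumpI TYPE('a) (r n) - 0) < e" if n: "n \<ge> n0" for n
 proof -
  have "Osc (r n) t x \<le> (LBINT y. e / 2 * bump (r n) (x - y))"
   unfolding Osc_def
  proof (rule integral_mono_AE)
   show "AE y in lborel. norm (bc t x - bc t y) * bump (r n) (x - y) \<le> e / 2 * bump (r n) (x - y)"
    using ae
   proof eventually_elim
    case (elim y)
    show ?case
    proof (cases "norm (x - y) < r n")
     case True
     then have "dist y x < d" using n0[OF n] by (simp add: dist_norm norm_minus_commute)
     from d(2)[OF this] have "norm (bc t x - bc t y) \<le> e / 2"
      using elim x by (simp add: bc_def dist_norm norm_minus_commute)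
     then show ?thesis by (intro mult_right_mono bump_nonneg)
    next
     case False
     then have "bump (r n) (x - y) = 0" using r(1)[of n] by (intro bump_outside) auto
     then show ?thesis by simp
    qed
   qed
  qed (intro Osc_integrable integrable_mult_right bump_shift_integral t r)+
  also have "\<dots> = e / 2 * bumpI TYPE('a) (r n)" using bump_shift_integral(2)[OF r(1)[of n], of x] by simp
  finally have "Osc (r n) t x / bumpI TYPE('a) (r n) \<le> e / 2" using bumpI_pos[OF r(1)[of n], where 'a='a] by (simp add: field_simps)
  moreover have "0 \<le> Osc (r n) t x / bumpI TYPE('a) (r n)"
   using Osc_bound(1)[OF t r(1)[of n] r(2)[of n] order_refl, of x] bumpI_pos[OF r(1)[of n], where 'a='a] by simp
  ultimately show ?thesis using e unfolding real_norm_def by linarith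
 qed
 then show "\<exists>no. \<forall>n\<ge>no. norm (Osc (r n) t x / bumpI TYPE('a) (r n) - 0) < e" by blast
qed

end

section \<open>The commutator estimate\<close>

lemma Lipschitz_continuous:
 fixes u :: "'a::real_normed_vector => real"
 assumes "0 \<le> L" "!!x y. \<bar>u x - u y\<bar> \<le> L * norm (x - y)"
 shows "continuous_on UNIV u"
proof -
 have "L-lipschitz_on UNIV u" by (rule lipschitz_onI) (use assms in \<open>auto simp: dist_norm\<close>)
 then show ?thesis by (rule lipschitz_on_continuous_on)
qed

lemma integrable_indicator_cball:
 "integrable lborel (\<lambda>y. indicat_real (cball (0::'a::euclidean_space) R) y * c)"
 by (intro integrable_mult_left integrable_real_indicator) (use lfb_cball[OF lfb_lborel, of "0::'a" R] in auto)

text \<open>With \<open>u = \<psi>(t + h)\<close>, \<open>\<phi> = \<phi>\<^bsub>t,t+h\<^esub>\<close> and \<open>v = w x\<close> the left-hand side is the part of the difference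
 quotient that is concentrated at \<open>x\<close>; after a translation of \<open>y\<close> by \<open>h *\<^sub>R v\<close> only differences of \<open>w\<close> remain.\<close>

lemma commutator_bound:
 fixes u :: "'a::euclidean_space => real" and w \<phi> :: "'a => 'a"
 assumes L: "0 \<le> L" "!!y z. \<bar>u y - u z\<bar> \<le> L * norm (y - z)" and U: "!!y. \<bar>u y\<bar> \<le> U"
  and z: "!!y. norm y > R ==> u y = 0" and \<phi>m: "\<phi> \<in> borel_measurable borel"
  and w: "w \<in> borel_measurable borel"
  and h: "0 < h" and r: "0 < r" "r \<le> 1" and x: "norm x \<le> R + 1"
  and q: "!!z. \<bar>(bump r z - bump r (z - h *\<^sub>R v)) / h - bump_grad r z \<bullet> v\<bar> \<le> e"
  and Oi: "integrable lborel (\<lambda>y. norm (v - w y) * bump r (x - y))"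
  and Di: "integrable lborel (\<lambda>y. indicat_real (cball 0 (R + 2)) y * norm (w y + (\<phi> y - y) /\<^sub>R h))"
 shows "\<bar>(LBINT y. ((u y - u (\<phi> y)) / h) * bump r (x - y)) - (LBINT y. u y * (bump_grad r (x - y) \<bullet> v))\<bar>
  \<le> L * (LBINT y. norm (v - w y) * bump r (x - y))
   + L * (LBINT y. indicat_real (cball 0 (R + 2)) y * norm (w y + (\<phi> y - y) /\<^sub>R h))
   + U * e * measure lborel (cball (0::'a) R)"
proof -
 have uc: "continuous_on UNIV u" by (rule Lipschitz_continuous[OF L])
 have um: "u \<in> borel_measurable borel" by (rule borel_measurable_continuous_onI[OF uc])
 have u\<phi>: "(\<lambda>y. u (\<phi> y)) \<in> borel_measurable borel" by (rule measurable_compose[OF \<phi>m um])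
 have uv: "(\<lambda>y. u (y - h *\<^sub>R v)) \<in> borel_measurable borel" by (rule measurable_compose[OF _ um]) simp
 have bm: "(\<lambda>y. bump r (x - y)) \<in> borel_measurable borel" by (rule measurable_compose[OF _ bump_measurable]) simp
 have bm': "(\<lambda>y. bump r (x - y - h *\<^sub>R v)) \<in> borel_measurable borel" by (rule measurable_compose[OF _ bump_measurable]) simp
 have gm: "(\<lambda>y. bump_grad r (x - y) \<bullet> v) \<in> borel_measurable borel"
  by (intro borel_measurable_inner measurable_compose[OF _ bump_grad_measurable]) auto
 have b1: "\<bar>bump r y\<bar> \<le> 1" for y :: 'a using bump_le_1[of r y] bump_nonneg[of r y] by simp
 have U0: "0 \<le> U" using U[of 0] by linarith
 have I: "integrable lborel (\<lambda>y. s y * bump r (x - y))" if s: "s \<in> borel_measurable borel" "!!y. \<bar>s y\<bar> \<le> S" for s and S :: real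
 proof (rule lfb_integrable(1)[OF lfb_lborel, where R="R + 2" and B=S])
  show "(\<lambda>y. s y * bump r (x - y)) \<in> borel_measurable borel" using s(1) bm by simp
  show "s y * bump r (x - y) = 0" if "norm y > R + 2" for y
   using that x r norm_triangle_ineq2[of y x] by (auto intro!: bump_outside simp: norm_minus_commute)
  have "0 \<le> S" using s(2)[of 0] by linarith
  then show "\<bar>s y * bump r (x - y)\<bar> \<le> S" for y
   using mult_mono[OF s(2)[of y] b1[of "x - y"]] by (simp add: abs_mult)
 qed
 have J: "integrable lborel (\<lambda>y. u y * s y)" if s: "s \<in> borel_measurable borel" "!!y. \<bar>s y\<bar> \<le> S" for s and S :: real
 proof (rule lfb_integrable(1)[OF lfb_lborel, where R=R and B="U * S"])
  show "(\<lambda>y. u y * s y) \<in> borel_measurable borel" using s(1) um by simp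
  show "\<bar>u y * s y\<bar> \<le> U * S" for y unfolding abs_mult by (intro mult_mono U s U0) auto
 qed (use z in auto)
 obtain C where C: "!!z::'a. norm (bump_grad r z) \<le> C" using bump_grad_bounded_ex[OF r(1)] by blast
 have gb: "\<bar>bump_grad r y \<bullet> v\<bar> \<le> C * norm v" for y
  by (rule order_trans[OF Cauchy_Schwarz_ineq2]) (intro mult_right_mono C norm_ge_zero)
 \<comment> \<open>\<open>?A\<close> keeps the differences of u after the shift by h v has been
   moved from the kernel to u; \<open>?B\<close> is the error made by a difference quotient in place
   of the directional derivative of the kernel.\<close>
 let ?A = "\<lambda>y. ((u (y - h *\<^sub>R v) - u (\<phi> y)) / h) * bump r (x - y)"
 let ?B = "\<lambda>y. u y * ((bump r (x - y) - bump r (x - y - h *\<^sub>R v)) / h - bump_grad r (x - y) \<bullet> v)"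
 have i1: "integrable lborel (\<lambda>y. u y * bump r (x - y))" by (rule I[OF um U])
 have i2: "integrable lborel (\<lambda>y. u (\<phi> y) * bump r (x - y))" by (rule I[OF u\<phi> U])
 have i3: "integrable lborel (\<lambda>y. u (y - h *\<^sub>R v) * bump r (x - y))" by (rule I[OF uv U])
 have i4: "integrable lborel (\<lambda>y. u y * bump r (x - y - h *\<^sub>R v))" by (rule J[OF bm' b1])
 have i5: "integrable lborel (\<lambda>y. u y * (bump_grad r (x - y) \<bullet> v))" by (rule J[OF gm gb])
 have tr: "(LBINT y. u (y - h *\<^sub>R v) * bump r (x - y)) = (LBINT y. u y * bump r (x - y - h *\<^sub>R v))"
 proof -
  have "(\<lambda>y. u y * bump r (x - y - h *\<^sub>R v)) \<in> borel_measurable borel" using um bm' by simp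
  from integral_lborel_translation[OF this, of "h *\<^sub>R v"] show ?thesis by simp
 qed
 have iA: "integrable lborel ?A"
  using Bochner_Integration.integrable_diff[OF i3 i2, THEN integrable_divide_zero, of h] by (simp add: left_diff_distrib diff_divide_distrib)
 have iB: "integrable lborel ?B"
  using Bochner_Integration.integrable_diff[OF Bochner_Integration.integrable_diff[OF i1 i4, THEN integrable_divide_zero, of h] i5]
  by (simp add: right_diff_distrib diff_divide_distrib)
 have A: "integral\<^sup>L lborel ?A = ((LBINT y. u (y - h *\<^sub>R v) * bump r (x - y)) - (LBINT y. u (\<phi> y) * bump r (x - y))) / h"
  using i2 i3 by (simp add: left_diff_distrib diff_divide_distrib)
 have B: "integral\<^sup>L lborel ?B = ((LBINT y. u y * bump r (x - y)) - (LBINT y. u y * bump r (x - y - h *\<^sub>R v))) / h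
  - (LBINT y. u y * (bump_grad r (x - y) \<bullet> v))"
  using i1 i4 i5 by (simp add: right_diff_distrib diff_divide_distrib)
 have "(LBINT y. ((u y - u (\<phi> y)) / h) * bump r (x - y))
   = ((LBINT y. u y * bump r (x - y)) - (LBINT y. u (\<phi> y) * bump r (x - y))) / h"
  using i1 i2 by (simp add: left_diff_distrib diff_divide_distrib)
 then have eq: "(LBINT y. ((u y - u (\<phi> y)) / h) * bump r (x - y)) - (LBINT y. u y * (bump_grad r (x - y) \<bullet> v))
   = integral\<^sup>L lborel ?A + integral\<^sup>L lborel ?B"
  unfolding A B tr by (simp add: diff_divide_distrib)
 let ?O = "\<lambda>y. norm (v - w y) * bump r (x - y)" and ?D = "\<lambda>y. indicat_real (cball 0 (R + 2)) y * norm (w y + (\<phi> y - y) /\<^sub>R h)"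
 have "\<bar>integral\<^sup>L lborel ?A\<bar> \<le> (LBINT y. \<bar>?A y\<bar>)" by (rule integral_abs_bound)
 also have "\<dots> \<le> (LBINT y. L * ?O y + L * ?D y)"
 proof (rule integral_mono)
  show "integrable lborel (\<lambda>y. \<bar>?A y\<bar>)" using iA by (rule integrable_abs)
  show "integrable lborel (\<lambda>y. L * ?O y + L * ?D y)" using Oi Di by (intro Bochner_Integration.integrable_add integrable_mult_right)
  fix y :: 'a
  show "\<bar>?A y\<bar> \<le> L * ?O y + L * ?D y"
  proof (cases "norm y \<le> R + 2")
   case True
   have "\<bar>u (y - h *\<^sub>R v) - u (\<phi> y)\<bar> \<le> L * norm (y - h *\<^sub>R v - \<phi> y)" by (rule L(2))
   \<comment> \<open>Adding and subtracting h w(y) separates the oscillation of w from the deviation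
     of the displacement from its expected velocity -w(y).\<close>
   also have "y - h *\<^sub>R v - \<phi> y = h *\<^sub>R ((w y - v) - (w y + (\<phi> y - y) /\<^sub>R h))" using h by (simp add: algebra_simps)
   also have "norm \<dots> = h * norm ((w y - v) - (w y + (\<phi> y - y) /\<^sub>R h))" using h by simp
   also have "L * (h * norm ((w y - v) - (w y + (\<phi> y - y) /\<^sub>R h))) \<le> L * (h * (norm (v - w y) + norm (w y + (\<phi> y - y) /\<^sub>R h)))"
    using L(1) h norm_triangle_ineq4[of "w y - v" "w y + (\<phi> y - y) /\<^sub>R h"]
    by (intro mult_left_mono) (auto simp: norm_minus_commute)
   finally have "\<bar>(u (y - h *\<^sub>R v) - u (\<phi> y)) / h\<bar> \<le> L * (norm (v - w y) + norm (w y + (\<phi> y - y) /\<^sub>R h))"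
    using h by (simp add: abs_divide divide_le_eq mult_ac)
   then have "\<bar>?A y\<bar> \<le> L * (norm (v - w y) + norm (w y + (\<phi> y - y) /\<^sub>R h)) * bump r (x - y)"
    unfolding abs_mult abs_of_nonneg[OF bump_nonneg] by (rule mult_right_mono[OF _ bump_nonneg])
   also have "\<dots> = L * ?O y + (L * norm (w y + (\<phi> y - y) /\<^sub>R h)) * bump r (x - y)" by (simp add: algebra_simps)
   also have "\<dots> \<le> L * ?O y + (L * norm (w y + (\<phi> y - y) /\<^sub>R h)) * 1"
    using L(1) bump_le_1[of r "x - y"] by (intro add_left_mono mult_left_mono) auto
   finally show ?thesis using True by simp
  next
   case False
   then have "bump r (x - y) = 0" using x r norm_triangle_ineq2[of y x] by (intro bump_outside) (auto simp: norm_minus_commute)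
   then show ?thesis using L(1) by simp
  qed
 qed
 also have "\<dots> = L * integral\<^sup>L lborel ?O + L * integral\<^sup>L lborel ?D"
  using Oi Di by (subst Bochner_Integration.integral_add) (auto intro!: integrable_mult_right)
 finally have 1: "\<bar>integral\<^sup>L lborel ?A\<bar> \<le> L * integral\<^sup>L lborel ?O + L * integral\<^sup>L lborel ?D" .
 have "\<bar>integral\<^sup>L lborel ?B\<bar> \<le> (U * e) * measure lborel (cball (0::'a) R)"
 proof (rule lfb_integrable(2)[OF lfb_lborel])
  show "?B \<in> borel_measurable borel" using borel_measurable_integrable[OF iB] by simp
  show "\<bar>?B y\<bar> \<le> U * e" for y unfolding abs_mult by (intro mult_mono U q U0) auto
 qed (use z in auto)
 then show ?thesis using 1 unfolding eq by linarith
qed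

section \<open>The test function transported along the flow\<close>

locale transported_test = weak_path +
 fixes g :: "'a => real" and L R0 \<tau> :: real
 assumes gL: "!!x y. \<bar>g x - g y\<bar> \<le> L * norm (x - y)" and L0: "0 \<le> L"
  and gz: "!!x. norm x > R0 ==> g x = 0" and R0: "0 \<le> R0" and \<tau>: "0 < \<tau>" "\<tau> \<le> T"
begin

definition psi :: "real => 'a => real" where "psi t y = g (flow b T t \<tau> y)"

text \<open>\<open>R1\<close>, \<open>L1\<close> and \<open>B1\<close> are a support radius, a
  Lipschitz constant and a sup bound common to all \<open>psi t\<close> with t in
  [0,\<tau>].\<close>

definition R1 :: real where "R1 = rad R0"
definition L1 :: real where "L1 = L * lam"
definition B1 :: real where "B1 = L * (2 * R0 + 1)"

lemma nonnegs: "0 \<le> R1" "0 \<le> L1" "0 \<le> B1" "0 \<le> rad R1"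
 using rad_nonneg L0 lam_pos R0 by (auto simp: R1_def L1_def B1_def)

lemma psi_zero: "0 \<le> t ==> t \<le> \<tau> ==> norm y > R1 ==> psi t y = 0"
 using gz[of "flow b T t \<tau> y"] flow_support[of t \<tau> y R0] \<tau> by (fastforce simp: psi_def R1_def)

lemma psi_zero_all: "0 \<le> t ==> t \<le> \<tau> ==> \<forall>y. norm y > R1 --> psi t y = 0"
 using psi_zero by blast

lemma psi_Lipschitz: "0 \<le> t ==> t \<le> \<tau> ==> \<bar>psi t y - psi t z\<bar> \<le> L1 * norm (y - z)"
proof -
 assume t: "0 \<le> t" "t \<le> \<tau>"
 have "\<bar>psi t y - psi t z\<bar> \<le> L * norm (flow b T t \<tau> y - flow b T t \<tau> z)" unfolding psi_def by (rule gL)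
 also have "\<dots> \<le> L * (lam * norm (y - z))" by (intro mult_left_mono flow_Lipschitz L0) (use t \<tau> in auto)
 finally show ?thesis by (simp add: L1_def)
qed

text \<open>Comparison with a point of norm R0 + 1, where g vanishes, at distance at most 2 R0 +
  1.\<close>

lemma g_bound: "\<bar>g x\<bar> \<le> B1"
proof (cases "norm x \<le> R0")
 case True
 obtain i :: 'a where i: "i \<in> Basis" using nonempty_Basis by blast
 let ?z = "(R0 + 1) *\<^sub>R i"
 have nz: "norm ?z = R0 + 1" using i R0 by simp
 have "\<bar>g x - g ?z\<bar> \<le> L * norm (x - ?z)" by (rule gL)
 also have "\<dots> \<le> L * (2 * R0 + 1)" using True nz norm_triangle_ineq4[of x ?z] by (intro mult_left_mono L0) simp
 finally show ?thesis using gz[of ?z] nz by (simp add: B1_def)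
next
 case False then show ?thesis using gz[of x] nonnegs(3) by simp
qed

lemma psi_bound: "\<bar>psi t y\<bar> \<le> B1" unfolding psi_def by (rule g_bound)

lemma psi_continuous: "0 \<le> t ==> t \<le> \<tau> ==> continuous_on UNIV (psi t)"
proof -
 assume t: "0 \<le> t" "t \<le> \<tau>"
 have gc: "continuous_on UNIV g" by (rule Lipschitz_continuous[OF L0 gL])
 show ?thesis unfolding psi_def[abs_def]
  by (rule continuous_on_compose2[OF gc flow_continuous]) (use t \<tau> in auto)
qed

lemma psi_measurable: "0 \<le> t ==> t \<le> \<tau> ==> psi t \<in> borel_measurable borel"
 by (intro borel_measurable_continuous_onI psi_continuous)

lemma psi_flow: "0 \<le> s ==> s \<le> t ==> t \<le> \<tau> ==> psi s y = psi t (flow b T s t y)"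
 unfolding psi_def using flow_semigroup[of s t \<tau> y] \<tau> by simp

text \<open>psi is constant along flow lines, so its change in time at y equals its change in space
  between y and the displaced point.\<close>

lemma psi_time:
 assumes st: "0 \<le> s" "s \<le> t" "t \<le> \<tau>"
 shows "\<bar>psi t y - psi s y\<bar> \<le> L1 * ((1 + rad R1) * integral {s..t} C0)"
proof (cases "norm y \<le> R1")
 case True
 have "\<bar>psi t y - psi s y\<bar> \<le> L1 * norm (y - flow b T s t y)"
  using psi_Lipschitz[of t y "flow b T s t y"] psi_flow[OF st] st by simp
 also have "\<dots> \<le> L1 * ((1 + rad R1) * integral {s..t} C0)"
  using flow_displacement[of s t y R1] True st \<tau> by (intro mult_left_mono nonnegs) (auto simp: norm_minus_commute)
 finally show ?thesis .
next
 case False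
 then have "psi t y = 0" "psi s y = 0" using psi_zero st by auto
 moreover have "0 \<le> L1 * ((1 + rad R1) * integral {s..t} C0)"
  using nonnegs IC0_nonneg[of s t] st \<tau> by (intro mult_nonneg_nonneg) auto
 ultimately show ?thesis by simp
qed

definition conv :: "real => ('a => real) => 'a => real" where
 "conv r u x = (LBINT y. u y * bump r (x - y))"

text \<open>Formally the derivative of \<open>conv r u\<close> at x in direction
  \<open>bc t x\<close>, with the gradient on the kernel.\<close>

definition gconv :: "real => real => ('a => real) => 'a => real" where
 "gconv r t u x = (LBINT y. u y * (bump_grad r (x - y) \<bullet> bc t x))"

text \<open>By Fubini, a mollified function integrated against f(t) is the function integrated
  against the mollified measure. The first form is bounded by the mass, the second gives access to
  the time dependence of \<open>moll\<close>.\<close>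

lemma conv_props:
 assumes r: "0 < r" "r \<le> 1" and u: "u \<in> borel_measurable borel" "!!y. \<bar>u y\<bar> \<le> U" "\<forall>y. norm y > R1 --> u y = 0"
 shows "conv r u \<in> borel_measurable borel" "norm x > R1 + 1 ==> conv r u x = 0" "\<bar>conv r u x\<bar> \<le> U * bumpI TYPE('a) r"
  "integrable lborel (\<lambda>y. u y * bump r (x - y))"
  "integrable lborel (\<lambda>y. u y * moll r y t)" "signed_integral (f t) (conv r u) = (LBINT y. u y * moll r y t)"
proof -
 note u3 = u(3)[rule_format]
 have [measurable]: "u \<in> borel_measurable borel" by (rule u)
 have k: "(\<lambda>p. u (snd p) * bump r (fst p - snd p)) \<in> borel_measurable (borel \<Otimes>\<^sub>M borel)" by measurable
 have kz: "u y * bump r (x - y) = 0" if "norm x > R1 + 1" for x y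
  using grad_outside[OF r _ that, of y] u3[of y] by (cases "norm y \<le> R1") auto
 have kz': "u y * bump r (x - y) = 0" if "norm y > R1" for x y using u3[OF that] by simp
 have kB: "\<bar>u y * bump r (x - y)\<bar> \<le> U * bump r (x - y)" for x y
  unfolding abs_mult using u(2)[of y] bump_nonneg[of r "x - y"] by (simp add: mult_right_mono)
 have U: "0 \<le> U" using u(2)[of 0] by linarith
 have kB': "\<bar>u y * bump r (x - y)\<bar> \<le> U" for x y
  using kB[of y x] mult_left_mono[OF bump_le_1[of r "x - y"] U] by linarith
 note sec = measurable_sections[OF k]
 show "conv r u \<in> borel_measurable borel" unfolding conv_def[abs_def] by (rule sec(1))
 show "conv r u x = 0" if "norm x > R1 + 1" unfolding conv_def by (simp only: kz[OF that] Bochner_Integration.integral_zero)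
 show i: "integrable lborel (\<lambda>y. u y * bump r (x - y))"
  by (rule lfb_integrable(1)[OF lfb_lborel sec(3)[of x] kz' kB'])
 have "\<bar>conv r u x\<bar> \<le> (LBINT y. \<bar>u y * bump r (x - y)\<bar>)" unfolding conv_def by (rule integral_abs_bound)
 also have "\<dots> \<le> (LBINT y. U * bump r (x - y))"
  by (intro integral_mono integrable_abs[OF i] integrable_mult_right bump_shift_integral(1) r kB)
 also have "\<dots> = U * bumpI TYPE('a) r" using bump_shift_integral(2)[OF r(1), of x] by simp
 finally show "\<bar>conv r u x\<bar> \<le> U * bumpI TYPE('a) r" .
 have m: "signed_integral (f t) (\<lambda>x. u y * bump r (x - y)) = u y * moll r y t" for y
  unfolding moll_def by (rule signed_integral_cmult) measurable
 show "integrable lborel (\<lambda>y. u y * moll r y t)"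
  using fubini_signed(1)[where \<mu>="f t", OF k kz kz' kB'] by (simp add: m)
 show "signed_integral (f t) (conv r u) = (LBINT y. u y * moll r y t)"
  unfolding conv_def[abs_def] using fubini_signed(2)[where \<mu>="f t", OF k kz kz' kB'] by (simp add: m)
qed

lemma gconv_props:
 assumes r: "0 < r" "r \<le> 1" and u: "u \<in> borel_measurable borel" "!!y. \<bar>u y\<bar> \<le> U" "\<forall>y. norm y > R1 --> u y = 0"
  and t: "t \<in> {0..T}"
 shows "gconv r t u \<in> borel_measurable borel" "norm x > R1 + 1 ==> gconv r t u x = 0" "\<exists>G. \<forall>x. \<bar>gconv r t u x\<bar> \<le> G"
  "integrable lborel (\<lambda>y. u y * flux r y t)" "signed_integral (f t) (gconv r t u) = (LBINT y. u y * flux r y t)"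
proof -
 note u3 = u(3)[rule_format]
 have [measurable]: "u \<in> borel_measurable borel" "bc t \<in> borel_measurable borel" by (rule u bc_measurable)+
 obtain C where C: "C \<ge> 0" "!!z::'a. norm (bump_grad r z) \<le> C" using bump_grad_bounded_ex[OF r(1)] by blast
 have k: "(\<lambda>p. u (snd p) * (bump_grad r (fst p - snd p) \<bullet> bc t (fst p))) \<in> borel_measurable (borel \<Otimes>\<^sub>M borel)" by measurable
 have kz: "u y * (bump_grad r (x - y) \<bullet> bc t x) = 0" if "norm x > R1 + 1" for x y
  using grad_outside[OF r _ that, of y] u3[of y] by (cases "norm y \<le> R1") auto
 have kz': "u y * (bump_grad r (x - y) \<bullet> bc t x) = 0" if "norm y > R1" for x y using u3[OF that] by simp
 have U: "0 \<le> U" using u(2)[of 0] by linarith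
 define K where "K = U * (C * (C0 t * (2 + R1)))"
 have K0: "0 \<le> K" unfolding K_def using U C C0nn[OF t] nonnegs by (intro mult_nonneg_nonneg) auto
 have kB: "\<bar>u y * (bump_grad r (x - y) \<bullet> bc t x)\<bar> \<le> K" for x y
 proof (cases "norm x > R1 + 1")
  case True show ?thesis using K0 by (simp only: kz[OF True] abs_zero)
 next
  case False
  then have "\<bar>bump_grad r (x - y) \<bullet> bc t x\<bar> \<le> C * (C0 t * (2 + R1))" by (intro grad_le t C) auto
  then show ?thesis unfolding abs_mult K_def by (intro mult_mono u U) auto
 qed
 note sec = measurable_sections[OF k]
 show "gconv r t u \<in> borel_measurable borel" unfolding gconv_def[abs_def] by (rule sec(1))
 show "gconv r t u x = 0" if "norm x > R1 + 1" unfolding gconv_def by (simp only: kz[OF that] Bochner_Integration.integral_zero)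
 have "\<bar>gconv r t u x\<bar> \<le> K * measure lborel (cball (0::'a) R1)" for x
  unfolding gconv_def by (rule lfb_integrable(2)[OF lfb_lborel sec(3)[of x] kz' kB])
 then show "\<exists>G. \<forall>x. \<bar>gconv r t u x\<bar> \<le> G" by blast
 have m: "signed_integral (f t) (\<lambda>x. u y * (bump_grad r (x - y) \<bullet> bc t x)) = u y * flux r y t" for y
  unfolding flux_def by (rule signed_integral_cmult[OF grad_measurable])
 show "integrable lborel (\<lambda>y. u y * flux r y t)"
  using fubini_signed(1)[where \<mu>="f t", OF k kz kz' kB] by (simp add: m)
 show "signed_integral (f t) (gconv r t u) = (LBINT y. u y * flux r y t)"
  unfolding gconv_def[abs_def] using fubini_signed(2)[where \<mu>="f t", OF k kz kz' kB] by (simp add: m)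
qed

text \<open>Pairing of f(t) with the mollified psi; normalised, it tends to the pairing with psi
  itself as the scale r vanishes.\<close>

definition F :: "real => real => real" where "F r t = signed_integral (f t) (conv r (psi t))"

text \<open>A discrete product rule: the change of \<open>moll\<close> with psi kept at the later
  time, bounded by \<open>moll_increment\<close>, plus the change of psi with f kept at the earlier
  time, bounded by \<open>psi_time\<close> and the mass.\<close>

lemma F_increments:
 assumes r: "0 < r" "r \<le> 1"
 shows "\<exists>K. dom_increments 0 \<tau> (\<lambda>t. K * C0 t) (F r)"
proof -
 define V where "V = measure lborel (cball (0::'a) R1)"
 define K where "K = (L1 * (1 + rad R1) * bumpI TYPE('a) r) * massB (R1 + 1) + B1 * speed r R1 * V"
 have K0: "0 \<le> K" unfolding K_def V_def
  using nonnegs bumpI_pos[OF r(1), where 'a='a] massB(1) speed(1)[OF r nonnegs(1)] by (intro add_nonneg_nonneg mult_nonneg_nonneg) auto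
 have "dom_increments 0 \<tau> (\<lambda>t. K * C0 t) (F r)"
  unfolding dom_increments_def
 proof (intro conjI ballI allI impI)
  show "(\<lambda>t. K * C0 t) integrable_on {0..\<tau>}" by (intro integrable_on_mult_right C0Is) (use \<tau> in auto)
  show "0 \<le> K * C0 t" if "t \<in> {0..\<tau>}" for t using K0 C0nn[of t] that \<tau> by simp
  fix s t assume st: "0 \<le> s" "s \<le> t" "t \<le> \<tau>"
  then have sT: "s \<in> {0..T}" "t \<in> {0..T}" "s \<le> \<tau>" "0 \<le> t" "t \<le> T" using \<tau> by auto
  define I where "I = integral {s..t} C0"
  have I0: "0 \<le> I" unfolding I_def by (rule IC0_nonneg) (use sT in auto)
  note pt = conv_props[OF r psi_measurable[OF sT(4) st(3)] psi_bound psi_zero_all[OF sT(4) st(3)]]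
  note ps = conv_props[OF r psi_measurable[OF st(1) sT(3)] psi_bound psi_zero_all[OF st(1) sT(3)]]
  have dm: "(\<lambda>y. psi t y - psi s y) \<in> borel_measurable borel" using psi_measurable st sT by simp
  have dz: "\<forall>y. norm y > R1 --> psi t y - psi s y = 0" using psi_zero st sT by simp
  note pd = conv_props[OF r dm psi_time[OF st] dz]
  have "F r t - F r s = (LBINT y. psi t y * moll r y t) - (LBINT y. psi s y * moll r y s)"
   by (simp add: F_def pt(6) ps(6))
  also have "\<dots> = (LBINT y. psi t y * (moll r y t - moll r y s)) + (LBINT y. (psi t y - psi s y) * moll r y s)"
   using pt(5)[of t] pt(5)[of s] ps(5)[of s] by (simp add: right_diff_distrib left_diff_distrib)
  finally have eq: "F r t - F r s = (LBINT y. psi t y * (moll r y t - moll r y s)) + signed_integral (f s) (conv r (\<lambda>y. psi t y - psi s y))"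
   by (simp add: pd(6))
  have "\<bar>signed_integral (f s) (conv r (\<lambda>y. psi t y - psi s y))\<bar> \<le> (L1 * ((1 + rad R1) * I) * bumpI TYPE('a) r) * mass (f s) (R1 + 1)"
   unfolding I_def by (rule signed_integral_bound[OF pd(1-3)])
  also have "\<dots> \<le> (L1 * ((1 + rad R1) * I) * bumpI TYPE('a) r) * massB (R1 + 1)"
   using nonnegs I0 bumpI_pos[OF r(1), where 'a='a] by (intro mult_left_mono massB sT mult_nonneg_nonneg) auto
  finally have 1: "\<bar>signed_integral (f s) (conv r (\<lambda>y. psi t y - psi s y))\<bar> \<le> (L1 * ((1 + rad R1) * I) * bumpI TYPE('a) r) * massB (R1 + 1)" .
  have 2: "\<bar>(LBINT y. psi t y * (moll r y t - moll r y s))\<bar> \<le> (B1 * (speed r R1 * I)) * V"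
   unfolding V_def
  proof (rule lfb_integrable(2)[OF lfb_lborel])
   have "integrable lborel (\<lambda>y. psi t y * (moll r y t - moll r y s))" using pt(5)[of t] pt(5)[of s] by (simp add: right_diff_distrib)
   then show "(\<lambda>y. psi t y * (moll r y t - moll r y s)) \<in> borel_measurable borel" using borel_measurable_integrable by fastforce
   show z: "psi t y * (moll r y t - moll r y s) = 0" if "norm y > R1" for y using psi_zero[OF sT(4) st(3) that] by simp
   show "\<bar>psi t y * (moll r y t - moll r y s)\<bar> \<le> B1 * (speed r R1 * I)" for y
   proof (cases "norm y > R1")
    case True
    have "0 \<le> B1 * (speed r R1 * I)" using nonnegs I0 speed(1)[OF r nonnegs(1)] by simp
    then show ?thesis by (simp only: z[OF True] abs_zero)
   next
    case False
    then have "\<bar>moll r y t - moll r y s\<bar> \<le> speed r R1 * I"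
     using moll_increment[OF r, of y R1 s t] st sT by (simp add: I_def)
    then show ?thesis unfolding abs_mult by (intro mult_mono psi_bound nonnegs) auto
   qed
  qed
  have "norm (F r t - F r s) \<le> K * I"
   using 1 2 unfolding eq K_def real_norm_def by (simp add: algebra_simps)
  then show "norm (F r t - F r s) \<le> integral {s..t} (\<lambda>t. K * C0 t)" by (simp add: I_def)
 qed
 then show ?thesis by blast
qed

end

section \<open>Time derivative of the mollified pairing\<close>

context transported_test
begin

text \<open>Mean oscillation integrated against the variation of f(t). The radius R1 + 1 is that of
  the supports of psi enlarged by the scale r <= 1.\<close>

definition OscTot :: "real => real => real" where
 "OscTot r t = (LINT x|pos_part (f t). indicat_real (cball 0 (R1 + 1)) x * Osc r t x)
  + (LINT x|neg_part (f t). indicat_real (cball 0 (R1 + 1)) x * Osc r t x)"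

lemma Osc_cut:
 assumes r: "0 < r" "r \<le> 1" and t: "t \<in> {0..T}"
 shows "(\<lambda>x. indicat_real (cball 0 (R1 + 1)) x * Osc r t x) \<in> borel_measurable borel"
  "norm x > R1 + 1 ==> indicat_real (cball 0 (R1 + 1)) x * Osc r t x = 0"
  "\<bar>indicat_real (cball 0 (R1 + 1)) x * Osc r t x\<bar> \<le> (C0 t * (2 * (3 + R1))) * bumpI TYPE('a) r"
  "0 \<le> indicat_real (cball 0 (R1 + 1)) x * Osc r t x"
proof -
 show "(\<lambda>x. indicat_real (cball 0 (R1 + 1)) x * Osc r t x) \<in> borel_measurable borel"
  by (intro borel_measurable_times borel_measurable_indicator Osc_measurable) simp
 show "norm x > R1 + 1 ==> indicat_real (cball 0 (R1 + 1)) x * Osc r t x = 0" by simp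
 have p: "0 \<le> (C0 t * (2 * (3 + R1))) * bumpI TYPE('a) r"
  using C0nn[OF t] nonnegs bumpI_pos[OF r(1), where 'a='a] by (intro mult_nonneg_nonneg) auto
 show "0 \<le> indicat_real (cball 0 (R1 + 1)) x * Osc r t x"
  using Osc_bound(1)[OF t r order_refl, of x] by simp
 show "\<bar>indicat_real (cball 0 (R1 + 1)) x * Osc r t x\<bar> \<le> (C0 t * (2 * (3 + R1))) * bumpI TYPE('a) r"
  using Osc_bound[OF t r, of x "R1 + 1"] p by (simp add: indicator_def add.commute)
qed

text \<open>The quotient of \<open>F r\<close> splits into \<open>E n\<close>, which vanishes since
  the quotients of \<open>moll\<close> tend to minus the flux, and the integral of a commutator
  against f(t). \<open>commutator_bound\<close> leaves the oscillation, the deviation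
  \<open>\<epsilon> n\<close> of the flow from its velocity, which also vanishes, and an arbitrary
  tolerance.\<close>

lemma F_derivative_bound:
 assumes r: "0 < r" "r \<le> 1" and t: "0 < t" "t < \<tau>" and gd: "good t"
  and Q: "!!y h. (\<forall>n. h n > 0 \<and> t + h n < T) ==> h \<longlonglongrightarrow> 0 ==> (\<lambda>n. (moll r y (t + h n) - moll r y t) / h n) \<longlonglongrightarrow> - flux r y t"
  and d: "(F r has_vector_derivative d) (at t)"
 shows "\<bar>d\<bar> \<le> L1 * OscTot r t"
proof -
 have tT: "t \<in> {0..T}" "0 \<le> t" "t \<le> \<tau>" using t \<tau> by auto
 obtain h :: "nat => real" where h: "!!n. h n > 0" "!!n. t + h n < \<tau>" and h0: "h \<longlonglongrightarrow> 0"
  using vanishing_steps[OF t(2)] by blast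
 have hT: "t + h n \<le> T" "t + h n < T" "0 \<le> t + h n" "t \<le> t + h n" "t + h n \<le> \<tau>" "t + h n \<in> {0..T}" for n
  using h[of n] \<tau> t by auto
 obtain K where K: "K \<ge> 0" "!!n. integral {t..t + h n} C0 / h n \<le> K"
  "!!n y R. norm y \<le> R ==> norm ((flow b T t (t + h n) y - y) /\<^sub>R h n) \<le> (1 + rad R) * K"
  using good_displacement_bounded[OF gd h(1) hT(1) h0] by metis
 define V where "V = measure lborel (cball (0::'a) R1)"
 have V0: "0 \<le> V" by (simp add: V_def)
 define A where "A = (\<lambda>n y. (psi (t + h n) y - psi t y) / h n)"
 define Qn where "Qn = (\<lambda>n y. (moll r y (t + h n) - moll r y t) / h n)"
 \<comment> \<open>psi stands at the later time, as in a discrete product rule; the added flux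
   completes the quotient of \<open>moll\<close> to a quantity that vanishes in the limit.\<close>
 define E where "E = (\<lambda>n. (LBINT y. psi (t + h n) y * (Qn n y + flux r y t)))"
 define Dn where "Dn = (\<lambda>n y. indicat_real (cball 0 (R1 + 2)) y * norm (bc t y + (flow b T t (t + h n) y - y) /\<^sub>R h n))"
 define \<epsilon> where "\<epsilon> = (\<lambda>n. integral\<^sup>L lborel (Dn n))"
 have bcm [measurable]: "bc t \<in> borel_measurable borel" by (rule bc_measurable)
 have flm: "flow b T t (t + h n) \<in> borel_measurable borel" for n
  by (intro borel_measurable_continuous_onI flow_continuous) (use tT hT in auto)
 have Dm: "Dn n \<in> borel_measurable borel" for n
 proof -
  have "(\<lambda>y. (flow b T t (t + h n) y - y) /\<^sub>R h n) \<in> borel_measurable borel"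
   by (intro borel_measurable_scaleR borel_measurable_diff flm borel_measurable_const) simp
  from borel_measurable_add[OF bcm this]
  have "(\<lambda>y. norm (bc t y + (flow b T t (t + h n) y - y) /\<^sub>R h n)) \<in> borel_measurable borel"
   by (rule measurable_compose) (intro borel_measurable_continuous_onI continuous_intros)
  then show ?thesis unfolding Dn_def by (intro borel_measurable_times borel_measurable_indicator) auto
 qed
 define WD where "WD = (1 + rad (R1 + 2)) * K + C0 t * (3 + R1)"
 have DB: "norm (Dn n y) \<le> indicat_real (cball 0 (R1 + 2)) y * WD" for n y
 proof (cases "norm y \<le> R1 + 2")
  case True
  have "norm (bc t y) \<le> C0 t * (1 + norm y)" by (rule bc_bound[OF tT(1)])
  also have "\<dots> \<le> C0 t * (3 + R1)" using True C0nn[OF tT(1)] by (intro mult_left_mono) auto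
  finally have "norm (bc t y) \<le> C0 t * (3 + R1)" .
  then have "norm (bc t y + (flow b T t (t + h n) y - y) /\<^sub>R h n) \<le> WD"
   unfolding WD_def using K(3)[OF True, of n] norm_triangle_ineq[of "bc t y" "(flow b T t (t + h n) y - y) /\<^sub>R h n"] by linarith
  then show ?thesis using True by (simp add: Dn_def)
 qed (simp add: Dn_def)
 have WDi: "integrable lborel (\<lambda>y. indicat_real (cball (0::'a) (R1 + 2)) y * WD)" by (rule integrable_indicator_cball)
 have Di: "integrable lborel (Dn n)" for n
  by (rule Bochner_Integration.integrable_bound[OF WDi]) (use Dm DB order_trans[OF DB abs_ge_self] in \<open>auto simp: real_norm_def\<close>)
 have isC: "AE y in lborel. isCont (b t) y" using good_isCont_AE[OF gd] by (simp add: AE_completion_iff)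
 have \<epsilon>0: "\<epsilon> \<longlonglongrightarrow> 0"
 proof -
  have "(\<lambda>n. integral\<^sup>L lborel (Dn n)) \<longlonglongrightarrow> integral\<^sup>L lborel (\<lambda>_::'a. 0::real)"
  proof (rule integral_dominated_convergence[OF _ _ WDi])
   show "AE y in lborel. (\<lambda>n. Dn n y) \<longlonglongrightarrow> 0"
    using isC
   proof eventually_elim
    case (elim y)
    have "(\<lambda>n. bc t y + (flow b T t (t + h n) y - y) /\<^sub>R h n) \<longlonglongrightarrow> bc t y + - b t y"
     by (intro tendsto_add tendsto_const flow_derivative[OF gd elim h(1) hT(1) h0])
    then have "(\<lambda>n. norm (bc t y + (flow b T t (t + h n) y - y) /\<^sub>R h n)) \<longlonglongrightarrow> norm (0::'a)"
     using elim by (intro tendsto_norm) (simp add: bc_def)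
    from tendsto_mult_left[OF this, of "indicat_real (cball 0 (R1 + 2)) y"] show ?case by (simp add: Dn_def)
   qed
  qed (use Dm DB in auto)
  then show ?thesis by (simp add: \<epsilon>_def)
 qed
 note pn = conv_props[OF r psi_measurable[OF hT(3,5)] psi_bound psi_zero_all[OF hT(3,5)]]
 note pg = gconv_props[OF r psi_measurable[OF hT(3,5)] psi_bound psi_zero_all[OF hT(3,5)] tT(1)]
 note pt = conv_props[OF r psi_measurable[OF tT(2,3)] psi_bound psi_zero_all[OF tT(2,3)]]
 have Am: "A n \<in> borel_measurable borel" for n
  unfolding A_def using psi_measurable[OF hT(3,5)[of n]] psi_measurable[OF tT(2,3)] by simp
 have Az: "\<forall>y. norm y > R1 --> A n y = 0" for n
  using psi_zero[OF hT(3,5)] psi_zero[OF tT(2,3)] by (simp add: A_def)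
 have AB: "\<bar>A n y\<bar> \<le> (B1 + B1) / h n" for n y
  using psi_bound[of "t + h n" y] psi_bound[of t y] h(1)[of n] by (simp add: A_def abs_divide divide_right_mono)
 note pA = conv_props[OF r Am AB Az]
 have quot: "(F r (t + h n) - F r t) / h n = E n + signed_integral (f t) (\<lambda>x. conv r (A n) x - gconv r t (psi (t + h n)) x)" for n
 proof -
  obtain G where G: "!!x. \<bar>gconv r t (psi (t + h n)) x\<bar> \<le> G" using pg(3) by blast
  have s: "signed_integral (f t) (\<lambda>x. conv r (A n) x - gconv r t (psi (t + h n)) x)
    = (LBINT y. A n y * moll r y t) - (LBINT y. psi (t + h n) y * flux r y t)"
  proof -
   have a1: "signed_integral (f t) (conv r (A n)) = (LBINT y. A n y * moll r y t)" by (rule pA(6))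
   have g1: "signed_integral (f t) (gconv r t (psi (t + h n))) = (LBINT y. psi (t + h n) y * flux r y t)" by (rule pg(5))
   show ?thesis unfolding a1[symmetric] g1[symmetric] by (rule signed_integral_diff[OF pA(1) pA(2) pA(3) pg(1) pg(2) G])
  qed
  have "E n = (LBINT y. (psi (t + h n) y * moll r y (t + h n) - psi (t + h n) y * moll r y t) / h n + psi (t + h n) y * flux r y t)"
   unfolding E_def Qn_def by (intro Bochner_Integration.integral_cong refl) (simp add: algebra_simps diff_divide_distrib)
  also have "\<dots> = ((LBINT y. psi (t + h n) y * moll r y (t + h n)) - (LBINT y. psi (t + h n) y * moll r y t)) / h n
    + (LBINT y. psi (t + h n) y * flux r y t)"
   using pn(5)[of n "t + h n"] pn(5)[of n t] pg(4)[of n] by simp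
  finally have e: "E n = ((LBINT y. psi (t + h n) y * moll r y (t + h n)) - (LBINT y. psi (t + h n) y * moll r y t)) / h n
    + (LBINT y. psi (t + h n) y * flux r y t)" .
  have "(LBINT y. A n y * moll r y t) = (LBINT y. (psi (t + h n) y * moll r y t - psi t y * moll r y t) / h n)"
   unfolding A_def by (intro Bochner_Integration.integral_cong refl) (simp add: algebra_simps diff_divide_distrib)
  also have "\<dots> = ((LBINT y. psi (t + h n) y * moll r y t) - (LBINT y. psi t y * moll r y t)) / h n"
   using pn(5)[of n t] pt(5)[of t] by simp
  finally have a: "(LBINT y. A n y * moll r y t)
    = ((LBINT y. psi (t + h n) y * moll r y t) - (LBINT y. psi t y * moll r y t)) / h n" .
  show ?thesis unfolding s e a F_def pn(6) pt(6) by (simp add: diff_divide_distrib)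
 qed
 have E0: "E \<longlonglongrightarrow> 0"
 proof -
  define W where "W = B1 * (speed r R1 * K + speed r R1 * C0 t)"
  have "(\<lambda>n. (LBINT y. psi (t + h n) y * (Qn n y + flux r y t))) \<longlonglongrightarrow> integral\<^sup>L lborel (\<lambda>_::'a. 0::real)"
  proof (rule integral_dominated_convergence[OF _ _ integrable_indicator_cball[of R1 W]])
   show "(\<lambda>y. psi (t + h n) y * (Qn n y + flux r y t)) \<in> borel_measurable lborel" for n
   proof -
    have "integrable lborel (\<lambda>y. (psi (t + h n) y * moll r y (t + h n) - psi (t + h n) y * moll r y t) / h n + psi (t + h n) y * flux r y t)"
     using pn(5)[of n "t + h n"] pn(5)[of n t] pg(4)[of n] by simp
    moreover have "(\<lambda>y. (psi (t + h n) y * moll r y (t + h n) - psi (t + h n) y * moll r y t) / h n + psi (t + h n) y * flux r y t)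
      = (\<lambda>y. psi (t + h n) y * (Qn n y + flux r y t))"
     by (auto simp: Qn_def fun_eq_iff algebra_simps diff_divide_distrib)
    ultimately show ?thesis using borel_measurable_integrable by fastforce
   qed
   show "AE y in lborel. (\<lambda>n. psi (t + h n) y * (Qn n y + flux r y t)) \<longlonglongrightarrow> 0"
   proof (rule AE_I2)
    fix y
    have "(\<lambda>n. Qn n y) \<longlonglongrightarrow> - flux r y t" unfolding Qn_def by (rule Q) (use h hT h0 in auto)
    then have "(\<lambda>n. Qn n y + flux r y t) \<longlonglongrightarrow> - flux r y t + flux r y t" by (intro tendsto_add tendsto_const)
    from tendsto_mult[OF tendsto_const[of B1] tendsto_rabs[OF this]]
    have z: "(\<lambda>n. B1 * \<bar>Qn n y + flux r y t\<bar>) \<longlonglongrightarrow> 0" by simp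
    show "(\<lambda>n. psi (t + h n) y * (Qn n y + flux r y t)) \<longlonglongrightarrow> 0"
     by (rule Lim_null_comparison[OF _ z]) (auto simp: abs_mult intro!: mult_right_mono psi_bound always_eventually)
   qed
   show "AE y in lborel. norm (psi (t + h n) y * (Qn n y + flux r y t)) \<le> indicat_real (cball 0 R1) y * W" for n
   proof (rule AE_I2)
    fix y
    show "norm (psi (t + h n) y * (Qn n y + flux r y t)) \<le> indicat_real (cball 0 R1) y * W"
    proof (cases "norm y > R1")
     case True then show ?thesis using psi_zero[OF hT(3,5) True] by simp
    next
     case False
     then have y: "norm y \<le> R1" by simp
     have "\<bar>moll r y (t + h n) - moll r y t\<bar> \<le> speed r R1 * integral {t..t + h n} C0"
      using moll_increment[OF r y tT(2) hT(4,1)] by simp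
     also have "\<dots> \<le> speed r R1 * (K * h n)"
      using K(2)[of n] h(1)[of n] speed(1)[OF r nonnegs(1)] by (intro mult_left_mono) (auto simp: field_simps)
     finally have "\<bar>Qn n y\<bar> \<le> speed r R1 * K" unfolding Qn_def using h(1)[of n] by (simp add: abs_divide divide_le_eq mult_ac)
     then have "\<bar>Qn n y + flux r y t\<bar> \<le> speed r R1 * K + speed r R1 * C0 t"
      using speed(2)[OF r nonnegs(1) y tT(1)] by linarith
     then have "norm (psi (t + h n) y * (Qn n y + flux r y t)) \<le> W"
      unfolding W_def real_norm_def abs_mult by (intro mult_mono psi_bound nonnegs) auto
     then show ?thesis using y by simp
    qed
   qed
  qed simp
  then show ?thesis by (simp add: E_def)
 qed
 have lim: "(\<lambda>n. (F r (t + h n) - F r t) / h n) \<longlonglongrightarrow> d"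
 proof -
  have "(\<lambda>n. (F r (t + h n) - F r t) /\<^sub>R h n) \<longlonglongrightarrow> 1 *\<^sub>R d"
   by (rule has_derivative_sequentially[OF d[unfolded has_vector_derivative_def] h(1) h0])
    (use h(1) in \<open>simp add: less_imp_neq[symmetric]\<close>)
  then show ?thesis by (simp add: divide_inverse mult.commute)
 qed
 define Mt where "Mt = mass (f t) (R1 + 1)"
 have Mt0: "0 \<le> Mt" by (simp add: Mt_def mass_nonneg)
 \<comment> \<open>e is the tolerance in the difference quotient of the kernel. It is sent to 0 only
   after n has gone to infinity, the scale r being fixed.\<close>
 have main: "\<bar>d\<bar> \<le> L1 * OscTot r t + B1 * e * V * Mt" if e: "0 < e" for e
 proof -
  have vn: "norm (bc t x) \<le> C0 t * (2 + R1)" if "norm x \<le> R1 + 1" for x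
  proof -
   have "C0 t * (1 + norm x) \<le> C0 t * (2 + R1)" using that C0nn[OF tT(1)] by (intro mult_left_mono) auto
   then show ?thesis using bc_bound[OF tT(1), of x] by linarith
  qed
  have "0 \<le> C0 t * (2 + R1)" using C0nn[OF tT(1)] nonnegs by simp
  from bump_difference_quotient[OF r(1) e this]
  obtain \<delta> where \<delta>: "\<delta> > 0" "!!(z::'a) v h. norm v \<le> C0 t * (2 + R1) ==> 0 < h ==> h < \<delta> ==>
   \<bar>(bump r z - bump r (z - h *\<^sub>R v)) / h - bump_grad r z \<bullet> v\<bar> \<le> e" by metis
  have key: "\<bar>(F r (t + h n) - F r t) / h n\<bar> \<le> \<bar>E n\<bar> + (L1 * OscTot r t + (L1 * \<epsilon> n + B1 * e * V) * Mt)" if hn: "h n < \<delta>" for n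
  proof -
   obtain G where G: "!!x. \<bar>gconv r t (psi (t + h n)) x\<bar> \<le> G" using pg(3) by blast
   define c where "c = L1 * \<epsilon> n + B1 * e * V"
   have "0 \<le> \<epsilon> n" unfolding \<epsilon>_def Dn_def by (intro Bochner_Integration.integral_nonneg) simp
   then have c0: "0 \<le> c" unfolding c_def using nonnegs e V0 by (intro add_nonneg_nonneg mult_nonneg_nonneg) auto
   let ?I = "\<lambda>x. indicat_real (cball (0::'a) (R1 + 1)) x" and ?g = "\<lambda>x. conv r (A n) x - gconv r t (psi (t + h n)) x"
   define w where "w = (\<lambda>x. L1 * (?I x * Osc r t x) + c * ?I x)"
   have wle: "\<bar>?g x\<bar> \<le> w x" for x
   proof (cases "norm x > R1 + 1")
    case True
    then show ?thesis using pA(2)[OF True] pg(2)[OF True] by (simp add: w_def)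
   next
    case False
    then have x: "norm x \<le> R1 + 1" by simp
    have "\<bar>(LBINT y. ((psi (t + h n) y - psi (t + h n) (flow b T t (t + h n) y)) / h n) * bump r (x - y))
      - (LBINT y. psi (t + h n) y * (bump_grad r (x - y) \<bullet> bc t x))\<bar>
     \<le> L1 * (LBINT y. norm (bc t x - bc t y) * bump r (x - y))
     + L1 * (LBINT y. indicat_real (cball 0 (R1 + 2)) y * norm (bc t y + (flow b T t (t + h n) y - y) /\<^sub>R h n))
     + B1 * e * measure lborel (cball (0::'a) R1)"
    proof (rule commutator_bound[OF nonnegs(2) psi_Lipschitz[OF hT(3,5)] psi_bound psi_zero[OF hT(3,5)] flm bcm h(1) r x])
     show "\<bar>(bump r z - bump r (z - h n *\<^sub>R bc t x)) / h n - bump_grad r z \<bullet> bc t x\<bar> \<le> e" for z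
      by (rule \<delta>(2)[OF vn[OF x] h(1) hn])
     show "integrable lborel (\<lambda>y. norm (bc t x - bc t y) * bump r (x - y))" by (rule Osc_integrable[OF tT(1) r])
     show "integrable lborel (\<lambda>y. indicat_real (cball 0 (R1 + 2)) y * norm (bc t y + (flow b T t (t + h n) y - y) /\<^sub>R h n))"
      using Di[of n] by (simp add: Dn_def)
    qed
    \<comment> \<open>Constancy along the flow expresses psi at time t by psi at the later time, the
      form that \<open>commutator_bound\<close> treats.\<close>
    moreover have "psi (t + h n) (flow b T t (t + h n) y) = psi t y" for y
     by (rule psi_flow[symmetric]) (use tT hT in auto)
    ultimately have "\<bar>?g x\<bar> \<le> L1 * Osc r t x + L1 * \<epsilon> n + B1 * e * V"
     by (simp add: conv_def gconv_def A_def Osc_def \<epsilon>_def Dn_def V_def)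
    then show ?thesis using x by (simp add: w_def c_def)
   qed
   have Im: "?I \<in> borel_measurable borel" by (rule borel_measurable_indicator) simp
   note oc = Osc_cut[OF r tT(1)]
   have wm: "w \<in> borel_measurable borel" unfolding w_def using oc(1) Im by simp
   define B where "B = L1 * ((C0 t * (2 * (3 + R1))) * bumpI TYPE('a) r) + c"
   have wB: "\<bar>w x\<bar> \<le> B" for x
   proof -
    have a: "L1 * (?I x * Osc r t x) \<le> L1 * ((C0 t * (2 * (3 + R1))) * bumpI TYPE('a) r)"
     using oc(3)[of x] nonnegs by (intro mult_left_mono) auto
    have b: "c * ?I x \<le> c" using c0 by (simp add: indicator_def)
    have "0 \<le> L1 * (?I x * Osc r t x)" by (rule mult_nonneg_nonneg[OF nonnegs(2) oc(4)])
    moreover have "0 \<le> c * ?I x" using c0 by simp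
    ultimately show ?thesis using a b by (simp add: w_def B_def)
   qed
   have wz: "w x = 0" if "norm x > R1 + 1" for x using that by (simp add: w_def)
   have gm: "?g \<in> borel_measurable borel" using pA(1) pg(1) by simp
   have wI: "integral\<^sup>L M w = L1 * (LINT x|M. ?I x * Osc r t x) + c * measure M (cball 0 (R1 + 1))"
    if M: "locally_finite_borel M" for M :: "'a measure"
   proof -
    have i1: "integrable M (\<lambda>x. ?I x * Osc r t x)" by (rule lfb_integrable(1)[OF M oc(1-3)])
    have i2: "integrable M ?I" by (rule lfb_integrable(1)[OF M Im, where R="R1 + 1" and B=1]) (auto simp: indicator_def)
    have "integral\<^sup>L M w = (LINT x|M. L1 * (?I x * Osc r t x)) + (LINT x|M. c * ?I x)"
     unfolding w_def by (intro Bochner_Integration.integral_add integrable_mult_right i1 i2)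
    also have "integral\<^sup>L M ?I = measure M (cball 0 (R1 + 1))" using lfb_space[OF M] by simp
    then have "(LINT x|M. c * ?I x) = c * measure M (cball 0 (R1 + 1))" using i2 by simp
    finally show ?thesis by simp
   qed
   have "\<bar>signed_integral (f t) ?g\<bar> \<le> integral\<^sup>L (pos_part (f t)) w + integral\<^sup>L (neg_part (f t)) w"
    by (rule signed_integral_abs_bound[OF gm wm wz wB wle])
   also have "\<dots> = L1 * OscTot r t + c * Mt"
    unfolding wI[OF signed_radon_parts(1)] wI[OF signed_radon_parts(2)] OscTot_def Mt_def mass_def by (simp add: algebra_simps)
   finally have "\<bar>signed_integral (f t) ?g\<bar> \<le> L1 * OscTot r t + c * Mt" .
   then show ?thesis unfolding quot c_def by linarith
  qed
  have ev: "eventually (\<lambda>n. \<bar>(F r (t + h n) - F r t) / h n\<bar> \<le> \<bar>E n\<bar> + (L1 * OscTot r t + (L1 * \<epsilon> n + B1 * e * V) * Mt)) sequentially"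
   using order_tendstoD(2)[OF h0 \<delta>(1)] by eventually_elim (rule key)
  have "(\<lambda>n. \<bar>E n\<bar> + (L1 * OscTot r t + (L1 * \<epsilon> n + B1 * e * V) * Mt)) \<longlonglongrightarrow> \<bar>0\<bar> + (L1 * OscTot r t + (L1 * 0 + B1 * e * V) * Mt)"
   by (intro tendsto_intros E0 \<epsilon>0)
  moreover have "(\<lambda>n. \<bar>(F r (t + h n) - F r t) / h n\<bar>) \<longlonglongrightarrow> \<bar>d\<bar>" by (rule tendsto_rabs[OF lim])
  ultimately have "\<bar>d\<bar> \<le> \<bar>0\<bar> + (L1 * OscTot r t + (L1 * 0 + B1 * e * V) * Mt)"
   using ev by (intro tendsto_le[OF trivial_limit_sequentially])
  then show ?thesis by (simp add: mult_ac)
 qed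
 show ?thesis
 proof (rule field_le_epsilon)
  fix e :: real assume e: "0 < e"
  have c: "0 \<le> B1 * V * Mt" using nonnegs V0 Mt0 by simp
  have "\<bar>d\<bar> \<le> L1 * OscTot r t + B1 * (e / (B1 * V * Mt + 1)) * V * Mt" by (rule main) (use e c in simp)
  also have "B1 * (e / (B1 * V * Mt + 1)) * V * Mt = e * (B1 * V * Mt) / (B1 * V * Mt + 1)" by (simp add: mult_ac)
  also have "\<dots> \<le> e" using e c by (simp add: divide_le_eq)
  finally show "\<bar>d\<bar> \<le> L1 * OscTot r t + e" by simp
 qed
qed

lemma OscTot_bound:
 assumes r: "0 < r" "r \<le> 1" and t: "t \<in> {0..T}"
 shows "OscTot r t \<le> (C0 t * (2 * (3 + R1))) * bumpI TYPE('a) r * massB (R1 + 1)"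
proof -
 have p: "0 \<le> (C0 t * (2 * (3 + R1))) * bumpI TYPE('a) r"
  using C0nn[OF t] nonnegs bumpI_pos[OF r(1), where 'a='a] by (intro mult_nonneg_nonneg) auto
 note oc = Osc_cut[OF r t]
 have "OscTot r t \<le> (C0 t * (2 * (3 + R1))) * bumpI TYPE('a) r * mass (f t) (R1 + 1)"
 proof -
  have "\<bar>(LINT x|M. indicat_real (cball 0 (R1 + 1)) x * Osc r t x)\<bar>
    \<le> ((C0 t * (2 * (3 + R1))) * bumpI TYPE('a) r) * measure M (cball 0 (R1 + 1))"
   if "locally_finite_borel M" for M :: "'a measure"
   by (rule lfb_integrable(2)[OF that oc(1-3)])
  from this[OF signed_radon_parts(1)[of "f t"]] this[OF signed_radon_parts(2)[of "f t"]]
  show ?thesis unfolding OscTot_def mass_def distrib_left[of "_ * bumpI _ _"] by linarith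
 qed
 also have "\<dots> \<le> (C0 t * (2 * (3 + R1))) * bumpI TYPE('a) r * massB (R1 + 1)" by (intro mult_left_mono massB t p)
 finally show ?thesis .
qed

text \<open>Here the concentration of f(t) on continuity points is decisive: it gives pointwise
  convergence almost everywhere for both parts, and the growth condition dominates.\<close>

lemma OscTot_tendsto:
 assumes gd: "good t" and r: "!!n. 0 < r n" "!!n. r n \<le> 1" "r \<longlonglongrightarrow> 0"
 shows "(\<lambda>n. OscTot (r n) t / bumpI TYPE('a) (r n)) \<longlonglongrightarrow> 0"
proof -
 have t: "t \<in> {0..T}" using gd by (auto simp: good_def)
 let ?I = "\<lambda>x. indicat_real (cball (0::'a) (R1 + 1)) x" and ?W = "C0 t * (2 * (3 + R1))"
 have one: "(\<lambda>n. (LINT x|M. ?I x * Osc (r n) t x) / bumpI TYPE('a) (r n)) \<longlonglongrightarrow> 0"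
  if M: "locally_finite_borel M" and C: "AE x in M. isCont (b t) x" for M :: "'a measure"
 proof -
  have "(\<lambda>n. (LINT x|M. (?I x * Osc (r n) t x) / bumpI TYPE('a) (r n))) \<longlonglongrightarrow> integral\<^sup>L M (\<lambda>_. 0::real)"
  proof (rule integral_dominated_convergence[where w="\<lambda>x. ?I x * ?W"])
   have "integrable M ?I"
    by (intro integrable_real_indicator) (use lfb_sets[OF M] lfb_cball[OF M, of 0 "R1 + 1"] in auto)
   then show "integrable M (\<lambda>x. ?I x * ?W)" by (rule integrable_mult_left)
   show "(\<lambda>x. (?I x * Osc (r n) t x) / bumpI TYPE('a) (r n)) \<in> borel_measurable M" for n
    by (rule lfb_measurableI[OF M]) (intro borel_measurable_divide borel_measurable_const Osc_cut(1) r t)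
   show "AE x in M. (\<lambda>n. (?I x * Osc (r n) t x) / bumpI TYPE('a) (r n)) \<longlonglongrightarrow> 0"
    using C
   proof eventually_elim
    case (elim x)
    from tendsto_mult_left[OF Osc_tendsto[OF gd elim r], of "?I x"] show ?case by simp
   qed
   show "AE x in M. norm ((?I x * Osc (r n) t x) / bumpI TYPE('a) (r n)) \<le> ?I x * ?W" for n
   proof (rule AE_I2)
    fix x
    have Z: "0 < bumpI TYPE('a) (r n)" by (rule bumpI_pos[OF r(1)])
    show "norm ((?I x * Osc (r n) t x) / bumpI TYPE('a) (r n)) \<le> ?I x * ?W"
    proof (cases "norm x \<le> R1 + 1")
     case True
     then show ?thesis using Osc_cut(3)[OF r(1)[of n] r(2)[of n] t, of x] Z by (simp add: abs_divide abs_mult divide_le_eq)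
    qed simp
   qed
  qed simp
  then show ?thesis by simp
 qed
 from tendsto_add[OF one[OF signed_radon_parts(1) conc_pos[OF gd]] one[OF signed_radon_parts(2) conc_neg[OF gd]]]
 show ?thesis unfolding OscTot_def by (simp add: add_divide_distrib)
qed

text \<open>The normalised mollification approximates the Lipschitz function psi uniformly within L1
  times the scale.\<close>

lemma F_tendsto:
 assumes r: "!!n. 0 < r n" "!!n. r n \<le> 1" "r \<longlonglongrightarrow> 0" and t: "0 \<le> t" "t \<le> \<tau>"
 shows "(\<lambda>n. F (r n) t / bumpI TYPE('a) (r n)) \<longlonglongrightarrow> signed_integral (f t) (psi t)"
proof -
 let ?Z = "\<lambda>n. bumpI TYPE('a) (r n)"
 have Z: "0 < ?Z n" for n by (rule bumpI_pos[OF r(1)])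
 note pm = psi_measurable[OF t] and pz = psi_zero[OF t]
 note c = conv_props[OF r(1,2) pm psi_bound psi_zero_all[OF t]]
 define u where "u = (\<lambda>n x. inverse (?Z n) * conv (r n) (psi t) x)"
 have um: "u n \<in> borel_measurable borel" for n unfolding u_def using c(1)[of n] by simp
 have uz: "u n x = 0" if "norm x > R1 + 1" for n x using c(2)[OF that] by (simp add: u_def)
 have uB: "\<bar>u n x\<bar> \<le> B1" for n x
  using c(3)[of n x] Z[of n] by (simp add: u_def abs_mult inverse_eq_divide divide_le_eq)
 have eq: "F (r n) t / ?Z n = signed_integral (f t) (u n)" for n
  unfolding u_def F_def signed_integral_cmult[OF c(1)] by (simp add: divide_inverse)
 have close: "\<bar>u n x - psi t x\<bar> \<le> L1 * r n" for n x
 proof -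
  have "\<bar>(LBINT y. psi t y * bump (r n) (x - y)) / ?Z n - psi t x\<bar> \<le> L1 * r n"
  proof (rule mollification_error[OF r(1) c(4)])
   fix y assume y: "norm (x - y) < r n"
   have "\<bar>psi t y - psi t x\<bar> \<le> L1 * norm (y - x)" by (rule psi_Lipschitz[OF t])
   also have "\<dots> \<le> L1 * r n" using y nonnegs by (intro mult_left_mono) (auto simp: norm_minus_commute)
   finally show "\<bar>psi t y - psi t x\<bar> \<le> L1 * r n" .
  qed
  then show ?thesis by (simp add: u_def conv_def divide_inverse mult.commute)
 qed
 have lim: "(\<lambda>n. u n x) \<longlonglongrightarrow> psi t x" for x
 proof -
  have "(\<lambda>n. L1 * r n) \<longlonglongrightarrow> L1 * 0" by (intro tendsto_mult tendsto_const r(3))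
  then have "(\<lambda>n. L1 * r n) \<longlonglongrightarrow> 0" by simp
  from Lim_null_comparison[OF _ this, of "\<lambda>n. u n x - psi t x"] close
  show ?thesis by (simp add: LIM_zero_iff)
 qed
 show ?thesis unfolding eq signed_integral_borel[OF pm]
  by (rule signed_integral_dominated_convergence[OF um uz uB pm]) (use lim in auto)
qed

text \<open>The derivative of the normalised pairing is at most \<open>L1\<close> times the
  normalised oscillation, which tends to 0 under an integrable bound independent of the scale. So
  the increment from 0 to \<tau> tends to 0, while the end values tend to the two sides of the
  claim.\<close>

theorem duality_Lipschitz: "signed_integral (f \<tau>) g = signed_integral (f 0) (\<lambda>x. g (flow b T 0 \<tau> x))"
proof -
 define r where "r = (\<lambda>n. inverse (real (Suc n)))"
 have r: "0 < r n" "r n \<le> 1" for n by (auto simp: r_def inverse_le_1_iff)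
 have r0: "r \<longlonglongrightarrow> 0" unfolding r_def by (rule LIMSEQ_inverse_real_of_nat)
 let ?Z = "\<lambda>n. bumpI TYPE('a) (r n)"
 have Z: "0 < ?Z n" for n by (rule bumpI_pos[OF r(1)])
 \<comment> \<open>Packages the almost everywhere statement so that \<open>choice\<close> gives one
   null set for each of the countably many scales.\<close>
 define good_for where "good_for = (\<lambda>n t. good t \<and> (\<forall>y h. (\<forall>n. h n > 0 \<and> t + h n < T) --> h \<longlonglongrightarrow> 0 -->
  (\<lambda>k. (moll (r n) y (t + h k) - moll (r n) y t) / h k) \<longlonglongrightarrow> - flux (r n) y t))"
 have "\<forall>n. \<exists>N. negligible N \<and> (\<forall>t\<in>{0<..<T} - N. good_for n t)"
  unfolding good_for_def using moll_derivative_AE[OF r] by (rule allI)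
 from choice[OF this] obtain N where N0: "!!n. negligible (N n)" "!!n t. t \<in> {0<..<T} - N n ==> good_for n t"
  by blast
 have N: "!!n. negligible (N n)" "!!n t. t \<in> {0<..<T} - N n ==> good t"
  "!!n t y h. t \<in> {0<..<T} - N n ==> (\<forall>n. h n > 0 \<and> t + h n < T) ==> h \<longlonglongrightarrow> 0 ==>
  (\<lambda>k. (moll (r n) y (t + h k) - moll (r n) y t) / h k) \<longlonglongrightarrow> - flux (r n) y t"
  by (rule N0(1)) (use N0(2) in \<open>unfold good_for_def, blast+\<close>)
 have neg: "negligible (\<Union>n. N n)"
  using negligible_countable_Union[of "range N"] N(1) by auto
 obtain K where K: "!!n. dom_increments 0 \<tau> (\<lambda>t. K n * C0 t) (F (r n))" using F_increments[OF r] by metis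
 define G where "G = (\<lambda>n t. F (r n) t / ?Z n)"
 have Gd: "dom_increments 0 \<tau> (\<lambda>t. K n * C0 t / ?Z n) (G n)" for n
  unfolding dom_increments_def
 proof (intro conjI ballI allI impI)
  show "(\<lambda>t. K n * C0 t / ?Z n) integrable_on {0..\<tau>}"
   using dom_incrementsD(1)[OF K[of n]] by (rule integrable_on_divide)
  show "0 \<le> K n * C0 t / ?Z n" if "t \<in> {0..\<tau>}" for t
   using dom_incrementsD(2)[OF K[of n], of t] that Z[of n] by (intro divide_nonneg_pos) auto
  show "norm (G n t - G n s) \<le> integral {s..t} (\<lambda>t. K n * C0 t / ?Z n)" if "0 \<le> s" "s \<le> t" "t \<le> \<tau>" for s t
  proof -
   have "norm (G n t - G n s) = norm (F (r n) t - F (r n) s) / ?Z n"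
    using Z[of n] by (simp add: G_def diff_divide_distrib[symmetric] abs_divide)
   also have "\<dots> \<le> integral {s..t} (\<lambda>t. K n * C0 t) / ?Z n"
    using dom_incrementsD(3)[OF K[of n] that] Z[of n] by (intro divide_right_mono) auto
   finally show ?thesis by simp
  qed
 qed
 define M where "M = (\<lambda>t. (L1 * (2 * (3 + R1)) * massB (R1 + 1)) * C0 t)"
 have "(\<lambda>n. G n \<tau> - G n 0) \<longlonglongrightarrow> 0"
 proof (rule increments_tendsto_0[OF less_imp_le[OF \<tau>(1)] Gd _ neg, where r="\<lambda>n t. L1 * (OscTot (r n) t / ?Z n)" and M=M])
  show "M integrable_on {0..\<tau>}" unfolding M_def by (intro integrable_on_mult_right C0Is) (use \<tau> in auto)
  fix n t d assume t: "t \<in> {0<..<\<tau>}" "t \<notin> (\<Union>n. N n)" and d: "(G n has_vector_derivative d) (at t)"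
  have t': "t \<in> {0<..<T} - N n" "t \<in> {0..T}" "0 < t" "t < \<tau>" using t \<tau> by auto
  have "((\<lambda>s. ?Z n *\<^sub>R G n s) has_vector_derivative ?Z n *\<^sub>R d) (at t)"
   using bounded_linear.has_vector_derivative[OF bounded_linear_scaleR_right d] .
  moreover have "(\<lambda>s. ?Z n *\<^sub>R G n s) = F (r n)" using Z[of n] by (simp add: G_def fun_eq_iff)
  ultimately have "(F (r n) has_vector_derivative ?Z n * d) (at t)" by simp
  from F_derivative_bound[OF r t'(3,4) N(2)[OF t'(1)] N(3)[OF t'(1)] this]
  have "?Z n * \<bar>d\<bar> \<le> L1 * OscTot (r n) t" using Z[of n] by (simp add: abs_mult)
  then have "\<bar>d\<bar> \<le> L1 * (OscTot (r n) t / ?Z n)" using Z[of n] by (simp add: field_simps)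
  moreover have "L1 * (OscTot (r n) t / ?Z n) \<le> M t"
  proof -
   have "OscTot (r n) t / ?Z n \<le> (C0 t * (2 * (3 + R1))) * massB (R1 + 1)"
    using OscTot_bound[OF r t'(2), of n] Z[of n] by (simp add: divide_le_eq mult_ac)
   from mult_left_mono[OF this nonnegs(2)] show ?thesis by (simp add: M_def mult_ac)
  qed
  ultimately show "\<bar>d\<bar> \<le> L1 * (OscTot (r n) t / ?Z n) \<and> L1 * (OscTot (r n) t / ?Z n) \<le> M t" by simp
 next
  fix t assume t: "t \<in> {0<..<\<tau>}" "t \<notin> (\<Union>n. N n)"
  then have "good t" using N(2)[of t 0] \<tau> by auto
  from tendsto_mult[OF tendsto_const OscTot_tendsto[OF this r r0], of L1]
  show "(\<lambda>n. L1 * (OscTot (r n) t / ?Z n)) \<longlonglongrightarrow> 0" by simp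
 qed
 moreover have "(\<lambda>n. G n \<tau> - G n 0) \<longlonglongrightarrow> signed_integral (f \<tau>) (psi \<tau>) - signed_integral (f 0) (psi 0)"
  unfolding G_def by (intro tendsto_diff F_tendsto r r0) (use \<tau> in auto)
 ultimately have "signed_integral (f \<tau>) (psi \<tau>) - signed_integral (f 0) (psi 0) = 0" by (metis LIMSEQ_unique)
 moreover have "psi \<tau> = g" using flow_self[of \<tau>] \<tau> by (simp add: psi_def fun_eq_iff)
 moreover have "psi 0 = (\<lambda>x. g (flow b T 0 \<tau> x))" by (simp add: psi_def fun_eq_iff)
 ultimately show ?thesis by simp
qed

end

section \<open>From the weak form to duality\<close>

lemma bump_Lipschitz:
 assumes C: "!!z::'a::euclidean_space. norm (bump_grad r z) \<le> C"
 shows "\<bar>bump r x - bump r (y::'a)\<bar> \<le> C * norm (x - y)"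
proof -
 have "norm (bump r x - bump r y) \<le> C * norm (x - y)"
 proof (rule differentiable_bound[where S=UNIV and f'="\<lambda>z v. bump_grad r z \<bullet> v"])
  show "(bump r has_derivative (\<lambda>v. bump_grad r z \<bullet> v)) (at z within UNIV)" for z :: 'a
   by (rule has_derivative_at_withinI[OF bump_has_derivative])
  show "onorm (\<lambda>v. bump_grad r z \<bullet> v) \<le> C" for z :: 'a
  proof (rule onorm_le)
   show "norm (bump_grad r z \<bullet> v) \<le> C * norm v" for v
    by (rule order_trans[OF Cauchy_Schwarz_ineq2[folded real_norm_def]]) (intro mult_right_mono C norm_ge_zero)
  qed
 qed auto
 then show ?thesis by simp
qed

text \<open>Mollify g at a scale below its modulus of continuity for e. The bounded gradient of the
  kernel gives the Lipschitz constant, and the support grows by at most r <= 1.\<close>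

lemma Cc_Lipschitz_approximation:
 fixes g :: "'a::euclidean_space => real"
 assumes g: "g \<in> Cc" and z: "!!x. norm x > R ==> g x = 0" and e: "0 < e"
 shows "\<exists>u L. 0 \<le> L \<and> (\<forall>x y. \<bar>u x - u y\<bar> \<le> L * norm (x - y)) \<and> (\<forall>x. norm x > R + 1 --> u x = 0) \<and> (\<forall>x. \<bar>g x - u x\<bar> \<le> e)"
proof -
 obtain d where d: "d > 0" "!!x y. norm (x - y) < d ==> norm (g x - g y) < e"
  using uniformly_continuous_of_bounded_support[OF CcD(1)[OF g] z e] by blast
 obtain B where B: "0 \<le> B" "!!x. \<bar>g x\<bar> \<le> B" using CcD(3)[OF g] by blast
 define r where "r = min d 1"
 have r: "0 < r" "r \<le> 1" using d(1) by (auto simp: r_def)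
 obtain C where C: "C \<ge> 0" "!!z::'a. norm (bump_grad r z) \<le> C" using bump_grad_bounded_ex[OF r(1)] by blast
 let ?Z = "bumpI TYPE('a) r"
 have Z: "0 < ?Z" by (rule bumpI_pos[OF r(1)])
 define v where "v = (\<lambda>x. (LBINT y. g y * bump r (x - y)))"
 have gm: "g \<in> borel_measurable borel" by (rule CcD(2)[OF g])
 have bm: "(\<lambda>y. bump r (x - y)) \<in> borel_measurable borel" for x :: 'a by (rule measurable_compose[OF _ bump_measurable]) simp
 have i: "integrable lborel (\<lambda>y. g y * bump r (x - y))" for x
 proof (rule lfb_integrable(1)[OF lfb_lborel, where R=R and B="B * 1"])
  show "(\<lambda>y. g y * bump r (x - y)) \<in> borel_measurable borel" using gm bm by simp
  show "\<bar>g y * bump r (x - y)\<bar> \<le> B * 1" for y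
   unfolding abs_mult abs_of_nonneg[OF bump_nonneg] by (intro mult_mono B bump_le_1 bump_nonneg)
 qed (use z in simp)
 define V where "V = measure lborel (cball (0::'a) R)"
 have V: "0 \<le> V" by (simp add: V_def)
 have vL: "\<bar>v x - v x'\<bar> \<le> (B * (C * norm (x - x'))) * V" for x x'
 proof -
  have "v x - v x' = (LBINT y. g y * (bump r (x - y) - bump r (x' - y)))"
   using Bochner_Integration.integral_diff[OF i[of x] i[of x']] by (simp add: v_def right_diff_distrib)
  also have "\<bar>\<dots>\<bar> \<le> (B * (C * norm (x - x'))) * V"
   unfolding V_def
  proof (rule lfb_integrable(2)[OF lfb_lborel])
   show "(\<lambda>y. g y * (bump r (x - y) - bump r (x' - y))) \<in> borel_measurable borel" using gm bm by simp
   show "\<bar>g y * (bump r (x - y) - bump r (x' - y))\<bar> \<le> B * (C * norm (x - x'))" for y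
    unfolding abs_mult using bump_Lipschitz[OF C(2), of "x - y" "x' - y"] B by (intro mult_mono) auto
  qed (use z in simp)
  finally show ?thesis .
 qed
 have v0: "v x = 0" if "norm x > R + 1" for x
 proof -
  have "g y * bump r (x - y) = 0" for y
  proof (cases "norm y > R")
   case False
   then have "bump r (x - y) = 0" using that r norm_triangle_ineq2[of x y] by (intro bump_outside) auto
   then show ?thesis by simp
  qed (simp add: z)
  then show ?thesis unfolding v_def by (simp only: Bochner_Integration.integral_zero)
 qed
 have vc: "\<bar>v x / ?Z - g x\<bar> \<le> e" for x
  unfolding v_def
 proof (rule mollification_error[OF r(1) i])
  fix y assume "norm (x - y) < r"
  then show "\<bar>g y - g x\<bar> \<le> e" using d(2)[of y x] by (simp add: r_def norm_minus_commute)
 qed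
 show ?thesis
 proof (intro exI[of _ "\<lambda>x. v x / ?Z"] exI[of _ "B * C * V / ?Z"] conjI allI impI)
  show "0 \<le> B * C * V / ?Z" using B C V Z by simp
  show "\<bar>v x / ?Z - v y / ?Z\<bar> \<le> B * C * V / ?Z * norm (x - y)" for x y
   using vL[of x y] Z by (simp add: diff_divide_distrib[symmetric] abs_divide divide_right_mono mult_ac)
  show "v x / ?Z = 0" if "norm x > R + 1" for x using v0[OF that] by simp
  show "\<bar>g x - v x / ?Z\<bar> \<le> e" for x using vc[of x] by (simp add: abs_minus_commute)
 qed
qed

context weak_path
begin

text \<open>Both sides change by at most e times a mass when g is replaced by a Lipschitz function
  within e of it, the supports staying in a fixed ball; M collects the masses at times t and
  0.\<close>

theorem duality_of_weak_form:
 assumes g: "g \<in> Cc" and t: "t \<in> {0..T}"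
 shows "signed_integral (f t) g = signed_integral (f 0) (\<lambda>x. g (flow b T 0 t x))"
proof (cases "t = 0")
 case True
 then show ?thesis using flow_self[of 0] T by simp
next
 case False
 then have t': "0 < t" "t \<le> T" using t by auto
 obtain R B where R: "0 \<le> R" "!!x. norm x > R ==> g x = 0" "!!x. \<bar>g x\<bar> \<le> B" using CcD(3)[OF g] by blast
 let ?a = "signed_integral (f t) g" and ?c = "signed_integral (f 0) (\<lambda>x. g (flow b T 0 t x))"
 define M where "M = mass (f t) (R + 1) + mass (f 0) (rad (R + 1))"
 have M: "0 \<le> M" by (simp add: M_def mass_nonneg)
 have close: "\<bar>?a - ?c\<bar> \<le> e * M" if e: "0 < e" for e
 proof -
  obtain u L where u: "0 \<le> L" "!!x y. \<bar>u x - u y\<bar> \<le> L * norm (x - y)" "!!x. norm x > R + 1 ==> u x = 0" "!!x. \<bar>g x - u x\<bar> \<le> e"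
   using Cc_Lipschitz_approximation[OF g R(2) e] by blast
  interpret transported_test T b C0 C1 f u L "R + 1" t
   by unfold_locales (use u R t' in auto)
  note key = duality_Lipschitz
  have uCc: "u \<in> Cc" by (rule CcI[OF Lipschitz_continuous[OF u(1,2)] u(3)])
  have g0: "g x = 0" if "norm x > R + 1" for x using R(2)[of x] that by simp
  have uB: "\<bar>u x\<bar> \<le> B + e" for x using u(4)[of x] R(3)[of x] by linarith
  have d1: "signed_integral (f t) (\<lambda>x. g x - u x) = ?a - signed_integral (f t) u"
   by (rule signed_integral_diff[OF CcD(2)[OF g] g0 R(3) CcD(2)[OF uCc] u(3) uB])
  have "\<bar>signed_integral (f t) (\<lambda>x. g x - u x)\<bar> \<le> e * mass (f t) (R + 1)"
   by (rule signed_integral_bound) (use CcD(2)[OF g] CcD(2)[OF uCc] g0 u in auto)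
  then have 1: "\<bar>?a - signed_integral (f t) u\<bar> \<le> e * mass (f t) (R + 1)" unfolding d1 .
  have gf: "(\<lambda>x. g (flow b T 0 t x)) \<in> borel_measurable borel" "(\<lambda>x. u (flow b T 0 t x)) \<in> borel_measurable borel"
   using CcD(2)[OF Cc_flow[OF g, of 0 t]] CcD(2)[OF Cc_flow[OF uCc, of 0 t]] t' by auto
  have out: "norm (flow b T 0 t x) > R + 1" if "norm x > rad (R + 1)" for x
   using flow_support[of 0 t x "R + 1"] that t' by fastforce
  have d2: "signed_integral (f 0) (\<lambda>x. g (flow b T 0 t x) - u (flow b T 0 t x)) = ?c - signed_integral (f 0) (\<lambda>x. u (flow b T 0 t x))"
   by (rule signed_integral_diff[where R="rad (R + 1)" and R'="rad (R + 1)" and B=B and B'="B + e"]) (use gf out g0 u(3) R(3) uB in auto)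
  have "\<bar>signed_integral (f 0) (\<lambda>x. g (flow b T 0 t x) - u (flow b T 0 t x))\<bar> \<le> e * mass (f 0) (rad (R + 1))"
   by (rule signed_integral_bound) (use gf out g0 u(3,4) in auto)
  then have 2: "\<bar>?c - signed_integral (f 0) (\<lambda>x. u (flow b T 0 t x))\<bar> \<le> e * mass (f 0) (rad (R + 1))" unfolding d2 .
  show ?thesis using 1 2 key unfolding M_def distrib_left by linarith
 qed
 have "\<bar>?a - ?c\<bar> \<le> 0"
 proof (rule field_le_epsilon)
  fix e :: real assume e: "0 < e"
  have "\<bar>?a - ?c\<bar> \<le> (e / (M + 1)) * M" by (rule close) (use e M in simp)
  also have "\<dots> \<le> e" using e M by (simp add: field_simps)
  finally show "\<bar>?a - ?c\<bar> \<le> 0 + e" by simp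
 qed
 then show ?thesis by simp
qed

end

theorem theorem3p10:
 fixes T :: real
  and b :: "real \<Rightarrow> 'a::euclidean_space \<Rightarrow> 'a"
  and C0 C1 :: "real \<Rightarrow> real"
  and f0 :: "'a signed_radon"
  and f :: "real \<Rightarrow> 'a signed_radon"
 assumes "T > 0"
  and "(\<lambda>(t, x). b t x) \<in> borel_measurable (lebesgue_on ({0..T} \<times> UNIV))"
  and "integrable (lebesgue_on {0..T}) C0" and "\<And>t. t \<in> {0..T} \<Longrightarrow> 0 \<le> C0 t"
  and "integrable (lebesgue_on {0..T}) C1" and "\<And>t. t \<in> {0..T} \<Longrightarrow> 0 \<le> C1 t"
  and "\<And>t x. t \<in> {0..T} \<Longrightarrow> norm (b t x) \<le> C0 t * (1 + norm x)"
  and "\<And>t x y. t \<in> {0..T} \<Longrightarrow>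
     (b t x - b t y) \<bullet> (x - y) \<ge> - C1 t * (norm (x - y))\<^sup>2"
  and "f \<in> C_weak T" and "f 0 = f0"
  and "continuous_on ({0..T} \<times> UNIV) (\<lambda>(t, x). b t x) \<or> (\<forall>t\<in>{0..T}. f t \<in> L1_loc)"
 shows "distributional_solution b T f0 f \<longleftrightarrow> unique_duality_solution b T f0 f"
proof -
 interpret compressive T b C0 C1
  by unfold_locales (use assms in auto)
 \<comment> \<open>Joint continuity makes every x a continuity point of b(t,.). In the other case
   almost everywhere continuity for Lebesgue measure passes to both parts of f(t) by
   \<open>L1_loc_AE\<close>.\<close>
 have conc: "(AE x in pos_part (f t). isCont (b t) x) \<and> (AE x in neg_part (f t). isCont (b t) x)" if g: "good t" for t
 proof -
  have t: "t \<in> {0..T}" using g by (auto simp: good_def)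
  from assms(11) show ?thesis
  proof
   assume c: "continuous_on ({0..T} \<times> UNIV) (\<lambda>(t, x). b t x)"
   have "continuous_on UNIV (\<lambda>x. case (t, x) of (t, x) \<Rightarrow> b t x)"
    by (rule continuous_on_compose2[OF c]) (use t in \<open>auto intro!: continuous_intros\<close>)
   then have "isCont (b t) x" for x by (simp add: continuous_on_eq_continuous_at)
   then show ?thesis by simp
  next
   assume "\<forall>t\<in>{0..T}. f t \<in> L1_loc"
   then have "f t \<in> L1_loc" using t by blast
   from L1_loc_AE[OF this good_isCont_AE[OF g] isCont_borel] show ?thesis by blast
  qed
 qed
 interpret measure_path T b C0 C1 f
  by unfold_locales (use assms conc in auto)
 show ?thesis
 proof
  assume w: "distributional_solution b T f0 f"
  interpret weak_path T b C0 C1 f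
   by unfold_locales (use w in \<open>auto simp: distributional_solution_def\<close>)
  have d: "duality_solution b T f0 f"
   unfolding duality_solution_def using assms(9) duality_of_weak_form assms(10) by auto
  show "unique_duality_solution b T f0 f"
   unfolding unique_duality_solution_def
  proof (intro conjI d allI impI ballI)
   fix f' t assume "duality_solution b T f0 f'" and t: "t \<in> {0..T}"
   \<comment> \<open>Duality prescribes the integral of every function in \<open>Cc\<close>, and
     these integrals determine the signed measure.\<close>
   then show "f' t = f t" using d by (intro signed_radon_eqI) (simp add: duality_solution_def)
  qed
 next
  assume "unique_duality_solution b T f0 f"
  then have "duality_solution b T f0 f" by (simp add: unique_duality_solution_def)
  then have "signed_integral (f t) g = signed_integral (f 0) (\<lambda>x. g (flow b T 0 t x))" if "t \<in> {0..T}" "g \<in> Cc" for t g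
   using that assms(10) by (simp add: duality_solution_def)
  from weak_form_of_duality[OF this] show "distributional_solution b T f0 f"
   using assms(9,10) by (simp add: distributional_solution_def)
 qed
qed

end
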